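(* Let $\mathcal{A}$ be an abelian category. The category $\mathrm{C}(\mathcal{A})$ of complexes in $\mathcal{A}$ carries the structure of a saturated additive uni-fractionable category, where $$\mathrm{Den}\,\mathrm{C}(\mathcal{A})=\{f\in\mathrm{Mor}\,\mathrm{C}(\mathcal{A})\mid \mathrm{H}(f)\text{ is an isomorphism}\},$$ $$\mathrm{SDen}\,\mathrm{C}(\mathcal{A})=\{i\in\mathrm{Den}\,\mathrm{C}(\mathcal{A})\mid i\text{ is a monomorphism}\},$$ $$\mathrm{TDen}\,\mathrm{C}(\mathcal{A})=\{p\in\mathrm{Den}\,\mathrm{C}(\mathcal{A})\mid p\text{ is an epimorphism}\}.$$ In particular, the derived category $\mathrm{D}(\mathcal{A})$ is isomorphic to $\mathrm{Frac}\,\mathrm{C}(\mathcal{A})$.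
   Context: $\mathrm{H}$ denotes the ($\mathbb{Z}$-graded) cohomology functor on complexes, so $\mathrm{H}(f)$ is an isomorphism iff $f$ is a quasi-isomorphism. $\mathrm{D}(\mathcal{A})$ denotes the (unbounded) derived category, i.e. the localisation of the homotopy category of complexes $\mathrm{K}(\mathcal{A})$ at the quasi-isomorphisms. Composition is written diagrammatically: for $f\colon X\to Y$, $g\colon Y\to Z$ the composite is $fg\colon X\to Z$. A category with denominators is a category $\mathcal{C}$ together with a subset $\mathrm{Den}\,\mathcal{C}\subseteq\mathrm{Mor}\,\mathcal{C}$ of denominators. A subset $D\subseteq\mathrm{Mor}\,\mathcal{C}$ is multiplicative if it contains all identities and is closed under composition; it is semi-saturated if it is multiplicative and, for composable $f,g$, whenever two of $f,g,fg$ are in $D$, so is the third. A uni-fractionable category is a category with denominators $\mathcal{C}$ with $\mathrm{Den}\,\mathcal{C}$ semi-saturated, together with multiplicative subsets $\mathrm{SDen}\,\mathcal{C},\mathrm{TDen}\,\mathcal{C}\subseteq\mathrm{Den}\,\mathcal{C}$ (S-denominators, T-denominators) such that: (WU) for $i\in\mathrm{SDen}\,\mathcal{C}$ and a morphism $f$ with the same source as $i$ there is a weak pushout square $if'=fi'$ of $i$ and $f$ with $i'\in\mathrm{SDen}\,\mathcal{C}$; dually, for $p\in\mathrm{TDen}\,\mathcal{C}$ and a morphism $f$ with the same target as $p$ there is a weak pullback square $f'p=p'f$ of $f$ and $p$ with $p'\in\mathrm{TDen}\,\mathcal{C}$; (Fac) for every $d\in\mathrm{Den}\,\mathcal{C}$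 there are $i\in\mathrm{SDen}\,\mathcal{C}$, $p\in\mathrm{TDen}\,\mathcal{C}$ with $d=ip$. (Weak pushout/pullback: universal property without uniqueness.) It is additive if the underlying category is additive and $\mathrm{Den}\,\mathcal{C}$ is closed under finite (direct) sums of morphisms. A $3$-arrow $(b,f,a)\colon X\leftarrow\tilde X\to\tilde Y\leftarrow Y$ in $\mathcal{C}$ consists of denominators $b\colon\tilde X\to X$, $a\colon Y\to\tilde Y$ and a morphism $f\colon\tilde X\to\tilde Y$; its source is $X$, its target is $Y$. Fraction equality is the equivalence relation on $3$-arrows generated by $(b,f,a)\equiv(b,fc,ac)$ for $ac\in\mathrm{Den}\,\mathcal{C}$ and $(b,f,a)\equiv(cb,cf,a)$ for $cb\in\mathrm{Den}\,\mathcal{C}$; the class of $(b,f,a)$ is the double fraction $b\backslash f/a$. The fraction category $\mathrm{Frac}\,\mathcal{C}$ has the objects of $\mathcal{C}$, double fractions as morphisms, identities $1\backslash1/1$, and composition (independent of choices): choose an S-denominator $j$ and a T-denominator $q$ with $b_2a_1=jq$, a T-denominator $q'$ and $f_1'$ with $f_1'q=q'f_1$, an S-denominator $j'$ and $f_2'$ with $jf_2'=f_2j'$; then $(b_1\backslash f_1/a_1)(b_2\backslash f_2/a_2)=q'b_1\backslash f_1'f_2'/a_2j'$. It is a localisation of $\mathcal{C}$ with respect to $\mathrm{Den}\,\mathcal{C}$ via $\mathrm{loc}(X)=X$, $\mathrm{loc}(f)=1\backslash f/1$. $\mathcal{C}$ is saturated if every morphism $f$ of $\mathcal{C}$ with $\mathrm{loc}(f)$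 invertible is a denominator. *)

theory Defs
  imports "HOL-Algebra.FiniteProduct"
begin

section \<open>Categories\<close>

text \<open>Composition is written diagrammatically: \<open>f \<cdot> g\<close> is first \<open>f\<close>, then \<open>g\<close>.  Outside the carriers
  \<open>Ob\<close> and \<open>Mor\<close>, and on non-composable pairs, the operations are unspecified.\<close>

record ('o, 'm) cat =
  Ob  :: "'o set"
  Mor :: "'m set"
  Src :: "'m \<Rightarrow> 'o"
  Tgt :: "'m \<Rightarrow> 'o"
  Idn :: "'o \<Rightarrow> 'm"
  Cmp :: "'m \<Rightarrow> 'm \<Rightarrow> 'm"  (infixl "\<cdot>\<index>" 70)

definition Hom :: "('o, 'm, 'z) cat_scheme \<Rightarrow> 'o \<Rightarrow> 'o \<Rightarrow> 'm set" where
  "Hom C X Y = {f \<in> Mor C. Src C f = X \<and> Tgt C f = Y}"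

locale category =
  fixes C :: "('o, 'm, 'z) cat_scheme" (structure)
  assumes src_closed: "f \<in> Mor C \<Longrightarrow> Src C f \<in> Ob C"
    and tgt_closed: "f \<in> Mor C \<Longrightarrow> Tgt C f \<in> Ob C"
    and id_closed: "X \<in> Ob C \<Longrightarrow> Idn C X \<in> Hom C X X"
    and comp_closed: "\<lbrakk>f \<in> Hom C X Y; g \<in> Hom C Y Z\<rbrakk> \<Longrightarrow> f \<cdot> g \<in> Hom C X Z"
    and id_left: "f \<in> Mor C \<Longrightarrow> Idn C (Src C f) \<cdot> f = f"
    and id_right: "f \<in> Mor C \<Longrightarrow> f \<cdot> Idn C (Tgt C f) = f"
    and comp_assoc: "\<lbrakk>f \<in> Hom C W X; g \<in> Hom C X Y; h \<in> Hom C Y Z\<rbrakk>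
                       \<Longrightarrow> (f \<cdot> g) \<cdot> h = f \<cdot> (g \<cdot> h)"

definition is_iso :: "('o, 'm, 'z) cat_scheme \<Rightarrow> 'm \<Rightarrow> bool" where
  "is_iso C f \<longleftrightarrow> f \<in> Mor C \<and>
     (\<exists>g \<in> Hom C (Tgt C f) (Src C f).
        f \<cdot>\<^bsub>C\<^esub> g = Idn C (Src C f) \<and> g \<cdot>\<^bsub>C\<^esub> f = Idn C (Tgt C f))"

definition is_mono :: "('o, 'm, 'z) cat_scheme \<Rightarrow> 'm \<Rightarrow> bool" where
  "is_mono C f \<longleftrightarrow> f \<in> Mor C \<and>
     (\<forall>W. \<forall>g \<in> Hom C W (Src C f). \<forall>h \<in> Hom C W (Src C f). g \<cdot>\<^bsub>C\<^esub> f = h \<cdot>\<^bsub>C\<^esub> f \<longrightarrow> g = h)"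

definition is_epi :: "('o, 'm, 'z) cat_scheme \<Rightarrow> 'm \<Rightarrow> bool" where
  "is_epi C f \<longleftrightarrow> f \<in> Mor C \<and>
     (\<forall>Z. \<forall>g \<in> Hom C (Tgt C f) Z. \<forall>h \<in> Hom C (Tgt C f) Z. f \<cdot>\<^bsub>C\<^esub> g = f \<cdot>\<^bsub>C\<^esub> h \<longrightarrow> g = h)"

locale is_functor = C: category C + D: category D
  for C :: "('o, 'm, 'z) cat_scheme" and D :: "('p, 'n, 'y) cat_scheme" +
  fixes Fo :: "'o \<Rightarrow> 'p" and Fm :: "'m \<Rightarrow> 'n"
  assumes functor_ob: "X \<in> Ob C \<Longrightarrow> Fo X \<in> Ob D"
    and functor_mor: "f \<in> Mor C \<Longrightarrow> Fm f \<in> Hom D (Fo (Src C f)) (Fo (Tgt C f))"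
    and functor_id: "X \<in> Ob C \<Longrightarrow> Fm (Idn C X) = Idn D (Fo X)"
    and functor_comp: "\<lbrakk>f \<in> Mor C; g \<in> Mor C; Tgt C f = Src C g\<rbrakk>
                         \<Longrightarrow> Fm (f \<cdot>\<^bsub>C\<^esub> g) = Fm f \<cdot>\<^bsub>D\<^esub> Fm g"

definition isomorphic_categories ::
    "('o, 'm, 'z) cat_scheme \<Rightarrow> ('p, 'n, 'y) cat_scheme \<Rightarrow> bool" where
  "isomorphic_categories C D \<longleftrightarrow>
     (\<exists>Fo Fm. is_functor C D Fo Fm \<and> bij_betw Fo (Ob C) (Ob D) \<and> bij_betw Fm (Mor C) (Mor D))"

text \<open>The quotient of a category by a congruence \<open>r\<close> on its morphisms (an equivalence relation between
  parallel morphisms, compatible with composition); the objects do not change.\<close>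

definition quotient_cat :: "('o, 'm, 'z) cat_scheme \<Rightarrow> ('m \<times> 'm) set \<Rightarrow> ('o, 'm set) cat" where
  "quotient_cat C r =
     \<lparr> Ob = Ob C,
       Mor = Mor C // r,
       Src = (\<lambda>P. the_elem (Src C ` P)),
       Tgt = (\<lambda>P. the_elem (Tgt C ` P)),
       Idn = (\<lambda>X. r `` {Idn C X}),
       Cmp = (\<lambda>P Q. \<Union>f\<in>P. \<Union>g\<in>Q. r `` {f \<cdot>\<^bsub>C\<^esub> g}) \<rparr>"


section \<open>Additive and abelian categories\<close>

record ('o, 'm) add_cat = "('o, 'm) cat" +
  Add :: "'m \<Rightarrow> 'm \<Rightarrow> 'm"
  Zer :: "'o \<Rightarrow> 'o \<Rightarrow> 'm"

definition hom_group :: "('o, 'm, 'z) add_cat_scheme \<Rightarrow> 'o \<Rightarrow> 'o \<Rightarrow> 'm monoid" where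
  "hom_group C X Y = \<lparr>carrier = Hom C X Y, monoid.mult = Add C, one = Zer C X Y\<rparr>"

definition direct_sum :: "('o, 'm, 'z) add_cat_scheme \<Rightarrow> nat \<Rightarrow> (nat \<Rightarrow> 'o) \<Rightarrow> 'o
    \<Rightarrow> (nat \<Rightarrow> 'm) \<Rightarrow> (nat \<Rightarrow> 'm) \<Rightarrow> bool" where
  "direct_sum C n X S ins prj \<longleftrightarrow>
     S \<in> Ob C \<and>
     (\<forall>k<n. ins k \<in> Hom C (X k) S \<and> prj k \<in> Hom C S (X k)) \<and>
     (\<forall>k<n. \<forall>l<n. ins k \<cdot>\<^bsub>C\<^esub> prj l = (if k = l then Idn C (X k) else Zer C (X k) (X l))) \<and>
     finprod (hom_group C S S) (\<lambda>k. prj k \<cdot>\<^bsub>C\<^esub> ins k) {..<n} = Idn C S"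

text \<open>The empty direct sum is a zero object.\<close>

locale additive_category = category C for C :: "('o, 'm, 'z) add_cat_scheme" (structure) +
  assumes hom_comm_group: "\<lbrakk>X \<in> Ob C; Y \<in> Ob C\<rbrakk> \<Longrightarrow> comm_group (hom_group C X Y)"
    and comp_add_left: "\<lbrakk>f \<in> Hom C X Y; f' \<in> Hom C X Y; g \<in> Hom C Y Z\<rbrakk>
                          \<Longrightarrow> Add C f f' \<cdot> g = Add C (f \<cdot> g) (f' \<cdot> g)"
    and comp_add_right: "\<lbrakk>f \<in> Hom C X Y; g \<in> Hom C Y Z; g' \<in> Hom C Y Z\<rbrakk>
                           \<Longrightarrow> f \<cdot> Add C g g' = Add C (f \<cdot> g) (f \<cdot> g')"
    and direct_sums: "\<And>n X. (\<And>k. k < n \<Longrightarrow> X k \<in> Ob C)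
                            \<Longrightarrow> \<exists>S ins prj. direct_sum C n X S ins prj"

definition is_kernel :: "('o, 'm, 'z) add_cat_scheme \<Rightarrow> 'm \<Rightarrow> 'm \<Rightarrow> bool" where
  "is_kernel C f k \<longleftrightarrow> f \<in> Mor C \<and> k \<in> Mor C \<and> Tgt C k = Src C f \<and>
     k \<cdot>\<^bsub>C\<^esub> f = Zer C (Src C k) (Tgt C f) \<and>
     (\<forall>g \<in> Mor C. Tgt C g = Src C f \<and> g \<cdot>\<^bsub>C\<^esub> f = Zer C (Src C g) (Tgt C f) \<longrightarrow>
        (\<exists>!u. u \<in> Hom C (Src C g) (Src C k) \<and> u \<cdot>\<^bsub>C\<^esub> k = g))"

definition is_cokernel :: "('o, 'm, 'z) add_cat_scheme \<Rightarrow> 'm \<Rightarrow> 'm \<Rightarrow> bool" where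
  "is_cokernel C f c \<longleftrightarrow> f \<in> Mor C \<and> c \<in> Mor C \<and> Src C c = Tgt C f \<and>
     f \<cdot>\<^bsub>C\<^esub> c = Zer C (Src C f) (Tgt C c) \<and>
     (\<forall>g \<in> Mor C. Src C g = Tgt C f \<and> f \<cdot>\<^bsub>C\<^esub> g = Zer C (Src C f) (Tgt C g) \<longrightarrow>
        (\<exists>!u. u \<in> Hom C (Tgt C c) (Tgt C g) \<and> c \<cdot>\<^bsub>C\<^esub> u = g))"

locale abelian_category = additive_category C
  for C :: "('o, 'm, 'z) add_cat_scheme" (structure) +
  assumes kernels: "f \<in> Mor C \<Longrightarrow> \<exists>k. is_kernel C f k"
    and cokernels: "f \<in> Mor C \<Longrightarrow> \<exists>c. is_cokernel C f c"
    and mono_kernel: "is_mono C k \<Longrightarrow> \<exists>f. is_kernel C f k"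
    and epi_cokernel: "is_epi C c \<Longrightarrow> \<exists>f. is_cokernel C f c"


section \<open>Uni-fractionable categories\<close>

definition multiplicative :: "('o, 'm, 'z) cat_scheme \<Rightarrow> 'm set \<Rightarrow> bool" where
  "multiplicative C D \<longleftrightarrow> D \<subseteq> Mor C \<and> (\<forall>X \<in> Ob C. Idn C X \<in> D) \<and>
     (\<forall>f \<in> D. \<forall>g \<in> D. Tgt C f = Src C g \<longrightarrow> f \<cdot>\<^bsub>C\<^esub> g \<in> D)"

definition semi_saturated :: "('o, 'm, 'z) cat_scheme \<Rightarrow> 'm set \<Rightarrow> bool" where
  "semi_saturated C D \<longleftrightarrow> multiplicative C D \<and>
     (\<forall>f \<in> Mor C. \<forall>g \<in> Mor C. Tgt C f = Src C g \<longrightarrow>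
        (f \<in> D \<and> f \<cdot>\<^bsub>C\<^esub> g \<in> D \<longrightarrow> g \<in> D) \<and> (g \<in> D \<and> f \<cdot>\<^bsub>C\<^esub> g \<in> D \<longrightarrow> f \<in> D))"

text \<open>\<open>weak_pushout C i f f' i'\<close>: the square \<open>i f' = f i'\<close> is a weak pushout of \<open>i\<close> and \<open>f\<close>.
  \<open>weak_pullback C f p f' p'\<close>: the square \<open>f' p = p' f\<close> is a weak pullback of \<open>f\<close> and \<open>p\<close>.\<close>

definition weak_pushout :: "('o, 'm, 'z) cat_scheme \<Rightarrow> 'm \<Rightarrow> 'm \<Rightarrow> 'm \<Rightarrow> 'm \<Rightarrow> bool" where
  "weak_pushout C i f f' i' \<longleftrightarrow>
     i \<in> Mor C \<and> f \<in> Mor C \<and> f' \<in> Mor C \<and> i' \<in> Mor C \<and>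
     Src C i = Src C f \<and> Src C f' = Tgt C i \<and> Src C i' = Tgt C f \<and> Tgt C f' = Tgt C i' \<and>
     i \<cdot>\<^bsub>C\<^esub> f' = f \<cdot>\<^bsub>C\<^esub> i' \<and>
     (\<forall>V. \<forall>g \<in> Hom C (Tgt C i) V. \<forall>h \<in> Hom C (Tgt C f) V. i \<cdot>\<^bsub>C\<^esub> g = f \<cdot>\<^bsub>C\<^esub> h \<longrightarrow>
        (\<exists>u \<in> Hom C (Tgt C f') V. f' \<cdot>\<^bsub>C\<^esub> u = g \<and> i' \<cdot>\<^bsub>C\<^esub> u = h))"

definition weak_pullback :: "('o, 'm, 'z) cat_scheme \<Rightarrow> 'm \<Rightarrow> 'm \<Rightarrow> 'm \<Rightarrow> 'm \<Rightarrow> bool" where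
  "weak_pullback C f p f' p' \<longleftrightarrow>
     f \<in> Mor C \<and> p \<in> Mor C \<and> f' \<in> Mor C \<and> p' \<in> Mor C \<and>
     Tgt C p = Tgt C f \<and> Tgt C f' = Src C p \<and> Tgt C p' = Src C f \<and> Src C f' = Src C p' \<and>
     f' \<cdot>\<^bsub>C\<^esub> p = p' \<cdot>\<^bsub>C\<^esub> f \<and>
     (\<forall>V. \<forall>g \<in> Hom C V (Src C p). \<forall>h \<in> Hom C V (Src C f). g \<cdot>\<^bsub>C\<^esub> p = h \<cdot>\<^bsub>C\<^esub> f \<longrightarrow>
        (\<exists>u \<in> Hom C V (Src C f'). u \<cdot>\<^bsub>C\<^esub> f' = g \<and> u \<cdot>\<^bsub>C\<^esub> p' = h))"

locale uni_fractionable = category C for C :: "('o, 'm, 'z) cat_scheme" (structure) +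
  fixes Den SDen TDen :: "'m set"
  assumes den_semi_saturated: "semi_saturated C Den"
    and sden_multiplicative: "multiplicative C SDen" and sden_den: "SDen \<subseteq> Den"
    and tden_multiplicative: "multiplicative C TDen" and tden_den: "TDen \<subseteq> Den"
    and weak_universality_S: "\<lbrakk>i \<in> SDen; f \<in> Mor C; Src C f = Src C i\<rbrakk>
           \<Longrightarrow> \<exists>f'. \<exists>i' \<in> SDen. weak_pushout C i f f' i'"
    and weak_universality_T: "\<lbrakk>p \<in> TDen; f \<in> Mor C; Tgt C f = Tgt C p\<rbrakk>
           \<Longrightarrow> \<exists>f'. \<exists>p' \<in> TDen. weak_pullback C f p f' p'"
    and factorisation: "d \<in> Den \<Longrightarrow> \<exists>i \<in> SDen. \<exists>p \<in> TDen. Tgt C i = Src C p \<and> d = i \<cdot> p"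

text \<open>The morphism \<open>g\<close> below is the direct sum of the \<open>f k\<close> with respect to the given direct sums of
  their sources and of their targets.\<close>

locale additive_uni_fractionable =
  additive_category C + uni_fractionable C Den SDen TDen
  for C :: "('o, 'm, 'z) add_cat_scheme" (structure) and Den SDen TDen +
  assumes den_direct_sums: "\<And>n f g S ins prj T ins' prj'.
        \<lbrakk>\<And>k. k < n \<Longrightarrow> f k \<in> Den;
         direct_sum C n (\<lambda>k. Src C (f k)) S ins prj;
         direct_sum C n (\<lambda>k. Tgt C (f k)) T ins' prj';
         g \<in> Hom C S T; \<And>k. k < n \<Longrightarrow> ins k \<cdot> g = f k \<cdot> ins' k\<rbrakk> \<Longrightarrow> g \<in> Den"


section \<open>The fraction category\<close>

definition three_arrows :: "('o, 'm, 'z) cat_scheme \<Rightarrow> 'm set \<Rightarrow> ('m \<times> 'm \<times> 'm) set" where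
  "three_arrows C D = {(b, f, a). b \<in> D \<and> f \<in> Mor C \<and> a \<in> D \<and> Src C b = Src C f \<and> Tgt C a = Tgt C f}"

inductive fraction_step :: "('o, 'm, 'z) cat_scheme \<Rightarrow> 'm set
    \<Rightarrow> 'm \<times> 'm \<times> 'm \<Rightarrow> 'm \<times> 'm \<times> 'm \<Rightarrow> bool" for C D where
  right: "\<lbrakk>(b, f, a) \<in> three_arrows C D; c \<in> Mor C; Src C c = Tgt C a; a \<cdot>\<^bsub>C\<^esub> c \<in> D\<rbrakk>
            \<Longrightarrow> fraction_step C D (b, f, a) (b, f \<cdot>\<^bsub>C\<^esub> c, a \<cdot>\<^bsub>C\<^esub> c)"
| left: "\<lbrakk>(b, f, a) \<in> three_arrows C D; c \<in> Mor C; Tgt C c = Src C b; c \<cdot>\<^bsub>C\<^esub> b \<in> D\<rbrakk>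
            \<Longrightarrow> fraction_step C D (b, f, a) (c \<cdot>\<^bsub>C\<^esub> b, c \<cdot>\<^bsub>C\<^esub> f, a)"

definition fraction_equality :: "('o, 'm, 'z) cat_scheme \<Rightarrow> 'm set
    \<Rightarrow> (('m \<times> 'm \<times> 'm) \<times> ('m \<times> 'm \<times> 'm)) set" where
  "fraction_equality C D = {(s, t). s \<in> three_arrows C D \<and> t \<in> three_arrows C D \<and>
                              equivclp (fraction_step C D) s t}"

definition double_fraction :: "('o, 'm, 'z) cat_scheme \<Rightarrow> 'm set \<Rightarrow> 'm \<Rightarrow> 'm \<Rightarrow> 'm
    \<Rightarrow> ('m \<times> 'm \<times> 'm) set" where
  "double_fraction C D b f a = fraction_equality C D `` {(b, f, a)}"

text \<open>\<open>composite_choice C S T s\<^sub>1 s\<^sub>2 s\<close>: the 3-arrow \<open>s\<close> is a possible outcome of composing the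
  3-arrows \<open>s\<^sub>1\<close> and \<open>s\<^sub>2\<close>, given the S-denominators \<open>S\<close> and the T-denominators \<open>T\<close>.\<close>

inductive composite_choice :: "('o, 'm, 'z) cat_scheme \<Rightarrow> 'm set \<Rightarrow> 'm set
    \<Rightarrow> 'm \<times> 'm \<times> 'm \<Rightarrow> 'm \<times> 'm \<times> 'm \<Rightarrow> 'm \<times> 'm \<times> 'm \<Rightarrow> bool" for C S T where
  "\<lbrakk>Tgt C b2 = Src C a1;
    j \<in> S; q \<in> T; Tgt C j = Src C q; b2 \<cdot>\<^bsub>C\<^esub> a1 = j \<cdot>\<^bsub>C\<^esub> q;
    q' \<in> T; Tgt C q' = Src C f1; f1' \<in> Hom C (Src C q') (Src C q);
    f1' \<cdot>\<^bsub>C\<^esub> q = q' \<cdot>\<^bsub>C\<^esub> f1;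
    j' \<in> S; Src C j' = Tgt C f2; f2' \<in> Hom C (Tgt C j) (Tgt C j');
    j \<cdot>\<^bsub>C\<^esub> f2' = f2 \<cdot>\<^bsub>C\<^esub> j'\<rbrakk>
   \<Longrightarrow> composite_choice C S T (b1, f1, a1) (b2, f2, a2)
         (q' \<cdot>\<^bsub>C\<^esub> b1, f1' \<cdot>\<^bsub>C\<^esub> f2', a2 \<cdot>\<^bsub>C\<^esub> j')"

text \<open>As for library quotients, composition is the union over all representatives and all choices;
  independence of the choices means that this union is a single double fraction.\<close>

definition Frac :: "('o, 'm, 'z) cat_scheme \<Rightarrow> 'm set \<Rightarrow> 'm set \<Rightarrow> 'm set
    \<Rightarrow> ('o, ('m \<times> 'm \<times> 'm) set) cat" where
  "Frac C D S T =
     \<lparr> Ob = Ob C,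
       Mor = three_arrows C D // fraction_equality C D,
       Src = (\<lambda>P. the_elem ((\<lambda>(b, f, a). Tgt C b) ` P)),
       Tgt = (\<lambda>P. the_elem ((\<lambda>(b, f, a). Src C a) ` P)),
       Idn = (\<lambda>X. double_fraction C D (Idn C X) (Idn C X) (Idn C X)),
       Cmp = (\<lambda>P Q. \<Union>(b, f, a) \<in> {s. \<exists>s1 \<in> P. \<exists>s2 \<in> Q. composite_choice C S T s1 s2 s}.
                      double_fraction C D b f a) \<rparr>"

definition loc :: "('o, 'm, 'z) cat_scheme \<Rightarrow> 'm set \<Rightarrow> 'm \<Rightarrow> ('m \<times> 'm \<times> 'm) set" where
  "loc C D f = double_fraction C D (Idn C (Src C f)) f (Idn C (Tgt C f))"

definition saturated :: "('o, 'm, 'z) cat_scheme \<Rightarrow> 'm set \<Rightarrow> 'm set \<Rightarrow> 'm set \<Rightarrow> bool" where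
  "saturated C D S T \<longleftrightarrow> (\<forall>f \<in> Mor C. is_iso (Frac C D S T) (loc C D f) \<longrightarrow> f \<in> D)"


section \<open>Localisation\<close>

text \<open>The localisation of a category at a set \<open>D\<close> of morphisms, in the Gabriel--Zisman construction:
  zigzags of morphisms and formal inverses (\<open>Bwd d\<close>) of elements of \<open>D\<close>, modulo the congruence
  which makes the morphisms compose as in \<open>C\<close> and \<open>Bwd d\<close> inverse to \<open>Fwd d\<close>.\<close>

datatype 'm letter = Fwd 'm | Bwd 'm

primrec zigzag :: "('o, 'm, 'z) cat_scheme \<Rightarrow> 'm set \<Rightarrow> 'o \<Rightarrow> 'm letter list \<Rightarrow> 'o \<Rightarrow> bool" where
  "zigzag C D X [] Y \<longleftrightarrow> X \<in> Ob C \<and> X = Y"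
| "zigzag C D X (l # w) Y \<longleftrightarrow>
     (case l of Fwd f \<Rightarrow> f \<in> Mor C \<and> Src C f = X \<and> zigzag C D (Tgt C f) w Y
              | Bwd d \<Rightarrow> d \<in> D \<and> Tgt C d = X \<and> zigzag C D (Src C d) w Y)"

definition zigzag_cat :: "('o, 'm, 'z) cat_scheme \<Rightarrow> 'm set
    \<Rightarrow> ('o, 'o \<times> 'm letter list \<times> 'o) cat" where
  "zigzag_cat C D =
     \<lparr> Ob = Ob C,
       Mor = {(X, w, Y). zigzag C D X w Y},
       Src = (\<lambda>(X, w, Y). X),
       Tgt = (\<lambda>(X, w, Y). Y),
       Idn = (\<lambda>X. (X, [], X)),
       Cmp = (\<lambda>(X, w, Y) (X', w', Y'). (X, w @ w', Y')) \<rparr>"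

inductive zigzag_rule :: "('o, 'm, 'z) cat_scheme \<Rightarrow> 'm set
    \<Rightarrow> 'm letter list \<Rightarrow> 'm letter list \<Rightarrow> bool" for C D where
  "X \<in> Ob C \<Longrightarrow> zigzag_rule C D [Fwd (Idn C X)] []"
| "\<lbrakk>f \<in> Mor C; g \<in> Mor C; Tgt C f = Src C g\<rbrakk> \<Longrightarrow> zigzag_rule C D [Fwd f, Fwd g] [Fwd (f \<cdot>\<^bsub>C\<^esub> g)]"
| "d \<in> D \<Longrightarrow> zigzag_rule C D [Fwd d, Bwd d] []"
| "d \<in> D \<Longrightarrow> zigzag_rule C D [Bwd d, Fwd d] []"

inductive zigzag_step :: "('o, 'm, 'z) cat_scheme \<Rightarrow> 'm set
    \<Rightarrow> 'o \<times> 'm letter list \<times> 'o \<Rightarrow> 'o \<times> 'm letter list \<times> 'o \<Rightarrow> bool" for C D where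
  "\<lbrakk>zigzag_rule C D l r; zigzag C D X (u @ l @ v) Y; zigzag C D X (u @ r @ v) Y\<rbrakk>
     \<Longrightarrow> zigzag_step C D (X, u @ l @ v, Y) (X, u @ r @ v, Y)"

definition localisation :: "('o, 'm, 'z) cat_scheme \<Rightarrow> 'm set
    \<Rightarrow> ('o, ('o \<times> 'm letter list \<times> 'o) set) cat" where
  "localisation C D = quotient_cat (zigzag_cat C D)
     {(s, t). s \<in> Mor (zigzag_cat C D) \<and> t \<in> Mor (zigzag_cat C D) \<and> equivclp (zigzag_step C D) s t}"


section \<open>Complexes, cohomology and the derived category\<close>

datatype ('o, 'm) cochain = Cochain (obj: "int \<Rightarrow> 'o") (diff: "int \<Rightarrow> 'm")

datatype ('o, 'm) cochain_map =
  Cochain_Map (source: "('o, 'm) cochain") (component: "int \<Rightarrow> 'm") (target: "('o, 'm) cochain")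

definition complexes :: "('o, 'm, 'z) add_cat_scheme \<Rightarrow> ('o, 'm) cochain set" where
  "complexes A = {X. (\<forall>n. obj X n \<in> Ob A) \<and>
     (\<forall>n. diff X n \<in> Hom A (obj X n) (obj X (n + 1))) \<and>
     (\<forall>n. diff X n \<cdot>\<^bsub>A\<^esub> diff X (n + 1) = Zer A (obj X n) (obj X (n + 2)))}"

definition complex_mors :: "('o, 'm, 'z) add_cat_scheme \<Rightarrow> ('o, 'm) cochain_map set" where
  "complex_mors A = {f. source f \<in> complexes A \<and> target f \<in> complexes A \<and>
     (\<forall>n. component f n \<in> Hom A (obj (source f) n) (obj (target f) n)) \<and>
     (\<forall>n. diff (source f) n \<cdot>\<^bsub>A\<^esub> component f (n + 1) = component f n \<cdot>\<^bsub>A\<^esub> diff (target f) n)}"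

definition complex_cat :: "('o, 'm, 'z) add_cat_scheme
    \<Rightarrow> (('o, 'm) cochain, ('o, 'm) cochain_map) add_cat" where
  "complex_cat A =
     \<lparr> Ob = complexes A,
       Mor = complex_mors A,
       Src = source,
       Tgt = target,
       Idn = (\<lambda>X. Cochain_Map X (\<lambda>n. Idn A (obj X n)) X),
       Cmp = (\<lambda>f g. Cochain_Map (source f) (\<lambda>n. component f n \<cdot>\<^bsub>A\<^esub> component g n) (target g)),
       Add = (\<lambda>f g. Cochain_Map (source f) (\<lambda>n. Add A (component f n) (component g n)) (target f)),
       Zer = (\<lambda>X Y. Cochain_Map X (\<lambda>n. Zer A (obj X n) (obj Y n)) Y) \<rparr>"

definition homotopic :: "('o, 'm, 'z) add_cat_scheme
    \<Rightarrow> (('o, 'm) cochain_map \<times> ('o, 'm) cochain_map) set" where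
  "homotopic A = {(f, g). f \<in> complex_mors A \<and> g \<in> complex_mors A \<and>
     source f = source g \<and> target f = target g \<and>
     (\<exists>h. (\<forall>n. h n \<in> Hom A (obj (source f) n) (obj (target f) (n - 1))) \<and>
          (\<forall>n. component f n =
                 Add A (component g n)
                   (Add A (diff (source f) n \<cdot>\<^bsub>A\<^esub> h (n + 1)) (h n \<cdot>\<^bsub>A\<^esub> diff (target f) (n - 1)))))}"

definition homotopy_cat :: "('o, 'm, 'z) add_cat_scheme
    \<Rightarrow> (('o, 'm) cochain, ('o, 'm) cochain_map set) cat" where
  "homotopy_cat A = quotient_cat (complex_cat A) (homotopic A)"

definition graded_cat :: "('o, 'm, 'z) cat_scheme \<Rightarrow> (int \<Rightarrow> 'o, int \<Rightarrow> 'm) cat" where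
  "graded_cat A =
     \<lparr> Ob = {X. \<forall>n. X n \<in> Ob A},
       Mor = {f. \<forall>n. f n \<in> Mor A},
       Src = (\<lambda>f n. Src A (f n)),
       Tgt = (\<lambda>f n. Tgt A (f n)),
       Idn = (\<lambda>X n. Idn A (X n)),
       Cmp = (\<lambda>f g n. f n \<cdot>\<^bsub>A\<^esub> g n) \<rparr>"

text \<open>\<open>cocycles_incl A X n\<close> is a chosen kernel of the differential \<open>diff X n\<close>;
  \<open>coboundary A X n\<close> is the factorisation of \<open>diff X (n - 1)\<close> through it; and \<open>cohomology_proj A X n\<close>
  is a chosen cokernel of that factorisation, whose target is the cohomology object in degree \<open>n\<close>.\<close>

definition cocycles_incl :: "('o, 'm, 'z) add_cat_scheme \<Rightarrow> ('o, 'm) cochain \<Rightarrow> int \<Rightarrow> 'm" where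
  "cocycles_incl A X n = (SOME k. is_kernel A (diff X n) k)"

definition coboundary :: "('o, 'm, 'z) add_cat_scheme \<Rightarrow> ('o, 'm) cochain \<Rightarrow> int \<Rightarrow> 'm" where
  "coboundary A X n =
     (THE u. u \<in> Hom A (obj X (n - 1)) (Src A (cocycles_incl A X n)) \<and>
             u \<cdot>\<^bsub>A\<^esub> cocycles_incl A X n = diff X (n - 1))"

definition cohomology_proj :: "('o, 'm, 'z) add_cat_scheme \<Rightarrow> ('o, 'm) cochain \<Rightarrow> int \<Rightarrow> 'm" where
  "cohomology_proj A X n = (SOME c. is_cokernel A (coboundary A X n) c)"

definition cohomology_ob :: "('o, 'm, 'z) add_cat_scheme \<Rightarrow> ('o, 'm) cochain \<Rightarrow> int \<Rightarrow> 'o" where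
  "cohomology_ob A X n = Tgt A (cohomology_proj A X n)"

definition cocycles_mor :: "('o, 'm, 'z) add_cat_scheme \<Rightarrow> ('o, 'm) cochain_map \<Rightarrow> int \<Rightarrow> 'm" where
  "cocycles_mor A f n =
     (THE z. z \<in> Hom A (Src A (cocycles_incl A (source f) n)) (Src A (cocycles_incl A (target f) n)) \<and>
             z \<cdot>\<^bsub>A\<^esub> cocycles_incl A (target f) n = cocycles_incl A (source f) n \<cdot>\<^bsub>A\<^esub> component f n)"

definition cohomology_mor :: "('o, 'm, 'z) add_cat_scheme \<Rightarrow> ('o, 'm) cochain_map \<Rightarrow> int \<Rightarrow> 'm" where
  "cohomology_mor A f n =
     (THE h. h \<in> Hom A (cohomology_ob A (source f) n) (cohomology_ob A (target f) n) \<and>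
             cohomology_proj A (source f) n \<cdot>\<^bsub>A\<^esub> h = cocycles_mor A f n \<cdot>\<^bsub>A\<^esub> cohomology_proj A (target f) n)"

definition complex_Den :: "('o, 'm, 'z) add_cat_scheme \<Rightarrow> ('o, 'm) cochain_map set" where
  "complex_Den A = {f \<in> Mor (complex_cat A). is_iso (graded_cat A) (cohomology_mor A f)}"

definition complex_SDen :: "('o, 'm, 'z) add_cat_scheme \<Rightarrow> ('o, 'm) cochain_map set" where
  "complex_SDen A = {i \<in> complex_Den A. is_mono (complex_cat A) i}"

definition complex_TDen :: "('o, 'm, 'z) add_cat_scheme \<Rightarrow> ('o, 'm) cochain_map set" where
  "complex_TDen A = {p \<in> complex_Den A. is_epi (complex_cat A) p}"

definition derived_cat :: "('o, 'm, 'z) add_cat_scheme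
    \<Rightarrow> (('o, 'm) cochain, (('o, 'm) cochain \<times> ('o, 'm) cochain_map set letter list
                            \<times> ('o, 'm) cochain) set) cat" where
  "derived_cat A =
     localisation (homotopy_cat A) {homotopic A `` {f} | f. f \<in> complex_Den A}"

end

theory Submission
  imports Defs
begin

text \<open>
  Fractions: a 3-arrow \<open>(b, f, a)\<close> stands for \<open>b\<inverse> f a\<inverse>\<close>.  Morphisms and formal inverses of
  denominators act from the right on the classes of 3-arrows: \<open>d\<inverse>\<close> sends \<open>(b, f, a)\<close> to
  \<open>(b, f, d a)\<close>, while for \<open>g\<close> one writes \<open>a = i p\<close> with \<open>i\<close> an S- and \<open>p\<close> a T-denominator and moves
  \<open>g\<close> past \<open>i\<close> and \<open>f\<close> past \<open>p\<close>.  Evaluating zigzags at \<open>(1, 1, 1)\<close> inverts the obvious map from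
  double fractions to the localisation, so that the latter is the fraction category.  Homotopic
  morphisms factor through a cylinder \<open>X \<oplus> Cone(1\<^sub>X)\<close>, hence act equally, so that one may localise
  the homotopy category instead.

  Complexes: a morphism is a quasi-isomorphism iff it is surjective and injective on cohomology classes
  of generalised elements, after passing to epimorphic covers of their domains.  With this
  criterion the pushout of a monomorphic and the pullback of an epimorphic quasi-isomorphism are
  element chases.  Factorisations are \<open>X \<rightarrow> Y \<oplus> Cone(1\<^sub>X) \<rightarrow> Y\<close>, and saturation holds because
  cohomology extends to double fractions.
\<close>

section \<open>Quotient categories and localisations\<close>

text \<open>Fraction equality is merely generated by elementary steps, and no criterion for it is
  available; separating double fractions needs an invariant, and the action on classes is that
  invariant. Its well-definedness is the core of the fraction part: the action of a morphism
  involves a factorisation of \<open>a\<close> and two completions of squares, and it is weak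
  universality that makes different choices agree. The category laws of \<open>Frac\<close> are
  never checked on 3-arrows; they are transported along a bijection with the localisation. On the
  abelian side the objects have no elements and the operations are partial. Elements become
  morphisms \<open>T -> X\<close>, and each lift along an epimorphism costs a change of
  \<open>T\<close>. The partiality is removed by computing in one ring, with membership in
  \<open>H X Y\<close> as the only trace of sources and targets. As S- and T-denominators are
  defined by cancellation in the category of complexes, monomorphisms and epimorphisms must first be
  recognised degreewise, by testing against contractible complexes.\<close>

context category
begin

lemma HomI [intro]: "\<lbrakk>f \<in> Mor C; Src C f = X; Tgt C f = Y\<rbrakk> \<Longrightarrow> f \<in> Hom C X Y"
  by (simp add: Hom_def)

lemma HomD: "f \<in> Hom C X Y \<Longrightarrow> f \<in> Mor C" "f \<in> Hom C X Y \<Longrightarrow> Src C f = X"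
  "f \<in> Hom C X Y \<Longrightarrow> Tgt C f = Y" "f \<in> Hom C X Y \<Longrightarrow> X \<in> Ob C" "f \<in> Hom C X Y \<Longrightarrow> Y \<in> Ob C"
  using src_closed tgt_closed by (auto simp: Hom_def)

lemma comp_mor [simp]:
  assumes "f \<in> Mor C" "g \<in> Mor C" "Tgt C f = Src C g"
  shows "f \<cdot> g \<in> Mor C" "Src C (f \<cdot> g) = Src C f" "Tgt C (f \<cdot> g) = Tgt C g"
  using comp_closed[of f "Src C f" "Tgt C f" g "Tgt C g"] assms by (auto simp: Hom_def)

lemma id_mor [simp]:
  assumes "X \<in> Ob C"
  shows "Idn C X \<in> Mor C" "Src C (Idn C X) = X" "Tgt C (Idn C X) = X"
  using id_closed[OF assms] by (auto simp: Hom_def)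

lemma comp_assoc' [simp]:
  "\<lbrakk>f \<in> Mor C; g \<in> Mor C; h \<in> Mor C; Tgt C f = Src C g; Tgt C g = Src C h\<rbrakk>
    \<Longrightarrow> (f \<cdot> g) \<cdot> h = f \<cdot> (g \<cdot> h)"
  by (rule comp_assoc) auto

lemma id_left' [simp]: "\<lbrakk>f \<in> Mor C; Src C f = X\<rbrakk> \<Longrightarrow> Idn C X \<cdot> f = f"
  using id_left by auto

lemma id_right' [simp]: "\<lbrakk>f \<in> Mor C; Tgt C f = X\<rbrakk> \<Longrightarrow> f \<cdot> Idn C X = f"
  using id_right by auto

lemma src_ob [simp]: "f \<in> Mor C \<Longrightarrow> Src C f \<in> Ob C" and tgt_ob [simp]: "f \<in> Mor C \<Longrightarrow> Tgt C f \<in> Ob C"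
  using src_closed tgt_closed by auto

end

section \<open>Quotients of a category by a congruence on its morphisms\<close>

locale category_congruence = category C for C :: "('o, 'm, 'z) cat_scheme" (structure) +
  fixes r :: "('m \<times> 'm) set"
  assumes cong_equiv: "equiv (Mor C) r"
    and cong_parallel: "(f, g) \<in> r \<Longrightarrow> Src C f = Src C g \<and> Tgt C f = Tgt C g"
    and cong_comp: "\<lbrakk>(f, f') \<in> r; (g, g') \<in> r; Tgt C f = Src C g\<rbrakk> \<Longrightarrow> (f \<cdot> g, f' \<cdot> g') \<in> r"
begin

abbreviation Q where "Q \<equiv> quotient_cat C r"

lemma cong_mor: "(f, g) \<in> r \<Longrightarrow> f \<in> Mor C" "(f, g) \<in> r \<Longrightarrow> g \<in> Mor C"
  using equiv_type[OF cong_equiv] by blast+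

lemma cong_refl: "f \<in> Mor C \<Longrightarrow> (f, f) \<in> r"
  using cong_equiv by (meson equivE refl_onD)

lemma class_eq: "f \<in> Mor C \<Longrightarrow> g \<in> Mor C \<Longrightarrow> r `` {f} = r `` {g} \<longleftrightarrow> (f, g) \<in> r"
  using cong_equiv by (meson eq_equiv_class_iff)

lemma quotient_Mor: "Mor Q = Mor C // r" and quotient_Ob [simp]: "Ob Q = Ob C"
  by (simp_all add: quotient_cat_def)

lemma class_mor [simp]: "f \<in> Mor C \<Longrightarrow> r `` {f} \<in> Mor Q"
  by (simp add: quotient_Mor quotientI)

lemma quotient_morE: assumes "P \<in> Mor Q" obtains f where "f \<in> Mor C" "P = r `` {f}"
  using assms by (auto simp: quotient_Mor elim: quotientE)

lemma class_src [simp]: assumes f: "f \<in> Mor C" shows "Src Q (r `` {f}) = Src C f"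
proof -
  have "Src C ` (r `` {f}) = (\<lambda>_. Src C f) ` (r `` {f})"
    by (rule image_cong[OF refl]) (metis Image_singleton_iff cong_parallel)
  also have "\<dots> = {Src C f}"
    using cong_refl[OF f] by (blast intro: image_constant)
  finally show ?thesis by (simp add: quotient_cat_def)
qed

lemma class_tgt [simp]: assumes f: "f \<in> Mor C" shows "Tgt Q (r `` {f}) = Tgt C f"
proof -
  have "Tgt C ` (r `` {f}) = (\<lambda>_. Tgt C f) ` (r `` {f})"
    by (rule image_cong[OF refl]) (metis Image_singleton_iff cong_parallel)
  also have "\<dots> = {Tgt C f}"
    using cong_refl[OF f] by (blast intro: image_constant)
  finally show ?thesis by (simp add: quotient_cat_def)
qed

lemma class_id: "Idn Q X = r `` {Idn C X}"
  by (simp add: quotient_cat_def)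

text \<open>Compatibility of the relation with composition makes all members of the double union
  equal, and reflexivity makes the union nonempty; together they collapse it to a single
  class.\<close>

lemma class_comp:
  assumes f: "f \<in> Mor C" and g: "g \<in> Mor C" and fg: "Tgt C f = Src C g"
  shows "(r `` {f}) \<cdot>\<^bsub>Q\<^esub> (r `` {g}) = r `` {f \<cdot> g}"
proof -
  have *: "r `` {f' \<cdot> g'} = r `` {f \<cdot> g}" if "(f, f') \<in> r" "(g, g') \<in> r" for f' g'
    using equiv_class_eq[OF cong_equiv cong_comp[OF that fg]] by (rule sym)
  have "(\<Union>f'\<in>r `` {f}. \<Union>g'\<in>r `` {g}. r `` {f' \<cdot> g'}) = r `` {f \<cdot> g}"
  proof (intro equalityI subsetI)
    fix x assume "x \<in> (\<Union>f'\<in>r `` {f}. \<Union>g'\<in>r `` {g}. r `` {f' \<cdot> g'})"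
    then obtain f' g' where "(f, f') \<in> r" "(g, g') \<in> r" "x \<in> r `` {f' \<cdot> g'}" by blast
    then show "x \<in> r `` {f \<cdot> g}" using *[of f' g'] by (simp only:)
  next
    fix x assume "x \<in> r `` {f \<cdot> g}"
    then show "x \<in> (\<Union>f'\<in>r `` {f}. \<Union>g'\<in>r `` {g}. r `` {f' \<cdot> g'})"
      using cong_refl[OF f] cong_refl[OF g] by blast
  qed
  then show ?thesis by (simp add: quotient_cat_def)
qed

sublocale quotient: category Q
proof
  fix P assume "P \<in> Mor Q"
  then obtain f where f: "f \<in> Mor C" "P = r `` {f}" by (rule quotient_morE)
  then show "Src Q P \<in> Ob Q" "Tgt Q P \<in> Ob Q" by auto
  show "Idn Q (Src Q P) \<cdot>\<^bsub>Q\<^esub> P = P" "P \<cdot>\<^bsub>Q\<^esub> Idn Q (Tgt Q P) = P"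
    using f by (simp_all add: class_id class_comp)
next
  fix X assume "X \<in> Ob Q"
  then show "Idn Q X \<in> Hom Q X X" by (simp add: class_id Hom_def)
next
  fix P R X Y Z assume PR: "P \<in> Hom Q X Y" "R \<in> Hom Q Y Z"
  then obtain f g where "f \<in> Mor C" "P = r `` {f}" "g \<in> Mor C" "R = r `` {g}"
    by (metis (no_types, lifting) Hom_def mem_Collect_eq quotient_morE)
  with PR show "P \<cdot>\<^bsub>Q\<^esub> R \<in> Hom Q X Z" by (auto simp: Hom_def class_comp)
next
  fix P R S W X Y Z assume PR: "P \<in> Hom Q W X" "R \<in> Hom Q X Y" "S \<in> Hom Q Y Z"
  then obtain f g h where "f \<in> Mor C" "P = r `` {f}" "g \<in> Mor C" "R = r `` {g}" "h \<in> Mor C" "S = r `` {h}"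
    by (metis (no_types, lifting) Hom_def mem_Collect_eq quotient_morE)
  with PR show "(P \<cdot>\<^bsub>Q\<^esub> R) \<cdot>\<^bsub>Q\<^esub> S = P \<cdot>\<^bsub>Q\<^esub> (R \<cdot>\<^bsub>Q\<^esub> S)" by (auto simp: Hom_def class_comp)
qed

end

section \<open>Zigzags modulo rewriting form a category\<close>

locale localised_category = category C for C :: "('o, 'm, 'z) cat_scheme" (structure) +
  fixes D :: "'m set"
  assumes D_mor: "D \<subseteq> Mor C"
begin

definition zz_rel where
  "zz_rel = {(s, t). s \<in> Mor (zigzag_cat C D) \<and> t \<in> Mor (zigzag_cat C D) \<and> equivclp (zigzag_step C D) s t}"

lemma zz_rel_iff: "(s, t) \<in> zz_rel \<longleftrightarrow>
    s \<in> Mor (zigzag_cat C D) \<and> t \<in> Mor (zigzag_cat C D) \<and> equivclp (zigzag_step C D) s t"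
  by (simp add: zz_rel_def)

lemma zigzag_ob: "zigzag C D X w Y \<Longrightarrow> X \<in> Ob C \<and> Y \<in> Ob C"
  using D_mor by (induction w arbitrary: X) (auto split: letter.splits)

lemma zigzag_append: "zigzag C D X (u @ v) Y \<longleftrightarrow> (\<exists>Z. zigzag C D X u Z \<and> zigzag C D Z v Y)"
proof (induction u arbitrary: X)
  case Nil
  then show ?case using zigzag_ob by auto
qed (auto split: letter.splits)

lemma zigzag_step_parallel:
  "zigzag_step C D s t \<Longrightarrow> s \<in> Mor (zigzag_cat C D) \<and> t \<in> Mor (zigzag_cat C D) \<and>
     fst s = fst t \<and> snd (snd s) = snd (snd t)"
  by (erule zigzag_step.cases) (auto simp: zigzag_cat_def)

lemma equivclp_step_parallel:
  "equivclp (zigzag_step C D) s t \<Longrightarrow> fst s = fst t \<and> snd (snd s) = snd (snd t)"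
  by (induction rule: equivclp_induct) (use zigzag_step_parallel in fastforce)+

text \<open>A step already carries a context \<open>u\<close>, \<open>v\<close>, so attaching
  \<open>p\<close> and \<open>q\<close> at the ends only enlarges this context. This is what makes
  the generated equivalence compatible with concatenation.\<close>

lemma zigzag_step_extend:
  assumes "zigzag_step C D s t" "zigzag C D V p (fst s)" "zigzag C D (snd (snd s)) q W"
  shows "zigzag_step C D (V, p @ fst (snd s) @ q, W) (V, p @ fst (snd t) @ q, W)"
  using assms(1)
proof cases
  case (1 l r X u v Y)
  have z: "zigzag C D V (p @ u @ l @ v @ q) W" "zigzag C D V (p @ u @ r @ v @ q) W"
    using 1 assms(2,3) by (force simp: zigzag_append)+
  show ?thesis
    using zigzag_step.intros[OF 1(3), of V "p @ u" "v @ q" W] z 1 by simp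
qed

lemma zz_rel_extend:
  assumes "equivclp (zigzag_step C D) s t" "zigzag C D V p (fst s)" "zigzag C D (snd (snd s)) q W"
  shows "equivclp (zigzag_step C D) (V, p @ fst (snd s) @ q, W) (V, p @ fst (snd t) @ q, W)"
  using assms
proof (induction rule: equivclp_induct)
  case (step y z)
  have "fst s = fst y" "snd (snd s) = snd (snd y)"
    using equivclp_step_parallel[OF step(1)] by auto
  moreover from step(2) have "fst y = fst z \<and> snd (snd y) = snd (snd z)"
    using zigzag_step_parallel by fastforce
  ultimately have "zigzag_step C D (V, p @ fst (snd y) @ q, W) (V, p @ fst (snd z) @ q, W) \<or>
     zigzag_step C D (V, p @ fst (snd z) @ q, W) (V, p @ fst (snd y) @ q, W)"
    using step(2,4,5) zigzag_step_extend[of y z V p q W] zigzag_step_extend[of z y V p q W] by auto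
  then show ?case using step.IH[OF step.prems] by (blast intro: equivclp_into_equivclp)
qed auto

lemma zigzag_cat_simps [simp]:
  "Ob (zigzag_cat C D) = Ob C" "(X, w, Y) \<in> Mor (zigzag_cat C D) \<longleftrightarrow> zigzag C D X w Y"
  "Src (zigzag_cat C D) (X, w, Y) = X" "Tgt (zigzag_cat C D) (X, w, Y) = Y"
  "Idn (zigzag_cat C D) X = (X, [], X)"
  "(X, w, Y) \<cdot>\<^bsub>zigzag_cat C D\<^esub> (X', w', Y') = (X, w @ w', Y')"
  by (simp_all add: zigzag_cat_def)

sublocale zz: category_congruence "zigzag_cat C D" zz_rel
proof unfold_locales
  fix f f' g g' assume "(f, f') \<in> zz_rel" "(g, g') \<in> zz_rel" "Tgt (zigzag_cat C D) f = Src (zigzag_cat C D) g"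
  then show "(f \<cdot>\<^bsub>zigzag_cat C D\<^esub> g, f' \<cdot>\<^bsub>zigzag_cat C D\<^esub> g') \<in> zz_rel"
  proof (cases f; cases f'; cases g; cases g')
    fix X w Y X' w' Y' X1 v Y1 X1' v' Y1'
    assume e: "f = (X, w, Y)" "f' = (X', w', Y')" "g = (X1, v, Y1)" "g' = (X1', v', Y1')"
    assume "(f, f') \<in> zz_rel" "(g, g') \<in> zz_rel" "Tgt (zigzag_cat C D) f = Src (zigzag_cat C D) g"
    then have *: "equivclp (zigzag_step C D) f f'" "equivclp (zigzag_step C D) g g'" "Y = X1"
      "zigzag C D X w Y" "zigzag C D X' w' Y'" "zigzag C D X1 v Y1" "zigzag C D X1' v' Y1'"
      using e by (auto simp: zz_rel_iff)
    then have p: "X = X'" "Y = Y'" "X1 = X1'" "Y1 = Y1'"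
      using equivclp_step_parallel e by fastforce+
    \<comment> \<open>The left factor is rewritten first, with \<open>v\<close> as context, and then
      the right factor, with \<open>w'\<close> as context.\<close>
    have "equivclp (zigzag_step C D) (X, w @ v, Y1) (X, w' @ v, Y1)"
      using zz_rel_extend[OF *(1), of X "[]" v Y1] e * zigzag_ob by auto
    moreover have "equivclp (zigzag_step C D) (X, w' @ v, Y1) (X, w' @ v', Y1)"
      using zz_rel_extend[OF *(2), of X w' "[]" Y1] e * p zigzag_ob by auto
    ultimately show ?thesis
      using e * p equivclp_trans[of "zigzag_step C D" "(X, w @ v, Y1)"] by (auto simp: zigzag_append zz_rel_iff)
  qed
next
  show "equiv (Mor (zigzag_cat C D)) zz_rel"
  proof (rule equivI)
    show "trans zz_rel"
    proof (rule transI)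
      fix s t u assume "(s, t) \<in> zz_rel" "(t, u) \<in> zz_rel"
      then show "(s, u) \<in> zz_rel"
        using equivclp_trans[of "zigzag_step C D" s t u] by (simp add: zz_rel_iff)
    qed
    show "sym zz_rel"
      using equivclp_sym by (auto simp: sym_def zz_rel_iff)
  qed (auto simp: refl_on_def zz_rel_iff)
next
  fix f g assume "(f, g) \<in> zz_rel"
  then show "Src (zigzag_cat C D) f = Src (zigzag_cat C D) g \<and> Tgt (zigzag_cat C D) f = Tgt (zigzag_cat C D) g"
    using equivclp_step_parallel[of f g] by (cases f; cases g) (simp add: zz_rel_iff)
qed (use zigzag_ob in \<open>auto simp: zigzag_append Hom_def\<close>)

abbreviation L where "L \<equiv> localisation C D"

definition zclass where "zclass X w Y = zz_rel `` {(X, w, Y)}"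

lemma localisation_eq: "L = quotient_cat (zigzag_cat C D) zz_rel"
  by (simp add: localisation_def zz_rel_def)

sublocale loc: category L
  unfolding localisation_eq by (rule zz.quotient.category_axioms)

lemma zclass_mor [simp]: "zigzag C D X w Y \<Longrightarrow> zclass X w Y \<in> Mor L"
  "zigzag C D X w Y \<Longrightarrow> Src L (zclass X w Y) = X"
  "zigzag C D X w Y \<Longrightarrow> Tgt L (zclass X w Y) = Y"
  by (simp_all add: zclass_def localisation_eq)

lemma zclass_comp [simp]:
  "\<lbrakk>zigzag C D X u Y; zigzag C D Y v Z\<rbrakk> \<Longrightarrow> zclass X u Y \<cdot>\<^bsub>L\<^esub> zclass Y v Z = zclass X (u @ v) Z"
  by (simp add: zclass_def localisation_eq zz.class_comp)

lemma zclass_id: "Idn L X = zclass X [] X"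
  by (simp add: zclass_def localisation_eq zz.class_id)

lemma localisation_ob [simp]: "Ob L = Ob C"
  by (simp add: localisation_eq)

lemma localisation_morE:
  assumes "x \<in> Mor L" obtains X w Y where "zigzag C D X w Y" "x = zclass X w Y"
proof -
  from assms obtain s where "s \<in> Mor (zigzag_cat C D)" "x = zz_rel `` {s}"
    unfolding localisation_eq by (rule zz.quotient_morE)
  then show ?thesis using that unfolding zclass_def by (cases s) auto
qed

lemma zclass_eq:
  "\<lbrakk>zigzag C D X w Y; zigzag C D X' w' Y'\<rbrakk> \<Longrightarrow>
    zclass X w Y = zclass X' w' Y' \<longleftrightarrow> equivclp (zigzag_step C D) (X, w, Y) (X', w', Y')"
  unfolding zclass_def by (subst zz.class_eq) (auto simp: zz_rel_iff)

lemma zclass_rule: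
  assumes "zigzag_rule C D l r" "zigzag C D X l Y" "zigzag C D X r Y"
  shows "zclass X l Y = zclass X r Y"
proof -
  have "zigzag_step C D (X, l, Y) (X, r, Y)"
    using zigzag_step.intros[OF assms(1), of X "[]" "[]" Y] assms(2,3) by simp
  then show ?thesis using assms by (auto simp: zclass_eq)
qed

end

section \<open>Fraction equality\<close>

context uni_fractionable
begin

abbreviation arrows where "arrows \<equiv> three_arrows C Den"
definition feq (infix "\<approx>" 50) where "s \<approx> t \<longleftrightarrow> (s, t) \<in> fraction_equality C Den"

lemma arrows_iff:
  "(b, f, a) \<in> arrows \<longleftrightarrow> b \<in> Den \<and> f \<in> Mor C \<and> a \<in> Den \<and> Src C b = Src C f \<and> Tgt C a = Tgt C f"
  by (simp add: three_arrows_def)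

lemma den_mor [simp]: "d \<in> Den \<Longrightarrow> d \<in> Mor C"
  and den_comp: "\<lbrakk>f \<in> Den; g \<in> Den; Tgt C f = Src C g\<rbrakk> \<Longrightarrow> f \<cdot> g \<in> Den"
  and den_id [simp]: "X \<in> Ob C \<Longrightarrow> Idn C X \<in> Den"
  and den_cancel_left: "\<lbrakk>f \<in> Den; f \<cdot> g \<in> Den; g \<in> Mor C; Tgt C f = Src C g\<rbrakk> \<Longrightarrow> g \<in> Den"
  and den_cancel_right: "\<lbrakk>g \<in> Den; f \<cdot> g \<in> Den; f \<in> Mor C; Tgt C f = Src C g\<rbrakk> \<Longrightarrow> f \<in> Den"
  using den_semi_saturated unfolding semi_saturated_def multiplicative_def by blast+

lemma sden [simp]: "i \<in> SDen \<Longrightarrow> i \<in> Den" "i \<in> SDen \<Longrightarrow> i \<in> Mor C"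
  and sden_comp: "\<lbrakk>i \<in> SDen; j \<in> SDen; Tgt C i = Src C j\<rbrakk> \<Longrightarrow> i \<cdot> j \<in> SDen"
  and sden_id [simp]: "X \<in> Ob C \<Longrightarrow> Idn C X \<in> SDen"
  using sden_den sden_multiplicative unfolding multiplicative_def by blast+

lemma tden [simp]: "p \<in> TDen \<Longrightarrow> p \<in> Den" "p \<in> TDen \<Longrightarrow> p \<in> Mor C"
  and tden_comp: "\<lbrakk>p \<in> TDen; q \<in> TDen; Tgt C p = Src C q\<rbrakk> \<Longrightarrow> p \<cdot> q \<in> TDen"
  and tden_id [simp]: "X \<in> Ob C \<Longrightarrow> Idn C X \<in> TDen"
  using tden_den tden_multiplicative unfolding multiplicative_def by blast+

lemma feq_arrows: "s \<approx> t \<Longrightarrow> s \<in> arrows" "s \<approx> t \<Longrightarrow> t \<in> arrows"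
  by (simp_all add: feq_def fraction_equality_def)

lemma feq_refl: "s \<in> arrows \<Longrightarrow> s \<approx> s" and feq_sym: "s \<approx> t \<Longrightarrow> t \<approx> s"
  and feq_trans [trans]: "s \<approx> t \<Longrightarrow> t \<approx> u \<Longrightarrow> s \<approx> u"
  unfolding feq_def fraction_equality_def using equivclp_sym equivclp_trans by auto

lemma feq_equiv: "equiv arrows (fraction_equality C Den)"
proof (rule equivI)
  show "fraction_equality C Den \<subseteq> arrows \<times> arrows"
    by (auto simp: feq_def fraction_equality_def)
  show "refl_on arrows (fraction_equality C Den)"
    by (auto simp: refl_on_def fraction_equality_def)
  show "sym (fraction_equality C Den)"
    using feq_sym unfolding feq_def by (blast intro: symI)
  show "trans (fraction_equality C Den)"
    using feq_trans unfolding feq_def by (blast intro: transI)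
qed

lemma fraction_step_arrows:
  "fraction_step C Den s t \<Longrightarrow> s \<in> arrows \<and> t \<in> arrows"
  by (erule fraction_step.cases) (auto simp: arrows_iff)

text \<open>Steps have both ends in \<open>arrows\<close>, so a chain of steps that starts at a
  3-arrow never leaves them. The induction step may therefore assume this of both ends, whichever
  way the step is directed.\<close>

lemma feq_induct [consumes 1, case_names refl step]:
  assumes "s \<approx> t" "P s"
    and "\<And>y z. \<lbrakk>s \<approx> y; y \<in> arrows; z \<in> arrows; fraction_step C Den y z \<or> fraction_step C Den z y; P y\<rbrakk> \<Longrightarrow> P z"
  shows "P t"
proof -
  from assms(1) have "equivclp (fraction_step C Den) s t" "s \<in> arrows" by (auto simp: feq_def fraction_equality_def)
  then have "t \<in> arrows \<and> P t"
  proof (induction rule: equivclp_induct)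
    case (step y z)
    then have "y \<in> arrows" "z \<in> arrows" "s \<approx> y" "P y"
      using fraction_step_arrows[of y z] fraction_step_arrows[of z y] by (auto simp: feq_def fraction_equality_def)
    with step(2) assms(3)[of y z] show ?case by blast
  qed (use assms(2) in simp)
  then show ?thesis by simp
qed

lemma feq_right:
  "\<lbrakk>(b, f, a) \<in> arrows; c \<in> Mor C; Src C c = Tgt C a; a \<cdot> c \<in> Den; f' = f \<cdot> c; a' = a \<cdot> c\<rbrakk>
    \<Longrightarrow> (b, f, a) \<approx> (b, f', a')"
  using fraction_step.right[of b f a C Den c] fraction_step_arrows[of "(b, f, a)" "(b, f \<cdot> c, a \<cdot> c)"]
  by (auto simp: feq_def fraction_equality_def)

lemma feq_left:
  "\<lbrakk>(b, f, a) \<in> arrows; c \<in> Mor C; Tgt C c = Src C b; c \<cdot> b \<in> Den; b' = c \<cdot> b; f' = c \<cdot> f\<rbrakk>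
    \<Longrightarrow> (b, f, a) \<approx> (b', f', a)"
  using fraction_step.left[of b f a C Den c] fraction_step_arrows[of "(b, f, a)" "(c \<cdot> b, c \<cdot> f, a)"]
  by (auto simp: feq_def fraction_equality_def)

text \<open>A step precomposes \<open>b\<close> or postcomposes \<open>a\<close>, and thereby
  changes only the inner ends of these denominators.\<close>

lemma feq_src_tgt:
  assumes "(b, f, a) \<approx> (b', f', a')"
  shows "Tgt C b = Tgt C b'" "Src C a = Src C a'"
proof -
  have "Tgt C b = Tgt C (fst t) \<and> Src C a = Src C (snd (snd t))" if "(b, f, a) \<approx> t" for t
    using that
  proof (induction rule: feq_induct)
    case (step y z)
    from step(4) have "Tgt C (fst y) = Tgt C (fst z) \<and> Src C (snd (snd y)) = Src C (snd (snd z))"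
      by (auto elim!: fraction_step.cases simp: arrows_iff)
    with step(5) show ?case by simp
  qed simp
  from this[OF assms] show "Tgt C b = Tgt C b'" "Src C a = Src C a'" by simp_all
qed

subsection \<open>The action of morphisms and of inverses of denominators on fractions\<close>

text \<open>Only commutativity and the kind of the new denominator are recorded, so any commuting
  completion may be used in a computation, and such squares can be pasted. Weak universality is
  supplied separately for one distinguished square.\<close>

definition S_square where
  "S_square i g g' i' \<longleftrightarrow> i' \<in> SDen \<and> Src C i' = Tgt C g \<and> g' \<in> Mor C \<and> Src C g' = Tgt C i \<and>
     Tgt C g' = Tgt C i' \<and> i \<cdot> g' = g \<cdot> i'"

definition T_square where
  "T_square f p f' p' \<longleftrightarrow> p' \<in> TDen \<and> Tgt C p' = Src C f \<and> f' \<in> Mor C \<and> Src C f' = Src C p' \<and>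
     Tgt C f' = Src C p \<and> f' \<cdot> p = p' \<cdot> f"

text \<open>This is composition of the double fraction of \<open>(b, f, a)\<close> with
  \<open>loc\<close> of \<open>g\<close>: the product of the two inner denominators is then
  \<open>a\<close> itself, factored as \<open>i \<cdot> p\<close>. It is a relation because the
  factorisation and both squares are choices.\<close>

definition act where
  "act g s t \<longleftrightarrow> (\<exists>b f a i p g' i' f' p'. s = (b, f, a) \<and> i \<in> SDen \<and> p \<in> TDen \<and> Tgt C i = Src C p \<and>
     a = i \<cdot> p \<and> S_square i g g' i' \<and> T_square f p f' p' \<and> t = (p' \<cdot> b, f' \<cdot> g', i'))"

lemma S_square_weak_pushout:
  assumes "i \<in> SDen" "g \<in> Mor C" "Src C g = Src C i"
  obtains g' i' where "S_square i g g' i'"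
    "\<And>h k. \<lbrakk>h \<in> Mor C; k \<in> Mor C; Src C h = Tgt C i; Src C k = Tgt C g; Tgt C h = Tgt C k; i \<cdot> h = g \<cdot> k\<rbrakk>
        \<Longrightarrow> \<exists>u \<in> Mor C. Src C u = Tgt C i' \<and> Tgt C u = Tgt C k \<and> g' \<cdot> u = h \<and> i' \<cdot> u = k"
proof -
  obtain g' i' where i': "i' \<in> SDen" and w: "weak_pushout C i g g' i'"
    using weak_universality_S[OF assms] by blast
  show ?thesis
  proof (rule that)
    show "S_square i g g' i'" using i' w by (auto simp: S_square_def weak_pushout_def)
    fix h k
    assume "h \<in> Mor C" "k \<in> Mor C" "Src C h = Tgt C i" "Src C k = Tgt C g" "Tgt C h = Tgt C k" "i \<cdot> h = g \<cdot> k"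
    then have "\<exists>u \<in> Hom C (Tgt C g') (Tgt C k). g' \<cdot> u = h \<and> i' \<cdot> u = k"
      using w unfolding weak_pushout_def by (blast intro: HomI)
    then show "\<exists>u \<in> Mor C. Src C u = Tgt C i' \<and> Tgt C u = Tgt C k \<and> g' \<cdot> u = h \<and> i' \<cdot> u = k"
      using w by (auto simp: Hom_def weak_pushout_def)
  qed
qed

lemma T_square_weak_pullback:
  assumes "p \<in> TDen" "f \<in> Mor C" "Tgt C f = Tgt C p"
  obtains f' p' where "T_square f p f' p'"
    "\<And>h k. \<lbrakk>h \<in> Mor C; k \<in> Mor C; Tgt C h = Src C p; Tgt C k = Src C f; Src C h = Src C k; h \<cdot> p = k \<cdot> f\<rbrakk>
        \<Longrightarrow> \<exists>u \<in> Mor C. Tgt C u = Src C p' \<and> Src C u = Src C k \<and> u \<cdot> f' = h \<and> u \<cdot> p' = k"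
proof -
  obtain f' p' where p': "p' \<in> TDen" and w: "weak_pullback C f p f' p'"
    using weak_universality_T[OF assms] by blast
  show ?thesis
  proof (rule that)
    show "T_square f p f' p'" using p' w by (auto simp: T_square_def weak_pullback_def)
    fix h k
    assume "h \<in> Mor C" "k \<in> Mor C" "Tgt C h = Src C p" "Tgt C k = Src C f" "Src C h = Src C k" "h \<cdot> p = k \<cdot> f"
    then have "\<exists>u \<in> Hom C (Src C k) (Src C f'). u \<cdot> f' = h \<and> u \<cdot> p' = k"
      using w unfolding weak_pullback_def by (blast intro: HomI)
    then show "\<exists>u \<in> Mor C. Tgt C u = Src C p' \<and> Src C u = Src C k \<and> u \<cdot> f' = h \<and> u \<cdot> p' = k"
      using w by (auto simp: Hom_def weak_pullback_def)
  qed
qed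

lemma S_square_ex:
  assumes "i \<in> SDen" "g \<in> Mor C" "Src C g = Src C i" obtains g' i' where "S_square i g g' i'"
  using S_square_weak_pushout[OF assms] by metis

lemma T_square_ex:
  assumes "p \<in> TDen" "f \<in> Mor C" "Tgt C f = Tgt C p" obtains f' p' where "T_square f p f' p'"
  using T_square_weak_pullback[OF assms] by metis

text \<open>The weak pushout maps to every commuting completion by some \<open>c\<close>, and
  postcomposing with \<open>c\<close> is a right step; hence every completion gives the same
  fraction as the weak pushout.\<close>

lemma S_square_unique:
  assumes "S_square i g g1 i1" "S_square i g g2 i2" "i \<in> SDen" "g \<in> Mor C" "Src C g = Src C i"
    and "b \<in> Den" "f \<in> Mor C" "Src C b = Src C f" "Tgt C f = Tgt C i"
  shows "(b, f \<cdot> g1, i1) \<approx> (b, f \<cdot> g2, i2)"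
proof -
  obtain g0 i0 where 0: "S_square i g g0 i0"
    and u: "\<And>h k. \<lbrakk>h \<in> Mor C; k \<in> Mor C; Src C h = Tgt C i; Src C k = Tgt C g; Tgt C h = Tgt C k; i \<cdot> h = g \<cdot> k\<rbrakk>
        \<Longrightarrow> \<exists>u \<in> Mor C. Src C u = Tgt C i0 \<and> Tgt C u = Tgt C k \<and> g0 \<cdot> u = h \<and> i0 \<cdot> u = k"
    using S_square_weak_pushout assms(3-5) by metis
  have "(b, f \<cdot> g0, i0) \<approx> (b, f \<cdot> h, k)" if S: "S_square i g h k" for h k
  proof -
    from u[of h k] S obtain c where c: "c \<in> Mor C" "Src C c = Tgt C i0" "g0 \<cdot> c = h" "i0 \<cdot> c = k"
      by (auto simp: S_square_def)
    show ?thesis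
      by (rule feq_right[of _ _ _ c]) (use c 0 S assms(6-) in \<open>auto simp: S_square_def arrows_iff\<close>)
  qed
  from feq_trans[OF feq_sym[OF this[OF assms(1)]] this[OF assms(2)]] show ?thesis .
qed

text \<open>Every commuting completion factors through the weak pullback by some \<open>c\<close>,
  and precomposing with \<open>c\<close> is a left step.\<close>

lemma T_square_unique:
  assumes "T_square f p f1 p1" "T_square f p f2 p2" "p \<in> TDen" "f \<in> Mor C" "Tgt C f = Tgt C p"
    and "b \<in> Den" "Src C b = Src C f" "g \<in> Mor C" "Src C g = Src C p" "a \<in> Den" "Tgt C a = Tgt C g"
  shows "(p1 \<cdot> b, f1 \<cdot> g, a) \<approx> (p2 \<cdot> b, f2 \<cdot> g, a)"
proof -
  obtain f0 p0 where 0: "T_square f p f0 p0"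
    and u: "\<And>h k. \<lbrakk>h \<in> Mor C; k \<in> Mor C; Tgt C h = Src C p; Tgt C k = Src C f; Src C h = Src C k; h \<cdot> p = k \<cdot> f\<rbrakk>
        \<Longrightarrow> \<exists>u \<in> Mor C. Tgt C u = Src C p0 \<and> Src C u = Src C k \<and> u \<cdot> f0 = h \<and> u \<cdot> p0 = k"
    using T_square_weak_pullback assms(3-5) by metis
  have "(p0 \<cdot> b, f0 \<cdot> g, a) \<approx> (k \<cdot> b, h \<cdot> g, a)" if S: "T_square f p h k" for h k
  proof -
    from u[of h k] S obtain c where c: "c \<in> Mor C" "Tgt C c = Src C p0" "c \<cdot> f0 = h" "c \<cdot> p0 = k"
      by (auto simp: T_square_def)
    have e: "k \<cdot> b = c \<cdot> (p0 \<cdot> b)" "h \<cdot> g = c \<cdot> (f0 \<cdot> g)"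
      using c 0 S assms(3-) by (auto simp: T_square_def)
    have "k \<cdot> b \<in> Den" using S assms(6,7) by (auto simp: T_square_def intro!: den_comp)
    then show ?thesis
      by (intro feq_left[of _ _ _ c])
        (use c(1,2) 0 S assms(3-) e in \<open>auto simp: T_square_def arrows_iff intro!: den_comp\<close>)
  qed
  from feq_trans[OF feq_sym[OF this[OF assms(1)]] this[OF assms(2)]] show ?thesis .
qed

text \<open>Shifting the factor \<open>m\<close> from the S-part to the T-part does not change the
  outcome: \<open>m \<cdot> g1\<close> completes the square of \<open>l\<close> and
  \<open>g\<close>, and \<open>f2 \<cdot> m\<close> completes that of \<open>f\<close> and
  \<open>p\<close>. Both outcomes therefore equal the mixed fraction
  \<open>(p2 \<cdot> b, f2 \<cdot> m \<cdot> g1, i1)\<close>.\<close>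

lemma act_refine:
  assumes arr: "(b, f, i \<cdot> p) \<in> arrows" and g: "g \<in> Mor C" "Src C g = Src C i"
    and ip: "i \<in> SDen" "p \<in> TDen" "Tgt C i = Src C p" "S_square i g g1 i1" "T_square f p f1 p1"
    and l: "l \<in> SDen" "m \<in> Den" "Tgt C l = Src C m" "l \<cdot> m = i" "m \<cdot> p \<in> TDen"
      "S_square l g g2 i2" "T_square f (m \<cdot> p) f2 p2"
  shows "(p1 \<cdot> b, f1 \<cdot> g1, i1) \<approx> (p2 \<cdot> b, f2 \<cdot> g2, i2)"
proof -
  have e[simp]: "Src C i = Src C l" "Tgt C i = Tgt C m" and mp: "Tgt C m = Src C p"
    using l ip by auto
  have S: "S_square l g (m \<cdot> g1) i1"
    using ip l by (auto simp: S_square_def)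
  have T: "T_square f p (f2 \<cdot> m) p2"
    using ip l arr mp by (auto simp: T_square_def arrows_iff)
  have "(p1 \<cdot> b, f1 \<cdot> g1, i1) \<approx> (p2 \<cdot> b, (f2 \<cdot> m) \<cdot> g1, i1)"
    by (rule T_square_unique[OF ip(5) T ip(2)]) (use arr ip in \<open>auto simp: S_square_def arrows_iff\<close>)
  also have "(f2 \<cdot> m) \<cdot> g1 = f2 \<cdot> (m \<cdot> g1)"
    using ip l mp by (auto simp: T_square_def S_square_def)
  also have "(p2 \<cdot> b, f2 \<cdot> (m \<cdot> g1), i1) \<approx> (p2 \<cdot> b, f2 \<cdot> g2, i2)"
  proof (rule S_square_unique[OF S l(6) l(1) g(1)])
    show "Src C g = Src C l" "Tgt C f2 = Tgt C l" "f2 \<in> Mor C"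
      using g(2) l ip mp by (simp_all add: T_square_def)
    show "p2 \<cdot> b \<in> Den" "Src C (p2 \<cdot> b) = Src C f2"
      using l(7) arr by (auto simp: T_square_def arrows_iff intro!: den_comp)
  qed
  finally show ?thesis .
qed

lemma act_unique:
  assumes arr: "(b, f, a) \<in> arrows" and g: "g \<in> Mor C" "Src C g = Src C a"
    and s: "act g (b, f, a) s" and t: "act g (b, f, a) t"
  shows "s \<approx> t"
proof -
  from s obtain i p g1 i1 f1 p1 where i: "i \<in> SDen" "p \<in> TDen" "Tgt C i = Src C p" "a = i \<cdot> p"
    "S_square i g g1 i1" "T_square f p f1 p1" and s: "s = (p1 \<cdot> b, f1 \<cdot> g1, i1)"
    by (auto simp: act_def)
  from t obtain j q g2 i2 f2 p2 where j: "j \<in> SDen" "q \<in> TDen" "Tgt C j = Src C q" "a = j \<cdot> q"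
    "S_square j g g2 i2" "T_square f q f2 p2" and t: "t = (p2 \<cdot> b, f2 \<cdot> g2, i2)"
    by (auto simp: act_def)
  have ij: "Src C i = Src C j" "Tgt C p = Tgt C q" using i j by (metis comp_mor(2,3) sden(2) tden(2))+
  \<comment> \<open>Any two factorisations of \<open>a\<close> have a common refinement, through a weak pullback of \<open>p\<close> and \<open>q\<close>.\<close>
  obtain p' q' where sq: "T_square p q p' q'"
    and u: "\<And>h k. \<lbrakk>h \<in> Mor C; k \<in> Mor C; Tgt C h = Src C q; Tgt C k = Src C p; Src C h = Src C k; h \<cdot> q = k \<cdot> p\<rbrakk>
        \<Longrightarrow> \<exists>u \<in> Mor C. Tgt C u = Src C q' \<and> Src C u = Src C k \<and> u \<cdot> p' = h \<and> u \<cdot> q' = k"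
    using T_square_weak_pullback[OF j(2), of p] i(2) ij by (metis tden(2))
  have sq': "q' \<in> TDen" "Tgt C q' = Src C p" "p' \<in> Mor C" "Src C p' = Src C q'" "Tgt C p' = Src C q" "p' \<cdot> q = q' \<cdot> p"
    using sq by (auto simp: T_square_def)
  have pd: "p' \<in> Den"
    using den_cancel_right[of q p'] sq' i j by (simp add: den_comp)
  \<comment> \<open>Weak universality applied to \<open>j \<cdot> q = i \<cdot> p\<close> gives
    \<open>k\<close>, which is a denominator by cancellation and so factors again as
    \<open>l \<cdot> r\<close>. Then \<open>l\<close> is the S-part common to both
    refinements.\<close>
  obtain k where k: "k \<in> Mor C" "Tgt C k = Src C q'" "Src C k = Src C i" "k \<cdot> p' = j" "k \<cdot> q' = i"
    using u[of j i] i j ij by auto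
  have "k \<in> Den" using den_cancel_right[of q' k] sq' k i by simp
  then obtain l r where lr: "l \<in> SDen" "r \<in> TDen" "Tgt C l = Src C r" "k = l \<cdot> r"
    using factorisation by blast
  have lr': "Src C l = Src C i" "Tgt C r = Src C q'" using k lr by auto
  \<comment> \<open>\<open>r \<cdot> p'\<close> is only known to be a denominator. That
    \<open>(r \<cdot> p') \<cdot> q\<close> is a T-denominator is seen by writing it with
    \<open>q'\<close> and \<open>p\<close> instead.\<close>
  have T: "(r \<cdot> q') \<cdot> p \<in> TDen" using lr lr' sq' i by (auto intro!: tden_comp)
  have eq: "(r \<cdot> q') \<cdot> p = (r \<cdot> p') \<cdot> q"
    using lr lr' sq' i j by auto
  obtain g3 i3 where S3: "S_square l g g3 i3"
    using S_square_ex[OF lr(1) g(1)] lr' g i by (metis comp_mor(2) sden(2) tden(2))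
  have "Tgt C f = Tgt C ((r \<cdot> q') \<cdot> p)" using arr i lr lr' sq' by (auto simp: arrows_iff)
  then obtain f3 p3 where T3: "T_square f ((r \<cdot> q') \<cdot> p) f3 p3"
    using T_square_ex[OF T, of f] arr unfolding arrows_iff by blast
  have "s \<approx> (p3 \<cdot> b, f3 \<cdot> g3, i3)"
    unfolding s
  proof (rule act_refine[OF _ g(1) _ i(1-3,5,6) lr(1) _ _ _ T S3 T3])
    show "(b, f, i \<cdot> p) \<in> arrows" "Src C g = Src C i" using arr i g by simp_all
    show "r \<cdot> q' \<in> Den" using lr(2) sq'(1) lr' by (intro den_comp) simp_all
    show "Tgt C l = Src C (r \<cdot> q')" "l \<cdot> (r \<cdot> q') = i" using lr lr' sq'(1) k by simp_all
  qed
  moreover have "t \<approx> (p3 \<cdot> b, f3 \<cdot> g3, i3)"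
    unfolding t
  proof (rule act_refine[OF _ g(1) _ j(1-3,5,6) lr(1) _ _ _ T[unfolded eq] S3 T3[unfolded eq]])
    show "(b, f, j \<cdot> q) \<in> arrows" using arr j by simp
    show "Src C g = Src C j" using g(2) j by simp
    show "r \<cdot> p' \<in> Den" using lr(2) pd lr' sq' by (intro den_comp) simp_all
    show "Tgt C l = Src C (r \<cdot> p')" "l \<cdot> (r \<cdot> p') = j" using lr lr' sq' k by simp_all
  qed
  ultimately show ?thesis using feq_sym feq_trans by blast
qed

lemma act_arrows:
  assumes "(b, f, a) \<in> arrows" "g \<in> Mor C" "Src C g = Src C a" "act g (b, f, a) (b', f', a')"
  shows "(b', f', a') \<in> arrows" "Tgt C b' = Tgt C b" "Src C a' = Tgt C g"
  using assms by (auto simp: act_def S_square_def T_square_def arrows_iff intro!: den_comp)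

lemma act_ex:
  assumes "(b, f, a) \<in> arrows" "g \<in> Mor C" "Src C g = Src C a"
  shows "\<exists>t. act g (b, f, a) t"
proof -
  obtain i p where i: "i \<in> SDen" "p \<in> TDen" "Tgt C i = Src C p" "a = i \<cdot> p"
    using factorisation assms(1) by (metis arrows_iff)
  obtain g' i' where "S_square i g g' i'"
    using S_square_ex[OF i(1) assms(2)] assms(3) i by auto
  moreover obtain f' p' where "T_square f p f' p'"
    using T_square_ex[OF i(2), of f] assms(1) i by (auto simp: arrows_iff)
  ultimately show ?thesis using i unfolding act_def by blast
qed

text \<open>Compatible choices give outcomes that agree or differ by one step. For a right step,
  factoring \<open>p \<cdot> c = k \<cdot> q\<close> yields
  \<open>a \<cdot> c = (i \<cdot> k) \<cdot> q\<close>, and the two actions have a common outcome.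
  For a left step, the T-squares of \<open>p\<close> along \<open>f\<close> and of \<open>p'\<close>
  along \<open>c\<close> are pasted, and the outcomes differ by a left step along
  \<open>c'\<close>.\<close>

lemma act_step:
  assumes st: "fraction_step C Den s t" and g: "g \<in> Mor C" "Src C g = Src C (snd (snd s))"
    and s': "act g s s'" and t': "act g t t'"
  shows "s' \<approx> t'"
  using st
proof cases
  case (right b f a c)
  then have arr: "(b, f, a) \<in> arrows" "(b, f \<cdot> c, a \<cdot> c) \<in> arrows" using fraction_step_arrows st by auto
  obtain i p where i: "i \<in> SDen" "p \<in> TDen" "Tgt C i = Src C p" "a = i \<cdot> p"
    using factorisation arr(1) by (metis arrows_iff)
  have "p \<cdot> c \<in> Den"
    using den_cancel_left[of i "p \<cdot> c"] i right by auto
  then obtain k q where k: "k \<in> SDen" "q \<in> TDen" "Tgt C k = Src C q" "p \<cdot> c = k \<cdot> q"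
    using factorisation by blast
  have kp: "Src C k = Src C p" "Tgt C q = Tgt C c"
    using k i right by (metis comp_mor(2,3) sden(2) tden(2))+
  have ik: "i \<cdot> k \<in> SDen" using i k kp by (auto intro: sden_comp)
  obtain g' i' where S: "S_square (i \<cdot> k) g g' i'"
    using S_square_ex[OF ik g(1)] g(2) i k kp right by auto
  obtain f' p' where T: "T_square f p f' p'"
    using T_square_ex[OF i(2), of f] arr(1) i by (auto simp: arrows_iff)
  have S': "S_square i g (k \<cdot> g') i'" using S i k kp by (auto simp: S_square_def)
  have T': "T_square (f \<cdot> c) q (f' \<cdot> k) p'"
  proof -
    have "(f' \<cdot> k) \<cdot> q = f' \<cdot> (p \<cdot> c)" using T i k kp by (auto simp: T_square_def)
    also have "\<dots> = (f' \<cdot> p) \<cdot> c"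
      by (rule comp_assoc'[symmetric]) (use T i k kp right in \<open>auto simp: T_square_def\<close>)
    also have "\<dots> = (p' \<cdot> f) \<cdot> c" using T by (simp only: T_square_def)
    also have "\<dots> = p' \<cdot> (f \<cdot> c)" using T i k kp right arr by (auto simp: T_square_def arrows_iff)
    finally show ?thesis using T i k kp right arr by (auto simp: T_square_def arrows_iff)
  qed
  have eq: "f' \<cdot> (k \<cdot> g') = (f' \<cdot> k) \<cdot> g'" using S T i k kp by (auto simp: T_square_def S_square_def)
  have "a \<cdot> c = (i \<cdot> k) \<cdot> q" using i k kp right by auto
  then have "act g (b, f \<cdot> c, a \<cdot> c) (p' \<cdot> b, (f' \<cdot> k) \<cdot> g', i')"
    using ik k(1-3) S T' i kp unfolding act_def by (intro exI conjI) auto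
  moreover have "act g (b, f, a) (p' \<cdot> b, (f' \<cdot> k) \<cdot> g', i')"
    unfolding eq[symmetric] act_def using i S' T by blast
  ultimately have "(p' \<cdot> b, (f' \<cdot> k) \<cdot> g', i') \<approx> t'" "s' \<approx> (p' \<cdot> b, (f' \<cdot> k) \<cdot> g', i')"
    using act_unique[OF arr(1), of g] act_unique[OF arr(2), of g] g s' t' right arr by (simp_all add: arrows_iff)
  then show ?thesis using feq_trans by blast
next
  case (left b f a c)
  then have arr: "(b, f, a) \<in> arrows" "(c \<cdot> b, c \<cdot> f, a) \<in> arrows" using fraction_step_arrows st by auto
  obtain i p where i: "i \<in> SDen" "p \<in> TDen" "Tgt C i = Src C p" "a = i \<cdot> p"
    using factorisation arr(1) by (metis arrows_iff)
  obtain g' i' where S: "S_square i g g' i'"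
    using S_square_ex[OF i(1) g(1)] g(2) i left by auto
  obtain f' p' where T: "T_square f p f' p'"
    using T_square_ex[OF i(2), of f] arr(1) i by (auto simp: arrows_iff)
  then have p': "p' \<in> TDen" "Tgt C p' = Src C f" by (auto simp: T_square_def)
  obtain c' p'' where T': "T_square c p' c' p''"
    using T_square_ex[OF p'(1), of c] left p' arr(1) by (auto simp: arrows_iff)
  have T'': "T_square (c \<cdot> f) p (c' \<cdot> f') p''"
  proof -
    have "(c' \<cdot> f') \<cdot> p = c' \<cdot> (p' \<cdot> f)" using T T' i by (auto simp: T_square_def)
    also have "\<dots> = (c' \<cdot> p') \<cdot> f"
      by (rule comp_assoc'[symmetric]) (use T T' arr(1) in \<open>auto simp: T_square_def arrows_iff\<close>)
    also have "\<dots> = (p'' \<cdot> c) \<cdot> f" using T' by (simp only: T_square_def)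
    also have "\<dots> = p'' \<cdot> (c \<cdot> f)" using T T' arr(1) left by (auto simp: T_square_def arrows_iff)
    finally show ?thesis using T T' left arr(1) by (auto simp: T_square_def arrows_iff)
  qed
  have "act g (b, f, a) (p' \<cdot> b, f' \<cdot> g', i')" using i S T unfolding act_def by blast
  then have "s' \<approx> (p' \<cdot> b, f' \<cdot> g', i')"
    using act_unique[OF arr(1)] g s' left by fastforce
  also have "(p' \<cdot> b, f' \<cdot> g', i') \<approx> (p'' \<cdot> (c \<cdot> b), (c' \<cdot> f') \<cdot> g', i')"
  proof -
    have eq: "p'' \<cdot> (c \<cdot> b) = c' \<cdot> (p' \<cdot> b)"
    proof -
      have "p'' \<cdot> (c \<cdot> b) = (p'' \<cdot> c) \<cdot> b"
        by (rule comp_assoc'[symmetric]) (use T' left arr(1) in \<open>auto simp: T_square_def arrows_iff\<close>)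
      also have "\<dots> = (c' \<cdot> p') \<cdot> b" using T' by (simp only: T_square_def)
      also have "\<dots> = c' \<cdot> (p' \<cdot> b)"
        by (rule comp_assoc') (use T' p' arr(1) in \<open>auto simp: T_square_def arrows_iff\<close>)
      finally show ?thesis .
    qed
    have "p'' \<cdot> (c \<cdot> b) \<in> Den" using T' left arr(1) by (auto simp: T_square_def arrows_iff intro!: den_comp)
    then show ?thesis
      by (intro feq_left[of _ _ _ c'])
        (use arr(1) S T T' p' eq i in \<open>auto simp: arrows_iff S_square_def T_square_def intro!: den_comp\<close>)
  qed
  also have "\<dots> \<approx> t'"
  proof -
    have "act g (c \<cdot> b, c \<cdot> f, a) (p'' \<cdot> (c \<cdot> b), (c' \<cdot> f') \<cdot> g', i')"
      using i S T'' unfolding act_def by blast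
    then show ?thesis using act_unique[OF arr(2)] g t' left by fastforce
  qed
  finally show ?thesis .
qed

lemma act_feq:
  assumes "s \<approx> t" "g \<in> Mor C" "Src C g = Src C (snd (snd s))" "act g s s'" "act g t t'"
  shows "s' \<approx> t'"
  using assms(1,5)
proof (induction arbitrary: t' rule: feq_induct)
  case refl
  have "s \<in> arrows" using assms(1) by (rule feq_arrows)
  then show ?case using act_unique assms(2-4) refl by (cases s) auto
next
  case (step y z)
  have "Src C (snd (snd s)) = Src C (snd (snd y))"
    using feq_src_tgt step(1) by (metis prod.collapse)
  then have gy: "Src C g = Src C (snd (snd y))" using assms(3) by simp
  obtain y' where y': "act g y y'"
    using act_ex[of "fst y" "fst (snd y)" "snd (snd y)" g] step(2) gy assms(2) by auto
  have zy: "Src C (snd (snd z)) = Src C (snd (snd y))"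
    using step(4) by (auto elim!: fraction_step.cases simp: arrows_iff)
  have "y' \<approx> t'"
    using step(4)
  proof
    assume "fraction_step C Den y z"
    then show ?thesis using act_step[of y z g y' t'] step(6) y' gy assms(2) by simp
  next
    assume "fraction_step C Den z y"
    then have "t' \<approx> y'" using act_step[of z y g t' y'] step(6) y' gy zy assms(2) by simp
    then show ?thesis by (rule feq_sym)
  qed
  then show ?case using step(5)[OF y'] feq_trans by blast
qed

text \<open>With identities in the S-square the outcome is \<open>(p' \<cdot> b, f', i)\<close>. A
  right step along \<open>p\<close> makes it \<open>(p' \<cdot> b, f' \<cdot> p, a)\<close>, and
  \<open>f' \<cdot> p = p' \<cdot> f\<close> allows a left step along \<open>p'\<close> to be
  undone.\<close>

lemma act_id:
  assumes "(b, f, a) \<in> arrows" "act (Idn C (Src C a)) (b, f, a) t"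
  shows "t \<approx> (b, f, a)"
proof -
  obtain i p where i: "i \<in> SDen" "p \<in> TDen" "Tgt C i = Src C p" "a = i \<cdot> p"
    using factorisation assms(1) by (metis arrows_iff)
  obtain f' p' where T: "T_square f p f' p'"
    using T_square_ex[OF i(2), of f] assms(1) i by (auto simp: arrows_iff)
  have "S_square i (Idn C (Src C a)) (Idn C (Tgt C i)) i"
    using i by (auto simp: S_square_def)
  then have "act (Idn C (Src C a)) (b, f, a) (p' \<cdot> b, f' \<cdot> Idn C (Tgt C i), i)"
    using i T unfolding act_def by blast
  then have "act (Idn C (Src C a)) (b, f, a) (p' \<cdot> b, f', i)"
    using T i by (auto simp: T_square_def)
  then have "t \<approx> (p' \<cdot> b, f', i)"
    using act_unique[OF assms(1) _ _ assms(2)] assms(1) by (auto simp: arrows_iff)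
  also have "\<dots> \<approx> (p' \<cdot> b, f' \<cdot> p, a)"
    by (rule feq_right[of _ _ _ p]) (use i T assms(1) in \<open>auto simp: T_square_def arrows_iff intro!: den_comp\<close>)
  also have "\<dots> \<approx> (b, f, a)"
    by (rule feq_sym, rule feq_left[of _ _ _ p']) (use i T assms(1) in \<open>auto simp: T_square_def arrows_iff intro!: den_comp\<close>)
  finally show ?thesis .
qed

text \<open>The first action leaves an S-denominator \<open>i'\<close> in the last place. Factoring
  it as \<open>i'\<close> times an identity leaves only an S-square for \<open>g\<close>, and this
  is pasted to the S-square for \<open>f\<close>.\<close>

lemma act_comp:
  assumes arr: "(b, h, a) \<in> arrows" and f: "f \<in> Mor C" "Src C f = Src C a" and g: "g \<in> Mor C" "Src C g = Tgt C f"
    and s: "act f (b, h, a) s" and t: "act g s t" and u: "act (f \<cdot> g) (b, h, a) u"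
  shows "t \<approx> u"
proof -
  from s obtain i p f' i' h' p' where i: "i \<in> SDen" "p \<in> TDen" "Tgt C i = Src C p" "a = i \<cdot> p"
    "S_square i f f' i'" "T_square h p h' p'" and s': "s = (p' \<cdot> b, h' \<cdot> f', i')"
    by (auto simp: act_def)
  have i': "i' \<in> SDen" "Src C i' = Tgt C f" using i by (auto simp: S_square_def)
  have sa: "(p' \<cdot> b, h' \<cdot> f', i') \<in> arrows" using act_arrows[OF arr f] s unfolding s' by blast
  obtain g' i'' where S: "S_square i' g g' i''"
    using S_square_ex[OF i'(1) g(1)] g(2) i' by auto
  have T: "T_square (h' \<cdot> f') (Idn C (Tgt C i')) (h' \<cdot> f') (Idn C (Src C h'))"
    using i i' arr by (auto simp: T_square_def S_square_def arrows_iff)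
  have "act g s (Idn C (Src C h') \<cdot> (p' \<cdot> b), (h' \<cdot> f') \<cdot> g', i'')"
    unfolding s' act_def
    by (intro exI conjI, rule refl, rule i'(1), rule tden_id[of "Tgt C i'"], (use i' S T in auto)[6])
  then have 1: "act g s (p' \<cdot> b, h' \<cdot> (f' \<cdot> g'), i'')"
    using i S arr by (auto simp: T_square_def S_square_def arrows_iff)
  have "S_square i (f \<cdot> g) (f' \<cdot> g') i''"
  proof -
    have "i \<cdot> (f' \<cdot> g') = (i \<cdot> f') \<cdot> g'"
      by (rule comp_assoc'[symmetric]) (use i S i' in \<open>auto simp: S_square_def\<close>)
    also have "\<dots> = (f \<cdot> i') \<cdot> g'" using i by (simp only: S_square_def)
    also have "\<dots> = f \<cdot> (i' \<cdot> g')" using i S i' f g by (auto simp: S_square_def)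
    also have "\<dots> = (f \<cdot> g) \<cdot> i''" using i S f g by (auto simp: S_square_def)
    finally show ?thesis using i S f g by (auto simp: S_square_def)
  qed
  then have 2: "act (f \<cdot> g) (b, h, a) (p' \<cdot> b, h' \<cdot> (f' \<cdot> g'), i'')"
    using i unfolding act_def by blast
  have "t \<approx> (p' \<cdot> b, h' \<cdot> (f' \<cdot> g'), i'')"
    using act_unique[OF sa, of g] 1 t g i' unfolding s' by simp
  moreover have "u \<approx> (p' \<cdot> b, h' \<cdot> (f' \<cdot> g'), i'')"
    using act_unique[OF arr, of "f \<cdot> g"] 2 u f g by simp
  ultimately show ?thesis using feq_sym feq_trans by blast
qed

text \<open>The two expressions \<open>i \<cdot> p = d \<cdot> a\<close> of one denominator are
  compared through a weak pushout of \<open>i\<close> and \<open>d\<close>: it yields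
  \<open>c\<close> with \<open>d' \<cdot> c = p\<close> and \<open>j \<cdot> c = a\<close>, and a
  right step along \<open>c\<close> cancels \<open>d\<close>.\<close>

lemma act_inverse_left:
  assumes arr: "(b, f, a) \<in> arrows" and d: "d \<in> Den" "Tgt C d = Src C a" and t: "act d (b, f, d \<cdot> a) t"
  shows "t \<approx> (b, f, a)"
proof -
  have da: "d \<cdot> a \<in> Den" using arr d by (auto simp: arrows_iff intro!: den_comp)
  then have arr': "(b, f, d \<cdot> a) \<in> arrows" using arr d by (auto simp: arrows_iff)
  obtain i p where i: "i \<in> SDen" "p \<in> TDen" "Tgt C i = Src C p" "d \<cdot> a = i \<cdot> p"
    using factorisation[OF da] by blast
  have ia: "Src C i = Src C d" "Tgt C p = Tgt C a"
    using i arr d unfolding arrows_iff by (metis comp_mor(2,3) den_mor sden(2) tden(2))+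
  have i': "i \<in> SDen" "d \<in> Mor C" "Src C d = Src C i" using i d ia by auto
  obtain d' j where S: "S_square i d d' j"
    and u: "\<And>h k. \<lbrakk>h \<in> Mor C; k \<in> Mor C; Src C h = Tgt C i; Src C k = Tgt C d; Tgt C h = Tgt C k; i \<cdot> h = d \<cdot> k\<rbrakk>
        \<Longrightarrow> \<exists>u \<in> Mor C. Src C u = Tgt C j \<and> Tgt C u = Tgt C k \<and> d' \<cdot> u = h \<and> j \<cdot> u = k"
    using S_square_weak_pushout[OF i'] by blast
  obtain c where c: "c \<in> Mor C" "Src C c = Tgt C j" "d' \<cdot> c = p" "j \<cdot> c = a"
    using u[of p a] i ia arr d by (auto simp: arrows_iff)
  obtain f' p' where T: "T_square f p f' p'"
    using T_square_ex[OF i(2), of f] arr i ia by (auto simp: arrows_iff)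
  have "act d (b, f, d \<cdot> a) (p' \<cdot> b, f' \<cdot> d', j)" using i S T unfolding act_def by blast
  then have "t \<approx> (p' \<cdot> b, f' \<cdot> d', j)"
    using act_unique[OF arr' _ _ t] d arr by (auto simp: arrows_iff)
  also have "\<dots> \<approx> (p' \<cdot> b, f' \<cdot> p, a)"
  proof (rule feq_right[of _ _ _ c])
    show "(p' \<cdot> b, f' \<cdot> d', j) \<in> arrows"
      using i S T arr d by (auto simp: T_square_def S_square_def arrows_iff intro!: den_comp)
    show "j \<cdot> c \<in> Den" using c(4) arr by (simp add: arrows_iff)
    show "f' \<cdot> p = f' \<cdot> d' \<cdot> c" using S T c(1-3) i by (simp add: T_square_def S_square_def)
  qed (use c in simp_all)
  also have "\<dots> \<approx> (b, f, a)"
    by (rule feq_sym, rule feq_left[of _ _ _ p']) (use T arr in \<open>auto simp: T_square_def arrows_iff intro!: den_comp\<close>)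
  finally show ?thesis .
qed

text \<open>The S-square says \<open>d \<cdot> a' = i \<cdot> d'\<close>, so
  \<open>(b', f', d \<cdot> a')\<close> arises from \<open>(p' \<cdot> b, g', i)\<close> by a right
  step along \<open>d'\<close>.\<close>

lemma act_inverse_right:
  assumes arr: "(b, f, a) \<in> arrows" and d: "d \<in> Den" "Src C d = Src C a" and t: "act d (b, f, a) (b', f', a')"
  shows "(b', f', d \<cdot> a') \<approx> (b, f, a)"
proof -
  from t obtain i p d' g' p' where i: "i \<in> SDen" "p \<in> TDen" "Tgt C i = Src C p" "a = i \<cdot> p"
    "S_square i d d' a'" "T_square f p g' p'" and e: "b' = p' \<cdot> b" "f' = g' \<cdot> d'"
    by (auto simp: act_def)
  have "(p' \<cdot> b, g', i) \<approx> (b', f', d \<cdot> a')"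
    unfolding e by (rule feq_right[of _ _ _ d']) (use i arr d e in \<open>auto simp: T_square_def S_square_def arrows_iff intro!: den_comp\<close>)
  from feq_sym[OF this] have "(b', f', d \<cdot> a') \<approx> (p' \<cdot> b, g', i)" .
  also have "\<dots> \<approx> (p' \<cdot> b, g' \<cdot> p, a)"
    by (rule feq_right[of _ _ _ p]) (use i arr in \<open>auto simp: T_square_def arrows_iff intro!: den_comp\<close>)
  also have "\<dots> \<approx> (b, f, a)"
    by (rule feq_sym, rule feq_left[of _ _ _ p']) (use i arr in \<open>auto simp: T_square_def arrows_iff intro!: den_comp\<close>)
  finally show ?thesis .
qed

text \<open>Premultiplying \<open>a\<close> by \<open>d\<close> commutes with both kinds of steps: a
  right step acts on the other end of \<open>a\<close>, and a left step does not touch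
  \<open>a\<close>.\<close>

lemma inverse_feq:
  assumes "(b, f, a) \<approx> (b', f', a')" "d \<in> Den" "Tgt C d = Src C a"
  shows "(b, f, d \<cdot> a) \<approx> (b', f', d \<cdot> a')"
proof -
  have "(b, f, d \<cdot> a) \<approx> (fst t, fst (snd t), d \<cdot> snd (snd t))" if "(b, f, a) \<approx> t" for t
    using that
  proof (induction rule: feq_induct)
    case refl
    then show ?case using feq_arrows(1)[OF assms(1)] assms(2,3) by (auto simp: arrows_iff intro!: feq_refl den_comp)
  next
    case (step y z)
    have step': "(fst y, fst (snd y), d \<cdot> snd (snd y)) \<approx> (fst z, fst (snd z), d \<cdot> snd (snd z))"
      if st: "fraction_step C Den y z" and src: "Tgt C d = Src C (snd (snd y))" for y z
      using st
    proof cases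
      case (right b f a c)
      with src assms(2) have "(b, f, d \<cdot> a) \<approx> (b, f \<cdot> c, d \<cdot> (a \<cdot> c))"
        by (intro feq_right[of _ _ _ c]) (auto simp: arrows_iff intro!: den_comp)
      with right show ?thesis by simp
    next
      case (left b f a c)
      with src assms(2) have "(b, f, d \<cdot> a) \<approx> (c \<cdot> b, c \<cdot> f, d \<cdot> a)"
        by (intro feq_left[of _ _ _ c]) (auto simp: arrows_iff intro!: den_comp)
      with left show ?thesis by simp
    qed
    have "Tgt C d = Src C (snd (snd y))"
      using feq_src_tgt step(1) assms(3) by (metis prod.collapse)
    moreover have "Src C (snd (snd z)) = Src C (snd (snd y))"
      using step(4) by (auto elim!: fraction_step.cases simp: arrows_iff)
    ultimately have "(fst y, fst (snd y), d \<cdot> snd (snd y)) \<approx> (fst z, fst (snd z), d \<cdot> snd (snd z))"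
      using step(4) step'[of y z] step'[of z y] feq_sym by auto
    with step(5) show ?case using feq_trans by blast
  qed
  from this[OF assms(1)] show ?thesis by simp
qed

end

lemma image_eq_singleton: "\<lbrakk>t \<in> S; \<And>u. u \<in> S \<Longrightarrow> f u = c\<rbrakk> \<Longrightarrow> f ` S = {c}"
  by auto

section \<open>Functors that invert the denominators\<close>

text \<open>A functor with chosen inverses \<open>B d\<close> of the images of denominators. It is
  instantiated by the map to the localisation, where \<open>B d\<close> is the class of a formal
  inverse, and by cohomology, where it yields saturation.\<close>

locale inverting_functor =
  uni_fractionable C Den SDen TDen + is_functor C L Fo Fm
  for C :: "('o, 'm, 'z) cat_scheme" (structure) and Den SDen TDen
    and L :: "('p, 'n, 'y) cat_scheme" and Fo :: "'o \<Rightarrow> 'p" and Fm :: "'m \<Rightarrow> 'n" +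
  fixes B :: "'m \<Rightarrow> 'n"
  assumes B_hom: "d \<in> Den \<Longrightarrow> B d \<in> Hom L (Fo (Tgt C d)) (Fo (Src C d))"
    and B_left: "d \<in> Den \<Longrightarrow> B d \<cdot>\<^bsub>L\<^esub> Fm d = Idn L (Fo (Tgt C d))"
    and B_right: "d \<in> Den \<Longrightarrow> Fm d \<cdot>\<^bsub>L\<^esub> B d = Idn L (Fo (Src C d))"
begin

lemma Fm_simps [simp]:
  assumes "f \<in> Mor C"
  shows "Fm f \<in> Mor L" "Src L (Fm f) = Fo (Src C f)" "Tgt L (Fm f) = Fo (Tgt C f)"
  using functor_mor[OF assms] by (auto simp: Hom_def)

lemma B_simps [simp]:
  assumes "d \<in> Den"
  shows "B d \<in> Mor L" "Src L (B d) = Fo (Tgt C d)" "Tgt L (B d) = Fo (Src C d)"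
  using B_hom[OF assms] by (auto simp: Hom_def)

lemma Fo_ob [simp]: "X \<in> Ob C \<Longrightarrow> Fo X \<in> Ob L"
  by (rule functor_ob)

text \<open>A commuting square with two parallel denominators still commutes when these are replaced
  by their inverses. This is how an inverse is moved past a morphism.\<close>

lemma B_swap:
  assumes "q \<in> Den" "q' \<in> Den" "h \<in> Mor C" "k \<in> Mor C" "h \<cdot> q = q' \<cdot> k"
    "Tgt C h = Src C q" "Tgt C q' = Src C k" "Src C h = Src C q'" "Tgt C k = Tgt C q"
  shows "B q' \<cdot>\<^bsub>L\<^esub> Fm h = Fm k \<cdot>\<^bsub>L\<^esub> B q"
proof -
  have "B q' \<cdot>\<^bsub>L\<^esub> Fm h = B q' \<cdot>\<^bsub>L\<^esub> (Fm h \<cdot>\<^bsub>L\<^esub> (Fm q \<cdot>\<^bsub>L\<^esub> B q))"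
    using assms by (simp add: B_right)
  also have "\<dots> = B q' \<cdot>\<^bsub>L\<^esub> (Fm (h \<cdot> q) \<cdot>\<^bsub>L\<^esub> B q)"
    using assms(1-4,6-) by (simp add: functor_comp)
  also have "\<dots> = (B q' \<cdot>\<^bsub>L\<^esub> Fm q') \<cdot>\<^bsub>L\<^esub> (Fm k \<cdot>\<^bsub>L\<^esub> B q)"
    unfolding assms(5) using assms(1-4,6-) by (simp add: functor_comp)
  also have "\<dots> = Fm k \<cdot>\<^bsub>L\<^esub> B q"
    using assms(1-4,6-) by (simp add: B_left)
  finally show ?thesis .
qed

lemma B_comp:
  assumes "f \<in> Den" "g \<in> Den" "Tgt C f = Src C g"
  shows "B (f \<cdot> g) = B g \<cdot>\<^bsub>L\<^esub> B f"
proof -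
  have fg: "f \<cdot> g \<in> Den" using assms by (rule den_comp)
  have "B (f \<cdot> g) = B (f \<cdot> g) \<cdot>\<^bsub>L\<^esub> (Fm f \<cdot>\<^bsub>L\<^esub> ((Fm g \<cdot>\<^bsub>L\<^esub> B g) \<cdot>\<^bsub>L\<^esub> B f))"
    using assms fg by (simp add: B_right)
  also have "\<dots> = (B (f \<cdot> g) \<cdot>\<^bsub>L\<^esub> Fm (f \<cdot> g)) \<cdot>\<^bsub>L\<^esub> (B g \<cdot>\<^bsub>L\<^esub> B f)"
    using assms fg by (simp add: functor_comp)
  also have "\<dots> = B g \<cdot>\<^bsub>L\<^esub> B f"
    unfolding B_left[OF fg] using assms by simp
  finally show ?thesis .
qed

lemma B_id: "X \<in> Ob C \<Longrightarrow> B (Idn C X) = Idn L (Fo X)"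
  using B_right[of "Idn C X"] B_simps[of "Idn C X"] by (simp add: functor_id)

fun fr where "fr (b, f, a) = B b \<cdot>\<^bsub>L\<^esub> (Fm f \<cdot>\<^bsub>L\<^esub> B a)"

lemma fr_simps:
  assumes "(b, f, a) \<in> arrows"
  shows "fr (b, f, a) \<in> Mor L" "Src L (fr (b, f, a)) = Fo (Tgt C b)" "Tgt L (fr (b, f, a)) = Fo (Src C a)"
  using assms by (simp_all add: arrows_iff)

lemma fr_step:
  assumes "fraction_step C Den s t" shows "fr s = fr t"
  using assms
proof cases
  case (right b f a c)
  have "B a \<cdot>\<^bsub>L\<^esub> Fm (Idn C (Src C a)) = Fm c \<cdot>\<^bsub>L\<^esub> B (a \<cdot> c)"
    by (rule B_swap) (use right in \<open>simp_all add: arrows_iff\<close>)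
  then have "Fm c \<cdot>\<^bsub>L\<^esub> B (a \<cdot> c) = B a"
    using right(3) by (simp add: arrows_iff functor_id)
  then show ?thesis using right by (simp add: arrows_iff functor_comp)
next
  case (left b f a c)
  have "B (c \<cdot> b) \<cdot>\<^bsub>L\<^esub> Fm c = Fm (Idn C (Tgt C b)) \<cdot>\<^bsub>L\<^esub> B b"
    by (rule B_swap) (use left in \<open>simp_all add: arrows_iff\<close>)
  then have "B (c \<cdot> b) \<cdot>\<^bsub>L\<^esub> Fm c = B b"
    using left(3) by (simp add: arrows_iff functor_id)
  then have "(B (c \<cdot> b) \<cdot>\<^bsub>L\<^esub> Fm c) \<cdot>\<^bsub>L\<^esub> (Fm f \<cdot>\<^bsub>L\<^esub> B a) = B b \<cdot>\<^bsub>L\<^esub> (Fm f \<cdot>\<^bsub>L\<^esub> B a)"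
    by simp
  then show ?thesis using left by (simp add: arrows_iff functor_comp)
qed

lemma fr_feq: "s \<approx> t \<Longrightarrow> fr s = fr t"
  by (induction rule: feq_induct) (metis fr_step)+

lemma composite_choice_arrows:
  assumes "composite_choice C SDen TDen (b1, f1, a1) (b2, f2, a2) (b, f, a)"
    "(b1, f1, a1) \<in> arrows" "(b2, f2, a2) \<in> arrows"
  shows "(b, f, a) \<in> arrows" "Tgt C b = Tgt C b1" "Src C a = Src C a2" "Tgt C b2 = Src C a1"
  using assms by (auto elim!: composite_choice.cases simp: arrows_iff Hom_def intro!: den_comp)

text \<open>\<open>b2 \<cdot> a1 = j \<cdot> q\<close> turns the inner inverses \<open>B a1\<close>,
  \<open>B b2\<close> into \<open>B q\<close>, \<open>B j\<close>; the two squares then move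
  \<open>B q\<close> to the left past \<open>f1\<close> and \<open>B j\<close> to the right past
  \<open>f2\<close>. Hence evaluation is multiplicative for every admissible choice.\<close>

lemma fr_composite:
  assumes cc: "composite_choice C SDen TDen (b1, f1, a1) (b2, f2, a2) (b, f, a)"
    and s: "(b1, f1, a1) \<in> arrows" "(b2, f2, a2) \<in> arrows"
  shows "fr (b, f, a) = fr (b1, f1, a1) \<cdot>\<^bsub>L\<^esub> fr (b2, f2, a2)"
  using cc
proof cases
  case (1 j q q' f1' j' f2')
  note [simp] = 1(1-3)
  have d[simp]: "b1 \<in> Den" "f1 \<in> Mor C" "a1 \<in> Den" "b2 \<in> Den" "f2 \<in> Mor C" "a2 \<in> Den"
    "Src C b1 = Src C f1" "Tgt C a1 = Tgt C f1" "Src C b2 = Src C f2" "Tgt C a2 = Tgt C f2"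
    using s by (auto simp: arrows_iff)
  have c[simp]: "Tgt C b2 = Src C a1" "j \<in> Den" "q \<in> Den" "Tgt C j = Src C q" "q' \<in> Den" "Tgt C q' = Src C f1"
    "f1' \<in> Mor C" "Src C f1' = Src C q'" "Tgt C f1' = Src C q" "j' \<in> Den" "Src C j' = Tgt C f2"
    "f2' \<in> Mor C" "Src C f2' = Src C q" "Tgt C f2' = Tgt C j'"
    using 1 by (auto simp: Hom_def)
  have eq: "b2 \<cdot> a1 = j \<cdot> q" "f1' \<cdot> q = q' \<cdot> f1" "j \<cdot> f2' = f2 \<cdot> j'" using 1 by auto
  have c'[simp]: "Src C j = Src C f2" "Tgt C q = Tgt C f1"
    using comp_mor(2,3)[of b2 a1] comp_mor(2,3)[of j q] eq(1) by simp_all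
  have e: "B a1 \<cdot>\<^bsub>L\<^esub> B b2 = B q \<cdot>\<^bsub>L\<^esub> B j"
    using B_comp[of b2 a1] B_comp[of j q] eq(1) by simp
  have e1: "B q' \<cdot>\<^bsub>L\<^esub> Fm f1' = Fm f1 \<cdot>\<^bsub>L\<^esub> B q" using eq(2) by (intro B_swap) simp_all
  have e2: "B j \<cdot>\<^bsub>L\<^esub> Fm f2 = Fm f2' \<cdot>\<^bsub>L\<^esub> B j'" using eq(3) by (intro B_swap) simp_all
  have "fr (b, f, a) = B b1 \<cdot>\<^bsub>L\<^esub> ((B q' \<cdot>\<^bsub>L\<^esub> Fm f1') \<cdot>\<^bsub>L\<^esub> ((Fm f2' \<cdot>\<^bsub>L\<^esub> B j') \<cdot>\<^bsub>L\<^esub> B a2))"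
    by (simp add: B_comp functor_comp)
  also have "\<dots> = B b1 \<cdot>\<^bsub>L\<^esub> ((Fm f1 \<cdot>\<^bsub>L\<^esub> B q) \<cdot>\<^bsub>L\<^esub> ((B j \<cdot>\<^bsub>L\<^esub> Fm f2) \<cdot>\<^bsub>L\<^esub> B a2))"
    by (simp only: e1 e2)
  also have "\<dots> = B b1 \<cdot>\<^bsub>L\<^esub> (Fm f1 \<cdot>\<^bsub>L\<^esub> ((B q \<cdot>\<^bsub>L\<^esub> B j) \<cdot>\<^bsub>L\<^esub> (Fm f2 \<cdot>\<^bsub>L\<^esub> B a2)))"
    by simp
  also have "\<dots> = B b1 \<cdot>\<^bsub>L\<^esub> (Fm f1 \<cdot>\<^bsub>L\<^esub> ((B a1 \<cdot>\<^bsub>L\<^esub> B b2) \<cdot>\<^bsub>L\<^esub> (Fm f2 \<cdot>\<^bsub>L\<^esub> B a2)))"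
    by (simp only: e)
  also have "\<dots> = fr (b1, f1, a1) \<cdot>\<^bsub>L\<^esub> fr (b2, f2, a2)"
    by simp
  finally show ?thesis .
qed

lemma composite_choice_ex:
  assumes "(b1, f1, a1) \<in> arrows" "(b2, f2, a2) \<in> arrows" "Tgt C b2 = Src C a1"
  shows "\<exists>s. composite_choice C SDen TDen (b1, f1, a1) (b2, f2, a2) s"
proof -
  have "b2 \<cdot> a1 \<in> Den" using assms by (auto simp: arrows_iff intro: den_comp)
  then obtain j q where j: "j \<in> SDen" "q \<in> TDen" "Tgt C j = Src C q" "b2 \<cdot> a1 = j \<cdot> q"
    using factorisation by blast
  have jq: "Src C j = Src C f2" "Tgt C q = Tgt C f1"
    using comp_mor(2,3)[of b2 a1] comp_mor(2,3)[of j q] j assms by (simp_all add: arrows_iff)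
  obtain f1' q' where "T_square f1 q f1' q'"
    using T_square_ex[OF j(2), of f1] assms jq by (auto simp: arrows_iff)
  moreover obtain f2' j' where "S_square j f2 f2' j'"
    using S_square_ex[OF j(1), of f2] assms jq by (auto simp: arrows_iff)
  ultimately show ?thesis
    using composite_choice.intros[of C b2 a1 j SDen q TDen q' f1 f1' j' f2 f2' b1 a2] j assms(3)
    by (auto simp: T_square_def S_square_def Hom_def)
qed

lemma fr_loc: "f \<in> Mor C \<Longrightarrow> fr (Idn C (Src C f), f, Idn C (Tgt C f)) = Fm f"
  by (simp add: B_id)

text \<open>An action by \<open>g\<close> is a composite choice with the 3-arrow
  \<open>(1, g, 1)\<close>, for which \<open>1 \<cdot> a = a\<close> is factored as
  \<open>i \<cdot> p\<close>.\<close>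

lemma fr_act:
  assumes "act g (b, f, a) (b', f', a')" "(b, f, a) \<in> arrows" "g \<in> Mor C" "Src C g = Src C a"
  shows "fr (b', f', a') = fr (b, f, a) \<cdot>\<^bsub>L\<^esub> Fm g"
proof -
  have arr: "(Idn C (Src C g), g, Idn C (Tgt C g)) \<in> arrows" using assms(3) by (simp add: arrows_iff)
  from assms obtain i p g' h p' where c: "i \<in> SDen" "p \<in> TDen" "Tgt C i = Src C p" "a = i \<cdot> p"
    "S_square i g g' a'" "T_square f p h p'" "b' = p' \<cdot> b" "f' = h \<cdot> g'"
    by (auto simp: act_def)
  then have "composite_choice C SDen TDen (b, f, a) (Idn C (Src C g), g, Idn C (Tgt C g))
      (p' \<cdot> b, h \<cdot> g', Idn C (Tgt C g) \<cdot> a')"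
    using assms(2-) by (intro composite_choice.intros[of _ _ _ i _ p]) (auto simp: S_square_def T_square_def Hom_def arrows_iff)
  then have "composite_choice C SDen TDen (b, f, a) (Idn C (Src C g), g, Idn C (Tgt C g)) (b', f', a')"
    using c by (simp add: S_square_def)
  from fr_composite[OF this assms(2) arr] show ?thesis unfolding fr_loc[OF assms(3)] .
qed

lemma fraction_class_eq:
  "s \<in> arrows \<Longrightarrow> t \<in> arrows \<Longrightarrow> fraction_equality C Den `` {s} = fraction_equality C Den `` {t} \<longleftrightarrow> s \<approx> t"
  unfolding feq_def by (rule eq_equiv_class_iff[OF feq_equiv])

text \<open>Evaluation extends the functor to double fractions, so an inverse of \<open>loc\<close>
  of \<open>f\<close> evaluates to an inverse of \<open>Fm f\<close>. The argument rests on the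
  composition formula of \<open>Frac\<close> alone, with one representative chosen for the
  inverse.\<close>

lemma saturatedI:
  assumes "\<And>f. f \<in> Mor C \<Longrightarrow> is_iso L (Fm f) \<Longrightarrow> f \<in> Den"
  shows "saturated C Den SDen TDen"
  unfolding saturated_def
proof (intro ballI impI)
  let ?Q = "Frac C Den SDen TDen"
  fix f assume f: "f \<in> Mor C" and iso: "is_iso ?Q (loc C Den f)"
  let ?s = "(Idn C (Src C f), f, Idn C (Tgt C f))"
  have s: "?s \<in> arrows" using f by (simp add: arrows_iff)
  have one: "(Idn C X, Idn C X, Idn C X) \<in> arrows" if "X \<in> Ob C" for X using that by (simp add: arrows_iff)
  have loc: "loc C Den f = fraction_equality C Den `` {?s}"
    by (simp add: loc_def double_fraction_def)
  have s_in: "?s \<in> loc C Den f" unfolding loc using feq_refl[OF s] by (simp add: feq_def)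
  have ends: "Src ?Q (fraction_equality C Den `` {t}) = Tgt C (fst t)"
    "Tgt ?Q (fraction_equality C Den `` {t}) = Src C (snd (snd t))" if t: "t \<in> arrows" for t
  proof -
    have *: "u \<in> fraction_equality C Den `` {t} \<Longrightarrow> Tgt C (fst u) = Tgt C (fst t) \<and> Src C (snd (snd u)) = Src C (snd (snd t))" for u
      using feq_src_tgt[of "fst t" "fst (snd t)" "snd (snd t)" "fst u" "fst (snd u)" "snd (snd u)"] by (simp add: feq_def)
    have t': "t \<in> fraction_equality C Den `` {t}" using feq_refl[OF t] by (simp add: feq_def)
    have "(\<lambda>(b, f, a). Tgt C b) ` (fraction_equality C Den `` {t}) = {Tgt C (fst t)}"
      by (rule image_eq_singleton[OF t']) (drule *, simp add: case_prod_beta)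
    moreover have "(\<lambda>(b, f, a). Src C a) ` (fraction_equality C Den `` {t}) = {Src C (snd (snd t))}"
      by (rule image_eq_singleton[OF t']) (drule *, simp add: case_prod_beta)
    ultimately show "Src ?Q (fraction_equality C Den `` {t}) = Tgt C (fst t)"
      "Tgt ?Q (fraction_equality C Den `` {t}) = Src C (snd (snd t))" by (simp_all add: Frac_def)
  qed
  have src: "Src ?Q (loc C Den f) = Src C f" and tgt: "Tgt ?Q (loc C Den f) = Tgt C f"
    unfolding loc using ends[OF s] f by simp_all
  from iso obtain P where P: "P \<in> Mor ?Q" "Src ?Q P = Tgt C f" "Tgt ?Q P = Src C f"
    and inv: "loc C Den f \<cdot>\<^bsub>?Q\<^esub> P = Idn ?Q (Src C f)" "P \<cdot>\<^bsub>?Q\<^esub> loc C Den f = Idn ?Q (Tgt C f)"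
    unfolding is_iso_def src tgt Hom_def by auto
  from P(1) obtain t where t: "t \<in> arrows" "P = fraction_equality C Den `` {t}"
    by (auto simp: Frac_def elim: quotientE)
  obtain b g a where bga: "t = (b, g, a)" by (cases t)
  have tt: "Tgt C b = Tgt C f" "Src C a = Src C f" using ends[OF t(1)] P t bga by simp_all
  have t_in: "t \<in> P" unfolding t using feq_refl[OF t(1)] by (simp add: feq_def)
  \<comment> \<open>The union that defines the composite contains an actual composite
    \<open>s\<close> of the representatives. As the union is the class of the identity,
    \<open>s\<close> is equivalent to the identity 3-arrow and evaluates to an identity.\<close>
  have comp: "fr s1 \<cdot>\<^bsub>L\<^esub> fr s2 = Idn L (Fo X)"
    if H: "s1 \<in> arrows" "s2 \<in> arrows" "s1 \<in> P1" "s2 \<in> P2" "P1 \<cdot>\<^bsub>?Q\<^esub> P2 = Idn ?Q X" "X \<in> Ob C"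
      "Tgt C (fst s2) = Src C (snd (snd s1))" for s1 s2 P1 P2 X
  proof -
    obtain s where cc: "composite_choice C SDen TDen s1 s2 s"
      using composite_choice_ex[of "fst s1" "fst (snd s1)" "snd (snd s1)" "fst s2" "fst (snd s2)" "snd (snd s2)"]
        H(1,2,7) unfolding prod.collapse by blast
    have sa: "s \<in> arrows" "fr s = fr s1 \<cdot>\<^bsub>L\<^esub> fr s2"
      using composite_choice_arrows(1) fr_composite cc H(1,2) by (cases s; cases s1; cases s2; blast)+
    have "s \<in> fraction_equality C Den `` {s}" using feq_refl[OF sa(1)] by (simp add: feq_def)
    then have "s \<in> P1 \<cdot>\<^bsub>?Q\<^esub> P2"
      using H(3,4) cc by (cases s) (simp add: Frac_def double_fraction_def, blast)
    then have "s \<in> double_fraction C Den (Idn C X) (Idn C X) (Idn C X)"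
      unfolding H(5) by (simp add: Frac_def)
    then have "(Idn C X, Idn C X, Idn C X) \<approx> s"
      by (simp add: double_fraction_def feq_def)
    from fr_feq[OF this] sa H(6) show ?thesis by (simp add: B_id functor_id)
  qed
  have "fr ?s \<cdot>\<^bsub>L\<^esub> fr t = Idn L (Fo (Src C f))"
    by (rule comp[OF s t(1) s_in t_in inv(1)]) (use f tt bga in simp_all)
  moreover have "fr t \<cdot>\<^bsub>L\<^esub> fr ?s = Idn L (Fo (Tgt C f))"
    by (rule comp[OF t(1) s t_in s_in inv(2)]) (use f tt bga in simp_all)
  moreover have "fr t \<in> Hom L (Fo (Tgt C f)) (Fo (Src C f))"
    using fr_simps[OF t(1)[unfolded bga]] tt unfolding bga Hom_def by simp
  ultimately have "is_iso L (Fm f)"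
    unfolding fr_loc[OF f] is_iso_def using f by auto
  then show "f \<in> Den" using assms f by blast
qed

end

text \<open>Evaluation is here bijective between double fractions and morphisms of \<open>L\<close>.
  Thus a double fraction is a fibre of \<open>fr\<close>, and \<open>Frac\<close> inherits
  associativity and the identity laws from \<open>L\<close>.\<close>

locale frac_presentation =
  inverting_functor C Den SDen TDen L "\<lambda>X. X" Fm B
  for C :: "('o, 'm, 'z) cat_scheme" (structure) and Den SDen TDen
    and L :: "('o, 'n, 'y) cat_scheme" and Fm :: "'m \<Rightarrow> 'n" and B +
  assumes obs: "Ob L = Ob C"
    and fr_inj: "\<lbrakk>s \<in> arrows; t \<in> arrows; fr s = fr t\<rbrakk> \<Longrightarrow> s \<approx> t"
    and fr_surj: "x \<in> Mor L \<Longrightarrow> \<exists>s \<in> arrows. fr s = x"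
begin

abbreviation FC where "FC \<equiv> Frac C Den SDen TDen"

declare fr.simps [simp del]

definition fraction_of where "fraction_of x = {s \<in> arrows. fr s = x}"

lemma fraction_of_fr: "s \<in> arrows \<Longrightarrow> fraction_equality C Den `` {s} = fraction_of (fr s)"
proof -
  assume s: "s \<in> arrows"
  have "s \<approx> t \<longleftrightarrow> t \<in> arrows \<and> fr t = fr s" for t
    using fr_inj[OF s, of t] fr_feq[of s t] feq_arrows(2)[of s t] by metis
  then show ?thesis by (auto simp: fraction_of_def feq_def)
qed

lemma FC_simps:
  shows "Mor FC = fraction_of ` Mor L" "Ob FC = Ob L"
    and "x \<in> Mor L \<Longrightarrow> Src FC (fraction_of x) = Src L x" "x \<in> Mor L \<Longrightarrow> Tgt FC (fraction_of x) = Tgt L x"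
    and "X \<in> Ob L \<Longrightarrow> Idn FC X = fraction_of (Idn L X)"
proof -
  have "fr s \<in> Mor L" if "s \<in> arrows" for s using that fr_simps(1) by (cases s) blast
  then show "Mor FC = fraction_of ` Mor L"
    using fr_surj fraction_of_fr by (fastforce simp: Frac_def quotient_def)
  show "Ob FC = Ob L" by (simp add: Frac_def obs)
  show "Idn FC X = fraction_of (Idn L X)" if "X \<in> Ob L"
    using fraction_of_fr[of "(Idn C X, Idn C X, Idn C X)"] that obs
    by (simp add: Frac_def double_fraction_def arrows_iff fr.simps B_id functor_id)
  assume x: "x \<in> Mor L"
  then obtain s where s: "s \<in> fraction_of x" using fr_surj unfolding fraction_of_def by blast
  have "(\<lambda>(b, f, a). Tgt C b) t = Src L x \<and> (\<lambda>(b, f, a). Src C a) t = Tgt L x" if "t \<in> fraction_of x" for t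
    using that fr_simps(2,3)[of "fst t" "fst (snd t)" "snd (snd t)"] by (cases t) (auto simp: fraction_of_def)
  then have "(\<lambda>(b, f, a). Tgt C b) ` fraction_of x = {Src L x}" "(\<lambda>(b, f, a). Src C a) ` fraction_of x = {Tgt L x}"
    using s by (auto simp: image_iff)
  then show "Src FC (fraction_of x) = Src L x" "Tgt FC (fraction_of x) = Tgt L x"
    by (simp_all add: Frac_def)
qed

text \<open>All composites of representatives evaluate to the same product, and at least one
  composite exists; so the union in the definition of composition is a single fibre. This is the
  independence of the choices.\<close>

lemma fraction_of_comp:
  assumes x: "x \<in> Mor L" and y: "y \<in> Mor L" and xy: "Tgt L x = Src L y"
  shows "fraction_of x \<cdot>\<^bsub>FC\<^esub> fraction_of y = fraction_of (x \<cdot>\<^bsub>L\<^esub> y)"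
proof -
  let ?S = "{s. \<exists>s1 \<in> fraction_of x. \<exists>s2 \<in> fraction_of y. composite_choice C SDen TDen s1 s2 s}"
  have *: "s \<in> arrows \<and> fr s = x \<cdot>\<^bsub>L\<^esub> y" if s: "s \<in> ?S" for s
  proof -
    from s obtain s1 s2 where "s1 \<in> arrows" "s2 \<in> arrows" "fr s1 = x" "fr s2 = y" "composite_choice C SDen TDen s1 s2 s"
      by (auto simp: fraction_of_def)
    then show ?thesis
      using composite_choice_arrows(1) fr_composite by (cases s; cases s1; cases s2) blast
  qed
  from x y obtain s1 s2 where s: "s1 \<in> arrows" "s2 \<in> arrows" "fr s1 = x" "fr s2 = y" using fr_surj by blast
  obtain b1 f1 a1 b2 f2 a2 where s12: "s1 = (b1, f1, a1)" "s2 = (b2, f2, a2)" by (cases s1; cases s2) auto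
  have "Tgt C b2 = Src C a1"
    using fr_simps(3)[of b1 f1 a1] fr_simps(2)[of b2 f2 a2] s s12 xy by simp
  then obtain s0 where "composite_choice C SDen TDen s1 s2 s0"
    using composite_choice_ex s s12 by blast
  then have s0: "s0 \<in> ?S" using s unfolding fraction_of_def by blast
  have "fraction_of x \<cdot>\<^bsub>FC\<^esub> fraction_of y = (\<Union>s \<in> ?S. fraction_equality C Den `` {s})"
    by (simp add: Frac_def double_fraction_def case_prod_beta)
  also have "\<dots> = (\<Union>s \<in> ?S. fraction_of (x \<cdot>\<^bsub>L\<^esub> y))"
  proof (rule SUP_cong[OF refl])
    fix s assume "s \<in> ?S"
    from *[OF this] show "fraction_equality C Den `` {s} = fraction_of (x \<cdot>\<^bsub>L\<^esub> y)"
      using fraction_of_fr[of s] by simp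
  qed
  also have "\<dots> = fraction_of (x \<cdot>\<^bsub>L\<^esub> y)" using s0 by blast
  finally show ?thesis .
qed

lemma fraction_of_inj: "inj_on fraction_of (Mor L)"
proof (rule inj_onI)
  fix x y assume "x \<in> Mor L" "y \<in> Mor L" and e: "fraction_of x = fraction_of y"
  then obtain s where "s \<in> fraction_of x" using fr_surj unfolding fraction_of_def by blast
  moreover with e have "s \<in> fraction_of y" by simp
  ultimately show "x = y" by (auto simp: fraction_of_def)
qed

sublocale FC: category FC
proof
  show "P \<in> Mor FC \<Longrightarrow> Src FC P \<in> Ob FC" "P \<in> Mor FC \<Longrightarrow> Tgt FC P \<in> Ob FC" for P
    by (auto simp: FC_simps)
  show "X \<in> Ob FC \<Longrightarrow> Idn FC X \<in> Hom FC X X" for X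
    by (auto simp: FC_simps Hom_def)
  show "P \<cdot>\<^bsub>FC\<^esub> R \<in> Hom FC X Z" if "P \<in> Hom FC X Y" "R \<in> Hom FC Y Z" for P R X Y Z
    using that by (auto simp: FC_simps Hom_def fraction_of_comp)
  show "P \<in> Mor FC \<Longrightarrow> Idn FC (Src FC P) \<cdot>\<^bsub>FC\<^esub> P = P" "P \<in> Mor FC \<Longrightarrow> P \<cdot>\<^bsub>FC\<^esub> Idn FC (Tgt FC P) = P" for P
    by (auto simp: FC_simps fraction_of_comp)
  show "(P \<cdot>\<^bsub>FC\<^esub> R) \<cdot>\<^bsub>FC\<^esub> S = P \<cdot>\<^bsub>FC\<^esub> (R \<cdot>\<^bsub>FC\<^esub> S)"
    if "P \<in> Hom FC W X" "R \<in> Hom FC X Y" "S \<in> Hom FC Y Z" for P R S W X Y Z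
    using that by (auto simp: FC_simps Hom_def fraction_of_comp)
qed

lemma isomorphic_Frac: "isomorphic_categories L FC"
proof -
  have "is_functor L FC (\<lambda>X. X) fraction_of"
    by unfold_locales (auto simp: FC_simps Hom_def fraction_of_comp)
  then show ?thesis
    unfolding isomorphic_categories_def
    using fraction_of_inj FC_simps(1,2) by (intro exI[of _ "\<lambda>X. X"] exI[of _ fraction_of]) (auto simp: bij_betw_def)
qed

end

section \<open>The fraction category as a localisation of a quotient category\<close>

text \<open>The paper's passage from the localisation of complexes to that of the homotopy category: a
  congruence all of whose instances are detected by cylinders is invisible after inverting the
  denominators.\<close>

locale cylinder_congruence =
  uni_fractionable C Den SDen TDen + category_congruence C r
  for C :: "('o, 'm, 'z) cat_scheme" (structure) and Den SDen TDen and r +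
  assumes cylinder: "(f, g) \<in> r \<Longrightarrow>
    \<exists>i0 i1 s h. i0 \<in> Mor C \<and> i1 \<in> Mor C \<and> s \<in> Den \<and> h \<in> Mor C \<and>
      Src C i0 = Src C f \<and> Src C i1 = Src C f \<and> Tgt C i0 = Src C s \<and> Tgt C i1 = Src C s \<and>
      Src C h = Src C s \<and> i0 \<cdot> s = Idn C (Src C f) \<and> i1 \<cdot> s = Idn C (Src C f) \<and> i0 \<cdot> h = f \<and> i1 \<cdot> h = g"
begin

abbreviation W where "W \<equiv> {r `` {f} | f. f \<in> Den}"

sublocale localised_category Q W
  by unfold_locales auto

text \<open>Only the class of \<open>f\<close> in the quotient enters, so congruent morphisms are
  identified from the outset. What has to be shown is that evaluating double fractions of
  \<open>C\<close> remains injective nevertheless.\<close>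

definition fwd where "fwd f = zclass (Src C f) [Fwd (r `` {f})] (Tgt C f)"
definition bwd where "bwd d = zclass (Tgt C d) [Bwd (r `` {d})] (Src C d)"

lemma zigzag_fwd [simp]: "f \<in> Mor C \<Longrightarrow> zigzag Q W X (Fwd (r `` {f}) # w) Y \<longleftrightarrow> Src C f = X \<and> zigzag Q W (Tgt C f) w Y"
  by simp

lemma zigzag_bwd [simp]:
  assumes "d \<in> Den" shows "zigzag Q W X (Bwd (r `` {d}) # w) Y \<longleftrightarrow> Tgt C d = X \<and> zigzag Q W (Src C d) w Y"
  using assms by auto

declare zigzag.simps(2) [simp del]

sublocale inverting_functor C Den SDen TDen L "\<lambda>X. X" fwd bwd
proof unfold_locales
  fix f g assume fg: "f \<in> Mor C" "g \<in> Mor C" "Tgt C f = Src C g"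
  have "zigzag_rule Q W [Fwd (r `` {f}), Fwd (r `` {g})] [Fwd ((r `` {f}) \<cdot>\<^bsub>Q\<^esub> (r `` {g}))]"
    using fg by (intro zigzag_rule.intros) auto
  then have "zclass (Src C f) [Fwd (r `` {f}), Fwd (r `` {g})] (Tgt C g) = zclass (Src C f) [Fwd (r `` {f \<cdot> g})] (Tgt C g)"
    using fg by (intro zclass_rule) (auto simp: class_comp)
  then show "fwd (f \<cdot> g) = fwd f \<cdot>\<^bsub>L\<^esub> fwd g"
    using fg by (simp add: fwd_def)
next
  fix X assume X: "X \<in> Ob C"
  have "zigzag_rule Q W [Fwd (Idn Q X)] []" using X by (intro zigzag_rule.intros) simp
  then have "zclass X [Fwd (r `` {Idn C X})] X = zclass X [] X"
    using X by (intro zclass_rule) (auto simp: class_id)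
  then show "fwd (Idn C X) = Idn L X" using X by (simp add: fwd_def zclass_id)
next
  fix d assume d: "d \<in> Den"
  then have dW: "r `` {d} \<in> W" by blast
  have "zclass (Tgt C d) [Bwd (r `` {d}), Fwd (r `` {d})] (Tgt C d) = zclass (Tgt C d) [] (Tgt C d)"
    using d dW by (intro zclass_rule zigzag_rule.intros) auto
  then show "bwd d \<cdot>\<^bsub>L\<^esub> fwd d = Idn L (Tgt C d)"
    using d by (simp add: bwd_def fwd_def zclass_id)
  have "zclass (Src C d) [Fwd (r `` {d}), Bwd (r `` {d})] (Src C d) = zclass (Src C d) [] (Src C d)"
    using d dW by (intro zclass_rule zigzag_rule.intros) auto
  then show "fwd d \<cdot>\<^bsub>L\<^esub> bwd d = Idn L (Src C d)"
    using d by (simp add: bwd_def fwd_def zclass_id)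
qed (auto simp: fwd_def bwd_def Hom_def)

lemma fr_zclass:
  assumes "(b, f, a) \<in> arrows"
  shows "fr (b, f, a) = zclass (Tgt C b) [Bwd (r `` {b}), Fwd (r `` {f}), Bwd (r `` {a})] (Src C a)"
  using assms by (simp add: arrows_iff bwd_def fwd_def)

subsection \<open>Every zigzag is a fraction\<close>

text \<open>The induction removes the last letter. Appending a morphism is the action
  \<open>act\<close>, and appending the formal inverse of \<open>d\<close> replaces \<open>a\<close>
  by \<open>d \<cdot> a\<close>, since \<open>bwd\<close> reverses products.\<close>

lemma fr_surj_zigzag:
  "zigzag Q W X w Y \<Longrightarrow> \<exists>s \<in> arrows. fr s = zclass X w Y"
proof (induction w arbitrary: Y rule: rev_induct)
  case Nil
  then have "X \<in> Ob C" "Y = X" by auto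
  then show ?case
    using fr_loc[of "Idn C X"] by (intro bexI[of _ "(Idn C X, Idn C X, Idn C X)"]) (auto simp: functor_id zclass_id arrows_iff)
next
  case (snoc l w)
  then obtain Z where w: "zigzag Q W X w Z" and l: "zigzag Q W Z [l] Y" by (auto simp: zigzag_append)
  from snoc.IH[OF w] obtain b f a where s: "(b, f, a) \<in> arrows" "fr (b, f, a) = zclass X w Z" by auto
  have Z: "Src C a = Z" using fr_simps(3)[OF s(1)] s(2) w by simp
  have comp: "zclass X w Z \<cdot>\<^bsub>L\<^esub> zclass Z [l] Y = zclass X (w @ [l]) Y"
    using w l by simp
  show ?case
  proof (cases l)
    case (Fwd F)
    with l obtain g where g: "g \<in> Mor C" "F = r `` {g}"
      by (auto simp: zigzag.simps(2) elim: quotient_morE)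
    then have ZY: "Src C g = Z" "Tgt C g = Y" using l Fwd by auto
    obtain b' f' a' where t: "act g (b, f, a) (b', f', a')"
      using act_ex[OF s(1) g(1)] Z ZY by auto
    have "fr (b', f', a') = zclass X (w @ [l]) Y"
      unfolding fr_act[OF t s(1) g(1) ZY(1)[folded Z]] s(2) comp[symmetric] by (simp add: fwd_def Fwd g ZY)
    then show ?thesis using act_arrows(1)[OF s(1) g(1) _ t] Z ZY by blast
  next
    case (Bwd F)
    with l obtain d where d: "d \<in> Den" "F = r `` {d}" by (auto simp: zigzag.simps(2))
    then have ZY: "Tgt C d = Z" "Src C d = Y" using l Bwd by auto
    have "fr (b, f, d \<cdot> a) = fr (b, f, a) \<cdot>\<^bsub>L\<^esub> bwd d"
      using s(1) d Z ZY by (simp add: arrows_iff B_comp)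
    also have "\<dots> = zclass X (w @ [l]) Y"
      unfolding s(2) comp[symmetric] by (simp add: bwd_def Bwd d ZY)
    finally show ?thesis
      using s(1) d Z ZY by (intro bexI[of _ "(b, f, d \<cdot> a)"]) (auto simp: arrows_iff intro: den_comp)
  qed
qed

subsection \<open>Zigzags act on fractions\<close>

definition fcl where "fcl s = fraction_equality C Den `` {s}"
text \<open>Double fractions with fixed target and arbitrary source; on these sets zigzags act like
  a covariant set-valued functor. \<open>actF\<close> and \<open>actB\<close> pick representatives
  by choice, which \<open>act_feq\<close> and \<open>inverse_feq\<close> make harmless.\<close>

definition fractions_to where "fractions_to X = {fcl (b, f, a) | b f a. (b, f, a) \<in> arrows \<and> Src C a = X}"
definition actF where "actF g P = fcl (SOME t. \<exists>s \<in> P. act g s t)"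
definition actB where "actB d P = fcl (SOME t. \<exists>b f a. (b, f, a) \<in> P \<and> t = (b, f, d \<cdot> a))"

lemma fcl_eq: "s \<in> arrows \<Longrightarrow> t \<in> arrows \<Longrightarrow> fcl s = fcl t \<longleftrightarrow> s \<approx> t"
  unfolding fcl_def by (rule fraction_class_eq)

lemma fcl_iff: "t \<in> fcl s \<longleftrightarrow> s \<approx> t"
  by (simp add: fcl_def feq_def)

lemma fcl_eqI: "s \<approx> t \<Longrightarrow> fcl s = fcl t"
  using fcl_eq feq_arrows by blast

lemma fractions_toE:
  assumes "P \<in> fractions_to X" obtains b f a where "(b, f, a) \<in> arrows" "Src C a = X" "P = fcl (b, f, a)"
  using assms by (auto simp: fractions_to_def)

lemma actF_fcl:
  assumes s: "(b, f, a) \<in> arrows" and g: "g \<in> Mor C" "Src C g = Src C a" and t: "act g (b, f, a) t"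
  shows "actF g (fcl (b, f, a)) = fcl t"
proof -
  define t0 where "t0 = (SOME t. \<exists>s \<in> fcl (b, f, a). act g s t)"
  have "\<exists>s \<in> fcl (b, f, a). act g s t0"
    unfolding t0_def by (rule someI[of _ t]) (use t feq_refl[OF s] in \<open>auto simp: fcl_iff\<close>)
  then obtain s0 where "(b, f, a) \<approx> s0" "act g s0 t0" by (auto simp: fcl_iff)
  then have "t \<approx> t0" using act_feq[of "(b, f, a)" s0 g t t0] g t by simp
  from fcl_eqI[OF this] show ?thesis by (simp add: actF_def t0_def)
qed

lemma actF_ex:
  assumes "P \<in> fractions_to (Src C g)" "g \<in> Mor C"
  obtains b f a b' f' a' where "(b, f, a) \<in> arrows" "Src C a = Src C g" "P = fcl (b, f, a)"
    "act g (b, f, a) (b', f', a')" "(b', f', a') \<in> arrows" "Src C a' = Tgt C g" "actF g P = fcl (b', f', a')"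
proof -
  from assms(1) obtain b f a where s: "(b, f, a) \<in> arrows" "Src C a = Src C g" "P = fcl (b, f, a)"
    by (rule fractions_toE)
  obtain b' f' a' where t: "act g (b, f, a) (b', f', a')"
    using act_ex[OF s(1) assms(2)] s(2) by auto
  show ?thesis
    using that[OF s t] act_arrows[OF s(1) assms(2) _ t] actF_fcl[OF s(1) assms(2) _ t] s by auto
qed

lemma actB_fcl:
  assumes s: "(b, f, a) \<in> arrows" and d: "d \<in> Den" "Tgt C d = Src C a"
  shows "actB d (fcl (b, f, a)) = fcl (b, f, d \<cdot> a)"
proof -
  define t0 where "t0 = (SOME t. \<exists>b' f' a'. (b', f', a') \<in> fcl (b, f, a) \<and> t = (b', f', d \<cdot> a'))"
  have "\<exists>b' f' a'. (b', f', a') \<in> fcl (b, f, a) \<and> t0 = (b', f', d \<cdot> a')"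
    unfolding t0_def by (rule someI_ex) (use feq_refl[OF s] in \<open>auto simp: fcl_iff\<close>)
  then obtain b' f' a' where "(b, f, a) \<approx> (b', f', a')" "t0 = (b', f', d \<cdot> a')" by (auto simp: fcl_iff)
  then have "(b, f, d \<cdot> a) \<approx> t0" using inverse_feq d by blast
  from fcl_eqI[OF this] show ?thesis by (simp add: actB_def t0_def)
qed

lemma actF_fractions: "P \<in> fractions_to (Src C g) \<Longrightarrow> g \<in> Mor C \<Longrightarrow> actF g P \<in> fractions_to (Tgt C g)"
  by (erule (1) actF_ex) (auto simp: fractions_to_def)

lemma actB_fractions: "P \<in> fractions_to (Tgt C d) \<Longrightarrow> d \<in> Den \<Longrightarrow> actB d P \<in> fractions_to (Src C d)"
proof (erule fractions_toE)
  fix b f a assume "d \<in> Den" "(b, f, a) \<in> arrows" "Src C a = Tgt C d" "P = fcl (b, f, a)"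
  moreover from this have "(b, f, d \<cdot> a) \<in> arrows" "Src C (d \<cdot> a) = Src C d"
    by (auto simp: arrows_iff intro: den_comp)
  ultimately show ?thesis using actB_fcl unfolding fractions_to_def by fastforce
qed

lemma actF_id: "P \<in> fractions_to X \<Longrightarrow> X \<in> Ob C \<Longrightarrow> actF (Idn C X) P = P"
proof (rule actF_ex[of P "Idn C X"])
  fix b f a b' f' a'
  assume "X \<in> Ob C" and s: "(b, f, a) \<in> arrows" "Src C a = Src C (Idn C X)" "P = fcl (b, f, a)"
    "act (Idn C X) (b, f, a) (b', f', a')" "actF (Idn C X) P = fcl (b', f', a')"
  then have "act (Idn C (Src C a)) (b, f, a) (b', f', a')" by simp
  from act_id[OF s(1) this] s show ?thesis by (simp add: fcl_eqI)
qed simp_all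

lemma actF_comp:
  assumes P: "P \<in> fractions_to (Src C f)" and fg: "f \<in> Mor C" "g \<in> Mor C" "Tgt C f = Src C g"
  shows "actF g (actF f P) = actF (f \<cdot> g) P"
proof -
  obtain b h a b' h' a' where s: "(b, h, a) \<in> arrows" "Src C a = Src C f" "P = fcl (b, h, a)"
    "act f (b, h, a) (b', h', a')" "(b', h', a') \<in> arrows" "Src C a' = Tgt C f" "actF f P = fcl (b', h', a')"
    using actF_ex[OF P fg(1)] by metis
  obtain t where t: "act g (b', h', a') t" using act_ex[OF s(5) fg(2)] s fg by auto
  obtain u where u: "act (f \<cdot> g) (b, h, a) u" using act_ex[OF s(1), of "f \<cdot> g"] s fg by auto
  have "t \<approx> u" by (rule act_comp[OF s(1) fg(1) _ fg(2) _ s(4) t u]) (use s fg in simp_all)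
  moreover have "actF g (actF f P) = fcl t" "actF (f \<cdot> g) P = fcl u"
    using actF_fcl[OF s(5) fg(2) _ t] actF_fcl[OF s(1) _ _ u] s fg by simp_all
  ultimately show ?thesis by (simp add: fcl_eqI)
qed

lemma actF_actB:
  assumes "P \<in> fractions_to (Tgt C d)" and d: "d \<in> Den"
  shows "actF d (actB d P) = P"
proof -
  from assms(1) obtain b f a where s: "(b, f, a) \<in> arrows" "Src C a = Tgt C d" "P = fcl (b, f, a)"
    by (rule fractions_toE)
  have da: "(b, f, d \<cdot> a) \<in> arrows" using s d by (auto simp: arrows_iff intro: den_comp)
  have src: "Src C d = Src C (d \<cdot> a)" using s d by (simp add: arrows_iff)
  obtain t where t: "act d (b, f, d \<cdot> a) t" using act_ex[OF da den_mor[OF d] src] by blast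
  have "t \<approx> (b, f, a)" using act_inverse_left[OF s(1) d _ t] s by simp
  then show ?thesis using actF_fcl[OF da den_mor[OF d] src t] actB_fcl[OF s(1) d] s by (simp add: fcl_eqI)
qed

lemma actB_actF:
  assumes "P \<in> fractions_to (Src C d)" and d: "d \<in> Den"
  shows "actB d (actF d P) = P"
proof -
  obtain b f a b' f' a' where s: "(b, f, a) \<in> arrows" "Src C a = Src C d" "P = fcl (b, f, a)"
    "act d (b, f, a) (b', f', a')" "(b', f', a') \<in> arrows" "Src C a' = Tgt C d" "actF d P = fcl (b', f', a')"
    using actF_ex[OF assms(1) den_mor[OF d]] by metis
  have "(b', f', d \<cdot> a') \<approx> (b, f, a)" using act_inverse_right[OF s(1) d _ s(4)] s by simp
  then show ?thesis using actB_fcl[OF s(5) d] s by (simp add: fcl_eqI)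
qed

text \<open>Both ends of the cylinder are sections of the denominator \<open>s\<close>. A section of
  \<open>s\<close> acts as the inverse of the action of \<open>s\<close>, that is, as
  \<open>actB s\<close>; hence \<open>i0\<close> and \<open>i1\<close> act alike, and so do their
  composites with \<open>h\<close>.\<close>

lemma actF_cong:
  assumes fg: "(f, g) \<in> r" and P: "P \<in> fractions_to (Src C f)"
  shows "actF f P = actF g P"
proof -
  obtain i0 i1 s h where c: "i0 \<in> Mor C" "i1 \<in> Mor C" "s \<in> Den" "h \<in> Mor C"
    "Src C i0 = Src C f" "Src C i1 = Src C f" "Tgt C i0 = Src C s" "Tgt C i1 = Src C s"
    "Src C h = Src C s" "i0 \<cdot> s = Idn C (Src C f)" "i1 \<cdot> s = Idn C (Src C f)" "i0 \<cdot> h = f" "i1 \<cdot> h = g"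
    using cylinder[OF fg] by blast
  have X: "Src C f \<in> Ob C" using cong_mor[OF fg] by simp
  have "actF i P = actB s P" if i: "i \<in> Mor C" "Src C i = Src C f" "Tgt C i = Src C s" "i \<cdot> s = Idn C (Src C f)" for i
  proof -
    have "actF i P \<in> fractions_to (Src C s)" using actF_fractions[of P i] i P by simp
    moreover have "actF s (actF i P) = P"
      using actF_comp[of P i s] i P c(3) actF_id[OF P X] by simp
    ultimately show ?thesis using actB_actF[of "actF i P" s] c(3) by simp
  qed
  from this[of i0] this[of i1] have "actF h (actF i0 P) = actF h (actF i1 P)" using c by simp
  then show ?thesis using actF_comp[of P i0 h] actF_comp[of P i1 h] c P by simp
qed

lemma actB_cong:
  assumes "(d, e) \<in> r" and d: "d \<in> Den" and e: "e \<in> Den" and P: "P \<in> fractions_to (Tgt C d)"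
  shows "actB d P = actB e P"
proof -
  have p: "Src C d = Src C e" "Tgt C d = Tgt C e" using cong_parallel[OF assms(1)] by simp_all
  have dP: "actB d P \<in> fractions_to (Src C d)" using actB_fractions P d by blast
  have "actF e (actB d P) = P" using actF_cong[OF assms(1) dP] actF_actB[OF P d] by simp
  with actB_actF[of "actB d P" e] dP e p show ?thesis by simp
qed

text \<open>Letters are classes in the quotient category, so a representative must be chosen. For a
  formal inverse it is chosen inside \<open>Den\<close>, where \<open>actB\<close> is known to be
  well defined.\<close>

primrec lact where
  "lact (Fwd F) = actF (SOME f. f \<in> Mor C \<and> F = r `` {f})"
| "lact (Bwd F) = actB (SOME d. d \<in> Den \<and> F = r `` {d})"

lemma lact_Fwd:
  assumes "f \<in> Mor C" "P \<in> fractions_to (Src C f)" shows "lact (Fwd (r `` {f})) P = actF f P"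
proof -
  define g where "g = (SOME g. g \<in> Mor C \<and> r `` {f} = r `` {g})"
  have "g \<in> Mor C \<and> r `` {f} = r `` {g}" unfolding g_def by (rule someI[of _ f]) (use assms in simp)
  then have "(f, g) \<in> r" using class_eq assms by blast
  then show ?thesis using actF_cong assms by (simp add: g_def)
qed

lemma lact_Bwd:
  assumes "d \<in> Den" "P \<in> fractions_to (Tgt C d)" shows "lact (Bwd (r `` {d})) P = actB d P"
proof -
  define e where "e = (SOME e. e \<in> Den \<and> r `` {d} = r `` {e})"
  have e: "e \<in> Den \<and> r `` {d} = r `` {e}" unfolding e_def by (rule someI[of _ d]) (use assms in simp)
  then have "(d, e) \<in> r" using class_eq[of d e] assms(1) by simp
  from actB_cong[OF this assms(1) _ assms(2)] e show ?thesis unfolding lact.simps e_def[symmetric] by simp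
qed

definition zact where "zact w P = foldl (\<lambda>P l. lact l P) P w"

lemma zact_simps [simp]: "zact [] P = P" "zact (l # w) P = zact w (lact l P)" "zact (u @ v) P = zact v (zact u P)"
  by (simp_all add: zact_def)

lemma zact_fractions: "zigzag Q W X w Y \<Longrightarrow> P \<in> fractions_to X \<Longrightarrow> zact w P \<in> fractions_to Y"
proof (induction w arbitrary: X P)
  case (Cons l w)
  show ?case
  proof (cases l)
    case (Fwd F)
    with Cons.prems(1) obtain g where g: "g \<in> Mor C" "F = r `` {g}"
      by (auto simp: zigzag.simps(2) elim: quotient_morE)
    then show ?thesis using Cons Fwd actF_fractions by (auto simp: lact_Fwd simp del: lact.simps)
  next
    case (Bwd F)
    with Cons.prems(1) obtain d where d: "d \<in> Den" "F = r `` {d}" by (auto simp: zigzag.simps(2))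
    then show ?thesis using Cons Bwd actB_fractions by (auto simp: lact_Bwd simp del: lact.simps)
  qed
qed simp

text \<open>The four rules mirror, in this order, \<open>actF_id\<close>, \<open>actF_comp\<close>,
  \<open>actB_actF\<close> and \<open>actF_actB\<close>.\<close>

lemma zact_rule:
  assumes "zigzag_rule Q W l m" "zigzag Q W X l Y" "P \<in> fractions_to X"
  shows "zact l P = zact m P"
  using assms(1)
proof cases
  case (1 X')
  then show ?thesis using assms(2,3) by (auto simp: class_id lact_Fwd actF_id simp del: lact.simps)
next
  case (2 F G)
  then obtain f g where f: "f \<in> Mor C" "F = r `` {f}" and g: "g \<in> Mor C" "G = r `` {g}"
    by (metis quotient_morE)
  then have fg: "Tgt C f = Src C g" "Src C f = X" using 2 assms(2) by auto
  have "actF f P \<in> fractions_to (Src C g)" using actF_fractions[of P f] assms(3) f fg by simp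
  then show ?thesis
    using 2 f g fg assms(3) by (simp add: class_comp lact_Fwd actF_comp del: lact.simps)
next
  case (3 D)
  then obtain d where d: "d \<in> Den" "D = r `` {d}" by blast
  then have X: "X = Src C d" using 3 assms(2) by auto
  have "actF d P \<in> fractions_to (Tgt C d)" using actF_fractions[of P d] assms(3) d X by simp
  then show ?thesis using 3 d X assms(3) by (simp add: lact_Fwd lact_Bwd actB_actF del: lact.simps)
next
  case (4 D)
  then obtain d where d: "d \<in> Den" "D = r `` {d}" by blast
  then have X: "X = Tgt C d" using 4 assms(2) by auto
  have "actB d P \<in> fractions_to (Src C d)" using actB_fractions[of P d] assms(3) d X by simp
  then show ?thesis using 4 d X assms(3) by (simp add: lact_Fwd lact_Bwd actF_actB del: lact.simps)
qed

lemma zact_step: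
  assumes "zigzag_step Q W s t" "P \<in> fractions_to (fst s)"
  shows "zact (fst (snd s)) P = zact (fst (snd t)) P"
  using assms(1)
proof cases
  case (1 l m X u v Y)
  then obtain Z Z' where "zigzag Q W X u Z" "zigzag Q W Z l Z'" by (auto simp: zigzag_append)
  then have "zact l (zact u P) = zact m (zact u P)"
    using zact_rule[OF 1(3)] zact_fractions[of X u Z P] assms(2) 1 by simp
  then show ?thesis using 1 by simp
qed

lemma zact_zclass:
  assumes "zigzag Q W X w Y" "zigzag Q W X' w' Y'" "zclass X w Y = zclass X' w' Y'" "P \<in> fractions_to X"
  shows "X = X'" "zact w P = zact w' P"
proof -
  have "equivclp (zigzag_step Q W) (X, w, Y) (X', w', Y')" using assms by (simp add: zclass_eq)
  then have "fst (X, w, Y) = fst (X', w', Y') \<and> zact (fst (snd (X, w, Y))) P = zact (fst (snd (X', w', Y'))) P"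
  proof (induction rule: equivclp_induct)
    case (step y z)
    have "fst y = fst z" using step(2) zigzag_step_parallel[of y z] zigzag_step_parallel[of z y] by auto
    moreover have "zact (fst (snd y)) P = zact (fst (snd z)) P"
      using step(2)
    proof
      assume s: "zigzag_step Q W y z"
      show ?thesis by (rule zact_step[OF s]) (use step(3) assms(4) in simp)
    next
      assume s: "zigzag_step Q W z y"
      show ?thesis by (rule zact_step[OF s, symmetric]) (use step(3) assms(4) \<open>fst y = fst z\<close> in simp)
    qed
    ultimately show ?case using step(3) by simp
  qed simp
  then show "X = X'" "zact w P = zact w' P" by simp_all
qed

text \<open>Only the middle letter needs work. The first inverse turns \<open>(1, 1, 1)\<close> into
  \<open>(1, 1, b)\<close>, and the action of \<open>f\<close> must then give
  \<open>(b, f, 1)\<close>, that is, it transfers the denominator from the right slot to the left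
  one.\<close>

lemma zact_fraction:
  assumes "(b, f, a) \<in> arrows" "X = Tgt C b"
  shows "zact [Bwd (r `` {b}), Fwd (r `` {f}), Bwd (r `` {a})] (fcl (Idn C X, Idn C X, Idn C X)) = fcl (b, f, a)"
proof -
  have d: "b \<in> Den" "f \<in> Mor C" "a \<in> Den" "Src C b = Src C f" "Tgt C a = Tgt C f"
    using assms by (auto simp: arrows_iff)
  have X: "X \<in> Ob C" using assms d by simp
  have 1: "(Idn C X, Idn C X, Idn C X) \<in> arrows" using X by (simp add: arrows_iff)
  then have P: "fcl (Idn C X, Idn C X, Idn C X) \<in> fractions_to X" using X unfolding fractions_to_def by fastforce
  have 2: "(Idn C X, Idn C X, b) \<in> arrows" using X d assms by (simp add: arrows_iff)
  have P2: "fcl (Idn C X, Idn C X, b) \<in> fractions_to (Src C f)" using 2 d unfolding fractions_to_def by fastforce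
  have e1: "actB b (fcl (Idn C X, Idn C X, Idn C X)) = fcl (Idn C X, Idn C X, b)"
    using actB_fcl[OF 1 d(1)] d assms X by simp
  have bf1: "(b, f, Idn C (Tgt C f)) \<in> arrows" using d by (simp add: arrows_iff)
  have e2: "actF f (fcl (Idn C X, Idn C X, b)) = fcl (b, f, Idn C (Tgt C f))"
  proof -
    obtain i p where i: "i \<in> SDen" "p \<in> TDen" "Tgt C i = Src C p" "b = i \<cdot> p"
      using factorisation d(1) by blast
    have ip: "Src C i = Src C f" "Tgt C p = X" using i d assms by auto
    obtain f' i' where S: "S_square i f f' i'" using S_square_ex[OF i(1) d(2)] ip by metis
    \<comment> \<open>With \<open>b = i \<cdot> p\<close> the action gives
      \<open>(p, f', i')\<close>. A left step along \<open>i\<close>, together with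
      \<open>i \<cdot> f' = f \<cdot> i'\<close>, leads to \<open>(b, f \<cdot> i', i')\<close>,
      which is one right step away from \<open>(b, f, 1)\<close>.\<close>
    have "T_square (Idn C X) p (Idn C (Src C p)) p" using i ip X by (auto simp: T_square_def)
    then have "act f (Idn C X, Idn C X, b) (p \<cdot> Idn C X, Idn C (Src C p) \<cdot> f', i')"
      using i S unfolding act_def by blast
    then have "act f (Idn C X, Idn C X, b) (p, f', i')" using S i ip by (simp add: S_square_def)
    from actF_fcl[OF 2 d(2) d(4)[symmetric] this]
    have "actF f (fcl (Idn C X, Idn C X, b)) = fcl (p, f', i')" .
    also have "(p, f', i') \<approx> (b, f \<cdot> i', i')"
      by (rule feq_left[of _ _ _ i]) (use S i d in \<open>auto simp: arrows_iff S_square_def\<close>)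
    then have "fcl (p, f', i') = fcl (b, f \<cdot> i', i')" by (rule fcl_eqI)
    also have "(b, f, Idn C (Tgt C f)) \<approx> (b, f \<cdot> i', i')"
      by (rule feq_right[of _ _ _ i']) (use S i d bf1 in \<open>auto simp: S_square_def\<close>)
    then have "fcl (b, f \<cdot> i', i') = fcl (b, f, Idn C (Tgt C f))" using fcl_eqI by simp
    finally show ?thesis .
  qed
  have P3: "fcl (b, f, Idn C (Tgt C f)) \<in> fractions_to (Tgt C a)" using bf1 d unfolding fractions_to_def by fastforce
  have e3: "actB a (fcl (b, f, Idn C (Tgt C f))) = fcl (b, f, a)"
    using actB_fcl[OF bf1 d(3)] d by simp
  show ?thesis using P P2 P3 d assms by (simp add: lact_Fwd lact_Bwd e1[unfolded assms(2)] e2[unfolded assms(2)] e3 del: lact.simps)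
qed

sublocale frac_presentation C Den SDen TDen L fwd bwd
proof unfold_locales
  show "Ob L = Ob C" by simp
  show "\<exists>s \<in> arrows. fr s = x" if "x \<in> Mor L" for x
    using that by (rule localisation_morE) (use fr_surj_zigzag in blast)
  fix s t assume st: "s \<in> arrows" "t \<in> arrows" "fr s = fr t"
  obtain b f a b' f' a' where e: "s = (b, f, a)" "t = (b', f', a')" by (cases s; cases t) auto
  let ?w = "[Bwd (r `` {b}), Fwd (r `` {f}), Bwd (r `` {a})]" and ?w' = "[Bwd (r `` {b'}), Fwd (r `` {f'}), Bwd (r `` {a'})]"
  let ?X = "Tgt C b" and ?X' = "Tgt C b'"
  have z: "zigzag Q W ?X ?w (Src C a)" "zigzag Q W ?X' ?w' (Src C a')"
    using st e by (auto simp: arrows_iff)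
  have eq: "zclass ?X ?w (Src C a) = zclass ?X' ?w' (Src C a')"
    using st e fr_zclass by auto
  have X: "?X \<in> Ob C" using st e by (auto simp: arrows_iff)
  then have P: "fcl (Idn C ?X, Idn C ?X, Idn C ?X) \<in> fractions_to ?X"
    unfolding fractions_to_def by (fastforce simp: arrows_iff)
  have "?X = ?X'" "zact ?w (fcl (Idn C ?X, Idn C ?X, Idn C ?X)) = zact ?w' (fcl (Idn C ?X, Idn C ?X, Idn C ?X))"
    using zact_zclass[OF z eq P] by auto
  then have "fcl s = fcl t"
    using zact_fraction[of b f a ?X] zact_fraction[of b' f' a' ?X] st e by simp
  then show "s \<approx> t" using fcl_eq st by blast
qed

end

section \<open>Computing with morphisms of an additive category in a ring\<close>

text \<open>\<open>direct_sum\<close> is stated with products in groups of morphisms. They become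
  ordinary sums along any additive map \<open>\<Phi>\<close>; it will be the ring embedding, a
  component of a complex morphism, or cohomology in one degree.\<close>

lemma finprod_hom_group:
  fixes n :: nat and \<Phi> :: "'m \<Rightarrow> 'r :: comm_monoid_add"
  assumes G: "comm_group (hom_group C X Y)" and f: "\<And>k. k < n \<Longrightarrow> f k \<in> Hom C X Y"
    and add: "\<And>f g. \<lbrakk>f \<in> Hom C X Y; g \<in> Hom C X Y\<rbrakk> \<Longrightarrow> \<Phi> (Add C f g) = \<Phi> f + \<Phi> g"
    and zero: "\<Phi> (Zer C X Y) = 0"
  shows "finprod (hom_group C X Y) f {..<n} \<in> Hom C X Y" "\<Phi> (finprod (hom_group C X Y) f {..<n}) = (\<Sum>k<n. \<Phi> (f k))"
proof -
  interpret G: comm_group "hom_group C X Y" by (rule G)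
  have [simp]: "carrier (hom_group C X Y) = Hom C X Y" "monoid.mult (hom_group C X Y) = Add C" "one (hom_group C X Y) = Zer C X Y"
    by (simp_all add: hom_group_def)
  have "finprod (hom_group C X Y) f {..<n} \<in> Hom C X Y \<and>
    \<Phi> (finprod (hom_group C X Y) f {..<n}) = (\<Sum>k<n. \<Phi> (f k))"
    using f
  proof (induction n)
    case 0
    then show ?case using zero G.one_closed by simp
  next
    case (Suc n)
    then have IH: "finprod (hom_group C X Y) f {..<n} \<in> Hom C X Y"
      "\<Phi> (finprod (hom_group C X Y) f {..<n}) = (\<Sum>k<n. \<Phi> (f k))" "f n \<in> Hom C X Y" by auto
    have "finprod (hom_group C X Y) f (insert n {..<n}) = Add C (f n) (finprod (hom_group C X Y) f {..<n})"
      using G.finprod_insert[of "{..<n}" n f] Suc.prems by auto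
    then show ?case using IH add[of "f n"] G.m_closed[of "f n"]
      by (simp add: lessThan_Suc add.commute)
  qed
  then show "finprod (hom_group C X Y) f {..<n} \<in> Hom C X Y"
    "\<Phi> (finprod (hom_group C X Y) f {..<n}) = (\<Sum>k<n. \<Phi> (f k))" by simp_all
qed

context additive_category
begin

lemma hom_group_simps [simp]:
  "carrier (hom_group C X Y) = Hom C X Y" "monoid.mult (hom_group C X Y) = Add C" "one (hom_group C X Y) = Zer C X Y"
  by (simp_all add: hom_group_def)

definition Neg where "Neg X Y f = inv\<^bsub>hom_group C X Y\<^esub> f"

lemma
  assumes "X \<in> Ob C" "Y \<in> Ob C"
  shows zer_hom: "Zer C X Y \<in> Hom C X Y"
    and add_hom: "\<And>f g. \<lbrakk>f \<in> Hom C X Y; g \<in> Hom C X Y\<rbrakk> \<Longrightarrow> Add C f g \<in> Hom C X Y"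
    and neg_hom: "\<And>f. f \<in> Hom C X Y \<Longrightarrow> Neg X Y f \<in> Hom C X Y"
    and add_assoc: "\<And>f g h. \<lbrakk>f \<in> Hom C X Y; g \<in> Hom C X Y; h \<in> Hom C X Y\<rbrakk> \<Longrightarrow> Add C (Add C f g) h = Add C f (Add C g h)"
    and add_comm: "\<And>f g. \<lbrakk>f \<in> Hom C X Y; g \<in> Hom C X Y\<rbrakk> \<Longrightarrow> Add C f g = Add C g f"
    and add_zer: "\<And>f. f \<in> Hom C X Y \<Longrightarrow> Add C (Zer C X Y) f = f"
    and add_neg: "\<And>f. f \<in> Hom C X Y \<Longrightarrow> Add C (Neg X Y f) f = Zer C X Y"
    and add_idem: "\<And>f. \<lbrakk>f \<in> Hom C X Y; Add C f f = f\<rbrakk> \<Longrightarrow> f = Zer C X Y"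
proof -
  interpret G: comm_group "hom_group C X Y" by (rule hom_comm_group[OF assms])
  show "Zer C X Y \<in> Hom C X Y" using G.one_closed by simp
  show "\<And>f g. \<lbrakk>f \<in> Hom C X Y; g \<in> Hom C X Y\<rbrakk> \<Longrightarrow> Add C f g \<in> Hom C X Y" using G.m_closed by simp
  show "\<And>f. f \<in> Hom C X Y \<Longrightarrow> Neg X Y f \<in> Hom C X Y" using G.inv_closed by (simp add: Neg_def)
  show "\<And>f g h. \<lbrakk>f \<in> Hom C X Y; g \<in> Hom C X Y; h \<in> Hom C X Y\<rbrakk> \<Longrightarrow> Add C (Add C f g) h = Add C f (Add C g h)"
    using G.m_assoc by simp
  show "\<And>f g. \<lbrakk>f \<in> Hom C X Y; g \<in> Hom C X Y\<rbrakk> \<Longrightarrow> Add C f g = Add C g f" using G.m_comm by simp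
  show "\<And>f. f \<in> Hom C X Y \<Longrightarrow> Add C (Zer C X Y) f = f" using G.l_one by simp
  show "\<And>f. f \<in> Hom C X Y \<Longrightarrow> Add C (Neg X Y f) f = Zer C X Y" using G.l_inv by (simp add: Neg_def)
  show "\<And>f. \<lbrakk>f \<in> Hom C X Y; Add C f f = f\<rbrakk> \<Longrightarrow> f = Zer C X Y" using G.l_cancel_one by simp
qed

text \<open>By distributivity \<open>f \<cdot> 0\<close> is idempotent for addition, and zero is the
  only such element of a group.\<close>

lemma comp_zer: 
  assumes "f \<in> Hom C X Y" "Z \<in> Ob C" shows "f \<cdot> Zer C Y Z = Zer C X Z"
proof -
  have Y: "X \<in> Ob C" "Y \<in> Ob C" using assms HomD by blast+
  have z: "Zer C Y Z \<in> Hom C Y Z" using zer_hom Y assms by blast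
  have "f \<cdot> Zer C Y Z = f \<cdot> Add C (Zer C Y Z) (Zer C Y Z)" using add_zer[OF Y(2) assms(2) z] by simp
  also have "\<dots> = Add C (f \<cdot> Zer C Y Z) (f \<cdot> Zer C Y Z)" using comp_add_right assms z by blast
  finally show ?thesis using add_idem[OF Y(1) assms(2)] comp_closed[OF assms(1) z] by simp
qed

lemma zer_comp:
  assumes "f \<in> Hom C Y Z" "X \<in> Ob C" shows "Zer C X Y \<cdot> f = Zer C X Z"
proof -
  have Y: "Y \<in> Ob C" "Z \<in> Ob C" using assms HomD by blast+
  have z: "Zer C X Y \<in> Hom C X Y" using zer_hom Y assms by blast
  have "Zer C X Y \<cdot> f = Add C (Zer C X Y) (Zer C X Y) \<cdot> f" using add_zer[OF assms(2) Y(1) z] by simp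
  also have "\<dots> = Add C (Zer C X Y \<cdot> f) (Zer C X Y \<cdot> f)" using comp_add_left assms z by blast
  finally show ?thesis using add_idem[OF assms(2) Y(2)] comp_closed[OF z assms(1)] by simp
qed

end

text \<open>A type cannot depend on a category, so the following abelian group is the product of all
  morphism groups of all additive categories on the given types.  Composition with a fixed morphism
  is an additive endomorphism of it; this represents morphisms faithfully in the ring of additive
  endomorphisms, where the ring laws hold without side conditions on sources and targets.\<close>

typedef ('o, 'm) hom_family = "{m :: ('o, 'm) add_cat \<Rightarrow> 'o \<Rightarrow> 'o \<Rightarrow> 'm.
    \<forall>A T X. if additive_category A \<and> T \<in> Ob A \<and> X \<in> Ob A then m A T X \<in> Hom A T X else m A T X = undefined}"
  by (rule exI[of _ "\<lambda>A T X. if additive_category A \<and> T \<in> Ob A \<and> X \<in> Ob A then Zer A T X else undefined"])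
    (auto intro: additive_category.zer_hom)

setup_lifting type_definition_hom_family

instantiation hom_family :: (type, type) ab_group_add
begin

lift_definition zero_hom_family :: "('a, 'b) hom_family" is
  "\<lambda>A T X. if additive_category A \<and> T \<in> Ob A \<and> X \<in> Ob A then Zer A T X else undefined"
  by (auto intro: additive_category.zer_hom)

lift_definition plus_hom_family :: "('a, 'b) hom_family \<Rightarrow> ('a, 'b) hom_family \<Rightarrow> ('a, 'b) hom_family" is
  "\<lambda>m n A T X. if additive_category A \<and> T \<in> Ob A \<and> X \<in> Ob A then Add A (m A T X) (n A T X) else undefined"
  by (auto intro: additive_category.add_hom)

lift_definition uminus_hom_family :: "('a, 'b) hom_family \<Rightarrow> ('a, 'b) hom_family" is
  "\<lambda>m A T X. if additive_category A \<and> T \<in> Ob A \<and> X \<in> Ob A then additive_category.Neg A T X (m A T X) else undefined"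
  by (auto intro: additive_category.neg_hom)

definition minus_hom_family :: "('a, 'b) hom_family \<Rightarrow> ('a, 'b) hom_family \<Rightarrow> ('a, 'b) hom_family" where
  "minus_hom_family m n = m + - n"

instance
proof
  fix a b c :: "('a, 'b) hom_family"
  show "a + b + c = a + (b + c)"
    by transfer (auto simp: fun_eq_iff additive_category.add_assoc)
  show "a + b = b + a"
    by transfer (auto simp: fun_eq_iff intro: additive_category.add_comm)
  show "0 + a = a"
    by transfer (auto simp: fun_eq_iff additive_category.add_zer)
  show "- a + a = 0"
    by transfer (auto simp: fun_eq_iff additive_category.add_neg)
qed (simp add: minus_hom_family_def)

end

typedef ('o, 'm) hom_ring = "{\<phi> :: ('o, 'm) hom_family \<Rightarrow> ('o, 'm) hom_family. \<forall>x y. \<phi> (x + y) = \<phi> x + \<phi> y}"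
  by (rule exI[of _ "\<lambda>x. x"]) simp

setup_lifting type_definition_hom_ring

instantiation hom_ring :: (type, type) ring
begin

lift_definition zero_hom_ring :: "('a, 'b) hom_ring" is "\<lambda>x. 0" by simp
lift_definition plus_hom_ring :: "('a, 'b) hom_ring \<Rightarrow> ('a, 'b) hom_ring \<Rightarrow> ('a, 'b) hom_ring" is
  "\<lambda>\<phi> \<psi> x. \<phi> x + \<psi> x" by (simp add: algebra_simps)
lift_definition uminus_hom_ring :: "('a, 'b) hom_ring \<Rightarrow> ('a, 'b) hom_ring" is
  "\<lambda>\<phi> x. - \<phi> x" by simp
lift_definition minus_hom_ring :: "('a, 'b) hom_ring \<Rightarrow> ('a, 'b) hom_ring \<Rightarrow> ('a, 'b) hom_ring" is
  "\<lambda>\<phi> \<psi> x. \<phi> x - \<psi> x" by (simp add: algebra_simps)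
text \<open>Multiplication is in diagrammatic order, so that the embedding of morphisms preserves
  the order of composites.\<close>

lift_definition times_hom_ring :: "('a, 'b) hom_ring \<Rightarrow> ('a, 'b) hom_ring \<Rightarrow> ('a, 'b) hom_ring" is
  "\<lambda>\<phi> \<psi> x. \<psi> (\<phi> x)" by simp

instance
  by standard (transfer; simp add: fun_eq_iff algebra_simps)+

end

section \<open>Morphisms as additive endomorphisms of the group of families\<close>

lift_definition hom_eval :: "('o, 'm) hom_family \<Rightarrow> ('o, 'm) add_cat \<Rightarrow> 'o \<Rightarrow> 'o \<Rightarrow> 'm" is "\<lambda>m. m" .

text \<open>A test family: the identity at \<open>(A, X, X)\<close> and zero at all other valid
  indices. Postcomposing it with a morphism out of \<open>X\<close> reproduces this morphism as an
  entry.\<close>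

lift_definition hom_delta :: "('o, 'm) add_cat \<Rightarrow> 'o \<Rightarrow> ('o, 'm) hom_family" is
  "\<lambda>A X A' T Y. if additive_category A' \<and> T \<in> Ob A' \<and> Y \<in> Ob A' then if A' = A \<and> T = X \<and> Y = X then Idn A X else Zer A' T Y else undefined"
  by (auto intro: additive_category.zer_hom additive_category.axioms(1)[THEN category.id_closed])

lemma comp_family_hom:
  assumes m: "\<forall>A T X. if additive_category A \<and> T \<in> Ob A \<and> X \<in> Ob A then m A T X \<in> Hom A T X else m A T X = undefined"
    and "additive_category A" "T \<in> Ob A" "f \<in> Mor A"
  shows "m A T (Src A f) \<cdot>\<^bsub>A\<^esub> f \<in> Hom A T (Tgt A f)"
proof -
  interpret additive_category A by fact
  show ?thesis using m[rule_format, of A T "Src A f"] assms by (auto simp: Hom_def)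
qed

text \<open>A family is viewed as a row indexed by objects, and \<open>f\<close> as a matrix whose
  only entry sits between its source and its target. At the other valid indices the result is
  zero.\<close>

lift_definition post_compose :: "('o, 'm) add_cat \<Rightarrow> 'm \<Rightarrow> ('o, 'm) hom_family \<Rightarrow> ('o, 'm) hom_family" is
  "\<lambda>A f m A' T Y. if additive_category A' \<and> T \<in> Ob A' \<and> Y \<in> Ob A' then
      if A' = A \<and> f \<in> Mor A \<and> Y = Tgt A f then m A T (Src A f) \<cdot>\<^bsub>A\<^esub> f else Zer A' T Y else undefined"
  subgoal for A f m A' T Y
    using comp_family_hom[of m A T f] by (auto intro: additive_category.zer_hom)
  done

text \<open>At the entry belonging to \<open>f\<close> this is distributivity in \<open>A\<close>;
  at the other valid indices it is 0 + 0 = 0.\<close>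

lemma post_compose_add: "post_compose A f (m + n) = post_compose A f m + post_compose A f n"
proof (transfer, intro ext)
  fix A A' :: "('o, 'm) add_cat" and f T Y and m n :: "('o, 'm) add_cat \<Rightarrow> 'o \<Rightarrow> 'o \<Rightarrow> 'm"
  assume m: "\<forall>A T X. if additive_category A \<and> T \<in> Ob A \<and> X \<in> Ob A then m A T X \<in> Hom A T X else m A T X = undefined"
    and n: "\<forall>A T X. if additive_category A \<and> T \<in> Ob A \<and> X \<in> Ob A then n A T X \<in> Hom A T X else n A T X = undefined"
  have 1: "Add A (Zer A T Y) (Zer A T Y) = Zer A T Y" if "additive_category A" "T \<in> Ob A" "Y \<in> Ob A" for A :: "('o, 'm) add_cat"
    using that additive_category.add_zer additive_category.zer_hom by metis
  have 2: "Src A f \<in> Ob A" "Add A (m A T (Src A f)) (n A T (Src A f)) \<cdot>\<^bsub>A\<^esub> f = Add A (m A T (Src A f) \<cdot>\<^bsub>A\<^esub> f) (n A T (Src A f) \<cdot>\<^bsub>A\<^esub> f)"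
    if "additive_category A" "T \<in> Ob A" "f \<in> Mor A"
  proof -
    interpret additive_category A by fact
    show "Src A f \<in> Ob A" using that by simp
    then show "Add A (m A T (Src A f)) (n A T (Src A f)) \<cdot>\<^bsub>A\<^esub> f = Add A (m A T (Src A f) \<cdot>\<^bsub>A\<^esub> f) (n A T (Src A f) \<cdot>\<^bsub>A\<^esub> f)"
      using m[rule_format, of A T "Src A f"] n[rule_format, of A T "Src A f"] that comp_add_left[of _ T "Src A f" _ f "Tgt A f"] by (auto simp: Hom_def)
  qed
  show "(if additive_category A' \<and> T \<in> Ob A' \<and> Y \<in> Ob A' then
      if A' = A \<and> f \<in> Mor A \<and> Y = Tgt A f then
        (if additive_category A \<and> T \<in> Ob A \<and> Src A f \<in> Ob A then Add A (m A T (Src A f)) (n A T (Src A f)) else undefined) \<cdot>\<^bsub>A\<^esub> f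
      else Zer A' T Y else undefined) =
    (if additive_category A' \<and> T \<in> Ob A' \<and> Y \<in> Ob A' then
      Add A' (if additive_category A' \<and> T \<in> Ob A' \<and> Y \<in> Ob A' then if A' = A \<and> f \<in> Mor A \<and> Y = Tgt A f then m A T (Src A f) \<cdot>\<^bsub>A\<^esub> f else Zer A' T Y else undefined)
        (if additive_category A' \<and> T \<in> Ob A' \<and> Y \<in> Ob A' then if A' = A \<and> f \<in> Mor A \<and> Y = Tgt A f then n A T (Src A f) \<cdot>\<^bsub>A\<^esub> f else Zer A' T Y else undefined)
      else undefined)"
    using 1[of A'] 2 by auto
qed

lift_definition emb :: "('o, 'm) add_cat \<Rightarrow> 'm \<Rightarrow> ('o, 'm) hom_ring" is post_compose
  by (simp add: post_compose_add)

abbreviation ring_apply where "ring_apply \<equiv> Rep_hom_ring"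

lemmas ring_apply_simps = plus_hom_ring.rep_eq times_hom_ring.rep_eq zero_hom_ring.rep_eq

lemma hom_eval_simps:
  assumes "additive_category A" "T \<in> Ob A" "Y \<in> Ob A"
  shows "hom_eval m A T Y \<in> Hom A T Y"
    and "hom_eval (m + n) A T Y = Add A (hom_eval m A T Y) (hom_eval n A T Y)"
    and "hom_eval 0 A T Y = Zer A T Y"
    and "hom_eval (ring_apply (emb A f) m) A T Y =
      (if f \<in> Mor A \<and> Y = Tgt A f then hom_eval m A T (Src A f) \<cdot>\<^bsub>A\<^esub> f else Zer A T Y)"
    and "hom_eval (hom_delta A Y) A Y Y = Idn A Y"
proof -
  show "hom_eval m A T Y \<in> Hom A T Y" "hom_eval (m + n) A T Y = Add A (hom_eval m A T Y) (hom_eval n A T Y)"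
    "hom_eval 0 A T Y = Zer A T Y" "hom_eval (hom_delta A Y) A Y Y = Idn A Y"
    using assms by (transfer; simp; fail | transfer; auto; metis)+
  show "hom_eval (ring_apply (emb A f) m) A T Y =
      (if f \<in> Mor A \<and> Y = Tgt A f then hom_eval m A T (Src A f) \<cdot>\<^bsub>A\<^esub> f else Zer A T Y)"
    unfolding emb.rep_eq using assms by transfer simp
qed

lemma hom_eval_emb_other:
  "additive_category A' \<Longrightarrow> T \<in> Ob A' \<Longrightarrow> Y \<in> Ob A' \<Longrightarrow> A' \<noteq> A \<Longrightarrow> hom_eval (ring_apply (emb A f) m) A' T Y = Zer A' T Y"
  unfolding emb.rep_eq by transfer simp

text \<open>Families take the fixed value \<open>undefined\<close> at invalid indices, so their
  values at the valid ones determine them.\<close>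

lemma hom_ring_eqI:
  assumes "\<And>m A T Y. \<lbrakk>additive_category A; T \<in> Ob A; Y \<in> Ob A\<rbrakk> \<Longrightarrow> hom_eval (ring_apply x m) A T Y = hom_eval (ring_apply y m) A T Y"
  shows "x = y"
proof -
  have fam: "m = n" if "\<And>A T Y. \<lbrakk>additive_category A; T \<in> Ob A; Y \<in> Ob A\<rbrakk> \<Longrightarrow> hom_eval m A T Y = hom_eval n A T Y"
    for m n :: "('a, 'b) hom_family"
    using that by (transfer; simp add: fun_eq_iff; metis)
  have "ring_apply x m = ring_apply y m" for m
    by (rule fam) (rule assms)
  then show ?thesis by (simp add: Rep_hom_ring_inject[symmetric] fun_eq_iff)
qed

locale additive_in_ring = additive_category A for A :: "('o, 'm) add_cat" (structure)
begin

abbreviation E where "E \<equiv> emb A"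

lemma E_add:
  assumes "f \<in> Hom A X Y" "g \<in> Hom A X Y" shows "E (Add A f g) = E f + E g"
proof (rule hom_ring_eqI)
  fix m and A' :: "('o, 'm) add_cat" and T Z
  assume A': "additive_category A'" "T \<in> Ob A'" "Z \<in> Ob A'"
  have XY: "X \<in> Ob A" "Y \<in> Ob A" using assms HomD by blast+
  have fg: "Add A f g \<in> Hom A X Y" using add_hom XY assms by blast
  show "hom_eval (ring_apply (E (Add A f g)) m) A' T Z = hom_eval (ring_apply (E f + E g) m) A' T Z"
  proof (cases "A' = A")
    case True
    have TZ: "additive_category A" "T \<in> Ob A" "Z \<in> Ob A" using A' True by simp_all
    have z: "Add A (Zer A T Z) (Zer A T Z) = Zer A T Z" using add_zer[OF TZ(2,3) zer_hom[OF TZ(2,3)]] .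
    have "hom_eval m A T X \<in> Hom A T X" by (rule hom_eval_simps(1)[OF TZ(1,2) XY(1)])
    then show ?thesis
      unfolding True
      using TZ HomD(1-3)[OF assms(1)] HomD(1-3)[OF assms(2)] HomD(1-3)[OF fg] z comp_add_right[OF _ assms, of "hom_eval m A T X" T]
      by (simp add: hom_eval_simps ring_apply_simps)
  next
    case False
    have z: "Add A' (Zer A' T Z) (Zer A' T Z) = Zer A' T Z"
      using additive_category.add_zer[OF A' additive_category.zer_hom[OF A']] .
    then show ?thesis using A' False by (simp add: hom_eval_emb_other hom_eval_simps ring_apply_simps)
  qed
qed

lemma E_comp:
  assumes "f \<in> Hom A X Y" "g \<in> Hom A Y Z" shows "E (f \<cdot> g) = E f * E g"
proof (rule hom_ring_eqI)
  fix m and A' :: "('o, 'm) add_cat" and T V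
  assume A': "additive_category A'" "T \<in> Ob A'" "V \<in> Ob A'"
  have XY: "X \<in> Ob A" "Y \<in> Ob A" using assms HomD by blast+
  have fg: "f \<cdot> g \<in> Hom A X Z" using comp_closed assms by blast
  show "hom_eval (ring_apply (E (f \<cdot> g)) m) A' T V = hom_eval (ring_apply (E f * E g) m) A' T V"
  proof (cases "A' = A")
    case True
    have TV: "additive_category A" "T \<in> Ob A" "V \<in> Ob A" using A' True by simp_all
    have m: "hom_eval m A T X \<in> Hom A T X" by (rule hom_eval_simps(1)[OF TV(1,2) XY(1)])
    show ?thesis
      unfolding True
      using TV XY HomD(1-3)[OF assms(1)] HomD(1-3)[OF assms(2)] HomD(1-3)[OF fg] comp_assoc[OF m assms]
      by (simp add: hom_eval_simps ring_apply_simps)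
  next
    case False
    then show ?thesis using A' by (simp add: hom_eval_emb_other hom_eval_simps ring_apply_simps)
  qed
qed

lemma E_zer:
  assumes "X \<in> Ob A" "Y \<in> Ob A" shows "E (Zer A X Y) = 0"
proof -
  have "E (Zer A X Y) + E (Zer A X Y) = E (Zer A X Y)"
    using E_add[OF zer_hom zer_hom, OF assms assms] add_zer[OF assms zer_hom[OF assms]] by simp
  then show ?thesis by simp
qed

text \<open>\<open>f\<close> is read off from the effect of \<open>E f\<close> on
  \<open>hom_delta A X\<close>. Source and target are fixed here, because all zero morphisms have
  the same image 0.\<close>

lemma E_inj:
  assumes "f \<in> Hom A X Y" "g \<in> Hom A X Y" "E f = E g" shows "f = g"
proof -
  have XY: "X \<in> Ob A" "Y \<in> Ob A" using assms HomD by blast+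
  have A: "additive_category A" by unfold_locales
  have "hom_eval (ring_apply (E h) (hom_delta A X)) A X Y = h" if "h \<in> Hom A X Y" for h
    using hom_eval_simps(4)[OF A XY, of h "hom_delta A X"] hom_eval_simps(5)[OF A XY(1) XY(1)] that HomD(1-3)[OF that] by simp
  from this[OF assms(1)] this[OF assms(2)] assms(3) show ?thesis by metis
qed

text \<open>Membership in \<open>H X Y\<close> records source and target of a ring element. They are
  not functions of the element, since 0 lies in all these sets, and so \<open>X\<close> and
  \<open>Y\<close> are also arguments of \<open>R\<close>, which leads back to morphisms.\<close>

definition H where "H X Y = E ` Hom A X Y"
definition un where "un X = E (Idn A X)"
definition R where "R X Y x = (THE f. f \<in> Hom A X Y \<and> E f = x)"

lemma E_H [intro, simp]: "f \<in> Hom A X Y \<Longrightarrow> E f \<in> H X Y"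
  by (simp add: H_def)

lemma R_hom: assumes "x \<in> H X Y" shows "R X Y x \<in> Hom A X Y" "E (R X Y x) = x"
proof -
  obtain f where f: "f \<in> Hom A X Y" "x = E f" using assms by (auto simp: H_def)
  have "R X Y x \<in> Hom A X Y \<and> E (R X Y x) = x"
    unfolding R_def by (rule theI[of _ f]) (use f E_inj in auto)
  then show "R X Y x \<in> Hom A X Y" "E (R X Y x) = x" by simp_all
qed

lemma H_ob: "x \<in> H X Y \<Longrightarrow> X \<in> Ob A" "x \<in> H X Y \<Longrightarrow> Y \<in> Ob A"
  unfolding H_def by (blast dest: HomD)+

lemma un_H [intro, simp]: "X \<in> Ob A \<Longrightarrow> un X \<in> H X X"
  by (simp add: un_def H_def id_closed)

lemma zero_H [intro, simp]: "X \<in> Ob A \<Longrightarrow> Y \<in> Ob A \<Longrightarrow> 0 \<in> H X Y"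
  using E_zer zer_hom unfolding H_def by (metis image_eqI)

lemma add_H [intro]: "x \<in> H X Y \<Longrightarrow> y \<in> H X Y \<Longrightarrow> x + y \<in> H X Y"
  using E_add add_hom HomD(4,5) unfolding H_def by (smt (verit) image_iff)

lemma uminus_H [intro]: assumes "x \<in> H X Y" shows "- x \<in> H X Y"
proof -
  obtain f where f: "f \<in> Hom A X Y" "x = E f" using assms by (auto simp: H_def)
  then have XY: "X \<in> Ob A" "Y \<in> Ob A" by (blast dest: HomD)+
  have n: "Neg X Y f \<in> Hom A X Y" using neg_hom XY f by blast
  have "E (Neg X Y f) + x = 0" using E_add[OF n f(1)] add_neg[OF XY f(1)] E_zer[OF XY] f by simp
  then have "- x = E (Neg X Y f)" by (metis add_eq_0_iff2)
  then show ?thesis using n by simp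
qed

lemma diff_H [intro]: "x \<in> H X Y \<Longrightarrow> y \<in> H X Y \<Longrightarrow> x - y \<in> H X Y"
  using add_H[of x X Y "- y"] uminus_H by simp

lemma mult_H [intro]: "x \<in> H X Y \<Longrightarrow> y \<in> H Y Z \<Longrightarrow> x * y \<in> H X Z"
  using E_comp comp_closed unfolding H_def by (smt (verit) image_iff)

lemma un_left: assumes "x \<in> H X Y" shows "un X * x = x"
proof -
  obtain f where f: "f \<in> Hom A X Y" "x = E f" using assms by (auto simp: H_def)
  have "E (Idn A X) * E f = E (Idn A X \<cdot> f)" using E_comp id_closed f HomD(4,5)[OF f(1)] by metis
  then show ?thesis using f HomD(1-3)[OF f(1)] by (simp add: un_def)
qed

lemma un_right: assumes "x \<in> H X Y" shows "x * un Y = x"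
proof -
  obtain f where f: "f \<in> Hom A X Y" "x = E f" using assms by (auto simp: H_def)
  have "E f * E (Idn A Y) = E (f \<cdot> Idn A Y)" using E_comp id_closed f HomD(4,5)[OF f(1)] by metis
  then show ?thesis using f HomD(1-3)[OF f(1)] by (simp add: un_def)
qed

lemma sum_H [intro]: "X \<in> Ob A \<Longrightarrow> Y \<in> Ob A \<Longrightarrow> (\<And>k. k \<in> K \<Longrightarrow> f k \<in> H X Y) \<Longrightarrow> sum f K \<in> H X Y"
proof (induction K rule: infinite_finite_induct)
  case (insert k K)
  then show ?case by (simp add: add_H)
qed simp_all

lemma direct_sum_in_ring:
  assumes ds: "direct_sum A n X S ins prj"
  shows "S \<in> Ob A" and "\<And>k. k < n \<Longrightarrow> E (ins k) \<in> H (X k) S" and "\<And>k. k < n \<Longrightarrow> E (prj k) \<in> H S (X k)"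
    and "\<And>k l. \<lbrakk>k < n; l < n\<rbrakk> \<Longrightarrow> E (ins k) * E (prj l) = (if k = l then un (X k) else 0)"
    and "(\<Sum>k<n. E (prj k) * E (ins k)) = un S"
proof -
  have i: "\<And>k. k < n \<Longrightarrow> ins k \<in> Hom A (X k) S" and p: "\<And>k. k < n \<Longrightarrow> prj k \<in> Hom A S (X k)"
    using ds unfolding direct_sum_def by auto
  show S: "S \<in> Ob A" using ds unfolding direct_sum_def by auto
  show "E (ins k) \<in> H (X k) S" "E (prj k) \<in> H S (X k)" if "k < n" for k
    using i[OF that] p[OF that] by auto
  show "E (ins k) * E (prj l) = (if k = l then un (X k) else 0)" if "k < n" "l < n" for k l
    using E_comp[OF i[OF that(1)] p[OF that(2)]] ds that E_zer[OF HomD(4)[OF i] HomD(5)[OF p], OF that]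
    unfolding direct_sum_def by (auto simp: un_def)
  have "un S = E (finprod (hom_group A S S) (\<lambda>k. prj k \<cdot> ins k) {..<n})"
    using ds by (simp add: direct_sum_def un_def)
  also have "\<dots> = (\<Sum>k<n. E (prj k \<cdot> ins k))"
    by (rule finprod_hom_group(2)[OF hom_comm_group[OF S S]]) (use comp_closed[OF p i] E_add E_zer S in auto)
  also have "\<dots> = (\<Sum>k<n. E (prj k) * E (ins k))"
    by (rule sum.cong) (use E_comp[OF p i] in auto)
  finally show "(\<Sum>k<n. E (prj k) * E (ins k)) = un S" by simp
qed

end

section \<open>Diagram chasing in abelian categories\<close>

locale abelian_in_ring = abelian_category A + additive_in_ring A for A :: "('o, 'm) add_cat" (structure)
begin

text \<open>In an additive setting cancellation may be tested on zero alone.\<close>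

definition monic where "monic X Y x \<longleftrightarrow> x \<in> H X Y \<and> (\<forall>T. \<forall>t \<in> H T X. t * x = 0 \<longrightarrow> t = 0)"
definition epic where "epic X Y x \<longleftrightarrow> x \<in> H X Y \<and> (\<forall>T. \<forall>t \<in> H Y T. x * t = 0 \<longrightarrow> t = 0)"

definition ker where
  "ker X Y f K k \<longleftrightarrow> f \<in> H X Y \<and> monic K X k \<and> k * f = 0 \<and> (\<forall>T. \<forall>g \<in> H T X. g * f = 0 \<longrightarrow> (\<exists>u \<in> H T K. u * k = g))"
definition coker where
  "coker X Y f Q c \<longleftrightarrow> f \<in> H X Y \<and> epic Y Q c \<and> f * c = 0 \<and> (\<forall>T. \<forall>g \<in> H Y T. f * g = 0 \<longrightarrow> (\<exists>u \<in> H Q T. c * u = g))"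

lemma monicD: "monic X Y x \<Longrightarrow> x \<in> H X Y" "monic X Y x \<Longrightarrow> t \<in> H T X \<Longrightarrow> t * x = 0 \<Longrightarrow> t = 0"
  by (auto simp: monic_def)

lemma epicD: "epic X Y x \<Longrightarrow> x \<in> H X Y" "epic X Y x \<Longrightarrow> t \<in> H Y T \<Longrightarrow> x * t = 0 \<Longrightarrow> t = 0"
  by (auto simp: epic_def)

lemma epic_cancel:
  assumes "epic X Y x" "s \<in> H Y T" "t \<in> H Y T" "x * s = x * t" shows "s = t"
  using epicD(2)[OF assms(1), of "s - t" T] assms by (auto simp: algebra_simps)

lemma monic_cancel:
  assumes "monic X Y x" "s \<in> H T X" "t \<in> H T X" "s * x = t * x" shows "s = t"
  using monicD(2)[OF assms(1), of "s - t" T] assms by (auto simp: algebra_simps)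

lemma kerD:
  assumes "ker X Y f K k"
  shows "f \<in> H X Y" "k \<in> H K X" "monic K X k" "k * f = 0"
  using assms by (auto simp: ker_def monic_def)

lemma kerE:
  assumes "ker X Y f K k" "g \<in> H T X" "g * f = 0" obtains u where "u \<in> H T K" "u * k = g"
  using assms by (auto simp: ker_def)

lemma cokerD:
  assumes "coker X Y f Q c"
  shows "f \<in> H X Y" "c \<in> H Y Q" "epic Y Q c" "f * c = 0"
  using assms by (auto simp: coker_def epic_def)

lemma cokerE:
  assumes "coker X Y f Q c" "g \<in> H Y T" "f * g = 0" obtains u where "u \<in> H Q T" "c * u = g"
  using assms by (auto simp: coker_def)

lemma H_E:
  assumes "x \<in> H X Y" obtains f where "f \<in> Hom A X Y" "x = E f"
  using assms by (auto simp: H_def)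

lemma E_eq_0: "f \<in> Hom A X Y \<Longrightarrow> E f = 0 \<longleftrightarrow> f = Zer A X Y"
  using E_inj[of f X Y "Zer A X Y"] zer_hom[of X Y] E_zer[of X Y] HomD(4,5)[of f X Y] by auto

lemma ker_of_is_kernel:
  assumes k: "is_kernel A f k" shows "ker (Src A f) (Tgt A f) (E f) (Src A k) (E k)"
proof -
  have f: "f \<in> Hom A (Src A f) (Tgt A f)" and k': "k \<in> Hom A (Src A k) (Src A f)"
    using k by (auto simp: is_kernel_def Hom_def)
  have z: "k \<cdot> f = Zer A (Src A k) (Tgt A f)" using k by (auto simp: is_kernel_def)
  have kf: "E k * E f = 0"
    using E_comp[OF k' f] E_eq_0[OF comp_closed[OF k' f]] z by simp
  have fac: "\<exists>!u. u \<in> Hom A T (Src A k) \<and> u \<cdot> k = g" if g: "g \<in> Hom A T (Src A f)" "E g * E f = 0" for g T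
  proof -
    have "g \<cdot> f = Zer A T (Tgt A f)" using g E_comp[OF g(1) f] E_eq_0[OF comp_closed[OF g(1) f]] by simp
    then show ?thesis using k HomD(1-3)[OF g(1)] unfolding is_kernel_def by blast
  qed
  have mono: "t = 0" if t: "t \<in> H T (Src A k)" "t * E k = 0" for t T
  proof -
    obtain u where u: "u \<in> Hom A T (Src A k)" "t = E u" using t(1) by (rule H_E)
    have T: "T \<in> Ob A" "Src A k \<in> Ob A" "Src A f \<in> Ob A" using HomD(4,5)[OF u(1)] HomD(5)[OF k'] by auto
    have z: "Zer A T (Src A k) \<in> Hom A T (Src A k)" using zer_hom T by blast
    have "u \<cdot> k = Zer A T (Src A f)" using t u E_comp[OF u(1) k'] E_eq_0[OF comp_closed[OF u(1) k']] by simp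
    moreover have "Zer A T (Src A k) \<cdot> k = Zer A T (Src A f)" by (rule zer_comp[OF k' T(1)])
    moreover have "E (Zer A T (Src A f)) * E f = 0" using E_zer T by simp
    \<comment> \<open>Monicity of a kernel is the uniqueness of the factorisation of the zero
      morphism.\<close>
    ultimately have "u = Zer A T (Src A k)" using fac[OF zer_hom[OF T(1,3)]] u z by blast
    then show "t = 0" using u E_zer T by simp
  qed
  have "\<exists>v \<in> H T (Src A k). v * E k = g" if g: "g \<in> H T (Src A f)" "g * E f = 0" for g T
  proof -
    obtain g' where g': "g' \<in> Hom A T (Src A f)" "g = E g'" using g(1) by (rule H_E)
    obtain u where "u \<in> Hom A T (Src A k)" "u \<cdot> k = g'" using fac[OF g'(1)] g g' by blast
    then show ?thesis using E_comp[OF _ k'] g' by (metis E_H)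
  qed
  then show ?thesis using f k' kf mono by (auto simp: ker_def monic_def)
qed

lemma coker_of_is_cokernel:
  assumes k: "is_cokernel A f c" shows "coker (Src A f) (Tgt A f) (E f) (Tgt A c) (E c)"
proof -
  have f: "f \<in> Hom A (Src A f) (Tgt A f)" and c: "c \<in> Hom A (Tgt A f) (Tgt A c)"
    using k by (auto simp: is_cokernel_def Hom_def)
  have z: "f \<cdot> c = Zer A (Src A f) (Tgt A c)" using k by (auto simp: is_cokernel_def)
  have fc: "E f * E c = 0"
    using E_comp[OF f c] E_eq_0[OF comp_closed[OF f c]] z by simp
  have fac: "\<exists>!u. u \<in> Hom A (Tgt A c) T \<and> c \<cdot> u = g" if g: "g \<in> Hom A (Tgt A f) T" "E f * E g = 0" for g T
  proof -
    have "f \<cdot> g = Zer A (Src A f) T" using g E_comp[OF f g(1)] E_eq_0[OF comp_closed[OF f g(1)]] by simp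
    then show ?thesis using k HomD(1-3)[OF g(1)] unfolding is_cokernel_def by blast
  qed
  have epi: "t = 0" if t: "t \<in> H (Tgt A c) T" "E c * t = 0" for t T
  proof -
    obtain u where u: "u \<in> Hom A (Tgt A c) T" "t = E u" using t(1) by (rule H_E)
    have T: "T \<in> Ob A" "Tgt A c \<in> Ob A" "Tgt A f \<in> Ob A" using HomD(4,5)[OF u(1)] HomD(4)[OF c] by auto
    have z: "Zer A (Tgt A c) T \<in> Hom A (Tgt A c) T" using zer_hom T by blast
    have "c \<cdot> u = Zer A (Tgt A f) T" using t u E_comp[OF c u(1)] E_eq_0[OF comp_closed[OF c u(1)]] by simp
    moreover have "c \<cdot> Zer A (Tgt A c) T = Zer A (Tgt A f) T" by (rule comp_zer[OF c T(1)])
    moreover have "E f * E (Zer A (Tgt A f) T) = 0" using E_zer T by simp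
    ultimately have "u = Zer A (Tgt A c) T" using fac[OF zer_hom[OF T(3,1)]] u z by blast
    then show "t = 0" using u E_zer T by simp
  qed
  have "\<exists>v \<in> H (Tgt A c) T. E c * v = g" if g: "g \<in> H (Tgt A f) T" "E f * g = 0" for g T
  proof -
    obtain g' where g': "g' \<in> Hom A (Tgt A f) T" "g = E g'" using g(1) by (rule H_E)
    obtain u where "u \<in> Hom A (Tgt A c) T" "c \<cdot> u = g'" using fac[OF g'(1)] g g' by blast
    then show ?thesis using E_comp[OF c] g' by (metis E_H)
  qed
  then show ?thesis using f c fc epi by (auto simp: coker_def epic_def)
qed

lemma ker_ex: assumes "f \<in> H X Y" obtains K k where "ker X Y f K k"
proof -
  obtain g where g: "g \<in> Hom A X Y" "f = E g" using assms by (rule H_E)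
  then obtain k where "is_kernel A g k" using kernels HomD(1) by blast
  from ker_of_is_kernel[OF this] show ?thesis using that HomD(1-3)[OF g(1)] g(2) by simp
qed

lemma coker_ex: assumes "f \<in> H X Y" obtains Q c where "coker X Y f Q c"
proof -
  obtain g where g: "g \<in> Hom A X Y" "f = E g" using assms by (rule H_E)
  then obtain k where "is_cokernel A g k" using cokernels HomD(1) by blast
  from coker_of_is_cokernel[OF this] show ?thesis using that HomD(1-3)[OF g(1)] g(2) by simp
qed

lemma is_mono_monic:
  assumes f: "f \<in> Hom A X Y" shows "is_mono A f \<longleftrightarrow> monic X Y (E f)"
proof
  assume m: "is_mono A f"
  have "t = 0" if t: "t \<in> H T X" "t * E f = 0" for t T
  proof -
    obtain u where u: "u \<in> Hom A T X" "t = E u" using t(1) by (rule H_E)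
    have T: "T \<in> Ob A" "X \<in> Ob A" using HomD(4,5)[OF u(1)] by auto
    have "u \<cdot> f = Zer A T X \<cdot> f"
      using t u E_comp[OF u(1) f] E_eq_0[OF comp_closed[OF u(1) f]] zer_comp[OF f T(1)] by simp
    then have "u = Zer A T X" using m u zer_hom[OF T] HomD(2)[OF f] unfolding is_mono_def by blast
    then show ?thesis using E_zer T u by simp
  qed
  then show "monic X Y (E f)" using f by (auto simp: monic_def)
next
  assume m: "monic X Y (E f)"
  have "g = h" if "g \<in> Hom A W X" "h \<in> Hom A W X" "g \<cdot> f = h \<cdot> f" for g h W
    using monic_cancel[OF m, of "E g" W "E h"] that E_comp[OF _ f] E_inj E_H by metis
  then show "is_mono A f" using HomD(1-3)[OF f] by (auto simp: is_mono_def)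
qed

lemma is_epi_epic:
  assumes f: "f \<in> Hom A X Y" shows "is_epi A f \<longleftrightarrow> epic X Y (E f)"
proof
  assume m: "is_epi A f"
  have "t = 0" if t: "t \<in> H Y T" "E f * t = 0" for t T
  proof -
    obtain u where u: "u \<in> Hom A Y T" "t = E u" using t(1) by (rule H_E)
    have T: "T \<in> Ob A" "Y \<in> Ob A" using HomD(4,5)[OF u(1)] by auto
    have "f \<cdot> u = f \<cdot> Zer A Y T"
      using t u E_comp[OF f u(1)] E_eq_0[OF comp_closed[OF f u(1)]] comp_zer[OF f T(1)] by simp
    then have "u = Zer A Y T" using m u zer_hom[OF T(2,1)] HomD(3)[OF f] unfolding is_epi_def by blast
    then show ?thesis using E_zer T u by simp
  qed
  then show "epic X Y (E f)" using f by (auto simp: epic_def)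
next
  assume m: "epic X Y (E f)"
  have "g = h" if "g \<in> Hom A Y W" "h \<in> Hom A Y W" "f \<cdot> g = f \<cdot> h" for g h W
    using epic_cancel[OF m, of "E g" W "E h"] that E_comp[OF f] E_inj E_H by metis
  then show "is_epi A f" using HomD(1-3)[OF f] by (auto simp: is_epi_def)
qed

lemma monic_ker: assumes "monic X Y x" obtains Z f where "ker Y Z f X x"
proof -
  obtain g where g: "g \<in> Hom A X Y" "x = E g" using monicD(1)[OF assms] by (rule H_E)
  then obtain f where f: "is_kernel A f g" using mono_kernel is_mono_monic assms by blast
  then have "Src A f = Y" using HomD(3)[OF g(1)] by (simp add: is_kernel_def)
  with ker_of_is_kernel[OF f] show ?thesis using that HomD(2)[OF g(1)] g(2) by metis
qed

lemma epic_coker: assumes "epic X Y x" obtains W f where "coker W X f Y x"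
proof -
  obtain g where g: "g \<in> Hom A X Y" "x = E g" using epicD(1)[OF assms] by (rule H_E)
  then obtain f where f: "is_cokernel A f g" using epi_cokernel is_epi_epic assms by blast
  then have "Tgt A f = X" using HomD(2)[OF g(1)] by (simp add: is_cokernel_def)
  with coker_of_is_cokernel[OF f] show ?thesis using that HomD(3)[OF g(1)] g(2) by metis
qed

lemma epic_comp:
  assumes "epic X Y x" "epic Y Z y" shows "epic X Z (x * y)"
proof -
  have "t = 0" if "t \<in> H Z T" "x * y * t = 0" for t T
    using that epicD[OF assms(1)] epicD[OF assms(2)] by (metis mult.assoc mult_H)
  then show ?thesis using epicD(1)[OF assms(1)] epicD(1)[OF assms(2)] by (auto simp: epic_def)
qed

lemma epic_un: "X \<in> Ob A \<Longrightarrow> epic X X (un X)"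
  by (auto simp: epic_def un_left)

lemma epic_of_comp:
  assumes "epic X Z (x * y)" "x \<in> H X Y" "y \<in> H Y Z" shows "epic Y Z y"
proof -
  have "t = 0" if "t \<in> H Z T" "y * t = 0" for t T
    using epicD(2)[OF assms(1) that(1)] that(2) by (simp add: mult.assoc)
  then show ?thesis using assms by (auto simp: epic_def)
qed

text \<open>\<open>x\<close> is the kernel of some \<open>f\<close>, and \<open>x * f = 0\<close>
  with \<open>x\<close> epic forces \<open>f = 0\<close>. So the identity of \<open>Y\<close>
  factors through \<open>x\<close>; cancelling the monic \<open>x\<close> shows that the factor is
  inverse on the other side too.\<close>

lemma monic_epic_iso:
  assumes "monic X Y x" "epic X Y x"
  obtains y where "y \<in> H Y X" "x * y = un X" "y * x = un Y"
proof -
  obtain Z f where f: "ker Y Z f X x" using assms(1) by (rule monic_ker)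
  have x: "x \<in> H X Y" using assms(1) by (rule monicD)
  have "f = 0" using epicD(2)[OF assms(2) kerD(1)[OF f]] kerD(4)[OF f] by simp
  then obtain s where s: "s \<in> H Y X" "s * x = un Y"
    using kerE[OF f un_H[OF H_ob(2)[OF x]]] by auto
  have "x * s * x = un X * x"
    using s x by (simp add: mult.assoc un_left un_right)
  then have "x * s = un X"
    using monic_cancel[OF assms(1), of "x * s" X "un X"] s x H_ob(1)[OF x] by auto
  with s that show ?thesis by blast
qed

lemma biproduct_ex:
  assumes "X \<in> Ob A" "Y \<in> Ob A"
  obtains S i1 i2 p1 p2 where "S \<in> Ob A" "i1 \<in> H X S" "i2 \<in> H Y S" "p1 \<in> H S X" "p2 \<in> H S Y"
    "i1 * p1 = un X" "i2 * p2 = un Y" "i1 * p2 = 0" "i2 * p1 = 0" "p1 * i1 + p2 * i2 = un S"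
proof -
  define Z where "Z k = (if k = (0::nat) then X else Y)" for k
  obtain S ins prj where ds: "direct_sum A 2 Z S ins prj"
  proof -
    have "Z k \<in> Ob A" for k using assms by (simp add: Z_def)
    then show ?thesis using direct_sums[of 2 Z] that by blast
  qed
  note ds = direct_sum_in_ring[OF ds]
  have "E (prj 0) * E (ins 0) + E (prj 1) * E (ins 1) = un S"
    using ds(5) by (simp add: numeral_2_eq_2)
  then show ?thesis
    using that[of S "E (ins 0)" "E (ins 1)" "E (prj 0)" "E (prj 1)"] ds(1) ds(2,3)[of 0] ds(2,3)[of 1]
      ds(4)[of 0 0] ds(4)[of 0 1] ds(4)[of 1 0] ds(4)[of 1 1] by (simp add: Z_def)
qed

text \<open>Epimorphisms are stable under pullback. The pullback is the kernel \<open>l\<close> of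
  \<open>q = p1 * p - p2 * g\<close> on the direct sum of \<open>Y\<close> and \<open>T\<close>. As
  \<open>i1 * q = p\<close>, \<open>q\<close> is epic, hence a cokernel of some \<open>f\<close>. If
  \<open>l * p2 * t = 0\<close>, then \<open>f * (p2 * t) = 0\<close>, because \<open>f\<close>
  factors through \<open>l\<close>; so \<open>p2 * t = q * s\<close> for some \<open>s\<close>.
  Restricting to \<open>Y\<close> gives \<open>p * s = 0\<close>, whence \<open>s = 0\<close> and
  \<open>t = 0\<close>.\<close>

lemma pullback_epic:
  assumes p: "epic Y Z p" and g: "g \<in> H T Z"
  obtains T' c y where "epic T' T c" "y \<in> H T' Y" "c * g = y * p"
proof -
  have pH: "p \<in> H Y Z" using p by (rule epicD)
  obtain S i1 i2 p1 p2 where b: "S \<in> Ob A" "i1 \<in> H Y S" "i2 \<in> H T S" "p1 \<in> H S Y" "p2 \<in> H S T"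
    "i1 * p1 = un Y" "i2 * p2 = un T" "i1 * p2 = 0" "i2 * p1 = 0" "p1 * i1 + p2 * i2 = un S"
    using biproduct_ex[OF H_ob(1)[OF pH] H_ob(1)[OF g]] by metis
  define q where "q = p1 * p - p2 * g"
  have q: "q \<in> H S Z" unfolding q_def using b pH g by blast
  have i1q: "i1 * q = p"
    using b un_left[OF pH] by (simp add: q_def right_diff_distrib mult.assoc[symmetric])
  have epi: "epic S Z q"
    by (rule epic_of_comp[of Y Z i1]) (use i1q p b q in auto)
  obtain K l where l: "ker S Z q K l" using q by (rule ker_ex)
  have lH: "l \<in> H K S" and lq: "l * q = 0" using kerD[OF l] by auto
  obtain W f where f: "coker W S f Z q" using epi by (rule epic_coker)
  have c: "epic K T (l * p2)"
    unfolding epic_def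
  proof (intro conjI allI ballI impI)
    show "l * p2 \<in> H K T" using lH b by blast
    fix T2 t assume t: "t \<in> H T T2" "l * p2 * t = 0"
    obtain v where v: "v \<in> H W K" "v * l = f" using kerE[OF l cokerD(1)[OF f] cokerD(4)[OF f]] by blast
    have "f * (p2 * t) = v * (l * p2 * t)" by (simp add: v(2)[symmetric] mult.assoc)
    then have "f * (p2 * t) = 0" using t by simp
    moreover have "p2 * t \<in> H S T2" using b t by blast
    ultimately obtain s where s: "s \<in> H Z T2" "q * s = p2 * t" using cokerE[OF f] by metis
    have "p * s = i1 * (q * s)" by (simp add: i1q[symmetric] mult.assoc)
    also have "\<dots> = i1 * p2 * t" by (simp add: s(2) mult.assoc)
    finally have "p * s = 0" using b by simp
    then have "s = 0" using epicD(2)[OF p s(1)] by simp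
    then have "i2 * (p2 * t) = 0" using s by simp
    then show "t = 0" using b un_left[OF t(1)] by (simp add: mult.assoc[symmetric])
  qed
  have "l * p2 * g = l * p1 * p"
    using lq by (simp add: q_def right_diff_distrib mult.assoc)
  then show ?thesis using that[OF c, of "l * p1"] lH b by blast
qed

text \<open>The morphism \<open>q\<close> from \<open>X\<close> to the kernel \<open>I\<close> of
  the cokernel of \<open>u\<close> is epic: image and kernel of the cokernel agree. So
  \<open>x\<close>, which factors through \<open>I\<close>, lifts to \<open>X\<close> after a cover
  by \<open>pullback_epic\<close>.\<close>

lemma coker_exact:
  assumes c: "coker X Y u Z c" and x: "x \<in> H T Y" "x * c = 0"
  obtains T' s v where "epic T' T s" "v \<in> H T' X" "s * x = v * u"
proof -
  have u: "u \<in> H X Y" and uc: "u * c = 0" using cokerD[OF c] by auto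
  obtain I m where m: "ker Y Z c I m" using cokerD(2)[OF c] by (rule ker_ex)
  have mH: "m \<in> H I Y" and mm: "monic I Y m" and mc: "m * c = 0" using kerD[OF m] by auto
  obtain q where q: "q \<in> H X I" "q * m = u" using kerE[OF m u uc] by blast
  have "epic X I q"
    unfolding epic_def
  proof (intro conjI allI ballI impI)
    show "q \<in> H X I" by fact
    fix T2 t assume t: "t \<in> H I T2" "q * t = 0"
    obtain K k where k: "ker I T2 t K k" using t(1) by (rule ker_ex)
    have kH: "k \<in> H K I" and km: "monic K I k" using kerD[OF k] by auto
    obtain q' where q': "q' \<in> H X K" "q' * k = q" using kerE[OF k q(1) t(2)] by blast
    have "monic K Y (k * m)"
      unfolding monic_def
    proof (intro conjI allI ballI impI)
      show "k * m \<in> H K Y" using kH mH by blast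
      fix T3 w assume w: "w \<in> H T3 K" "w * (k * m) = 0"
      have "w * k \<in> H T3 I" using w kH by blast
      then have "w * k = 0" using monicD(2)[OF mm] w(2) by (simp add: mult.assoc)
      then show "w = 0" using monicD(2)[OF km w(1)] by simp
    qed
    \<comment> \<open>The kernel \<open>k\<close> of \<open>t\<close> gives a subobject
      \<open>k * m\<close> of \<open>Y\<close> through which \<open>u\<close> factors. It is the
      kernel of some \<open>g\<close>; since \<open>u * g = 0\<close>, also
      \<open>m * g = 0\<close>, so \<open>m\<close> factors through \<open>k * m\<close> as well.
      This yields \<open>s * k = un I\<close> and \<open>t = s * k * t = 0\<close>.\<close>
    then obtain V g where g: "ker Y V g K (k * m)" by (rule monic_ker)
    have "u * g = q' * (k * m * g)" by (simp add: q(2)[symmetric] q'(2)[symmetric] mult.assoc)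
    then have "u * g = 0" using kerD(4)[OF g] by simp
    then obtain g' where g': "g' \<in> H Z V" "c * g' = g" using cokerE[OF c kerD(1)[OF g]] by blast
    have "m * g = m * c * g'" by (simp add: g'(2)[symmetric] mult.assoc)
    then have "m * g = 0" using mc by simp
    then obtain s where s: "s \<in> H I K" "s * (k * m) = m" using kerE[OF g mH] by blast
    have "s * k = un I"
      by (rule monic_cancel[OF mm, of _ I]) (use s kH H_ob(1)[OF mH] un_left[OF mH] in \<open>auto simp: mult.assoc\<close>)
    then have "t = s * (k * t)" using un_left[OF t(1)] by (simp add: mult.assoc[symmetric])
    then show "t = 0" using kerD(4)[OF k] by simp
  qed
  moreover obtain x' where x': "x' \<in> H T I" "x' * m = x" using kerE[OF m x] by blast
  ultimately obtain T' s v where s: "epic T' T s" "v \<in> H T' X" "s * x' = v * q"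
    using pullback_epic by metis
  have "s * x = v * u"
    by (simp add: x'(2)[symmetric] q(2)[symmetric] mult.assoc[symmetric] s(3))
  with s that show ?thesis by blast
qed

end

section \<open>The additive category of complexes\<close>

context additive_in_ring
begin

abbreviation K where "K \<equiv> complex_cat A"

definition d where "d X n = E (diff X n)"
definition c where "c f n = E (component f n)"

lemma K_simps [simp]:
  "Ob K = complexes A" "Mor K = complex_mors A" "Src K f = source f" "Tgt K f = target f"
  "Idn K X = Cochain_Map X (\<lambda>n. Idn A (obj X n)) X"
  "f \<cdot>\<^bsub>K\<^esub> g = Cochain_Map (source f) (\<lambda>n. component f n \<cdot> component g n) (target g)"
  "Add K f g = Cochain_Map (source f) (\<lambda>n. Add A (component f n) (component g n)) (target f)"
  "Zer K X Y = Cochain_Map X (\<lambda>n. Zer A (obj X n) (obj Y n)) Y"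
  by (simp_all add: complex_cat_def)

lemma complexD:
  assumes X: "X \<in> complexes A"
  shows "obj X n \<in> Ob A" "diff X n \<in> Hom A (obj X n) (obj X (n + 1))"
    "d X n \<in> H (obj X n) (obj X (n + 1))" "d X n * d X (n + 1) = 0"
    "d X (n - 1) \<in> H (obj X (n - 1)) (obj X n)" "d X (n - 1) * d X n = 0"
proof -
  have *: "obj X n \<in> Ob A" "diff X n \<in> Hom A (obj X n) (obj X (n + 1))" "diff X n \<cdot> diff X (n + 1) = Zer A (obj X n) (obj X (n + 2))" for n
    using X by (auto simp: complexes_def)
  show "obj X n \<in> Ob A" "diff X n \<in> Hom A (obj X n) (obj X (n + 1))" by (rule *)+
  have 1: "d X n \<in> H (obj X n) (obj X (n + 1))" for n using *(2) by (simp add: d_def)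
  \<comment> \<open>The definition of complexes types the composite of two differentials with degree
    \<open>n + 2\<close>, while iteration produces \<open>n + 1 + 1\<close>.\<close>
  have "n + 1 + 1 = n + 2" for n :: int by simp
  then have d2: "diff X (n + 1) \<in> Hom A (obj X (n + 1)) (obj X (n + 2))" for n using *(2)[of "n + 1"] by metis
  have 2: "d X n * d X (n + 1) = 0" for n
    using E_comp[OF *(2) d2, of n] *(3)[of n] E_zer[OF *(1) *(1)] by (simp add: d_def)
  show "d X n \<in> H (obj X n) (obj X (n + 1))" "d X n * d X (n + 1) = 0" by (rule 1 2)+
  show "d X (n - 1) \<in> H (obj X (n - 1)) (obj X n)" "d X (n - 1) * d X n = 0" using 1[of "n - 1"] 2[of "n - 1"] by simp_all
qed

text \<open>Direct sums, cones, pushouts and pullbacks are built from ring data; \<open>R\<close>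
  supplies the actual differentials in \<open>A\<close>.\<close>

lemma complex_of_ring:
  assumes \<delta>: "\<And>n. \<delta> n \<in> H (ob n) (ob (n + 1))" and \<delta>\<delta>: "\<And>n. \<delta> n * \<delta> (n + 1) = 0"
  obtains X where "X \<in> complexes A" "obj X = ob" "d X = \<delta>"
proof
  let ?X = "Cochain ob (\<lambda>n. R (ob n) (ob (n + 1)) (\<delta> n))"
  note r = R_hom[OF \<delta>]
  show "d ?X = \<delta>" using r(2) by (simp add: d_def fun_eq_iff)
  show "?X \<in> complexes A"
    unfolding complexes_def
  proof (intro CollectI conjI allI)
    show "obj ?X n \<in> Ob A" "diff ?X n \<in> Hom A (obj ?X n) (obj ?X (n + 1))" for n
      using H_ob(1)[OF \<delta>] r by simp_all
    have 1: "n + 1 + 1 = n + 2" for n :: int by simp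
    have r': "R (ob (n + 1)) (ob (n + 1 + 1)) (\<delta> (n + 1)) \<in> Hom A (ob (n + 1)) (ob (n + 2))" for n
      using r(1)[of "n + 1"] unfolding 1 .
    have "R (ob n) (ob (n + 1)) (\<delta> n) \<cdot> R (ob (n + 1)) (ob (n + 1 + 1)) (\<delta> (n + 1)) = Zer A (ob n) (ob (n + 2))" for n
      by (rule E_inj[OF comp_closed[OF r(1) r'] zer_hom])
        (use E_comp[OF r(1) r'] r(2) r(2)[of "n + 1"] \<delta>\<delta> E_zer H_ob(1)[OF \<delta>] in simp_all)
    then show "diff ?X n \<cdot> diff ?X (n + 1) = Zer A (obj ?X n) (obj ?X (n + 2))" for n by simp
  qed
qed simp

lemma complex_mor_iff:
  "Cochain_Map X \<phi> Y \<in> complex_mors A \<longleftrightarrow> X \<in> complexes A \<and> Y \<in> complexes A \<and>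
    (\<forall>n. \<phi> n \<in> Hom A (obj X n) (obj Y n)) \<and> (\<forall>n. d X n * E (\<phi> (n + 1)) = E (\<phi> n) * d Y n)"
proof -
  have "diff X n \<cdot> \<phi> (n + 1) = \<phi> n \<cdot> diff Y n \<longleftrightarrow> d X n * E (\<phi> (n + 1)) = E (\<phi> n) * d Y n"
    if "X \<in> complexes A" "Y \<in> complexes A" "\<forall>n. \<phi> n \<in> Hom A (obj X n) (obj Y n)" for n
  proof -
    note p = that(3)[rule_format]
    note dX = complexD(2)[OF that(1), of n] and dY = complexD(2)[OF that(2), of n]
    show ?thesis
      using E_inj[OF comp_closed[OF dX p] comp_closed[OF p dY]] E_comp[OF dX p] E_comp[OF p dY]
      by (auto simp: d_def)
  qed
  then show ?thesis by (auto simp: complex_mors_def)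
qed

lemma K_homD:
  assumes "f \<in> Hom K X Y"
  shows "X \<in> complexes A" "Y \<in> complexes A" "source f = X" "target f = Y" "f \<in> complex_mors A"
    "component f n \<in> Hom A (obj X n) (obj Y n)" "c f n \<in> H (obj X n) (obj Y n)"
    "d X n * c f (n + 1) = c f n * d Y n" "d X (n - 1) * c f n = c f (n - 1) * d Y (n - 1)"
proof -
  obtain \<phi> where f: "f = Cochain_Map X \<phi> Y" using assms by (cases f) (simp add: Hom_def)
  have "f \<in> complex_mors A" using assms by (simp add: Hom_def)
  note m = this[unfolded f complex_mor_iff]
  show "X \<in> complexes A" "Y \<in> complexes A" "source f = X" "target f = Y" "f \<in> complex_mors A"
    "component f n \<in> Hom A (obj X n) (obj Y n)" "c f n \<in> H (obj X n) (obj Y n)"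
    "d X n * c f (n + 1) = c f n * d Y n" "d X (n - 1) * c f n = c f (n - 1) * d Y (n - 1)"
    using m spec[of _ "n - 1"] assms by (auto simp: f c_def Hom_def dest: spec[of _ "n - 1"])
qed

lemma K_homI:
  assumes "X \<in> complexes A" "Y \<in> complexes A" "\<And>n. \<phi> n \<in> H (obj X n) (obj Y n)" "\<And>n. d X n * \<phi> (n + 1) = \<phi> n * d Y n"
  obtains f where "f \<in> Hom K X Y" "c f = \<phi>"
proof
  let ?f = "Cochain_Map X (\<lambda>n. R (obj X n) (obj Y n) (\<phi> n)) Y"
  show "c ?f = \<phi>" using R_hom(2)[OF assms(3)] by (simp add: c_def fun_eq_iff)
  show "?f \<in> Hom K X Y" using assms R_hom[OF assms(3)] by (simp add: Hom_def complex_mor_iff)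
qed

lemma K_hom_eqI:
  assumes "f \<in> Hom K X Y" "g \<in> Hom K X Y" "\<And>n. c f n = c g n" shows "f = g"
proof -
  have "component f n = component g n" for n
    using E_inj[OF K_homD(6)[OF assms(1)] K_homD(6)[OF assms(2)]] assms(3) by (simp add: c_def)
  then show ?thesis using K_homD(3,4)[OF assms(1)] K_homD(3,4)[OF assms(2)] by (cases f; cases g) auto
qed

lemma K_comp:
  assumes "f \<in> Hom K X Y" "g \<in> Hom K Y Z"
  shows "f \<cdot>\<^bsub>K\<^esub> g \<in> Hom K X Z" "c (f \<cdot>\<^bsub>K\<^esub> g) n = c f n * c g n"
proof -
  note f = K_homD[OF assms(1)] and g = K_homD[OF assms(2)]
  have e: "E (component f n \<cdot> component g n) = c f n * c g n" for n
    using E_comp[OF f(6) g(6)] by (simp add: c_def)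
  have "d X n * (c f (n + 1) * c g (n + 1)) = c f n * c g n * d Z n" for n
    using f(8)[of n] g(8)[of n] by (metis mult.assoc)
  then show "f \<cdot>\<^bsub>K\<^esub> g \<in> Hom K X Z"
    using f g comp_closed[OF f(6) g(6)] by (simp add: Hom_def complex_mor_iff e)
  show "c (f \<cdot>\<^bsub>K\<^esub> g) n = c f n * c g n" using e by (simp add: c_def)
qed

lemma K_idn:
  assumes X: "X \<in> complexes A" shows "Idn K X \<in> Hom K X X" "c (Idn K X) n = un (obj X n)"
proof -
  show "c (Idn K X) n = un (obj X n)" by (simp add: c_def un_def)
  show "Idn K X \<in> Hom K X X"
    using X complexD[OF X] id_closed un_left[OF complexD(3)[OF X]] un_right[OF complexD(3)[OF X]]
    by (simp add: Hom_def complex_mor_iff un_def)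
qed

lemma K_zer:
  assumes "X \<in> complexes A" "Y \<in> complexes A" shows "Zer K X Y \<in> Hom K X Y" "c (Zer K X Y) n = 0"
  using assms complexD(1)[OF assms(1)] complexD(1)[OF assms(2)] zer_hom E_zer
  by (simp_all add: Hom_def complex_mor_iff c_def)

lemma K_add:
  assumes "f \<in> Hom K X Y" "g \<in> Hom K X Y"
  shows "Add K f g \<in> Hom K X Y" "c (Add K f g) n = c f n + c g n"
proof -
  note f = K_homD[OF assms(1)] and g = K_homD[OF assms(2)]
  have e: "E (Add A (component f n) (component g n)) = c f n + c g n" for n
    using E_add[OF f(6) g(6)] by (simp add: c_def)
  show "c (Add K f g) n = c f n + c g n" using e by (simp add: c_def)
  have "d X n * (c f (n + 1) + c g (n + 1)) = (c f n + c g n) * d Y n" for n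
    using f(8)[of n] g(8)[of n] by (simp add: algebra_simps)
  then show "Add K f g \<in> Hom K X Y"
    using f(1-5) add_hom[OF complexD(1)[OF f(1)] complexD(1)[OF f(2)] f(6) g(6)] by (simp add: Hom_def complex_mor_iff e)
qed

declare K_simps(5-8) [simp del]

lemma K_category: "category K"
proof
  show "f \<in> Mor K \<Longrightarrow> Src K f \<in> Ob K" "f \<in> Mor K \<Longrightarrow> Tgt K f \<in> Ob K" for f
    by (auto simp: complex_mors_def)
  show "X \<in> Ob K \<Longrightarrow> Idn K X \<in> Hom K X X" for X by (simp add: K_idn)
  show "\<lbrakk>f \<in> Hom K X Y; g \<in> Hom K Y Z\<rbrakk> \<Longrightarrow> f \<cdot>\<^bsub>K\<^esub> g \<in> Hom K X Z" for f g X Y Z by (rule K_comp)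
  show "Idn K (Src K f) \<cdot>\<^bsub>K\<^esub> f = f" "f \<cdot>\<^bsub>K\<^esub> Idn K (Tgt K f) = f" if "f \<in> Mor K" for f
  proof -
    have f: "f \<in> Hom K (source f) (target f)" using that by (simp add: Hom_def)
    note i = K_idn[OF K_homD(1)[OF f]] K_idn[OF K_homD(2)[OF f]]
    show "Idn K (Src K f) \<cdot>\<^bsub>K\<^esub> f = f"
      using K_hom_eqI[OF K_comp(1)[OF i(1) f] f] K_comp(2)[OF i(1) f] i(2) un_left[OF K_homD(7)[OF f]] by simp
    show "f \<cdot>\<^bsub>K\<^esub> Idn K (Tgt K f) = f"
      using K_hom_eqI[OF K_comp(1)[OF f i(3)] f] K_comp(2)[OF f i(3)] i(4) un_right[OF K_homD(7)[OF f]] by simp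
  qed
  show "f \<cdot>\<^bsub>K\<^esub> g \<cdot>\<^bsub>K\<^esub> h = f \<cdot>\<^bsub>K\<^esub> (g \<cdot>\<^bsub>K\<^esub> h)"
    if "f \<in> Hom K W X" "g \<in> Hom K X Y" "h \<in> Hom K Y Z" for f g h W X Y Z
    using K_hom_eqI[OF K_comp(1)[OF K_comp(1)[OF that(1,2)] that(3)] K_comp(1)[OF that(1) K_comp(1)[OF that(2,3)]]]
      K_comp(2)[OF K_comp(1)[OF that(1,2)] that(3)] K_comp(2)[OF that(1) K_comp(1)[OF that(2,3)]]
      K_comp(2)[OF that(1,2)] K_comp(2)[OF that(2,3)] by (simp add: mult.assoc)
qed

lemma K_hom_group:
  assumes "X \<in> complexes A" "Y \<in> complexes A" shows "comm_group (hom_group K X Y)"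
proof (rule comm_groupI)
  note z = K_zer[OF assms]
  show "\<one>\<^bsub>hom_group K X Y\<^esub> \<in> carrier (hom_group K X Y)" using z by (simp add: hom_group_def)
  fix f assume f: "f \<in> carrier (hom_group K X Y)"
  then have f: "f \<in> Hom K X Y" by (simp add: hom_group_def)
  show "\<one>\<^bsub>hom_group K X Y\<^esub> \<otimes>\<^bsub>hom_group K X Y\<^esub> f = f"
    using K_hom_eqI[OF K_add(1)[OF z(1) f] f] K_add(2)[OF z(1) f] z(2) by (simp add: hom_group_def)
  obtain g where g: "g \<in> Hom K X Y" "c g = (\<lambda>n. - c f n)"
    by (rule K_homI[OF assms, of "\<lambda>n. - c f n"]) (use K_homD(7,8)[OF f] in \<open>auto\<close>)
  show "\<exists>g\<in>carrier (hom_group K X Y). g \<otimes>\<^bsub>hom_group K X Y\<^esub> f = \<one>\<^bsub>hom_group K X Y\<^esub>"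
    using K_hom_eqI[OF K_add(1)[OF g(1) f] z(1)] K_add(2)[OF g(1) f] z(2) g by (auto simp: hom_group_def)
  fix g assume "g \<in> carrier (hom_group K X Y)"
  then have g: "g \<in> Hom K X Y" by (simp add: hom_group_def)
  show "f \<otimes>\<^bsub>hom_group K X Y\<^esub> g \<in> carrier (hom_group K X Y)" using K_add(1)[OF f g] by (simp add: hom_group_def)
  show "f \<otimes>\<^bsub>hom_group K X Y\<^esub> g = g \<otimes>\<^bsub>hom_group K X Y\<^esub> f"
    using K_hom_eqI[OF K_add(1)[OF f g] K_add(1)[OF g f]] K_add(2)[OF f g] K_add(2)[OF g f]
    by (simp add: hom_group_def add.commute)
  fix h assume "h \<in> carrier (hom_group K X Y)"
  then have h: "h \<in> Hom K X Y" by (simp add: hom_group_def)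
  show "f \<otimes>\<^bsub>hom_group K X Y\<^esub> g \<otimes>\<^bsub>hom_group K X Y\<^esub> h = f \<otimes>\<^bsub>hom_group K X Y\<^esub> (g \<otimes>\<^bsub>hom_group K X Y\<^esub> h)"
    using K_hom_eqI[OF K_add(1)[OF K_add(1)[OF f g] h] K_add(1)[OF f K_add(1)[OF g h]]]
      K_add(2)[OF f g] K_add(2)[OF g h] K_add(2)[OF K_add(1)[OF f g] h] K_add(2)[OF f K_add(1)[OF g h]]
    by (simp add: hom_group_def add.assoc)
qed

lemma K_finprod:
  fixes n :: nat
  assumes "X \<in> complexes A" "Y \<in> complexes A" "\<And>k. k < n \<Longrightarrow> f k \<in> Hom K X Y"
  shows "finprod (hom_group K X Y) f {..<n} \<in> Hom K X Y"
    "c (finprod (hom_group K X Y) f {..<n}) m = (\<Sum>k<n. c (f k) m)"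
proof -
  show 1: "finprod (hom_group K X Y) f {..<n} \<in> Hom K X Y"
    by (rule finprod_hom_group(1)[where \<Phi> = "\<lambda>g. c g m", OF K_hom_group[OF assms(1,2)] assms(3)])
      (use K_add(2) K_zer assms in simp_all)
  show "c (finprod (hom_group K X Y) f {..<n}) m = (\<Sum>k<n. c (f k) m)"
    by (rule finprod_hom_group(2)[where \<Phi> = "\<lambda>g. c g m", OF K_hom_group[OF assms(1,2)] assms(3)])
      (use K_add(2) K_zer assms in simp_all)
qed

lemma K_direct_sums:
  fixes n :: nat
  assumes X: "\<And>k. k < n \<Longrightarrow> X k \<in> complexes A"
  shows "\<exists>S ins prj. direct_sum K n X S ins prj"
proof -
  have "\<exists>S ins prj. direct_sum A n (\<lambda>k. obj (X k) m) S ins prj" for m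
    by (rule direct_sums) (use complexD(1) X in blast)
  then obtain S0 i0 p0 where ds: "\<And>m. direct_sum A n (\<lambda>k. obj (X k) m) (S0 m) (i0 m) (p0 m)" by metis
  define i p where "i m k = E (i0 m k)" and "p m k = E (p0 m k)" for m k
  have S: "S0 m \<in> Ob A" and iH: "k < n \<Longrightarrow> i m k \<in> H (obj (X k) m) (S0 m)" and pH: "k < n \<Longrightarrow> p m k \<in> H (S0 m) (obj (X k) m)"
    and ip: "k < n \<Longrightarrow> l < n \<Longrightarrow> i m k * p m l = (if k = l then un (obj (X k) m) else 0)"
    and sum: "(\<Sum>k<n. p m k * i m k) = un (S0 m)" for m k l
    using direct_sum_in_ring[OF ds[of m]] unfolding i_def p_def by blast+
  \<comment> \<open>The diagonal differential. The direct sums are chosen separately in each degree,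
    which is why it runs through \<open>p m\<close> and \<open>i (m + 1)\<close>.\<close>
  define \<delta> where "\<delta> m = (\<Sum>k<n. p m k * (d (X k) m * i (m + 1) k))" for m
  have \<delta>H: "\<delta> m \<in> H (S0 m) (S0 (m + 1))" for m
    unfolding \<delta>_def by (intro sum_H S mult_H[OF pH mult_H[OF complexD(3)[OF X] iH]]) auto
  have i\<delta>: "i m k * \<delta> m = d (X k) m * i (m + 1) k" if k: "k < n" for m k
  proof -
    have "i m k * \<delta> m = (\<Sum>l<n. (i m k * p m l) * (d (X l) m * i (m + 1) l))"
      unfolding \<delta>_def sum_distrib_left by (simp add: mult.assoc)
    also have "\<dots> = (\<Sum>l<n. if l = k then d (X k) m * i (m + 1) k else 0)"
      by (rule sum.cong[OF refl])
        (use k ip un_left[OF mult_H[OF complexD(3)[OF X[OF k]] iH[OF k]]] in auto)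
    also have "\<dots> = d (X k) m * i (m + 1) k" using k by simp
    finally show ?thesis .
  qed
  have \<delta>p: "\<delta> m * p (m + 1) k = p m k * d (X k) m" if k: "k < n" for m k
  proof -
    have "\<delta> m * p (m + 1) k = (\<Sum>l<n. p m l * (d (X l) m * (i (m + 1) l * p (m + 1) k)))"
      unfolding \<delta>_def sum_distrib_right by (simp add: mult.assoc)
    also have "\<dots> = (\<Sum>l<n. if l = k then p m k * d (X k) m else 0)"
      by (rule sum.cong[OF refl])
        (use k ip un_right[OF complexD(3)[OF X[OF k]]] in auto)
    also have "\<dots> = p m k * d (X k) m" using k by simp
    finally show ?thesis .
  qed
  have "\<delta> m * \<delta> (m + 1) = 0" for m
  proof -
    have "\<delta> m * \<delta> (m + 1) = (\<Sum>k<n. p m k * (d (X k) m * (i (m + 1) k * \<delta> (m + 1))))"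
      by (simp add: \<delta>_def[of m] sum_distrib_right mult.assoc)
    also have "\<dots> = (\<Sum>k<n. p m k * (d (X k) m * d (X k) (m + 1) * i (m + 1 + 1) k))"
      by (rule sum.cong[OF refl]) (simp add: i\<delta> mult.assoc)
    also have "\<dots> = 0" by (rule sum.neutral) (use complexD(4)[OF X] in simp)
    finally show ?thesis .
  qed
  with \<delta>H obtain S where SC: "S \<in> complexes A" "obj S = S0" "d S = \<delta>"
    by (rule complex_of_ring)
  have "\<exists>f. f \<in> Hom K (X k) S \<and> c f = (\<lambda>m. i m k)" if "k < n" for k
    by (rule K_homI[OF X[OF that] SC(1), of "\<lambda>m. i m k"]) (use iH i\<delta> that SC in auto)
  then obtain ins where ins: "\<And>k. k < n \<Longrightarrow> ins k \<in> Hom K (X k) S \<and> c (ins k) = (\<lambda>m. i m k)" by metis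
  have "\<exists>f. f \<in> Hom K S (X k) \<and> c f = (\<lambda>m. p m k)" if "k < n" for k
    by (rule K_homI[OF SC(1) X[OF that], of "\<lambda>m. p m k"]) (use pH \<delta>p that SC in auto)
  then obtain prj where prj: "\<And>k. k < n \<Longrightarrow> prj k \<in> Hom K S (X k) \<and> c (prj k) = (\<lambda>m. p m k)" by metis
  have "ins k \<cdot>\<^bsub>K\<^esub> prj l = (if k = l then Idn K (X k) else Zer K (X k) (X l))" if kl: "k < n" "l < n" for k l
  proof -
    note i = conjunct1[OF ins[OF kl(1)]] and p = conjunct1[OF prj[OF kl(2)]]
    have "ins k \<cdot>\<^bsub>K\<^esub> prj l = Idn K (X k)" if "k = l"
      by (rule K_hom_eqI[OF K_comp(1)[OF i p]])
        (use that K_idn[OF X[OF kl(1)]] K_comp(2)[OF i p] ins prj kl ip in auto)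
    moreover have "ins k \<cdot>\<^bsub>K\<^esub> prj l = Zer K (X k) (X l)" if "k \<noteq> l"
      by (rule K_hom_eqI[OF K_comp(1)[OF i p]])
        (use that K_zer[OF X[OF kl(1)] X[OF kl(2)]] K_comp(2)[OF i p] ins prj kl ip in auto)
    ultimately show ?thesis by simp
  qed
  moreover have "finprod (hom_group K S S) (\<lambda>k. prj k \<cdot>\<^bsub>K\<^esub> ins k) {..<n} = Idn K S"
  proof (rule K_hom_eqI)
    have pi: "prj k \<cdot>\<^bsub>K\<^esub> ins k \<in> Hom K S S" "c (prj k \<cdot>\<^bsub>K\<^esub> ins k) m = p m k * i m k" if "k < n" for k m
      using K_comp[OF conjunct1[OF prj[OF that]] conjunct1[OF ins[OF that]]] ins prj that by auto
    show "finprod (hom_group K S S) (\<lambda>k. prj k \<cdot>\<^bsub>K\<^esub> ins k) {..<n} \<in> Hom K S S"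
      by (rule K_finprod(1)[OF SC(1) SC(1) pi(1)])
    show "c (finprod (hom_group K S S) (\<lambda>k. prj k \<cdot>\<^bsub>K\<^esub> ins k) {..<n}) m = c (Idn K S) m" for m
      using K_finprod(2)[OF SC(1) SC(1) pi(1)] pi(2) sum K_idn(2)[OF SC(1)] SC by simp
    show "Idn K S \<in> Hom K S S" by (rule K_idn[OF SC(1)])
  qed
  ultimately have "direct_sum K n X S ins prj"
    using ins prj SC(1) by (simp add: direct_sum_def)
  then show ?thesis by blast
qed

sublocale K: additive_category K
proof (intro additive_category.intro K_category additive_category_axioms.intro)
  show "comm_group (hom_group K X Y)" if "X \<in> Ob K" "Y \<in> Ob K" for X Y using K_hom_group that by simp
  show "Add K f f' \<cdot>\<^bsub>K\<^esub> g = Add K (f \<cdot>\<^bsub>K\<^esub> g) (f' \<cdot>\<^bsub>K\<^esub> g)"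
    if "f \<in> Hom K X Y" "f' \<in> Hom K X Y" "g \<in> Hom K Y Z" for f f' g X Y Z
    using K_hom_eqI[OF K_comp(1)[OF K_add(1)[OF that(1,2)] that(3)] K_add(1)[OF K_comp(1)[OF that(1,3)] K_comp(1)[OF that(2,3)]]]
      K_comp(2)[OF K_add(1)[OF that(1,2)] that(3)] K_add(2)[OF K_comp(1)[OF that(1,3)] K_comp(1)[OF that(2,3)]]
      K_comp(2)[OF that(1,3)] K_comp(2)[OF that(2,3)] K_add(2)[OF that(1,2)] by (simp add: algebra_simps)
  show "f \<cdot>\<^bsub>K\<^esub> Add K g g' = Add K (f \<cdot>\<^bsub>K\<^esub> g) (f \<cdot>\<^bsub>K\<^esub> g')"
    if "f \<in> Hom K X Y" "g \<in> Hom K Y Z" "g' \<in> Hom K Y Z" for f g g' X Y Z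
    using K_hom_eqI[OF K_comp(1)[OF that(1) K_add(1)[OF that(2,3)]] K_add(1)[OF K_comp(1)[OF that(1,2)] K_comp(1)[OF that(1,3)]]]
      K_comp(2)[OF that(1) K_add(1)[OF that(2,3)]] K_add(2)[OF K_comp(1)[OF that(1,2)] K_comp(1)[OF that(1,3)]]
      K_comp(2)[OF that(1,2)] K_comp(2)[OF that(1,3)] K_add(2)[OF that(2,3)] by (simp add: algebra_simps)
  show "\<exists>S ins prj. direct_sum K n X S ins prj" if "\<And>k. k < n \<Longrightarrow> X k \<in> Ob K" for n :: nat and X
    by (rule K_direct_sums) (use that in simp)
qed

end

section \<open>Cohomology\<close>

context abelian_in_ring
begin

text \<open>Naming scheme: \<open>z\<close> for cocycles and \<open>h\<close> for cohomology,
  followed by \<open>o\<close> for object, \<open>i\<close> for inclusion, \<open>p\<close> for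
  projection, \<open>m\<close> for the induced morphism; \<open>bd\<close> is the coboundary. Apart
  from the objects these are ring images of the chosen morphisms.\<close>

definition zo where "zo X n = Src A (cocycles_incl A X n)"
definition zi where "zi X n = E (cocycles_incl A X n)"
definition bd where "bd X n = E (coboundary A X n)"
definition ho where "ho X n = cohomology_ob A X n"
definition hp where "hp X n = E (cohomology_proj A X n)"
definition zm where "zm f n = E (cocycles_mor A f n)"
definition hm where "hm f n = E (cohomology_mor A f n)"

lemma zi_ker:
  assumes X: "X \<in> complexes A"
  shows "ker (obj X n) (obj X (n + 1)) (d X n) (zo X n) (zi X n)"
    "is_kernel A (diff X n) (cocycles_incl A X n)"
proof -
  have f: "diff X n \<in> Hom A (obj X n) (obj X (n + 1))" using complexD[OF X] by blast
  have "\<exists>k. is_kernel A (diff X n) k" using kernels HomD(1)[OF f] by blast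
  then show "is_kernel A (diff X n) (cocycles_incl A X n)" unfolding cocycles_incl_def by (rule someI_ex)
  from ker_of_is_kernel[OF this] show "ker (obj X n) (obj X (n + 1)) (d X n) (zo X n) (zi X n)"
    using HomD(1-3)[OF f] by (simp add: zo_def zi_def d_def)
qed

lemma zi_hom: "X \<in> complexes A \<Longrightarrow> cocycles_incl A X n \<in> Hom A (zo X n) (obj X n)"
  using zi_ker(2)[of X n] complexD(2)[of X n] by (auto simp: is_kernel_def Hom_def zo_def)

text \<open>The coboundary and the map on cocycles are selected by \<open>THE\<close>. As
  \<open>k\<close> is monic, the condition determines the morphism, so exhibiting a factor
  \<open>u\<close> in the ring identifies the selected one.\<close>

lemma the_factor:
  assumes k: "k \<in> Hom A Z Y" and m: "monic Z Y (E k)" and g: "g \<in> Hom A X Y"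
    and u: "u \<in> H X Z" "u * E k = E g"
  defines "t \<equiv> THE v. v \<in> Hom A X Z \<and> v \<cdot> k = g"
  shows "t \<in> Hom A X Z" "E t = u"
proof -
  obtain v where v: "v \<in> Hom A X Z" "u = E v" using u(1) by (rule H_E)
  have iff: "w \<in> Hom A X Z \<and> w \<cdot> k = g \<longleftrightarrow> w = v" for w
  proof
    assume w: "w \<in> Hom A X Z \<and> w \<cdot> k = g"
    then have "E w * E k = E v * E k" using E_comp[OF conjunct1[OF w] k] u v by simp
    then show "w = v" using monic_cancel[OF m] E_inj w v E_H by blast
  next
    assume "w = v"
    then show "w \<in> Hom A X Z \<and> w \<cdot> k = g"
      using v u E_comp[OF v(1) k] E_inj[OF comp_closed[OF v(1) k] g] by simp
  qed
  show "t \<in> Hom A X Z" "E t = u" unfolding t_def iff using v by simp_all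
qed

lemma the_cofactor:
  assumes k: "k \<in> Hom A Y Z" and m: "epic Y Z (E k)" and g: "g \<in> Hom A Y X"
    and u: "u \<in> H Z X" "E k * u = E g"
  defines "t \<equiv> THE v. v \<in> Hom A Z X \<and> k \<cdot> v = g"
  shows "t \<in> Hom A Z X" "E t = u"
proof -
  obtain v where v: "v \<in> Hom A Z X" "u = E v" using u(1) by (rule H_E)
  have iff: "w \<in> Hom A Z X \<and> k \<cdot> w = g \<longleftrightarrow> w = v" for w
  proof
    assume w: "w \<in> Hom A Z X \<and> k \<cdot> w = g"
    then have "E k * E w = E k * E v" using E_comp[OF k conjunct1[OF w]] u v by simp
    then show "w = v" using epic_cancel[OF m] E_inj w v E_H by blast
  next
    assume "w = v"
    then show "w \<in> Hom A Z X \<and> k \<cdot> w = g"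
      using v u E_comp[OF k v(1)] E_inj[OF comp_closed[OF k v(1)] g] by simp
  qed
  show "t \<in> Hom A Z X" "E t = u" unfolding t_def iff using v by simp_all
qed

lemma bd:
  assumes X: "X \<in> complexes A"
  shows "coboundary A X n \<in> Hom A (obj X (n - 1)) (zo X n)" "bd X n \<in> H (obj X (n - 1)) (zo X n)"
    "bd X n * zi X n = d X (n - 1)"
proof -
  note k = zi_ker(1)[OF X, of n]
  have g: "diff X (n - 1) \<in> Hom A (obj X (n - 1)) (obj X n)" using complexD(2)[OF X, of "n - 1"] by simp
  obtain u where u: "u \<in> H (obj X (n - 1)) (zo X n)" "u * zi X n = d X (n - 1)"
    using kerE[OF k complexD(5,6)[OF X]] by blast
  have "u * E (cocycles_incl A X n) = E (diff X (n - 1))" using u by (simp add: zi_def d_def)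
  from the_factor[OF zi_hom[OF X] kerD(3)[OF k, unfolded zi_def] g u(1) this]
  have t: "coboundary A X n \<in> Hom A (obj X (n - 1)) (zo X n)" "E (coboundary A X n) = u"
    unfolding coboundary_def zo_def by auto
  show "coboundary A X n \<in> Hom A (obj X (n - 1)) (zo X n)" by (rule t)
  then show "bd X n \<in> H (obj X (n - 1)) (zo X n)" "bd X n * zi X n = d X (n - 1)"
    using t u by (simp_all add: bd_def)
qed

lemma hp_coker:
  assumes X: "X \<in> complexes A"
  shows "coker (obj X (n - 1)) (zo X n) (bd X n) (ho X n) (hp X n)"
    "cohomology_proj A X n \<in> Hom A (zo X n) (ho X n)"
proof -
  note f = bd(1)[OF X, of n]
  have "\<exists>k. is_cokernel A (coboundary A X n) k" using cokernels HomD(1)[OF f] by blast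
  then have k: "is_cokernel A (coboundary A X n) (cohomology_proj A X n)" unfolding cohomology_proj_def by (rule someI_ex)
  from coker_of_is_cokernel[OF this] show "coker (obj X (n - 1)) (zo X n) (bd X n) (ho X n) (hp X n)"
    using HomD(1-3)[OF f] by (simp add: ho_def hp_def bd_def cohomology_ob_def)
  show "cohomology_proj A X n \<in> Hom A (zo X n) (ho X n)"
    using k HomD(1-3)[OF f] by (auto simp: is_cokernel_def Hom_def ho_def cohomology_ob_def)
qed

lemma zm:
  assumes f: "f \<in> Hom K X Y"
  shows "cocycles_mor A f n \<in> Hom A (zo X n) (zo Y n)" "zm f n \<in> H (zo X n) (zo Y n)"
    "zm f n * zi Y n = zi X n * c f n" "bd X n * zm f n = c f (n - 1) * bd Y n"
proof -
  note XY = K_homD(1,2)[OF f] and kX = zi_ker(1)[OF K_homD(1)[OF f], of n] and kY = zi_ker(1)[OF K_homD(2)[OF f], of n]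
  have g: "cocycles_incl A X n \<cdot> component f n \<in> Hom A (zo X n) (obj Y n)"
    using comp_closed zi_hom XY K_homD(6)[OF f] by blast
  have Eg: "E (cocycles_incl A X n \<cdot> component f n) = zi X n * c f n"
    using E_comp[OF zi_hom[OF XY(1)] K_homD(6)[OF f]] by (simp add: zi_def c_def)
  have "zi X n * c f n * d Y n = zi X n * d X n * c f (n + 1)"
    using K_homD(8)[OF f, of n] by (simp add: mult.assoc)
  also have "\<dots> = 0" using kerD(4)[OF kX] by simp
  finally obtain u where u: "u \<in> H (zo X n) (zo Y n)" "u * zi Y n = zi X n * c f n"
    using kerE[OF kY mult_H[OF kerD(2)[OF kX] K_homD(7)[OF f]]] by blast
  have "u * E (cocycles_incl A Y n) = E (cocycles_incl A X n \<cdot> component f n)" using u Eg by (simp add: zi_def)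
  from the_factor[OF zi_hom[OF XY(2)] kerD(3)[OF kY, unfolded zi_def] g u(1) this]
  have t: "cocycles_mor A f n \<in> Hom A (zo X n) (zo Y n)" "E (cocycles_mor A f n) = u"
    unfolding cocycles_mor_def K_homD(3,4)[OF f] zo_def by auto
  show "cocycles_mor A f n \<in> Hom A (zo X n) (zo Y n)" by (rule t)
  show zmH: "zm f n \<in> H (zo X n) (zo Y n)" and z: "zm f n * zi Y n = zi X n * c f n"
    using t u by (simp_all add: zm_def)
  show "bd X n * zm f n = c f (n - 1) * bd Y n"
  proof (rule monic_cancel[OF kerD(3)[OF kY]])
    show "bd X n * zm f n \<in> H (obj X (n - 1)) (zo Y n)" using bd(2)[OF XY(1)] zmH by blast
    show "c f (n - 1) * bd Y n \<in> H (obj X (n - 1)) (zo Y n)" using bd(2)[OF XY(2)] K_homD(7)[OF f, of "n - 1"] by blast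
    have "bd X n * zm f n * zi Y n = bd X n * zi X n * c f n" using z by (simp add: mult.assoc)
    also have "\<dots> = d X (n - 1) * c f n" using bd(3)[OF XY(1), of n] by simp
    also have "\<dots> = c f (n - 1) * bd Y n * zi Y n"
      using K_homD(9)[OF f, of n] bd(3)[OF XY(2), of n] by (simp add: mult.assoc)
    finally show "bd X n * zm f n * zi Y n = c f (n - 1) * bd Y n * zi Y n" .
  qed
qed

lemma hm:
  assumes f: "f \<in> Hom K X Y"
  shows "cohomology_mor A f n \<in> Hom A (ho X n) (ho Y n)" "hm f n \<in> H (ho X n) (ho Y n)"
    "hp X n * hm f n = zm f n * hp Y n"
proof -
  note XY = K_homD(1,2)[OF f] and qX = hp_coker[OF K_homD(1)[OF f], of n] and qY = hp_coker[OF K_homD(2)[OF f], of n]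
  have g: "cocycles_mor A f n \<cdot> cohomology_proj A Y n \<in> Hom A (zo X n) (ho Y n)"
    using comp_closed zm(1)[OF f] qY(2) by blast
  have Eg: "E (cocycles_mor A f n \<cdot> cohomology_proj A Y n) = zm f n * hp Y n"
    using E_comp[OF zm(1)[OF f] qY(2)] by (simp add: zm_def hp_def)
  have "bd X n * (zm f n * hp Y n) = c f (n - 1) * (bd Y n * hp Y n)"
    using zm(4)[OF f, of n] by (simp add: mult.assoc[symmetric])
  also have "\<dots> = 0" using cokerD(4)[OF qY(1)] by simp
  finally obtain u where u: "u \<in> H (ho X n) (ho Y n)" "hp X n * u = zm f n * hp Y n"
    using cokerE[OF qX(1) mult_H[OF zm(2)[OF f] cokerD(2)[OF qY(1)]]] by blast
  have "E (cohomology_proj A X n) * u = E (cocycles_mor A f n \<cdot> cohomology_proj A Y n)" using u Eg by (simp add: hp_def)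
  from the_cofactor[OF qX(2) cokerD(3)[OF qX(1), unfolded hp_def] g u(1) this]
  have t: "cohomology_mor A f n \<in> Hom A (ho X n) (ho Y n)" "E (cohomology_mor A f n) = u"
    unfolding cohomology_mor_def K_homD(3,4)[OF f] ho_def by auto
  show "cohomology_mor A f n \<in> Hom A (ho X n) (ho Y n)" by (rule t)
  show "hm f n \<in> H (ho X n) (ho Y n)" "hp X n * hm f n = zm f n * hp Y n"
    using t u by (simp_all add: hm_def)
qed

text \<open>\<open>zi Y n\<close> is monic and \<open>hp X n\<close> is epic, so the two equations
  determine \<open>z\<close> and \<open>x\<close>. Functoriality and additivity of cohomology thus
  reduce to naming the right \<open>z\<close> and \<open>x\<close>.\<close>

lemma hm_eqI:
  assumes f: "f \<in> Hom K X Y" and z: "z \<in> H (zo X n) (zo Y n)" "z * zi Y n = zi X n * c f n"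
    and x: "x \<in> H (ho X n) (ho Y n)" "hp X n * x = z * hp Y n"
  shows "hm f n = x"
proof -
  have "zm f n = z"
    by (rule monic_cancel[OF kerD(3)[OF zi_ker(1)[OF K_homD(2)[OF f]]] zm(2)[OF f] z(1)])
      (use zm(3)[OF f] z(2) in simp)
  then show ?thesis
    using epic_cancel[OF cokerD(3)[OF hp_coker(1)[OF K_homD(1)[OF f]]] hm(2)[OF f] x(1)] hm(3)[OF f] x(2) by simp
qed

lemma zi_H: "X \<in> complexes A \<Longrightarrow> zi X n \<in> H (zo X n) (obj X n)"
  and hp_H: "X \<in> complexes A \<Longrightarrow> hp X n \<in> H (zo X n) (ho X n)"
  using kerD(2)[OF zi_ker(1)] cokerD(2)[OF hp_coker(1)] by blast+

lemma zo_ho_ob: "X \<in> complexes A \<Longrightarrow> zo X n \<in> Ob A" "X \<in> complexes A \<Longrightarrow> ho X n \<in> Ob A"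
  using H_ob[OF hp_H] by blast+

lemma hm_id: assumes X: "X \<in> complexes A" shows "hm (Idn K X) n = un (ho X n)"
  by (rule hm_eqI[OF K_idn(1)[OF X], of "un (zo X n)"])
    (use zo_ho_ob[OF X] un_left[OF zi_H[OF X]] un_right[OF zi_H[OF X]] un_left[OF hp_H[OF X]]
       un_right[OF hp_H[OF X]] K_idn(2)[OF X] in simp_all)

lemma hm_comp:
  assumes f: "f \<in> Hom K X Y" and g: "g \<in> Hom K Y Z" shows "hm (f \<cdot>\<^bsub>K\<^esub> g) n = hm f n * hm g n"
proof (rule hm_eqI[OF K_comp(1)[OF f g]])
  show "zm f n * zm g n \<in> H (zo X n) (zo Z n)" "hm f n * hm g n \<in> H (ho X n) (ho Z n)"
    using zm(2)[OF f] zm(2)[OF g] hm(2)[OF f] hm(2)[OF g] by blast+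
  have "zm f n * zm g n * zi Z n = zm f n * zi Y n * c g n" using zm(3)[OF g, of n] by (simp add: mult.assoc)
  also have "\<dots> = zi X n * c (f \<cdot>\<^bsub>K\<^esub> g) n" using zm(3)[OF f, of n] K_comp(2)[OF f g] by (simp add: mult.assoc)
  finally show "zm f n * zm g n * zi Z n = zi X n * c (f \<cdot>\<^bsub>K\<^esub> g) n" .
  have "hp X n * (hm f n * hm g n) = zm f n * (hp Y n * hm g n)" using hm(3)[OF f, of n] by (simp add: mult.assoc[symmetric])
  also have "\<dots> = zm f n * zm g n * hp Z n" using hm(3)[OF g, of n] by (simp add: mult.assoc)
  finally show "hp X n * (hm f n * hm g n) = zm f n * zm g n * hp Z n" .
qed

lemma hm_add:
  assumes f: "f \<in> Hom K X Y" and g: "g \<in> Hom K X Y" shows "hm (Add K f g) n = hm f n + hm g n"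
  by (rule hm_eqI[OF K_add(1)[OF f g], of "zm f n + zm g n"])
    (use zm(2,3)[OF f] zm(2,3)[OF g] hm(2,3)[OF f] hm(2,3)[OF g] K_add(2)[OF f g] in \<open>auto simp: algebra_simps\<close>)

lemma hm_zer:
  assumes "X \<in> complexes A" "Y \<in> complexes A" shows "hm (Zer K X Y) n = 0"
  by (rule hm_eqI[OF K_zer(1)[OF assms], of 0]) (use zo_ho_ob assms K_zer(2)[OF assms] in auto)

section \<open>Cohomology as a functor to graded objects, and isomorphisms there\<close>

abbreviation G where "G \<equiv> graded_cat A"

lemma G_simps [simp]: "Ob G = {X. \<forall>n. X n \<in> Ob A}" "Mor G = {f. \<forall>n. f n \<in> Mor A}"
  "Src G f = (\<lambda>n. Src A (f n))" "Tgt G f = (\<lambda>n. Tgt A (f n))" "Idn G X = (\<lambda>n. Idn A (X n))"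
  "f' \<cdot>\<^bsub>G\<^esub> g' = (\<lambda>n. f' n \<cdot> g' n)"
  by (simp_all add: graded_cat_def)

lemma G_hom: "f \<in> Hom G X Y \<longleftrightarrow> (\<forall>n. f n \<in> Hom A (X n) (Y n))"
  by (auto simp: Hom_def)

lemma G_category: "category G"
proof
  show "f \<cdot>\<^bsub>G\<^esub> g \<cdot>\<^bsub>G\<^esub> h = f \<cdot>\<^bsub>G\<^esub> (g \<cdot>\<^bsub>G\<^esub> h)" if "f \<in> Hom G W X" "g \<in> Hom G X Y" "h \<in> Hom G Y Z" for f g h W X Y Z
  proof -
    have "f n \<cdot> g n \<cdot> h n = f n \<cdot> (g n \<cdot> h n)" for n using comp_assoc that unfolding G_hom by blast
    then show ?thesis by simp
  qed
  show "f \<cdot>\<^bsub>G\<^esub> g \<in> Hom G X Z" if "f \<in> Hom G X Y" "g \<in> Hom G Y Z" for f g X Y Z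
    using that comp_closed unfolding G_hom G_simps by blast
qed (auto simp: G_hom id_closed)

sublocale coh: is_functor K G "cohomology_ob A" "cohomology_mor A"
proof (intro is_functor.intro K_category G_category is_functor_axioms.intro)
  have ho: "cohomology_ob A X = ho X" for X by (simp add: fun_eq_iff ho_def)
  show "cohomology_ob A X \<in> Ob G" if "X \<in> Ob K" for X using zo_ho_ob(2) that by (simp add: ho)
  show m: "cohomology_mor A f \<in> Hom G (cohomology_ob A (Src K f)) (cohomology_ob A (Tgt K f))" if "f \<in> Mor K" for f
    unfolding G_hom ho using hm(1)[of f "Src K f" "Tgt K f"] that by (simp add: Hom_def)
  show "cohomology_mor A (Idn K X) = Idn G (cohomology_ob A X)" if "X \<in> Ob K" for X
  proof
    fix n
    have X: "X \<in> complexes A" using that by simp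
    show "cohomology_mor A (Idn K X) n = Idn G (cohomology_ob A X) n"
      by (rule E_inj[OF hm(1)[OF K_idn(1)[OF X]]])
        (use id_closed zo_ho_ob[OF X] hm_id[OF X, of n] in \<open>simp_all add: ho hm_def un_def\<close>)
  qed
  show "cohomology_mor A (f \<cdot>\<^bsub>K\<^esub> g) = cohomology_mor A f \<cdot>\<^bsub>G\<^esub> cohomology_mor A g"
    if "f \<in> Mor K" "g \<in> Mor K" "Tgt K f = Src K g" for f g
  proof
    fix n
    have f: "f \<in> Hom K (source f) (target f)" and g: "g \<in> Hom K (target f) (target g)" using that by (auto simp: Hom_def)
    show "cohomology_mor A (f \<cdot>\<^bsub>K\<^esub> g) n = (cohomology_mor A f \<cdot>\<^bsub>G\<^esub> cohomology_mor A g) n"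
      by (rule E_inj[OF hm(1)[OF K_comp(1)[OF f g]]])
        (use comp_closed[OF hm(1)[OF f] hm(1)[OF g]] E_comp[OF hm(1)[OF f] hm(1)[OF g]] hm_comp[OF f g, of n] in \<open>simp_all add: hm_def\<close>)
  qed
qed

lemma is_iso_ring:
  assumes f: "f \<in> Hom A X Y"
  shows "is_iso A f \<longleftrightarrow> (\<exists>y \<in> H Y X. E f * y = un X \<and> y * E f = un Y)"
proof
  assume "is_iso A f"
  then obtain g where g: "g \<in> Hom A Y X" "f \<cdot> g = Idn A X" "g \<cdot> f = Idn A Y"
    using HomD(2,3)[OF f] by (auto simp: is_iso_def)
  then show "\<exists>y \<in> H Y X. E f * y = un X \<and> y * E f = un Y"
    using E_comp[OF f g(1)] E_comp[OF g(1) f] by (intro bexI[of _ "E g"]) (auto simp: un_def)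
next
  assume "\<exists>y \<in> H Y X. E f * y = un X \<and> y * E f = un Y"
  then obtain g where g: "g \<in> Hom A Y X" "E f * E g = un X" "E g * E f = un Y" by (auto elim!: H_E)
  have "f \<cdot> g = Idn A X"
    by (rule E_inj[OF comp_closed[OF f g(1)] id_closed[OF HomD(4)[OF f]]]) (use E_comp[OF f g(1)] g in \<open>simp add: un_def\<close>)
  moreover have "g \<cdot> f = Idn A Y"
    by (rule E_inj[OF comp_closed[OF g(1) f] id_closed[OF HomD(5)[OF f]]]) (use E_comp[OF g(1) f] g in \<open>simp add: un_def\<close>)
  ultimately show "is_iso A f" using g(1) HomD(1-3)[OF f] by (auto simp: is_iso_def)
qed

lemma is_iso_graded: "is_iso G F \<longleftrightarrow> (\<forall>n. is_iso A (F n))"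
proof
  assume "is_iso G F"
  then obtain g where "\<forall>n. F n \<in> Mor A" "\<forall>n. g n \<in> Hom A (Tgt A (F n)) (Src A (F n))"
    "(\<lambda>n. F n \<cdot> g n) = (\<lambda>n. Idn A (Src A (F n)))" "(\<lambda>n. g n \<cdot> F n) = (\<lambda>n. Idn A (Tgt A (F n)))"
    by (auto simp: is_iso_def G_hom)
  then show "\<forall>n. is_iso A (F n)" unfolding is_iso_def fun_eq_iff by blast
next
  assume iso: "\<forall>n. is_iso A (F n)"
  then have "\<forall>n. \<exists>g. g \<in> Hom A (Tgt A (F n)) (Src A (F n)) \<and> F n \<cdot> g = Idn A (Src A (F n)) \<and> g \<cdot> F n = Idn A (Tgt A (F n))"
    unfolding is_iso_def by blast
  then obtain g where "\<forall>n. g n \<in> Hom A (Tgt A (F n)) (Src A (F n)) \<and> F n \<cdot> g n = Idn A (Src A (F n)) \<and> g n \<cdot> F n = Idn A (Tgt A (F n))"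
    by (metis (no_types))
  then show "is_iso G F" using iso by (auto simp: is_iso_def G_hom intro!: bexI[of _ g])
qed

lemma Den_iff_inverse:
  assumes f: "f \<in> Hom K X Y"
  shows "f \<in> complex_Den A \<longleftrightarrow> (\<forall>n. \<exists>y \<in> H (ho Y n) (ho X n). hm f n * y = un (ho X n) \<and> y * hm f n = un (ho Y n))"
  using K_homD(5)[OF f] is_iso_ring[OF hm(1)[OF f]] by (simp add: complex_Den_def is_iso_graded hm_def)

subsection \<open>Quasi-isomorphisms by diagram chasing\<close>

text \<open>The cover \<open>s\<close> accounts for lifts along epimorphisms, which exist only after
  a change of the domain. Neither this notion nor \<open>coh_inj\<close> mentions a chosen kernel or
  cokernel, so quasi-isomorphisms can be recognised without computing cohomology objects.\<close>

definition coh_surj where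
  "coh_surj X Y f n \<longleftrightarrow> (\<forall>T. \<forall>y \<in> H T (obj Y n). y * d Y n = 0 \<longrightarrow>
    (\<exists>T' s. epic T' T s \<and> (\<exists>x \<in> H T' (obj X n). \<exists>w \<in> H T' (obj Y (n - 1)). x * d X n = 0 \<and> s * y = x * c f n + w * d Y (n - 1))))"

definition coh_inj where
  "coh_inj X Y f n \<longleftrightarrow> (\<forall>T. \<forall>x \<in> H T (obj X n). \<forall>w \<in> H T (obj Y (n - 1)). x * d X n = 0 \<longrightarrow> x * c f n = w * d Y (n - 1) \<longrightarrow>
    (\<exists>T' s. epic T' T s \<and> (\<exists>v \<in> H T' (obj X (n - 1)). s * x = v * d X (n - 1))))"

text \<open>If \<open>hm f n\<close> is epic, the class of \<open>y\<close> is lifted along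
  \<open>hp X n * hm f n\<close>, and the error, having class zero, is a coboundary after a second
  cover. Conversely, the criterion is applied to the universal cocycle \<open>zi Y n\<close>: the
  resulting cover, followed by \<open>hp Y n\<close>, is epic and factors through
  \<open>hm f n\<close>.\<close>

lemma hm_epic:
  assumes f: "f \<in> Hom K X Y"
  shows "epic (ho X n) (ho Y n) (hm f n) \<longleftrightarrow> coh_surj X Y f n"
proof
  note XY = K_homD(1,2)[OF f]
  note kX = zi_ker(1)[OF XY(1), of n] and kY = zi_ker(1)[OF XY(2), of n]
  note qX = hp_coker(1)[OF XY(1), of n] and qY = hp_coker(1)[OF XY(2), of n]
  assume e: "epic (ho X n) (ho Y n) (hm f n)"
  show "coh_surj X Y f n"
    unfolding coh_surj_def
  proof (intro allI ballI impI)
    fix T y assume y: "y \<in> H T (obj Y n)" "y * d Y n = 0"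
    obtain y' where y': "y' \<in> H T (zo Y n)" "y' * zi Y n = y" using kerE[OF kY y] by blast
    have e': "epic (zo X n) (ho Y n) (hp X n * hm f n)" by (rule epic_comp[OF cokerD(3)[OF qX] e])
    obtain T1 s x where x: "epic T1 T s" "x \<in> H T1 (zo X n)" "s * (y' * hp Y n) = x * (hp X n * hm f n)"
      using pullback_epic[OF e' mult_H[OF y'(1) cokerD(2)[OF qY]]] by metis
    have xz: "x * zm f n \<in> H T1 (zo Y n)" using x(2) zm(2)[OF f] by blast
    have "(s * y' - x * zm f n) * hp Y n = 0"
      using x(3) hm(3)[OF f, of n] by (simp add: algebra_simps)
    then obtain T2 s2 w where w: "epic T2 T1 s2" "w \<in> H T2 (obj Y (n - 1))" "s2 * (s * y' - x * zm f n) = w * bd Y n"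
      using coker_exact[OF qY diff_H[OF mult_H[OF epicD(1)[OF x(1)] y'(1)] xz]] by metis
    have "s2 * s * y = s2 * (s * y' - x * zm f n) * zi Y n + s2 * x * (zm f n * zi Y n)"
      unfolding y'(2)[symmetric] by (simp add: algebra_simps)
    also have "\<dots> = w * (bd Y n * zi Y n) + s2 * x * (zi X n * c f n)"
      unfolding w(3) zm(3)[OF f] by (simp add: mult.assoc)
    finally have eq: "s2 * s * y = s2 * x * zi X n * c f n + w * d Y (n - 1)"
      unfolding bd(3)[OF XY(2)] by (simp add: mult.assoc add.commute)
    have "s2 * x * zi X n \<in> H T2 (obj X n)" "s2 * x * zi X n * d X n = 0"
      using mult_H[OF mult_H[OF epicD(1)[OF w(1)] x(2)] kerD(2)[OF kX]] kerD(4)[OF kX] by (simp_all add: mult.assoc)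
    then show "\<exists>T' s. epic T' T s \<and> (\<exists>x \<in> H T' (obj X n). \<exists>w \<in> H T' (obj Y (n - 1)). x * d X n = 0 \<and> s * y = x * c f n + w * d Y (n - 1))"
      using epic_comp[OF w(1) x(1)] eq w(2) by blast
  qed
next
  note XY = K_homD(1,2)[OF f]
  note kX = zi_ker(1)[OF XY(1), of n] and kY = zi_ker(1)[OF XY(2), of n]
  note qX = hp_coker(1)[OF XY(1), of n] and qY = hp_coker(1)[OF XY(2), of n]
  assume surj: "coh_surj X Y f n"
  obtain T s x w where t: "epic T (zo Y n) s" "x \<in> H T (obj X n)" "w \<in> H T (obj Y (n - 1))" "x * d X n = 0"
    "s * zi Y n = x * c f n + w * d Y (n - 1)"
    using surj[unfolded coh_surj_def, rule_format, OF kerD(2)[OF kY] kerD(4)[OF kY]] by blast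
  obtain x' where x': "x' \<in> H T (zo X n)" "x' * zi X n = x" using kerE[OF kX t(2,4)] by blast
  have "s = x' * zm f n + w * bd Y n"
  proof (rule monic_cancel[OF kerD(3)[OF kY] epicD(1)[OF t(1)]])
    show "x' * zm f n + w * bd Y n \<in> H T (zo Y n)" using x'(1) zm(2)[OF f] t(3) bd(2)[OF XY(2)] by blast
    have "s * zi Y n = x' * (zi X n * c f n) + w * (bd Y n * zi Y n)"
      unfolding t(5) bd(3)[OF XY(2)] x'(2)[symmetric] by (simp add: mult.assoc)
    then show "s * zi Y n = (x' * zm f n + w * bd Y n) * zi Y n"
      unfolding zm(3)[OF f, symmetric] by (simp add: algebra_simps)
  qed
  then have "s * hp Y n = x' * (zm f n * hp Y n) + w * (bd Y n * hp Y n)" by (simp add: algebra_simps)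
  then have eq: "s * hp Y n = x' * hp X n * hm f n"
    using hm(3)[OF f, of n] cokerD(4)[OF qY] by (simp add: mult.assoc)
  have "epic T (ho Y n) (s * hp Y n)" by (rule epic_comp[OF t(1) cokerD(3)[OF qY]])
  from epic_of_comp[OF this[unfolded eq] mult_H[OF x'(1) cokerD(2)[OF qX]] hm(2)[OF f]]
  show "epic (ho X n) (ho Y n) (hm f n)" .
qed

text \<open>If \<open>hm f n\<close> is monic, the class of \<open>x\<close> vanishes, which makes
  \<open>x\<close> a coboundary after a cover. Conversely, an element \<open>t\<close> of cohomology
  is represented by a cocycle, whose image is a coboundary, so that the cocycle itself is one. Each
  of these steps costs a cover; the product of the three covers is epic and kills
  \<open>t\<close>.\<close>

lemma hm_monic:
  assumes f: "f \<in> Hom K X Y"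
  shows "monic (ho X n) (ho Y n) (hm f n) \<longleftrightarrow> coh_inj X Y f n"
proof
  note XY = K_homD(1,2)[OF f]
  note kX = zi_ker(1)[OF XY(1), of n] and kY = zi_ker(1)[OF XY(2), of n]
  note qX = hp_coker(1)[OF XY(1), of n] and qY = hp_coker(1)[OF XY(2), of n]
  assume m: "monic (ho X n) (ho Y n) (hm f n)"
  show "coh_inj X Y f n"
    unfolding coh_inj_def
  proof (intro allI ballI impI)
    fix T x w assume x: "x \<in> H T (obj X n)" "w \<in> H T (obj Y (n - 1))" "x * d X n = 0" "x * c f n = w * d Y (n - 1)"
    obtain x' where x': "x' \<in> H T (zo X n)" "x' * zi X n = x" using kerE[OF kX x(1,3)] by blast
    have "x' * zm f n = w * bd Y n"
    proof (rule monic_cancel[OF kerD(3)[OF kY]])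
      show "x' * zm f n \<in> H T (zo Y n)" "w * bd Y n \<in> H T (zo Y n)" using x'(1) zm(2)[OF f] x(2) bd(2)[OF XY(2)] by blast+
      have "x' * zm f n * zi Y n = x' * zi X n * c f n" using zm(3)[OF f, of n] by (simp add: mult.assoc)
      then show "x' * zm f n * zi Y n = w * bd Y n * zi Y n"
        unfolding x'(2) x(4) using bd(3)[OF XY(2), of n] by (simp add: mult.assoc)
    qed
    then have "x' * hp X n * hm f n = w * (bd Y n * hp Y n)"
      using hm(3)[OF f, of n] by (simp add: mult.assoc) (simp add: mult.assoc[symmetric])
    then have "x' * hp X n * hm f n = 0" using cokerD(4)[OF qY] by simp
    then have "x' * hp X n = 0" using monicD(2)[OF m mult_H[OF x'(1) cokerD(2)[OF qX]]] by simp
    then obtain T' s v where s: "epic T' T s" "v \<in> H T' (obj X (n - 1))" "s * x' = v * bd X n"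
      using coker_exact[OF qX x'(1)] by metis
    have "s * x = v * d X (n - 1)"
      unfolding x'(2)[symmetric] bd(3)[OF XY(1), of n, symmetric] mult.assoc[symmetric] s(3) ..
    then show "\<exists>T' s. epic T' T s \<and> (\<exists>v \<in> H T' (obj X (n - 1)). s * x = v * d X (n - 1))" using s by blast
  qed
next
  note XY = K_homD(1,2)[OF f]
  note kX = zi_ker(1)[OF XY(1), of n] and kY = zi_ker(1)[OF XY(2), of n]
  note qX = hp_coker(1)[OF XY(1), of n] and qY = hp_coker(1)[OF XY(2), of n]
  assume inj: "coh_inj X Y f n"
  show "monic (ho X n) (ho Y n) (hm f n)"
    unfolding monic_def
  proof (intro conjI allI ballI impI hm(2)[OF f])
    fix T t assume t: "t \<in> H T (ho X n)" "t * hm f n = 0"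
    obtain T1 s x where x: "epic T1 T s" "x \<in> H T1 (zo X n)" "s * t = x * hp X n"
      using pullback_epic[OF cokerD(3)[OF qX] t(1)] by metis
    have "x * zm f n * hp Y n = x * hp X n * hm f n" using hm(3)[OF f, of n] by (simp add: mult.assoc)
    also have "\<dots> = 0" unfolding x(3)[symmetric] using t(2) by (simp add: mult.assoc)
    finally obtain T2 s2 w where w: "epic T2 T1 s2" "w \<in> H T2 (obj Y (n - 1))" "s2 * (x * zm f n) = w * bd Y n"
      using coker_exact[OF qY mult_H[OF x(2) zm(2)[OF f]]] by metis
    have sx: "s2 * x \<in> H T2 (zo X n)" using epicD(1)[OF w(1)] x(2) by blast
    have 1: "s2 * x * zi X n \<in> H T2 (obj X n)" using sx kerD(2)[OF kX] by blast
    have 2: "s2 * x * zi X n * d X n = 0" using kerD(4)[OF kX] by (simp add: mult.assoc)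
    have "s2 * x * zi X n * c f n = s2 * (x * zm f n) * zi Y n" using zm(3)[OF f, of n] by (simp add: mult.assoc)
    then have 3: "s2 * x * zi X n * c f n = w * d Y (n - 1)" unfolding w(3) using bd(3)[OF XY(2), of n] by (simp add: mult.assoc)
    obtain T3 s3 v where v: "epic T3 T2 s3" "v \<in> H T3 (obj X (n - 1))" "s3 * (s2 * x * zi X n) = v * d X (n - 1)"
      using inj[unfolded coh_inj_def, rule_format, OF 1 w(2) 2 3] by blast
    have "s3 * (s2 * x) = v * bd X n"
    proof (rule monic_cancel[OF kerD(3)[OF kX]])
      show "s3 * (s2 * x) \<in> H T3 (zo X n)" "v * bd X n \<in> H T3 (zo X n)"
        using epicD(1)[OF v(1)] sx v(2) bd(2)[OF XY(1)] by blast+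
      show "s3 * (s2 * x) * zi X n = v * bd X n * zi X n"
        using v(3) bd(3)[OF XY(1), of n] by (simp add: mult.assoc)
    qed
    then have "s3 * (s2 * x) * hp X n = v * (bd X n * hp X n)" by (simp add: mult.assoc)
    then have "s3 * s2 * s * t = 0" using x(3) cokerD(4)[OF qX] by (simp add: mult.assoc)
    moreover have "epic T3 T (s3 * s2 * s)" by (intro epic_comp[OF epic_comp[OF v(1) w(1)] x(1)])
    ultimately show "t = 0" using epicD(2) t(1) by blast
  qed
qed

text \<open>In an abelian category a morphism that is both monic and epic is invertible, so the two
  criteria combine.\<close>

lemma Den_iff_chase:
  assumes f: "f \<in> Hom K X Y"
  shows "f \<in> complex_Den A \<longleftrightarrow> (\<forall>n. coh_surj X Y f n \<and> coh_inj X Y f n)"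
proof -
  have "(\<exists>y \<in> H (ho Y n) (ho X n). hm f n * y = un (ho X n) \<and> y * hm f n = un (ho Y n)) \<longleftrightarrow>
     epic (ho X n) (ho Y n) (hm f n) \<and> monic (ho X n) (ho Y n) (hm f n)" (is "?L \<longleftrightarrow> ?R") for n
  proof
    assume ?L
    then obtain y where y: "y \<in> H (ho Y n) (ho X n)" "hm f n * y = un (ho X n)" "y * hm f n = un (ho Y n)" by blast
    have "t = 0" if "t \<in> H (ho Y n) T" "hm f n * t = 0" for t T
      using un_left[OF that(1)] that(2) y(3) by (metis mult.assoc mult_zero_right)
    moreover have "t = 0" if "t \<in> H T (ho X n)" "t * hm f n = 0" for t T
      using un_right[OF that(1)] that(2) y(2) by (metis mult.assoc mult_zero_left)
    ultimately show ?R using hm(2)[OF f] by (simp add: epic_def monic_def)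
  next
    assume ?R
    then show ?L using monic_epic_iso by metis
  qed
  then show ?thesis unfolding Den_iff_inverse[OF f] hm_epic[OF f] hm_monic[OF f] by blast
qed

end

section \<open>Quasi-isomorphisms between complexes\<close>

context category
begin

lemma is_isoE:
  assumes "is_iso C f" obtains g where "f \<in> Mor C" "g \<in> Mor C" "Src C g = Tgt C f" "Tgt C g = Src C f"
    "f \<cdot> g = Idn C (Src C f)" "g \<cdot> f = Idn C (Tgt C f)"
  using assms by (auto simp: is_iso_def Hom_def)

lemma is_isoI:
  assumes "f \<in> Mor C" "g \<in> Mor C" "Src C g = Tgt C f" "Tgt C g = Src C f"
    "f \<cdot> g = Idn C (Src C f)" "g \<cdot> f = Idn C (Tgt C f)"
  shows "is_iso C f"
  using assms by (auto simp: is_iso_def Hom_def)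

lemma iso_id: "X \<in> Ob C \<Longrightarrow> is_iso C (Idn C X)"
  by (rule is_isoI[of _ "Idn C X"]) simp_all

lemma iso_comp:
  assumes "is_iso C f" "is_iso C g" "Tgt C f = Src C g" shows "is_iso C (f \<cdot> g)"
proof -
  obtain f' where f: "f \<in> Mor C" "f' \<in> Mor C" "Src C f' = Tgt C f" "Tgt C f' = Src C f"
    "f \<cdot> f' = Idn C (Src C f)" "f' \<cdot> f = Idn C (Tgt C f)" using assms(1) by (rule is_isoE)
  obtain g' where g: "g \<in> Mor C" "g' \<in> Mor C" "Src C g' = Tgt C g" "Tgt C g' = Src C g"
    "g \<cdot> g' = Idn C (Src C g)" "g' \<cdot> g = Idn C (Tgt C g)" using assms(2) by (rule is_isoE)
  have "(f \<cdot> g) \<cdot> (g' \<cdot> f') = f \<cdot> ((g \<cdot> g') \<cdot> f')" using f(1-4) g(1-4) assms(3) by simp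
  moreover have "(g' \<cdot> f') \<cdot> (f \<cdot> g) = g' \<cdot> ((f' \<cdot> f) \<cdot> g)" using f(1-4) g(1-4) assms(3) by simp
  ultimately show ?thesis
    using f g assms(3) by (intro is_isoI[of _ "g' \<cdot> f'"]) simp_all
qed

lemma iso_cancel_left:
  assumes "is_iso C f" "is_iso C (f \<cdot> g)" "g \<in> Mor C" "Tgt C f = Src C g" shows "is_iso C g"
proof -
  obtain f' where f: "f \<in> Mor C" "f' \<in> Mor C" "Src C f' = Tgt C f" "Tgt C f' = Src C f"
    "f \<cdot> f' = Idn C (Src C f)" "f' \<cdot> f = Idn C (Tgt C f)" using assms(1) by (rule is_isoE)
  have f': "is_iso C f'" by (rule is_isoI[of _ f]) (use f in simp_all)
  have "f' \<cdot> (f \<cdot> g) = (f' \<cdot> f) \<cdot> g" using f(1-4) assms(3,4) by simp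
  also have "\<dots> = g" using f assms(3,4) by simp
  finally show ?thesis using iso_comp[OF f' assms(2)] f assms(3,4) by simp
qed

lemma iso_cancel_right:
  assumes "is_iso C g" "is_iso C (f \<cdot> g)" "f \<in> Mor C" "Tgt C f = Src C g" shows "is_iso C f"
proof -
  obtain g' where g: "g \<in> Mor C" "g' \<in> Mor C" "Src C g' = Tgt C g" "Tgt C g' = Src C g"
    "g \<cdot> g' = Idn C (Src C g)" "g' \<cdot> g = Idn C (Tgt C g)" using assms(1) by (rule is_isoE)
  have g': "is_iso C g'" by (rule is_isoI[of _ g]) (use g in simp_all)
  have "(f \<cdot> g) \<cdot> g' = f \<cdot> (g \<cdot> g')" using g(1-4) assms(3,4) by simp
  also have "\<dots> = f" using g assms(3,4) by simp
  finally show ?thesis using iso_comp[OF assms(2) g'] g assms(3,4) by simp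
qed

lemma is_mono_comp:
  assumes "is_mono C f" "is_mono C g" "Tgt C f = Src C g" shows "is_mono C (f \<cdot> g)"
proof -
  have fg: "f \<in> Mor C" "g \<in> Mor C" using assms by (auto simp: is_mono_def)
  have "h = k" if "h \<in> Hom C W (Src C f)" "k \<in> Hom C W (Src C f)" "h \<cdot> (f \<cdot> g) = k \<cdot> (f \<cdot> g)" for h k W
  proof -
    have "(h \<cdot> f) \<cdot> g = (k \<cdot> f) \<cdot> g" using that fg assms(3) by (simp add: Hom_def)
    moreover have "h \<cdot> f \<in> Hom C W (Src C g)" "k \<cdot> f \<in> Hom C W (Src C g)" using that fg assms(3) by (auto simp: Hom_def)
    ultimately have "h \<cdot> f = k \<cdot> f" using assms(2) unfolding is_mono_def by blast
    then show ?thesis using assms(1) that unfolding is_mono_def by blast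
  qed
  then show ?thesis using fg assms(3) by (simp add: is_mono_def)
qed

lemma is_epi_comp:
  assumes "is_epi C f" "is_epi C g" "Tgt C f = Src C g" shows "is_epi C (f \<cdot> g)"
proof -
  have fg: "f \<in> Mor C" "g \<in> Mor C" using assms by (auto simp: is_epi_def)
  have "h = k" if "h \<in> Hom C (Tgt C g) W" "k \<in> Hom C (Tgt C g) W" "(f \<cdot> g) \<cdot> h = (f \<cdot> g) \<cdot> k" for h k W
  proof -
    have "f \<cdot> (g \<cdot> h) = f \<cdot> (g \<cdot> k)" using that fg assms(3) by (simp add: Hom_def)
    moreover have "g \<cdot> h \<in> Hom C (Tgt C f) W" "g \<cdot> k \<in> Hom C (Tgt C f) W" using that fg assms(3) by (auto simp: Hom_def)
    ultimately have "g \<cdot> h = g \<cdot> k" using assms(1) unfolding is_epi_def by blast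
    then show ?thesis using assms(2) that unfolding is_epi_def by blast
  qed
  then show ?thesis using fg assms(3) by (simp add: is_epi_def)
qed

lemma is_mono_id: "X \<in> Ob C \<Longrightarrow> is_mono C (Idn C X)" and is_epi_id: "X \<in> Ob C \<Longrightarrow> is_epi C (Idn C X)"
  by (auto simp: is_mono_def is_epi_def Hom_def)

end

text \<open>Two out of three holds for isomorphisms and passes to preimages under a functor;
  \<open>complex_Den\<close> is such a preimage under cohomology.\<close>

lemma (in is_functor) preimage_iso_semi_saturated: "semi_saturated C {f \<in> Mor C. is_iso D (Fm f)}"
proof -
  have F: "Fm f \<in> Mor D" "Src D (Fm f) = Fo (Src C f)" "Tgt D (Fm f) = Fo (Tgt C f)" if "f \<in> Mor C" for f
    using functor_mor[OF that] by (auto simp: Hom_def)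
  show ?thesis
    unfolding semi_saturated_def multiplicative_def
    by (auto simp: functor_id functor_comp functor_ob D.iso_id F
        intro: D.iso_comp dest: D.iso_cancel_left D.iso_cancel_right)
qed

context abelian_in_ring
begin

lemma Den_semi_saturated: "semi_saturated K (complex_Den A)"
  using coh.preimage_iso_semi_saturated by (simp add: complex_Den_def)

lemma Den_mor: "f \<in> complex_Den A \<Longrightarrow> f \<in> Hom K (source f) (target f)"
  by (simp add: complex_Den_def Hom_def)

subsection \<open>Cones of identities\<close>

text \<open>Only the objects \<open>T n\<close> enter: up to isomorphism the cone of an identity
  does not depend on the differential of the original complex. In degree \<open>n\<close> it is the
  sum of \<open>T n\<close> and \<open>T (n + 1)\<close>, and its differential carries the second
  summand identically to the first summand one degree higher.\<close>

lemma cone_ex: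
  assumes T: "\<And>n. T n \<in> Ob A"
  obtains S i1 i2 p1 p2 where "S \<in> complexes A"
    "\<And>n. i1 n \<in> H (T n) (obj S n)" "\<And>n. i2 n \<in> H (T (n + 1)) (obj S n)"
    "\<And>n. p1 n \<in> H (obj S n) (T n)" "\<And>n. p2 n \<in> H (obj S n) (T (n + 1))"
    "\<And>n. i1 n * p1 n = un (T n)" "\<And>n. i2 n * p2 n = un (T (n + 1))" "\<And>n. i1 n * p2 n = 0" "\<And>n. i2 n * p1 n = 0"
    "\<And>n. p1 n * i1 n + p2 n * i2 n = un (obj S n)" "\<And>n. d S n = p2 n * i1 (n + 1)"
proof -
  have "\<forall>n. \<exists>S i1 i2 p1 p2. i1 \<in> H (T n) S \<and> i2 \<in> H (T (n + 1)) S \<and> p1 \<in> H S (T n) \<and> p2 \<in> H S (T (n + 1)) \<and>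
    i1 * p1 = un (T n) \<and> i2 * p2 = un (T (n + 1)) \<and> i1 * p2 = 0 \<and> i2 * p1 = 0 \<and> p1 * i1 + p2 * i2 = un S"
  proof
    fix n show "\<exists>S i1 i2 p1 p2. i1 \<in> H (T n) S \<and> i2 \<in> H (T (n + 1)) S \<and> p1 \<in> H S (T n) \<and> p2 \<in> H S (T (n + 1)) \<and>
      i1 * p1 = un (T n) \<and> i2 * p2 = un (T (n + 1)) \<and> i1 * p2 = 0 \<and> i2 * p1 = 0 \<and> p1 * i1 + p2 * i2 = un S"
      by (rule biproduct_ex[OF T T, of n "n + 1"]) blast
  qed
  then obtain ob i1 i2 p1 p2 where b: "\<And>n. i1 n \<in> H (T n) (ob n) \<and> i2 n \<in> H (T (n + 1)) (ob n) \<and>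
    p1 n \<in> H (ob n) (T n) \<and> p2 n \<in> H (ob n) (T (n + 1)) \<and>
    i1 n * p1 n = un (T n) \<and> i2 n * p2 n = un (T (n + 1)) \<and> i1 n * p2 n = 0 \<and> i2 n * p1 n = 0 \<and> p1 n * i1 n + p2 n * i2 n = un (ob n)"
    by metis
  obtain S where S: "S \<in> complexes A" "obj S = ob" "d S = (\<lambda>n. p2 n * i1 (n + 1))"
  proof (rule complex_of_ring)
    show "p2 n * i1 (n + 1) \<in> H (ob n) (ob (n + 1))" for n using b by blast
    have "p2 n * i1 (n + 1) * (p2 (n + 1) * i1 (n + 1 + 1)) = p2 n * ((i1 (n + 1) * p2 (n + 1)) * i1 (n + 1 + 1))" for n
      by (simp only: mult.assoc)
    then show "p2 n * i1 (n + 1) * (p2 (n + 1) * i1 (n + 1 + 1)) = 0" for n using b by simp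
  qed
  show ?thesis by (rule that[of S i1 i2 p1 p2]) (simp_all add: S b)
qed

text \<open>Cancellation in complexes only sees chain maps, whereas monicity of a component is
  tested on a single morphism \<open>t\<close>. The gap is closed by extending \<open>t\<close> to a
  chain map defined on a contractible complex with objects built from \<open>T\<close>.\<close>

lemma is_mono_degreewise:
  assumes f: "f \<in> Hom K X Y"
  shows "is_mono K f \<longleftrightarrow> (\<forall>n. monic (obj X n) (obj Y n) (c f n))"
proof
  note X = K_homD(1)[OF f]
  assume m: "is_mono K f"
  show "\<forall>n. monic (obj X n) (obj Y n) (c f n)"
    unfolding monic_def
  proof (intro conjI allI ballI impI K_homD(7)[OF f])
    fix n T t assume t: "t \<in> H T (obj X n)" "t * c f n = 0"
    have T: "T \<in> Ob A" using H_ob[OF t(1)] by simp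
    \<comment> \<open>The objects of the test complex are the same in all degrees; the concentration
      in degree \<open>n\<close> is put into \<open>\<beta>\<close>.\<close>
    define \<beta> where "\<beta> m = (if m = n then t else 0)" for m
    have \<beta>: "\<beta> m \<in> H T (obj X m)" "\<beta> m * c f m = 0" for m
      using t T complexD(1)[OF X] by (auto simp: \<beta>_def)
    have \<beta>': "\<beta> (m - 1) * (d X (m - 1) * c f m) = 0" for m
      using K_homD(9)[OF f, of m] \<beta>(2)[of "m - 1"] by (simp add: mult.assoc[symmetric])
    obtain S i1 i2 p1 p2 where S: "S \<in> complexes A"
      and i: "\<And>n. i1 n \<in> H T (obj S n)" "\<And>n. i2 n \<in> H T (obj S n)"
      and p: "\<And>n. p1 n \<in> H (obj S n) T" "\<And>n. p2 n \<in> H (obj S n) T"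
      and e: "\<And>n. i1 n * p1 n = un T" "\<And>n. i2 n * p2 n = un T" "\<And>n. i1 n * p2 n = 0" "\<And>n. i2 n * p1 n = 0"
      and dS: "\<And>n. d S n = p2 n * i1 (n + 1)"
      using cone_ex[of "\<lambda>_. T", OF T] by metis
    \<comment> \<open>A chain map out of \<open>S\<close> is free on the second summands; on the
      first summands it is forced to be the differential of the preceding value.\<close>
    define \<phi> where "\<phi> m = p1 m * (\<beta> (m - 1) * d X (m - 1)) + p2 m * \<beta> m" for m
    have \<phi>H: "\<phi> m \<in> H (obj S m) (obj X m)" for m
      unfolding \<phi>_def using p \<beta>(1) complexD(5)[OF X] by blast
    have chain: "d S m * \<phi> (m + 1) = \<phi> m * d X m" for m
    proof -
      have "d S m * \<phi> (m + 1) = p2 m * ((i1 (m + 1) * p1 (m + 1)) * (\<beta> m * d X m)) + p2 m * ((i1 (m + 1) * p2 (m + 1)) * \<beta> (m + 1))"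
        unfolding \<phi>_def dS by (simp add: algebra_simps)
      also have "\<dots> = p2 m * (\<beta> m * d X m)"
        using e un_left[OF mult_H[OF \<beta>(1) complexD(3)[OF X]], of m] by simp
      also have "\<dots> = \<phi> m * d X m"
        unfolding \<phi>_def using complexD(6)[OF X, of m] by (simp add: algebra_simps)
      finally show ?thesis .
    qed
    obtain g where g: "g \<in> Hom K S X" "c g = \<phi>" using K_homI[OF S X \<phi>H chain] by blast
    note z = K_zer[OF S X]
    have "g \<cdot>\<^bsub>K\<^esub> f = Zer K S X \<cdot>\<^bsub>K\<^esub> f"
    proof (rule K_hom_eqI[OF K_comp(1)[OF g(1) f] K_comp(1)[OF z(1) f]])
      fix m
      have "\<phi> m * c f m = 0"
        unfolding \<phi>_def using \<beta>(2)[of m] \<beta>'[of m] by (simp add: algebra_simps)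
      then show "c (g \<cdot>\<^bsub>K\<^esub> f) m = c (Zer K S X \<cdot>\<^bsub>K\<^esub> f) m"
        using K_comp(2)[OF g(1) f] K_comp(2)[OF z(1) f] g z by simp
    qed
    then have "g = Zer K S X" using m g(1) z(1) K_homD(3)[OF f] unfolding is_mono_def K_simps by blast
    then have "\<phi> n = 0" using g z by simp
    then have "i2 n * \<phi> n = 0" by simp
    then have "(i2 n * p1 n) * (\<beta> (n - 1) * d X (n - 1)) + (i2 n * p2 n) * \<beta> n = 0"
      by (simp add: \<phi>_def algebra_simps)
    then show "t = 0" using e un_left[OF t(1)] by (simp add: \<beta>_def)
  qed
next
  assume m: "\<forall>n. monic (obj X n) (obj Y n) (c f n)"
  have "g = h" if gh: "g \<in> Hom K W X" "h \<in> Hom K W X" "g \<cdot>\<^bsub>K\<^esub> f = h \<cdot>\<^bsub>K\<^esub> f" for g h W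
  proof (rule K_hom_eqI[OF gh(1,2)])
    show "c g n = c h n" for n
      by (rule monic_cancel[OF m[rule_format] K_homD(7)[OF gh(1)] K_homD(7)[OF gh(2)]])
        (use K_comp(2)[OF gh(1) f] K_comp(2)[OF gh(2) f] gh(3) in metis)
  qed
  then show "is_mono K f" using K_homD(3,5)[OF f] by (simp add: is_mono_def)
qed

lemma is_epi_degreewise:
  assumes f: "f \<in> Hom K X Y"
  shows "is_epi K f \<longleftrightarrow> (\<forall>n. epic (obj X n) (obj Y n) (c f n))"
proof
  note Y = K_homD(2)[OF f]
  assume m: "is_epi K f"
  show "\<forall>n. epic (obj X n) (obj Y n) (c f n)"
    unfolding epic_def
  proof (intro conjI allI ballI impI K_homD(7)[OF f])
    fix n T t assume t: "t \<in> H (obj Y n) T" "c f n * t = 0"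
    have T: "T \<in> Ob A" using H_ob[OF t(1)] by simp
    define \<alpha> where "\<alpha> m = (if m = n then t else 0)" for m
    have \<alpha>: "\<alpha> m \<in> H (obj Y m) T" "c f m * \<alpha> m = 0" for m
      using t T complexD(1)[OF Y] by (auto simp: \<alpha>_def)
    have \<alpha>': "c f m * (d Y m * \<alpha> (m + 1)) = 0" for m
      using K_homD(8)[OF f, of m, symmetric] \<alpha>(2)[of "m + 1"] by (simp add: mult.assoc[symmetric]) (simp add: mult.assoc)
    obtain S i1 i2 p1 p2 where S: "S \<in> complexes A"
      and i: "\<And>n. i1 n \<in> H T (obj S n)" "\<And>n. i2 n \<in> H T (obj S n)"
      and p: "\<And>n. p1 n \<in> H (obj S n) T" "\<And>n. p2 n \<in> H (obj S n) T"
      and e: "\<And>n. i1 n * p1 n = un T" "\<And>n. i2 n * p2 n = un T" "\<And>n. i1 n * p2 n = 0" "\<And>n. i2 n * p1 n = 0"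
      and dS: "\<And>n. d S n = p2 n * i1 (n + 1)"
      using cone_ex[of "\<lambda>_. T", OF T] by metis
    \<comment> \<open>Dually, a chain map into \<open>S\<close> is free in its first component, and
      its second component is forced to be the differential of \<open>Y\<close> followed by the next
      value of \<open>\<alpha>\<close>.\<close>
    define \<psi> where "\<psi> m = \<alpha> m * i1 m + d Y m * \<alpha> (m + 1) * i2 m" for m
    have \<psi>H: "\<psi> m \<in> H (obj Y m) (obj S m)" for m
      unfolding \<psi>_def using i \<alpha>(1) complexD(3)[OF Y] by blast
    have chain: "d Y m * \<psi> (m + 1) = \<psi> m * d S m" for m
    proof -
      have "\<psi> m * d S m = \<alpha> m * ((i1 m * p2 m) * i1 (m + 1)) + d Y m * (\<alpha> (m + 1) * (i2 m * p2 m) * i1 (m + 1))"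
        unfolding \<psi>_def dS by (simp add: algebra_simps)
      also have "\<dots> = d Y m * (\<alpha> (m + 1) * i1 (m + 1))"
        using e un_right[OF \<alpha>(1)] by simp
      also have "\<dots> = d Y m * (\<alpha> (m + 1) * i1 (m + 1)) + (d Y m * d Y (m + 1)) * (\<alpha> (m + 1 + 1) * i2 (m + 1))"
        using complexD(4)[OF Y, of m] by simp
      also have "\<dots> = d Y m * \<psi> (m + 1)"
        unfolding \<psi>_def by (simp only: mult.assoc distrib_left)
      finally show ?thesis by simp
    qed
    obtain g where g: "g \<in> Hom K Y S" "c g = \<psi>" using K_homI[OF Y S \<psi>H chain] by blast
    note z = K_zer[OF Y S]
    have "f \<cdot>\<^bsub>K\<^esub> g = f \<cdot>\<^bsub>K\<^esub> Zer K Y S"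
    proof (rule K_hom_eqI[OF K_comp(1)[OF f g(1)] K_comp(1)[OF f z(1)]])
      fix m
      have "c f m * \<psi> m = (c f m * \<alpha> m) * i1 m + (c f m * (d Y m * \<alpha> (m + 1))) * i2 m"
        unfolding \<psi>_def by (simp add: algebra_simps)
      also have "\<dots> = 0" using \<alpha>(2)[of m] \<alpha>'[of m] by simp
      finally show "c (f \<cdot>\<^bsub>K\<^esub> g) m = c (f \<cdot>\<^bsub>K\<^esub> Zer K Y S) m"
        using K_comp(2)[OF f g(1)] K_comp(2)[OF f z(1)] g z by simp
    qed
    then have "g = Zer K Y S" using m g(1) z(1) K_homD(4)[OF f] unfolding is_epi_def K_simps by blast
    then have "\<psi> n = 0" using g z by simp
    then have "\<psi> n * p1 n = 0" by simp
    then have "\<alpha> n * (i1 n * p1 n) + d Y n * \<alpha> (n + 1) * (i2 n * p1 n) = 0"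
      by (simp add: \<psi>_def algebra_simps)
    then show "t = 0" using e un_right[OF t(1)] by (simp add: \<alpha>_def)
  qed
next
  assume m: "\<forall>n. epic (obj X n) (obj Y n) (c f n)"
  have "g = h" if gh: "g \<in> Hom K Y W" "h \<in> Hom K Y W" "f \<cdot>\<^bsub>K\<^esub> g = f \<cdot>\<^bsub>K\<^esub> h" for g h W
  proof (rule K_hom_eqI[OF gh(1,2)])
    show "c g n = c h n" for n
      by (rule epic_cancel[OF m[rule_format] K_homD(7)[OF gh(1)] K_homD(7)[OF gh(2)]])
        (use K_comp(2)[OF f gh(1)] K_comp(2)[OF f gh(2)] gh(3) in metis)
  qed
  then show "is_epi K f" using K_homD(4,5)[OF f] by (simp add: is_epi_def)
qed

subsection \<open>Direct sums\<close>

text \<open>\<open>\<Phi>\<close> behaves like an additive functor with values in a ring. It is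
  applied to components and to cohomology, both in a fixed degree.\<close>

lemma direct_sum_image:
  fixes \<Phi> :: "('o, 'm) cochain_map \<Rightarrow> 'r :: ring"
  assumes ds: "direct_sum K n X S ins prj" and X: "\<And>k. k < n \<Longrightarrow> X k \<in> complexes A"
    and comp: "\<And>f g X Y Z. \<lbrakk>f \<in> Hom K X Y; g \<in> Hom K Y Z\<rbrakk> \<Longrightarrow> \<Phi> (f \<cdot>\<^bsub>K\<^esub> g) = \<Phi> f * \<Phi> g"
    and idn: "\<And>X. X \<in> complexes A \<Longrightarrow> \<Phi> (Idn K X) = u X"
    and add: "\<And>f g X Y. \<lbrakk>f \<in> Hom K X Y; g \<in> Hom K X Y\<rbrakk> \<Longrightarrow> \<Phi> (Add K f g) = \<Phi> f + \<Phi> g"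
    and zer: "\<And>X Y. \<lbrakk>X \<in> complexes A; Y \<in> complexes A\<rbrakk> \<Longrightarrow> \<Phi> (Zer K X Y) = 0"
  shows "\<lbrakk>k < n; l < n\<rbrakk> \<Longrightarrow> \<Phi> (ins k) * \<Phi> (prj l) = (if k = l then u (X k) else 0)"
    and "(\<Sum>k<n. \<Phi> (prj k) * \<Phi> (ins k)) = u S"
proof -
  have S: "S \<in> complexes A" and i: "\<And>k. k < n \<Longrightarrow> ins k \<in> Hom K (X k) S" and p: "\<And>k. k < n \<Longrightarrow> prj k \<in> Hom K S (X k)"
    using ds unfolding direct_sum_def by auto
  show "\<Phi> (ins k) * \<Phi> (prj l) = (if k = l then u (X k) else 0)" if "k < n" "l < n"
    using comp[OF i[OF that(1)] p[OF that(2)]] ds that X idn zer unfolding direct_sum_def by auto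
  have "u S = \<Phi> (finprod (hom_group K S S) (\<lambda>k. prj k \<cdot>\<^bsub>K\<^esub> ins k) {..<n})"
    using ds idn[OF S] by (simp add: direct_sum_def)
  also have "\<dots> = (\<Sum>k<n. \<Phi> (prj k \<cdot>\<^bsub>K\<^esub> ins k))"
    by (rule finprod_hom_group(2)[OF K_hom_group[OF S S]]) (use K_comp(1)[OF p i] add zer S in auto)
  also have "\<dots> = (\<Sum>k<n. \<Phi> (prj k) * \<Phi> (ins k))"
    by (rule sum.cong) (use comp[OF p i] in auto)
  finally show "(\<Sum>k<n. \<Phi> (prj k) * \<Phi> (ins k)) = u S" by simp
qed

lemma K_biproduct_ex:
  assumes "X \<in> complexes A" "Y \<in> complexes A"
  obtains S i1 i2 p1 p2 where "S \<in> complexes A" "i1 \<in> Hom K X S" "i2 \<in> Hom K Y S" "p1 \<in> Hom K S X" "p2 \<in> Hom K S Y"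
    "\<And>n. c i1 n * c p1 n = un (obj X n)" "\<And>n. c i2 n * c p2 n = un (obj Y n)"
    "\<And>n. c i1 n * c p2 n = 0" "\<And>n. c i2 n * c p1 n = 0"
    "\<And>n. c p1 n * c i1 n + c p2 n * c i2 n = un (obj S n)"
proof -
  define Z where "Z k = (if k = (0::nat) then X else Y)" for k
  have Z: "Z k \<in> complexes A" for k using assms by (simp add: Z_def)
  obtain S ins prj where ds: "direct_sum K 2 Z S ins prj"
    using K_direct_sums[of 2 Z] Z by blast
  then have S: "S \<in> complexes A" and i: "\<And>k. k < 2 \<Longrightarrow> ins k \<in> Hom K (Z k) S" and p: "\<And>k. k < 2 \<Longrightarrow> prj k \<in> Hom K S (Z k)"
    unfolding direct_sum_def by auto
  have 1: "c (ins k) n * c (prj l) n = (if k = l then un (obj (Z k) n) else 0)" if "k < 2" "l < 2" for k l n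
    by (rule direct_sum_image(1)[OF ds Z, of "\<lambda>f. c f n" "\<lambda>X. un (obj X n)", OF K_comp(2) K_idn(2) K_add(2) K_zer(2) that])
  have 2: "(\<Sum>k<2. c (prj k) n * c (ins k) n) = un (obj S n)" for n
    by (rule direct_sum_image(2)[OF ds Z, of "\<lambda>f. c f n" "\<lambda>X. un (obj X n)", OF K_comp(2) K_idn(2) K_add(2) K_zer(2)])
  show ?thesis
    using that[of S "ins 0" "ins 1" "prj 0" "prj 1"] S i[of 0] i[of 1] p[of 0] p[of 1] 1[of 0 0] 1[of 0 1] 1[of 1 0] 1[of 1 1] 2
    by (simp add: Z_def numeral_2_eq_2)
qed

text \<open>Cohomology is additive, so it carries both given direct sums to direct sums. The
  inverses \<open>\<psi> k\<close> of the maps induced by the \<open>f k\<close> then assemble to an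
  inverse \<open>v\<close> of the map induced by \<open>g\<close>.\<close>

lemma Den_direct_sums:
  fixes n :: nat
  assumes f: "\<And>k. k < n \<Longrightarrow> f k \<in> complex_Den A"
    and S: "direct_sum K n (\<lambda>k. source (f k)) S ins prj" and T: "direct_sum K n (\<lambda>k. target (f k)) T ins' prj'"
    and g: "g \<in> Hom K S T" "\<And>k. k < n \<Longrightarrow> ins k \<cdot>\<^bsub>K\<^esub> g = f k \<cdot>\<^bsub>K\<^esub> ins' k"
  shows "g \<in> complex_Den A"
  unfolding Den_iff_inverse[OF g(1)]
proof
  fix m
  note fk = Den_mor[OF f]
  have i: "\<And>k. k < n \<Longrightarrow> ins k \<in> Hom K (source (f k)) S" and i': "\<And>k. k < n \<Longrightarrow> ins' k \<in> Hom K (target (f k)) T"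
    and p': "\<And>k. k < n \<Longrightarrow> prj' k \<in> Hom K T (target (f k))"
    using S T unfolding direct_sum_def by auto
  have "\<forall>k. \<exists>y. k < n \<longrightarrow> y \<in> H (ho (target (f k)) m) (ho (source (f k)) m) \<and>
    hm (f k) m * y = un (ho (source (f k)) m) \<and> y * hm (f k) m = un (ho (target (f k)) m)"
    using Den_iff_inverse[OF fk] f by blast
  then obtain \<psi> where \<psi>: "\<And>k. k < n \<Longrightarrow> \<psi> k \<in> H (ho (target (f k)) m) (ho (source (f k)) m) \<and>
    hm (f k) m * \<psi> k = un (ho (source (f k)) m) \<and> \<psi> k * hm (f k) m = un (ho (target (f k)) m)"
    by metis
  have sumS: "(\<Sum>k<n. hm (prj k) m * hm (ins k) m) = un (ho S m)"
    by (rule direct_sum_image(2)[OF S, of "\<lambda>f. hm f m" "\<lambda>X. un (ho X m)", OF _ hm_comp hm_id hm_add hm_zer])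
      (use K_homD(1)[OF fk] in blast)
  have sumT: "(\<Sum>k<n. hm (prj' k) m * hm (ins' k) m) = un (ho T m)"
    by (rule direct_sum_image(2)[OF T, of "\<lambda>f. hm f m" "\<lambda>X. un (ho X m)", OF _ hm_comp hm_id hm_add hm_zer])
      (use K_homD(2)[OF fk] in blast)
  have ip: "hm (ins' k) m * hm (prj' l) m = (if k = l then un (ho (target (f k)) m) else 0)" if "k < n" "l < n" for k l
    by (rule direct_sum_image(1)[OF T, of "\<lambda>f. hm f m" "\<lambda>X. un (ho X m)", OF _ hm_comp hm_id hm_add hm_zer that])
      (use K_homD(2)[OF fk] in blast)
  have ig: "hm (ins k) m * hm g m = hm (f k) m * hm (ins' k) m" if k: "k < n" for k
    using hm_comp[OF i[OF k] g(1), of m] hm_comp[OF fk[OF k] i'[OF k], of m] g(2)[OF k] by simp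
  define v where "v = (\<Sum>k<n. hm (prj' k) m * (\<psi> k * hm (ins k) m))"
  have SC: "S \<in> complexes A" "T \<in> complexes A" using K_homD(1,2)[OF g(1)] .
  have vH: "v \<in> H (ho T m) (ho S m)"
    unfolding v_def using hm(2)[OF p'] hm(2)[OF i] \<psi> zo_ho_ob(2)[OF SC(1)] zo_ho_ob(2)[OF SC(2)]
    by (intro sum_H mult_H) auto
  have "v * hm g m = (\<Sum>k<n. hm (prj' k) m * (\<psi> k * (hm (ins k) m * hm g m)))"
    by (simp add: v_def sum_distrib_right mult.assoc)
  also have "\<dots> = (\<Sum>k<n. hm (prj' k) m * ((\<psi> k * hm (f k) m) * hm (ins' k) m))"
    by (rule sum.cong) (simp_all add: ig mult.assoc)
  also have "\<dots> = (\<Sum>k<n. hm (prj' k) m * hm (ins' k) m)"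
    by (rule sum.cong) (use \<psi> un_left[OF hm(2)[OF i']] in auto)
  finally have 1: "v * hm g m = un (ho T m)" using sumT by simp
  have iv: "hm (ins' k) m * v = \<psi> k * hm (ins k) m" if k: "k < n" for k
  proof -
    have "hm (ins' k) m * v = (\<Sum>l<n. (hm (ins' k) m * hm (prj' l) m) * (\<psi> l * hm (ins l) m))"
      by (simp add: v_def sum_distrib_left mult.assoc)
    also have "\<dots> = (\<Sum>l<n. if l = k then \<psi> k * hm (ins k) m else 0)"
      by (rule sum.cong) (use ip k \<psi> un_left[OF mult_H[OF _ hm(2)[OF i]]] in auto)
    finally show ?thesis using k by simp
  qed
  \<comment> \<open>\<open>g\<close> is only known on the inclusions \<open>ins k\<close>, so the
    decomposition of the identity of \<open>ho S m\<close> is inserted in front.\<close>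
  have "hm g m * v = un (ho S m) * hm g m * v" using un_left[OF hm(2)[OF g(1)]] by simp
  also have "\<dots> = (\<Sum>k<n. hm (prj k) m * (hm (ins k) m * hm g m * v))"
    unfolding sumS[symmetric] by (simp add: sum_distrib_right mult.assoc)
  also have "\<dots> = (\<Sum>k<n. hm (prj k) m * ((hm (f k) m * \<psi> k) * hm (ins k) m))"
    by (rule sum.cong) (simp_all add: ig iv mult.assoc)
  also have "\<dots> = (\<Sum>k<n. hm (prj k) m * hm (ins k) m)"
    by (rule sum.cong) (use \<psi> un_left[OF hm(2)[OF i]] in auto)
  finally have 2: "hm g m * v = un (ho S m)" using sumS by simp
  show "\<exists>y \<in> H (ho T m) (ho S m). hm g m * y = un (ho S m) \<and> y * hm g m = un (ho T m)"
    using vH 1 2 by blast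
qed

subsection \<open>Factorisations and cylinders\<close>

text \<open>\<open>M\<close> is the direct sum of \<open>Y\<close> and the cone of the identity of \<open>X\<close>; the morphism \<open>F\<close> has the
  components \<open>f\<close> and the inclusion of \<open>X\<close> into this cone.\<close>

lemma cone_sum_ex:
  assumes X: "X \<in> complexes A" and Y: "Y \<in> complexes A"
  obtains M j q where "M \<in> complexes A" "j \<in> Hom K Y M" "q \<in> Hom K M Y" "j \<cdot>\<^bsub>K\<^esub> q = Idn K Y" "q \<in> complex_TDen A"
    "\<And>f. f \<in> Hom K X Y \<Longrightarrow> \<exists>F \<in> Hom K X M. F \<cdot>\<^bsub>K\<^esub> q = f \<and> is_mono K F \<and>
      (\<forall>Z g \<eta>. g \<in> Hom K Y Z \<longrightarrow> (\<forall>n. \<eta> n \<in> H (obj X n) (obj Z (n - 1))) \<longrightarrow>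
        (\<exists>h \<in> Hom K M Z. j \<cdot>\<^bsub>K\<^esub> h = g \<and> (\<forall>n. c (F \<cdot>\<^bsub>K\<^esub> h) n = c f n * c g n + (d X n * \<eta> (n + 1) + \<eta> n * d Z (n - 1)))))"
proof -
  obtain S i1 i2 p1 p2 where S: "S \<in> complexes A"
    and i: "\<And>n. i1 n \<in> H (obj X n) (obj S n)" "\<And>n. i2 n \<in> H (obj X (n + 1)) (obj S n)"
    and p: "\<And>n. p1 n \<in> H (obj S n) (obj X n)" "\<And>n. p2 n \<in> H (obj S n) (obj X (n + 1))"
    and ip: "\<And>n. i1 n * p1 n = un (obj X n)" "\<And>n. i2 n * p2 n = un (obj X (n + 1))" "\<And>n. i1 n * p2 n = 0" "\<And>n. i2 n * p1 n = 0"
    and pi: "\<And>n. p1 n * i1 n + p2 n * i2 n = un (obj S n)" and dS: "\<And>n. d S n = p2 n * i1 (n + 1)"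
    using cone_ex[of "obj X", OF complexD(1)[OF X]] by metis
  have i2': "i2 (n - 1) \<in> H (obj X n) (obj S (n - 1))" "i2 (n - 1) * p2 (n - 1) = un (obj X n)" "d S (n - 1) = p2 (n - 1) * i1 n" for n
    using i(2)[of "n - 1"] ip(2)[of "n - 1"] dS[of "n - 1"] by simp_all
  \<comment> \<open>Cocycles of the cone are coboundaries: \<open>x * d S n = 0\<close> forces
    \<open>x * p2 n = 0\<close>, and then \<open>x * p1 n\<close>, placed in the second summand one
    degree lower, is sent to \<open>x\<close> by the differential.\<close>
  have contract: "\<exists>v \<in> H T (obj S (n - 1)). v * d S (n - 1) = x" if x: "x \<in> H T (obj S n)" "x * d S n = 0" for T x n
  proof
    show "x * p1 n * i2 (n - 1) \<in> H T (obj S (n - 1))" using x p i2' by blast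
    have "x * p2 n = x * (p2 n * (i1 (n + 1) * p1 (n + 1)))"
      using ip(1)[of "n + 1"] un_right[OF p(2)] by simp
    also have "\<dots> = x * d S n * p1 (n + 1)" by (simp add: dS mult.assoc)
    finally have z: "x * p2 n = 0" using x(2) by simp
    have "x * p1 n * i2 (n - 1) * d S (n - 1) = x * p1 n * (i2 (n - 1) * p2 (n - 1)) * i1 n"
      by (simp add: i2'(3) mult.assoc)
    also have "\<dots> = x * (p1 n * i1 n)"
      unfolding i2'(2) using un_right[OF mult_H[OF x(1) p(1)]] by (simp add: mult.assoc)
    also have "\<dots> = x * (p1 n * i1 n + p2 n * i2 n)" using z by (simp add: distrib_left mult.assoc[symmetric])
    also have "\<dots> = x" unfolding pi using un_right[OF x(1)] .
    finally show "x * p1 n * i2 (n - 1) * d S (n - 1) = x" .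
  qed
  obtain M j1 j2 q1 q2 where M: "M \<in> complexes A"
    and j: "j1 \<in> Hom K Y M" "j2 \<in> Hom K S M" and q: "q1 \<in> Hom K M Y" "q2 \<in> Hom K M S"
    and jq: "\<And>n. c j1 n * c q1 n = un (obj Y n)" "\<And>n. c j2 n * c q2 n = un (obj S n)"
      "\<And>n. c j1 n * c q2 n = 0" "\<And>n. c j2 n * c q1 n = 0"
    and qj: "\<And>n. c q1 n * c j1 n + c q2 n * c j2 n = un (obj M n)"
    using K_biproduct_ex[OF Y S] by metis
  note j1 = K_homD[OF j(1)] and j2 = K_homD[OF j(2)] and q1 = K_homD[OF q(1)] and q2 = K_homD[OF q(2)]
  have jqI: "j1 \<cdot>\<^bsub>K\<^esub> q1 = Idn K Y"
    by (rule K_hom_eqI[OF K_comp(1)[OF j(1) q(1)] K_idn(1)[OF Y]]) (use K_comp(2)[OF j(1) q(1)] K_idn(2)[OF Y] jq in simp)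
  \<comment> \<open>The section \<open>j1\<close> lifts cocycles globally, so the trivial cover
    \<open>un T\<close> suffices. It also suffices for injectivity, where the cone part of
    \<open>x\<close> is contracted.\<close>
  have surj: "coh_surj M Y q1 n" for n
    unfolding coh_surj_def
  proof (intro allI ballI impI)
    fix T y assume y: "y \<in> H T (obj Y n)" "y * d Y n = 0"
    have T: "T \<in> Ob A" using H_ob[OF y(1)] by simp
    have "y * c j1 n * d M n = y * d Y n * c j1 (n + 1)" using j1(8)[of n] by (simp add: mult.assoc)
    then have 1: "y * c j1 n * d M n = 0" using y by simp
    have "un T * y = y * c j1 n * c q1 n + 0 * d Y (n - 1)"
      using jq(1)[of n] un_left[OF y(1)] un_right[OF y(1)] by (simp add: mult.assoc)
    moreover have "y * c j1 n \<in> H T (obj M n)" using y(1) j1(7) by blast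
    moreover have "0 \<in> H T (obj Y (n - 1))" using T complexD(1)[OF Y] by blast
    ultimately show "\<exists>T' s. epic T' T s \<and> (\<exists>x \<in> H T' (obj M n). \<exists>w \<in> H T' (obj Y (n - 1)). x * d M n = 0 \<and> s * y = x * c q1 n + w * d Y (n - 1))"
      using epic_un[OF T] 1 by blast
  qed
  have inj: "coh_inj M Y q1 n" for n
    unfolding coh_inj_def
  proof (intro allI ballI impI)
    fix T x w assume x: "x \<in> H T (obj M n)" "w \<in> H T (obj Y (n - 1))" "x * d M n = 0" "x * c q1 n = w * d Y (n - 1)"
    have T: "T \<in> Ob A" using H_ob[OF x(1)] by simp
    have "x * c q2 n * d S n = x * d M n * c q2 (n + 1)" using q2(8)[of n] by (simp add: mult.assoc)
    then have "x * c q2 n * d S n = 0" using x by simp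
    then obtain v where v: "v \<in> H T (obj S (n - 1))" "v * d S (n - 1) = x * c q2 n"
      using contract[OF mult_H[OF x(1) q2(7)]] by blast
    have "x = x * (c q1 n * c j1 n + c q2 n * c j2 n)" unfolding qj using un_right[OF x(1)] by simp
    also have "\<dots> = (x * c q1 n) * c j1 n + (x * c q2 n) * c j2 n" by (simp add: algebra_simps)
    also have "\<dots> = w * (d Y (n - 1) * c j1 n) + v * (d S (n - 1) * c j2 n)"
      unfolding x(4) v(2)[symmetric] by (simp add: mult.assoc)
    also have "\<dots> = (w * c j1 (n - 1) + v * c j2 (n - 1)) * d M (n - 1)"
      unfolding j1(9) j2(9) by (simp add: algebra_simps)
    finally have "un T * x = (w * c j1 (n - 1) + v * c j2 (n - 1)) * d M (n - 1)" using un_left[OF x(1)] by simp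
    moreover have "w * c j1 (n - 1) + v * c j2 (n - 1) \<in> H T (obj M (n - 1))" using x(2) v(1) j1(7) j2(7) by blast
    ultimately show "\<exists>T' s. epic T' T s \<and> (\<exists>v \<in> H T' (obj M (n - 1)). s * x = v * d M (n - 1))"
      using epic_un[OF T] by blast
  qed
  have "epic (obj M n) (obj Y n) (c q1 n)" for n
    by (rule epic_of_comp[of "obj Y n" _ "c j1 n"]) (use jq(1) epic_un complexD(1)[OF Y] j1(7) q1(7) in auto)
  then have TD: "q1 \<in> complex_TDen A"
    using Den_iff_chase[OF q(1)] surj inj is_epi_degreewise[OF q(1)] by (simp add: complex_TDen_def)
  \<comment> \<open>The inclusion of \<open>X\<close> into its cone. As \<open>S\<close> was built
    from the objects of \<open>X\<close> alone, the differential of \<open>X\<close> reappears here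
    as the second component, which is what the chain map condition demands.\<close>
  have iotaH: "i1 n + d X n * i2 n \<in> H (obj X n) (obj S n)" for n using i complexD(3)[OF X] by blast
  have iota_chain: "d X n * (i1 (n + 1) + d X (n + 1) * i2 (n + 1)) = (i1 n + d X n * i2 n) * d S n" for n
  proof -
    have "(i1 n + d X n * i2 n) * d S n = (i1 n * p2 n) * i1 (n + 1) + d X n * (i2 n * p2 n) * i1 (n + 1)"
      by (simp add: dS algebra_simps)
    also have "\<dots> = d X n * i1 (n + 1) + (d X n * d X (n + 1)) * i2 (n + 1)"
      using ip un_right[OF complexD(3)[OF X]] complexD(4)[OF X] by simp
    finally show ?thesis by (simp add: algebra_simps)
  qed
  obtain \<iota> where \<iota>: "\<iota> \<in> Hom K X S" "c \<iota> = (\<lambda>n. i1 n + d X n * i2 n)"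
    by (rule K_homI[OF X S, of "\<lambda>n. i1 n + d X n * i2 n"]) (use iotaH iota_chain in blast)+
  have main: "\<exists>F \<in> Hom K X M. F \<cdot>\<^bsub>K\<^esub> q1 = f \<and> is_mono K F \<and>
      (\<forall>Z g \<eta>. g \<in> Hom K Y Z \<longrightarrow> (\<forall>n. \<eta> n \<in> H (obj X n) (obj Z (n - 1))) \<longrightarrow>
        (\<exists>h \<in> Hom K M Z. j1 \<cdot>\<^bsub>K\<^esub> h = g \<and> (\<forall>n. c (F \<cdot>\<^bsub>K\<^esub> h) n = c f n * c g n + (d X n * \<eta> (n + 1) + \<eta> n * d Z (n - 1)))))"
    if f: "f \<in> Hom K X Y" for f
  proof -
    define F where "F = Add K (f \<cdot>\<^bsub>K\<^esub> j1) (\<iota> \<cdot>\<^bsub>K\<^esub> j2)"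
    note fj = K_comp[OF f j(1)] and ij = K_comp[OF \<iota>(1) j(2)]
    have F: "F \<in> Hom K X M" and cF: "c F n = c f n * c j1 n + (i1 n + d X n * i2 n) * c j2 n" for n
      using K_add[OF fj(1) ij(1)] fj(2) ij(2) by (simp_all add: F_def \<iota>(2))
    have "F \<cdot>\<^bsub>K\<^esub> q1 = f"
    proof (rule K_hom_eqI[OF K_comp(1)[OF F q(1)] f])
      fix n
      have "c F n * c q1 n = c f n * (c j1 n * c q1 n) + (i1 n + d X n * i2 n) * (c j2 n * c q1 n)"
        by (simp only: cF distrib_right mult.assoc)
      then show "c (F \<cdot>\<^bsub>K\<^esub> q1) n = c f n" using K_comp(2)[OF F q(1)] jq un_right[OF K_homD(7)[OF f]] by simp
    qed
    \<comment> \<open>In each degree \<open>c q2 n * p1 n\<close> is a retraction of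
      \<open>F\<close>, because the first component of the inclusion into the cone is an
      identity.\<close>
    moreover have "is_mono K F"
      unfolding is_mono_degreewise[OF F] monic_def
    proof (intro allI conjI ballI impI K_homD(7)[OF F])
      fix n T t assume t: "t \<in> H T (obj X n)" "t * c F n = 0"
      have "c F n * (c q2 n * p1 n) = c f n * (c j1 n * c q2 n) * p1 n + (i1 n + d X n * i2 n) * ((c j2 n * c q2 n) * p1 n)"
        by (simp only: cF distrib_right mult.assoc)
      also have "\<dots> = i1 n * p1 n + d X n * (i2 n * p1 n)"
        using jq un_left[OF p(1)] by (simp add: algebra_simps)
      also have "\<dots> = un (obj X n)" using ip by simp
      finally have "t * un (obj X n) = (t * c F n) * (c q2 n * p1 n)" by (simp add: mult.assoc)
      then show "t = 0" using t un_right[OF t(1)] by simp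
    qed
    moreover have "\<exists>h \<in> Hom K M Z. j1 \<cdot>\<^bsub>K\<^esub> h = g \<and> (\<forall>n. c (F \<cdot>\<^bsub>K\<^esub> h) n = c f n * c g n + (d X n * \<eta> (n + 1) + \<eta> n * d Z (n - 1)))"
      if g: "g \<in> Hom K Y Z" and \<eta>: "\<forall>n. \<eta> n \<in> H (obj X n) (obj Z (n - 1))" for Z g \<eta>
    proof -
      note Z = K_homD(2)[OF g]
      have \<eta>1: "\<eta> (n + 1) \<in> H (obj X (n + 1)) (obj Z n)" for n using \<eta>[rule_format, of "n + 1"] by simp
      \<comment> \<open>Null-homotopic morphisms extend over the cone: \<open>\<phi>\<close> is the
        homotopy on the second summand and, as forced, the homotopy followed by the differential of
        \<open>Z\<close> on the first. Precomposing with the inclusion of \<open>X\<close> produces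
        exactly the two terms of the homotopy formula.\<close>
      define \<phi> where "\<phi> n = p1 n * (\<eta> n * d Z (n - 1)) + p2 n * \<eta> (n + 1)" for n
      have \<phi>H: "\<phi> n \<in> H (obj S n) (obj Z n)" for n
        unfolding \<phi>_def using p \<eta> \<eta>1 complexD(5)[OF Z] by blast
      have \<phi>c: "d S n * \<phi> (n + 1) = \<phi> n * d Z n" for n
      proof -
        have "d S n * \<phi> (n + 1) = p2 n * ((i1 (n + 1) * p1 (n + 1)) * (\<eta> (n + 1) * d Z n)) + p2 n * ((i1 (n + 1) * p2 (n + 1)) * \<eta> (n + 1 + 1))"
          by (simp add: \<phi>_def dS distrib_left mult.assoc)
        also have "\<dots> = p2 n * (\<eta> (n + 1) * d Z n)"
          using ip un_left[OF mult_H[OF \<eta>1 complexD(3)[OF Z]]] by simp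
        also have "\<dots> = \<phi> n * d Z n" using complexD(6)[OF Z] by (simp add: \<phi>_def distrib_right mult.assoc)
        finally show ?thesis .
      qed
      obtain k where k: "k \<in> Hom K S Z" "c k = \<phi>" using K_homI[OF S Z \<phi>H \<phi>c] by blast
      define h where "h = Add K (q1 \<cdot>\<^bsub>K\<^esub> g) (q2 \<cdot>\<^bsub>K\<^esub> k)"
      note qg = K_comp[OF q(1) g] and qk = K_comp[OF q(2) k(1)]
      have h: "h \<in> Hom K M Z" and ch: "c h n = c q1 n * c g n + c q2 n * \<phi> n" for n
        using K_add[OF qg(1) qk(1)] qg(2) qk(2) by (simp_all add: h_def k(2))
      have jh: "c j1 n * c h n = c g n" "c j2 n * c h n = \<phi> n" for n
      proof -
        have "c j1 n * c h n = (c j1 n * c q1 n) * c g n + (c j1 n * c q2 n) * \<phi> n"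
          "c j2 n * c h n = (c j2 n * c q1 n) * c g n + (c j2 n * c q2 n) * \<phi> n"
          by (simp_all only: ch distrib_left mult.assoc)
        then show "c j1 n * c h n = c g n" "c j2 n * c h n = \<phi> n"
          using jq un_left[OF K_homD(7)[OF g]] un_left[OF \<phi>H] by simp_all
      qed
      have "j1 \<cdot>\<^bsub>K\<^esub> h = g"
        by (rule K_hom_eqI[OF K_comp(1)[OF j(1) h] g]) (use K_comp(2)[OF j(1) h] jh in simp)
      moreover have "c (F \<cdot>\<^bsub>K\<^esub> h) n = c f n * c g n + (d X n * \<eta> (n + 1) + \<eta> n * d Z (n - 1))" for n
      proof -
        have "c (F \<cdot>\<^bsub>K\<^esub> h) n = c f n * (c j1 n * c h n) + (i1 n + d X n * i2 n) * (c j2 n * c h n)"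
          unfolding K_comp(2)[OF F h] cF by (simp only: distrib_right mult.assoc)
        also have "(i1 n + d X n * i2 n) * (c j2 n * c h n) = (i1 n * p1 n) * (\<eta> n * d Z (n - 1)) + (i1 n * p2 n) * \<eta> (n + 1)
            + d X n * ((i2 n * p1 n) * (\<eta> n * d Z (n - 1))) + d X n * ((i2 n * p2 n) * \<eta> (n + 1))"
          unfolding jh \<phi>_def by (simp add: algebra_simps)
        also have "\<dots> = d X n * \<eta> (n + 1) + \<eta> n * d Z (n - 1)"
          using ip un_left[OF mult_H[OF \<eta>[rule_format] complexD(5)[OF Z]]] un_left[OF \<eta>1] by simp
        finally show ?thesis unfolding jh .
      qed
      ultimately show ?thesis using h by blast
    qed
    ultimately show ?thesis using F by blast
  qed
  show ?thesis by (rule that[OF M j(1) q(1) jqI TD main])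
qed

text \<open>The first factor \<open>F\<close> is a denominator by two out of three, since
  \<open>f\<close> and the projection \<open>q\<close> are.\<close>

lemma Den_factorisation:
  assumes f: "f \<in> complex_Den A"
  shows "\<exists>i \<in> complex_SDen A. \<exists>p \<in> complex_TDen A. target i = source p \<and> f = i \<cdot>\<^bsub>K\<^esub> p"
proof -
  note fH = Den_mor[OF f]
  obtain M q F where q: "q \<in> Hom K M (target f)" "q \<in> complex_TDen A"
    and F: "F \<in> Hom K (source f) M" "F \<cdot>\<^bsub>K\<^esub> q = f" "is_mono K F"
    using cone_sum_ex[OF K_homD(1,2)[OF fH]] fH by metis
  have "F \<in> complex_Den A"
    using Den_semi_saturated f q F unfolding semi_saturated_def
    by (auto simp: Hom_def complex_TDen_def)
  then have "F \<in> complex_SDen A" using F(3) by (simp add: complex_SDen_def)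
  moreover have "target F = source q" using K_homD(3)[OF q(1)] K_homD(4)[OF F(1)] by simp
  ultimately show ?thesis using q(2) F(2) by blast
qed

subsection \<open>Homotopies\<close>

lemma homotopic_iff:
  "(f, g) \<in> homotopic A \<longleftrightarrow> (\<exists>X Y. f \<in> Hom K X Y \<and> g \<in> Hom K X Y \<and>
    (\<exists>\<eta>. \<forall>n. \<eta> n \<in> H (obj X n) (obj Y (n - 1)) \<and> c f n = c g n + (d X n * \<eta> (n + 1) + \<eta> n * d Y (n - 1))))"
proof -
  have *: "(\<exists>h. (\<forall>n. h n \<in> Hom A (obj X n) (obj Y (n - 1))) \<and>
          (\<forall>n. component f n = Add A (component g n) (Add A (diff X n \<cdot> h (n + 1)) (h n \<cdot> diff Y (n - 1))))) \<longleftrightarrow>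
     (\<exists>\<eta>. \<forall>n. \<eta> n \<in> H (obj X n) (obj Y (n - 1)) \<and> c f n = c g n + (d X n * \<eta> (n + 1) + \<eta> n * d Y (n - 1)))"
    (is "?L \<longleftrightarrow> ?R") if f: "f \<in> Hom K X Y" and g: "g \<in> Hom K X Y" for X Y
  proof -
    note X = K_homD(1)[OF f] and Y = K_homD(2)[OF f]
    have key: "component f n = Add A (component g n) (Add A (diff X n \<cdot> h (n + 1)) (h n \<cdot> diff Y (n - 1))) \<longleftrightarrow>
      c f n = c g n + (d X n * E (h (n + 1)) + E (h n) * d Y (n - 1))" if h: "\<forall>n. h n \<in> Hom A (obj X n) (obj Y (n - 1))" for h n
    proof -
      have h1: "h (n + 1) \<in> Hom A (obj X (n + 1)) (obj Y n)" using h[rule_format, of "n + 1"] by simp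
      have dY: "diff Y (n - 1) \<in> Hom A (obj Y (n - 1)) (obj Y n)" using complexD(2)[OF Y, of "n - 1"] by simp
      note a = comp_closed[OF complexD(2)[OF X] h1] and b = comp_closed[OF h[rule_format] dY]
      note ab = add_hom[OF complexD(1)[OF X] complexD(1)[OF Y] a b]
      have "E (Add A (component g n) (Add A (diff X n \<cdot> h (n + 1)) (h n \<cdot> diff Y (n - 1)))) =
        c g n + (d X n * E (h (n + 1)) + E (h n) * d Y (n - 1))"
        using E_add[OF K_homD(6)[OF g] ab] E_add[OF a b] E_comp[OF complexD(2)[OF X] h1] E_comp[OF h[rule_format] dY]
        by (simp add: c_def d_def)
      then show ?thesis
        using E_inj[OF K_homD(6)[OF f] add_hom[OF complexD(1)[OF X] complexD(1)[OF Y] K_homD(6)[OF g] ab]] by (auto simp: c_def)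
    qed
    show ?thesis
    proof
      assume ?L
      then obtain h where h: "\<forall>n. h n \<in> Hom A (obj X n) (obj Y (n - 1))"
        "\<forall>n. component f n = Add A (component g n) (Add A (diff X n \<cdot> h (n + 1)) (h n \<cdot> diff Y (n - 1)))" by blast
      then show ?R using key[OF h(1)] by (intro exI[of _ "\<lambda>n. E (h n)"]) simp
    next
      assume ?R
      then obtain \<eta> where \<eta>: "\<And>n. \<eta> n \<in> H (obj X n) (obj Y (n - 1))"
        "\<And>n. c f n = c g n + (d X n * \<eta> (n + 1) + \<eta> n * d Y (n - 1))" by blast
      define h where "h n = R (obj X n) (obj Y (n - 1)) (\<eta> n)" for n
      have h: "\<forall>n. h n \<in> Hom A (obj X n) (obj Y (n - 1))" and Eh: "\<And>n. E (h n) = \<eta> n"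
        using R_hom[OF \<eta>(1)] by (simp_all add: h_def)
      show ?L using h key[OF h] \<eta>(2) by (intro exI[of _ h]) (simp add: Eh)
    qed
  qed
  show ?thesis
  proof
    assume l: "(f, g) \<in> homotopic A"
    have fg: "f \<in> Hom K (source f) (target f)" "g \<in> Hom K (source f) (target f)"
      using l by (auto simp: homotopic_def Hom_def)
    show "\<exists>X Y. f \<in> Hom K X Y \<and> g \<in> Hom K X Y \<and>
      (\<exists>\<eta>. \<forall>n. \<eta> n \<in> H (obj X n) (obj Y (n - 1)) \<and> c f n = c g n + (d X n * \<eta> (n + 1) + \<eta> n * d Y (n - 1)))"
      using l fg *[OF fg] unfolding homotopic_def by blast
  next
    assume "\<exists>X Y. f \<in> Hom K X Y \<and> g \<in> Hom K X Y \<and>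
      (\<exists>\<eta>. \<forall>n. \<eta> n \<in> H (obj X n) (obj Y (n - 1)) \<and> c f n = c g n + (d X n * \<eta> (n + 1) + \<eta> n * d Y (n - 1)))"
    then obtain X Y where fg: "f \<in> Hom K X Y" "g \<in> Hom K X Y" and
      h: "\<exists>\<eta>. \<forall>n. \<eta> n \<in> H (obj X n) (obj Y (n - 1)) \<and> c f n = c g n + (d X n * \<eta> (n + 1) + \<eta> n * d Y (n - 1))" by blast
    show "(f, g) \<in> homotopic A"
      using h[folded *[OF fg]] K_homD(3-5)[OF fg(1)] K_homD(3-5)[OF fg(2)] by (simp add: homotopic_def)
  qed
qed

lemma homotopicI:
  assumes "f \<in> Hom K X Y" "g \<in> Hom K X Y" "\<And>n. \<eta> n \<in> H (obj X n) (obj Y (n - 1))"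
    "\<And>n. c f n = c g n + (d X n * \<eta> (n + 1) + \<eta> n * d Y (n - 1))"
  shows "(f, g) \<in> homotopic A"
  unfolding homotopic_iff using assms by blast

lemma homotopicE:
  assumes "(f, g) \<in> homotopic A"
  obtains X Y \<eta> where "f \<in> Hom K X Y" "g \<in> Hom K X Y" "\<And>n. \<eta> n \<in> H (obj X n) (obj Y (n - 1))"
    "\<And>n. c f n = c g n + (d X n * \<eta> (n + 1) + \<eta> n * d Y (n - 1))"
  using assms unfolding homotopic_iff by blast

lemma K_hom_unique: "f \<in> Hom K X Y \<Longrightarrow> f \<in> Hom K X' Y' \<Longrightarrow> X' = X \<and> Y' = Y"
  by (auto simp: Hom_def)

sublocale homotopy: category_congruence K "homotopic A"
proof (intro category_congruence.intro K_category category_congruence_axioms.intro)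
  show "equiv (Mor K) (homotopic A)"
  proof (rule equivI)
    show "homotopic A \<subseteq> Mor K \<times> Mor K" by (auto simp: homotopic_def)
    show "refl_on (Mor K) (homotopic A)"
    proof (rule refl_onI)
      fix f assume "f \<in> Mor K"
      then have f: "f \<in> Hom K (source f) (target f)" by (simp add: Hom_def)
      show "(f, f) \<in> homotopic A"
        by (rule homotopicI[OF f f, of "\<lambda>_. 0"]) (use complexD(1)[OF K_homD(1)[OF f]] complexD(1)[OF K_homD(2)[OF f]] in auto)
    qed
    show "sym (homotopic A)"
    proof (rule symI)
      fix f g assume "(f, g) \<in> homotopic A"
      then obtain X Y \<eta> where h: "f \<in> Hom K X Y" "g \<in> Hom K X Y" "\<And>n. \<eta> n \<in> H (obj X n) (obj Y (n - 1))"
        "\<And>n. c f n = c g n + (d X n * \<eta> (n + 1) + \<eta> n * d Y (n - 1))" by (rule homotopicE) blast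
      show "(g, f) \<in> homotopic A"
        by (rule homotopicI[OF h(2,1), of "\<lambda>n. - \<eta> n"]) (use h in \<open>auto simp: algebra_simps\<close>)
    qed
    show "trans (homotopic A)"
    proof (rule transI)
      fix f g k assume "(f, g) \<in> homotopic A" "(g, k) \<in> homotopic A"
      then obtain X Y \<eta> X' Y' \<theta> where h: "f \<in> Hom K X Y" "g \<in> Hom K X Y" "\<And>n. \<eta> n \<in> H (obj X n) (obj Y (n - 1))"
        "\<And>n. c f n = c g n + (d X n * \<eta> (n + 1) + \<eta> n * d Y (n - 1))"
        and h': "g \<in> Hom K X' Y'" "k \<in> Hom K X' Y'" "\<And>n. \<theta> n \<in> H (obj X' n) (obj Y' (n - 1))"
        "\<And>n. c g n = c k n + (d X' n * \<theta> (n + 1) + \<theta> n * d Y' (n - 1))"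
        by (elim homotopicE) blast
      have e: "X' = X" "Y' = Y" using K_hom_unique h(2) h'(1) by blast+
      show "(f, k) \<in> homotopic A"
        by (rule homotopicI[OF h(1) h'(2)[unfolded e], of "\<lambda>n. \<eta> n + \<theta> n"])
          (use h(3) h'(3) h(4) h'(4) in \<open>auto simp: e algebra_simps\<close>)
    qed
  qed
  show "Src K f = Src K g \<and> Tgt K f = Tgt K g" if "(f, g) \<in> homotopic A" for f g
    using that by (simp add: homotopic_def)
  show "(f \<cdot>\<^bsub>K\<^esub> g, f' \<cdot>\<^bsub>K\<^esub> g') \<in> homotopic A"
    if "(f, f') \<in> homotopic A" "(g, g') \<in> homotopic A" "Tgt K f = Src K g" for f f' g g'
  proof -
    from that(1,2) obtain X Y \<eta> Y' Z \<theta> where h: "f \<in> Hom K X Y" "f' \<in> Hom K X Y" "\<And>n. \<eta> n \<in> H (obj X n) (obj Y (n - 1))"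
        "\<And>n. c f n = c f' n + (d X n * \<eta> (n + 1) + \<eta> n * d Y (n - 1))"
        and h': "g \<in> Hom K Y' Z" "g' \<in> Hom K Y' Z" "\<And>n. \<theta> n \<in> H (obj Y' n) (obj Z (n - 1))"
        "\<And>n. c g n = c g' n + (d Y' n * \<theta> (n + 1) + \<theta> n * d Z (n - 1))"
      by (elim homotopicE) blast
    have [simp]: "Y' = Y" using that(3) h(1) h'(1) by (auto simp: Hom_def)
    note g = h'(1)[simplified] and g' = h'(2)[simplified]
    \<comment> \<open>The difference of the composites is split as
      \<open>(f - f') * g + f' * (g - g')\<close>.\<close>
    define \<zeta> where "\<zeta> n = \<eta> n * c g (n - 1) + c f' n * \<theta> n" for n
    show ?thesis
    proof (rule homotopicI[OF K_comp(1)[OF h(1) g] K_comp(1)[OF h(2) g'], of \<zeta>])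
      show "\<zeta> n \<in> H (obj X n) (obj Z (n - 1))" for n
        unfolding \<zeta>_def by (rule add_H[OF mult_H[OF h(3) K_homD(7)[OF g]] mult_H[OF K_homD(7)[OF h(2)] h'(3)[simplified]]])
      fix n
      have "c f n * c g n = c f' n * c g n + (d X n * (\<eta> (n + 1) * c g n) + \<eta> n * (d Y (n - 1) * c g n))"
        unfolding h(4) by (simp add: algebra_simps)
      also have "d Y (n - 1) * c g n = c g (n - 1) * d Z (n - 1)" by (rule K_homD(9)[OF g])
      also have "c f' n * c g n = c f' n * c g' n + ((c f' n * d Y n) * \<theta> (n + 1) + c f' n * (\<theta> n * d Z (n - 1)))"
        unfolding h'(4) by (simp add: algebra_simps)
      also have "c f' n * d Y n = d X n * c f' (n + 1)" using K_homD(8)[OF h(2)] by simp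
      finally show "c (f \<cdot>\<^bsub>K\<^esub> g) n = c (f' \<cdot>\<^bsub>K\<^esub> g') n + (d X n * \<zeta> (n + 1) + \<zeta> n * d Z (n - 1))"
        unfolding K_comp(2)[OF h(1) g] K_comp(2)[OF h(2) g'] \<zeta>_def by (simp add: algebra_simps)
    qed
  qed
qed

text \<open>The cylinder is the sum \<open>M\<close> formed with \<open>Y = X\<close>. Its ends are
  \<open>F\<close> over the identity and the summand inclusion \<open>j\<close>, both sections of
  the projection \<open>q\<close>. The morphism on \<open>M\<close> that is \<open>g\<close> on
  \<open>j\<close> and is given by the homotopy on the cone takes the value \<open>f\<close> on
  \<open>F\<close>.\<close>

lemma homotopic_cylinder:
  assumes "(f, g) \<in> homotopic A"
  shows "\<exists>i0 i1 s h. i0 \<in> Mor K \<and> i1 \<in> Mor K \<and> s \<in> complex_Den A \<and> h \<in> Mor K \<and>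
      Src K i0 = Src K f \<and> Src K i1 = Src K f \<and> Tgt K i0 = Src K s \<and> Tgt K i1 = Src K s \<and>
      Src K h = Src K s \<and> i0 \<cdot>\<^bsub>K\<^esub> s = Idn K (Src K f) \<and> i1 \<cdot>\<^bsub>K\<^esub> s = Idn K (Src K f) \<and> i0 \<cdot>\<^bsub>K\<^esub> h = f \<and> i1 \<cdot>\<^bsub>K\<^esub> h = g"
proof -
  from assms obtain X Y \<eta> where h: "f \<in> Hom K X Y" "g \<in> Hom K X Y" "\<And>n. \<eta> n \<in> H (obj X n) (obj Y (n - 1))"
    "\<And>n. c f n = c g n + (d X n * \<eta> (n + 1) + \<eta> n * d Y (n - 1))" by (rule homotopicE) blast
  note X = K_homD(1)[OF h(1)]
  obtain M j q where M: "M \<in> complexes A" "j \<in> Hom K X M" "q \<in> Hom K M X" "j \<cdot>\<^bsub>K\<^esub> q = Idn K X" "q \<in> complex_TDen A"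
    and F: "\<And>f. f \<in> Hom K X X \<Longrightarrow> \<exists>F \<in> Hom K X M. F \<cdot>\<^bsub>K\<^esub> q = f \<and> is_mono K F \<and>
      (\<forall>Z g \<eta>. g \<in> Hom K X Z \<longrightarrow> (\<forall>n. \<eta> n \<in> H (obj X n) (obj Z (n - 1))) \<longrightarrow>
        (\<exists>h \<in> Hom K M Z. j \<cdot>\<^bsub>K\<^esub> h = g \<and> (\<forall>n. c (F \<cdot>\<^bsub>K\<^esub> h) n = c f n * c g n + (d X n * \<eta> (n + 1) + \<eta> n * d Z (n - 1)))))"
    using cone_sum_ex[OF X X] by blast
  obtain F where F: "F \<in> Hom K X M" "F \<cdot>\<^bsub>K\<^esub> q = Idn K X" and ex: "\<exists>h \<in> Hom K M Y. j \<cdot>\<^bsub>K\<^esub> h = g \<and>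
    (\<forall>n. c (F \<cdot>\<^bsub>K\<^esub> h) n = c (Idn K X) n * c g n + (d X n * \<eta> (n + 1) + \<eta> n * d Y (n - 1)))"
    using F[OF K_idn(1)[OF X]] h(2,3) by blast
  then obtain k where k: "k \<in> Hom K M Y" "j \<cdot>\<^bsub>K\<^esub> k = g"
    "\<And>n. c (F \<cdot>\<^bsub>K\<^esub> k) n = c (Idn K X) n * c g n + (d X n * \<eta> (n + 1) + \<eta> n * d Y (n - 1))" by blast
  have "F \<cdot>\<^bsub>K\<^esub> k = f"
    by (rule K_hom_eqI[OF K_comp(1)[OF F(1) k(1)] h(1)])
      (use k(3) h(4) K_idn(2)[OF X] un_left[OF K_homD(7)[OF h(2)]] in simp)
  then show ?thesis
    using F M k K_homD(3-5)[OF F(1)] K_homD(3-5)[OF M(2)] K_homD(3-5)[OF M(3)] K_homD(3-5)[OF k(1)] K_homD(3-5)[OF h(1)]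
    by - (rule exI[of _ F], rule exI[of _ j], rule exI[of _ q], rule exI[of _ k], simp add: complex_TDen_def)
qed

end

subsection \<open>Pushouts of monomorphic and pullbacks of epimorphic quasi-isomorphisms\<close>

context abelian_in_ring
begin

text \<open>The pushout is the degreewise cokernel of \<open>u\<close>, with components
  \<open>i\<close> and \<open>- f\<close>. Its elements lift to pairs along \<open>\<pi>\<close>
  after a cover, and \<open>coker_exact\<close> turns an equality there into a correction by an
  element of \<open>X\<close>, which is then controlled by the chase criteria for
  \<open>i\<close>.\<close>

lemma weak_pushout_SDen:
  assumes i: "i \<in> complex_SDen A" and f: "f \<in> complex_mors A" "source f = source i"
  shows "\<exists>f'. \<exists>i' \<in> complex_SDen A. weak_pushout K i f f' i'"
proof -
  define X Y X' where "X = source i" and "Y = target i" and "X' = target f"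
  have iD: "i \<in> complex_Den A" and im: "is_mono K i" using i by (auto simp: complex_SDen_def)
  have iH: "i \<in> Hom K X Y" and fH: "f \<in> Hom K X X'"
    using Den_mor[OF iD] f by (auto simp: Hom_def X_def Y_def X'_def)
  note iK = K_homD[OF iH] and fK = K_homD[OF fH]
  have mono: "monic (obj X n) (obj Y n) (c i n)" for n using im is_mono_degreewise[OF iH] by blast
  have isurj: "coh_surj X Y i n" and iinj: "coh_inj X Y i n" for n using iD Den_iff_chase[OF iH] by blast+
  obtain P j1 j2 q1 q2 where P: "P \<in> complexes A"
    and j: "j1 \<in> Hom K Y P" "j2 \<in> Hom K X' P" and q: "q1 \<in> Hom K P Y" "q2 \<in> Hom K P X'"
    and jq: "\<And>n. c j1 n * c q1 n = un (obj Y n)" "\<And>n. c j2 n * c q2 n = un (obj X' n)"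
      "\<And>n. c j1 n * c q2 n = 0" "\<And>n. c j2 n * c q1 n = 0"
    and qj: "\<And>n. c q1 n * c j1 n + c q2 n * c j2 n = un (obj P n)"
    using K_biproduct_ex[OF iK(2) fK(2)] by metis
  note j1 = K_homD[OF j(1)] and j2 = K_homD[OF j(2)] and q1 = K_homD[OF q(1)] and q2 = K_homD[OF q(2)]
  define u where "u n = c i n * c j1 n - c f n * c j2 n" for n
  have uH: "u n \<in> H (obj X n) (obj P n)" for n unfolding u_def using iK(7) fK(7) j1(7) j2(7) by blast
  have uq: "u n * c q1 n = c i n" "u n * c q2 n = - c f n" for n
    using jq un_right[OF iK(7)] un_right[OF fK(7)] by (simp_all add: u_def left_diff_distrib mult.assoc)
  have du: "d X n * u (n + 1) = u n * d P n" for n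
  proof -
    have "d X n * u (n + 1) = (d X n * c i (n + 1)) * c j1 (n + 1) - (d X n * c f (n + 1)) * c j2 (n + 1)"
      by (simp add: u_def right_diff_distrib mult.assoc)
    also have "\<dots> = c i n * (d Y n * c j1 (n + 1)) - c f n * (d X' n * c j2 (n + 1))"
      unfolding iK(8) fK(8) by (simp add: mult.assoc)
    also have "\<dots> = u n * d P n" unfolding j1(8) j2(8) by (simp add: u_def left_diff_distrib mult.assoc)
    finally show ?thesis .
  qed
  have "\<forall>n. \<exists>Q \<pi>. coker (obj X n) (obj P n) (u n) Q \<pi>" using coker_ex[OF uH] by metis
  then obtain ob \<pi> where \<pi>: "\<And>n. coker (obj X n) (obj P n) (u n) (ob n) (\<pi> n)" by metis
  note \<pi>H = cokerD(2)[OF \<pi>] and \<pi>e = cokerD(3)[OF \<pi>] and u\<pi> = cokerD(4)[OF \<pi>]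
  have "\<exists>\<delta>. \<delta> \<in> H (ob n) (ob (n + 1)) \<and> \<pi> n * \<delta> = d P n * \<pi> (n + 1)" for n
  proof -
    have "u n * (d P n * \<pi> (n + 1)) = d X n * (u (n + 1) * \<pi> (n + 1))"
      using du[of n] by (simp add: mult.assoc[symmetric])
    then have "u n * (d P n * \<pi> (n + 1)) = 0" using u\<pi> by simp
    then show ?thesis using cokerE[OF \<pi> mult_H[OF complexD(3)[OF P] \<pi>H]] by metis
  qed
  then obtain \<delta> where \<delta>: "\<And>n. \<delta> n \<in> H (ob n) (ob (n + 1))" "\<And>n. \<pi> n * \<delta> n = d P n * \<pi> (n + 1)" by metis
  have "\<delta> n * \<delta> (n + 1) = 0" for n
  proof (rule epicD(2)[OF \<pi>e mult_H[OF \<delta>(1) \<delta>(1)]])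
    have "\<pi> n * (\<delta> n * \<delta> (n + 1)) = d P n * (\<pi> (n + 1) * \<delta> (n + 1))" using \<delta>(2)[of n] by (simp add: mult.assoc[symmetric])
    also have "\<dots> = (d P n * d P (n + 1)) * \<pi> (n + 1 + 1)" unfolding \<delta>(2) by (simp add: mult.assoc)
    finally show "\<pi> n * (\<delta> n * \<delta> (n + 1)) = 0" using complexD(4)[OF P] by simp
  qed
  with \<delta>(1) obtain Z where Z: "Z \<in> complexes A" "obj Z = ob" "d Z = \<delta>" by (rule complex_of_ring)
  have \<pi>Z: "\<pi> n \<in> H (obj P n) (obj Z n)" "d P n * \<pi> (n + 1) = \<pi> n * d Z n" "epic (obj P n) (obj Z n) (\<pi> n)"
    "coker (obj X n) (obj P n) (u n) (obj Z n) (\<pi> n)" for n using \<pi>H \<delta>(2) \<pi>e \<pi> Z by simp_all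
  obtain p where p: "p \<in> Hom K P Z" "c p = \<pi>" using K_homI[OF P Z(1) \<pi>Z(1,2)] by blast
  define f' i' where "f' = j1 \<cdot>\<^bsub>K\<^esub> p" and "i' = j2 \<cdot>\<^bsub>K\<^esub> p"
  have f'H: "f' \<in> Hom K Y Z" and cf': "\<And>n. c f' n = c j1 n * \<pi> n"
    and i'H: "i' \<in> Hom K X' Z" and ci': "\<And>n. c i' n = c j2 n * \<pi> n"
    using K_comp[OF j(1) p(1)] K_comp[OF j(2) p(1)] p(2) by (simp_all add: f'_def i'_def)
  have comm: "c i n * (c j1 n * \<pi> n) = c f n * (c j2 n * \<pi> n)" for n
    using u\<pi>[of n] by (simp add: u_def left_diff_distrib mult.assoc)
  have decomp: "m = m * c q1 n * c j1 n + m * c q2 n * c j2 n" if "m \<in> H T (obj P n)" for m T n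
  proof -
    have "m = m * (c q1 n * c j1 n + c q2 n * c j2 n)" unfolding qj using un_right[OF that] by simp
    then show ?thesis by (simp add: distrib_left mult.assoc)
  qed
  have square: "i \<cdot>\<^bsub>K\<^esub> f' = f \<cdot>\<^bsub>K\<^esub> i'"
    by (rule K_hom_eqI[OF K_comp(1)[OF iH f'H] K_comp(1)[OF fH i'H]])
      (use K_comp(2)[OF iH f'H] K_comp(2)[OF fH i'H] cf' ci' comm in simp)
  have univ: "\<exists>t \<in> Hom K Z V. f' \<cdot>\<^bsub>K\<^esub> t = g \<and> i' \<cdot>\<^bsub>K\<^esub> t = h"
    if g: "g \<in> Hom K Y V" and h: "h \<in> Hom K X' V" and e: "i \<cdot>\<^bsub>K\<^esub> g = f \<cdot>\<^bsub>K\<^esub> h" for V g h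
  proof -
    have V: "V \<in> complexes A" using K_homD(2)[OF g] .
    have e': "c i n * c g n = c f n * c h n" for n using e K_comp(2)[OF iH g] K_comp(2)[OF fH h] by metis
    define w where "w n = c q1 n * c g n + c q2 n * c h n" for n
    have wH: "w n \<in> H (obj P n) (obj V n)" for n unfolding w_def using q1(7) q2(7) K_homD(7)[OF g] K_homD(7)[OF h] by blast
    have uw: "u n * w n = 0" for n
    proof -
      have "u n * w n = (u n * c q1 n) * c g n + (u n * c q2 n) * c h n" by (simp only: w_def distrib_left mult.assoc)
      then show ?thesis unfolding uq using e' by simp
    qed
    have dw: "d P n * w (n + 1) = w n * d V n" for n
    proof -
      have "d P n * w (n + 1) = (d P n * c q1 (n + 1)) * c g (n + 1) + (d P n * c q2 (n + 1)) * c h (n + 1)"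
        by (simp only: w_def distrib_left mult.assoc)
      also have "\<dots> = c q1 n * (d Y n * c g (n + 1)) + c q2 n * (d X' n * c h (n + 1))"
        unfolding q1(8) q2(8) by (simp only: mult.assoc)
      finally show ?thesis unfolding K_homD(8)[OF g] K_homD(8)[OF h] by (simp only: w_def distrib_right mult.assoc)
    qed
    have "\<forall>n. \<exists>t. t \<in> H (obj Z n) (obj V n) \<and> \<pi> n * t = w n"
      using cokerE[OF \<pi>Z(4) wH uw] by metis
    then obtain t where t: "\<And>n. t n \<in> H (obj Z n) (obj V n)" "\<And>n. \<pi> n * t n = w n" by metis
    have dt: "d Z n * t (n + 1) = t n * d V n" for n
    proof (rule epic_cancel[OF \<pi>Z(3)])
      show "d Z n * t (n + 1) \<in> H (obj Z n) (obj V (n + 1))" "t n * d V n \<in> H (obj Z n) (obj V (n + 1))"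
        using t(1) complexD(3)[OF Z(1)] complexD(3)[OF V] by blast+
      have "\<pi> n * (d Z n * t (n + 1)) = d P n * (\<pi> (n + 1) * t (n + 1))"
        using \<pi>Z(2)[of n] by (simp add: mult.assoc[symmetric])
      also have "\<dots> = \<pi> n * t n * d V n" using t(2) dw by simp
      finally show "\<pi> n * (d Z n * t (n + 1)) = \<pi> n * (t n * d V n)" by (simp add: mult.assoc)
    qed
    obtain k where k: "k \<in> Hom K Z V" "c k = t" using K_homI[OF Z(1) V t(1) dt] by blast
    have jw: "c j1 n * w n = c g n" "c j2 n * w n = c h n" for n
    proof -
      have "c j1 n * w n = (c j1 n * c q1 n) * c g n + (c j1 n * c q2 n) * c h n"
        "c j2 n * w n = (c j2 n * c q1 n) * c g n + (c j2 n * c q2 n) * c h n"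
        by (simp_all only: w_def distrib_left mult.assoc)
      then show "c j1 n * w n = c g n" "c j2 n * w n = c h n"
        using jq un_left[OF K_homD(7)[OF g]] un_left[OF K_homD(7)[OF h]] by simp_all
    qed
    have "f' \<cdot>\<^bsub>K\<^esub> k = g"
      by (rule K_hom_eqI[OF K_comp(1)[OF f'H k(1)] g]) (use K_comp(2)[OF f'H k(1)] cf' k(2) t(2) jw in \<open>simp add: mult.assoc\<close>)
    moreover have "i' \<cdot>\<^bsub>K\<^esub> k = h"
      by (rule K_hom_eqI[OF K_comp(1)[OF i'H k(1)] h]) (use K_comp(2)[OF i'H k(1)] ci' k(2) t(2) jw in \<open>simp add: mult.assoc\<close>)
    ultimately show ?thesis using k(1) by blast
  qed
  have mono': "is_mono K i'"
    unfolding is_mono_degreewise[OF i'H] monic_def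
  proof (intro allI conjI ballI impI K_homD(7)[OF i'H])
    fix n T x assume x: "x \<in> H T (obj X' n)" "x * c i' n = 0"
    have "x * c j2 n * \<pi> n = 0" using x(2) by (simp add: ci' mult.assoc)
    then obtain T' s v where s: "epic T' T s" "v \<in> H T' (obj X n)" "s * (x * c j2 n) = v * u n"
      using coker_exact[OF \<pi>Z(4) mult_H[OF x(1) j2(7)]] by metis
    \<comment> \<open>After the cover the pair \<open>(0, x)\<close> is the image of
      \<open>v\<close> under \<open>u\<close>. Its first component says that
      \<open>v * c i n\<close> vanishes, and \<open>i\<close> is degreewise monic.\<close>
    have "v * c i n = s * (x * c j2 n) * c q1 n" unfolding s(3) using uq by (simp add: mult.assoc)
    also have "\<dots> = s * (x * (c j2 n * c q1 n))" by (simp add: mult.assoc)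
    finally have "v = 0" using jq monicD(2)[OF mono s(2)] by simp
    have "s * x = s * (x * c j2 n) * c q2 n" using jq un_right[OF x(1)] by (simp add: mult.assoc)
    then have "s * x = 0" unfolding s(3) \<open>v = 0\<close> by simp
    then show "x = 0" using epicD(2)[OF s(1) x(1)] by simp
  qed
  have surj': "coh_surj X' Z i' n" for n
    unfolding coh_surj_def
  proof (intro allI ballI impI)
    fix T z assume z: "z \<in> H T (obj Z n)" "z * d Z n = 0"
    obtain T1 s1 m where s1: "epic T1 T s1" "m \<in> H T1 (obj P n)" "s1 * z = m * \<pi> n"
      using pullback_epic[OF \<pi>Z(3) z(1)] by metis
    have "m * d P n * \<pi> (n + 1) = m * \<pi> n * d Z n" using \<pi>Z(2)[of n] by (simp add: mult.assoc)
    also have "\<dots> = s1 * (z * d Z n)" unfolding s1(3)[symmetric] by (simp add: mult.assoc)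
    finally have "m * d P n * \<pi> (n + 1) = 0" using z by simp
    then obtain T2 s2 x where s2: "epic T2 T1 s2" "x \<in> H T2 (obj X (n + 1))" "s2 * (m * d P n) = x * u (n + 1)"
      using coker_exact[OF \<pi>Z(4) mult_H[OF s1(2) complexD(3)[OF P]]] by metis
    \<comment> \<open>\<open>x\<close> measures the failure of the lift \<open>m\<close> to be a
      cocycle. Its image in \<open>Y\<close> is a coboundary, so by injectivity \<open>x\<close> is
      itself one after a cover, and the resulting \<open>v\<close> corrects
      \<open>m\<close>.\<close>
    have xi: "x * c i (n + 1) = s2 * m * c q1 n * d Y n"
    proof -
      have "x * c i (n + 1) = s2 * (m * d P n) * c q1 (n + 1)" unfolding s2(3) using uq by (simp add: mult.assoc)
      then show ?thesis using q1(8)[of n] by (simp add: mult.assoc)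
    qed
    have xf: "- (x * c f (n + 1)) = s2 * m * c q2 n * d X' n"
    proof -
      have "- (x * c f (n + 1)) = s2 * (m * d P n) * c q2 (n + 1)" unfolding s2(3) using uq by (simp add: mult.assoc)
      then show ?thesis using q2(8)[of n] by (simp add: mult.assoc)
    qed
    have "x * d X (n + 1) = 0"
    proof (rule monicD(2)[OF mono])
      show "x * d X (n + 1) \<in> H T2 (obj X (n + 1 + 1))" using s2(2) complexD(3)[OF iK(1)] by blast
      have "x * d X (n + 1) * c i (n + 1 + 1) = x * c i (n + 1) * d Y (n + 1)"
        using iK(8)[of "n + 1"] by (simp add: mult.assoc)
      also have "\<dots> = s2 * m * c q1 n * (d Y n * d Y (n + 1))" unfolding xi by (simp add: mult.assoc)
      finally show "x * d X (n + 1) * c i (n + 1 + 1) = 0" using complexD(4)[OF iK(2)] by simp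
    qed
    moreover have w: "s2 * m * c q1 n \<in> H T2 (obj Y n)" using epicD(1)[OF s2(1)] s1(2) q1(7) by blast
    ultimately obtain T3 s3 v where s3: "epic T3 T2 s3" "v \<in> H T3 (obj X n)" "s3 * x = v * d X n"
      using iinj[of "n + 1", unfolded coh_inj_def, rule_format, of x T2 "s2 * m * c q1 n"] s2(2) xi by auto
    \<comment> \<open>The corrected first component is a cocycle of \<open>Y\<close>; surjectivity
      replaces it by the image of a cocycle \<open>x2\<close> of \<open>X\<close>, up to the
      coboundary of \<open>w2\<close>.\<close>
    define y where "y = s3 * (s2 * m * c q1 n) - v * c i n"
    have yH: "y \<in> H T3 (obj Y n)" unfolding y_def using epicD(1)[OF s3(1)] w s3(2) iK(7) by blast
    have "y * d Y n = s3 * (x * c i (n + 1)) - v * (c i n * d Y n)"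
      unfolding xi y_def by (simp add: left_diff_distrib mult.assoc)
    also have "\<dots> = s3 * x * c i (n + 1) - v * d X n * c i (n + 1)"
      using iK(8)[of n] by (simp add: mult.assoc)
    finally have "y * d Y n = 0" unfolding s3(3) by simp
    then obtain T4 s4 x2 w2 where s4: "epic T4 T3 s4" "x2 \<in> H T4 (obj X n)" "w2 \<in> H T4 (obj Y (n - 1))" "x2 * d X n = 0"
      "s4 * y = x2 * c i n + w2 * d Y (n - 1)"
      using isurj[of n, unfolded coh_surj_def, rule_format, OF yH] by blast
    define s where "s = s4 * s3 * s2"
    have sE: "epic T4 T1 s" unfolding s_def by (intro epic_comp[OF epic_comp[OF s4(1) s3(1)] s2(1)])
    \<comment> \<open>A first component coming from \<open>X\<close> may be moved to
      \<open>X'\<close> through \<open>f\<close>, because \<open>comm\<close> identifies the two in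
      the pushout. Only the coboundary of \<open>w2\<close> stays behind.\<close>
    define x' where "x' = (x2 + s4 * v) * c f n + s * m * c q2 n"
    have x'H: "x' \<in> H T4 (obj X' n)"
      unfolding x'_def using s4(2) epicD(1)[OF s4(1)] s3(2) fK(7) epicD(1)[OF sE] s1(2) q2(7)
      by (intro add_H mult_H) blast+
    have sm: "s * m * c q1 n = (x2 + s4 * v) * c i n + w2 * d Y (n - 1)"
      using s4(5) by (simp add: y_def s_def algebra_simps)
    have "x' * d X' n = (x2 + s4 * v) * (c f n * d X' n) + s4 * s3 * (s2 * m * c q2 n * d X' n)"
      by (simp add: x'_def s_def distrib_right mult.assoc)
    also have "\<dots> = x2 * d X n * c f (n + 1) + s4 * (v * d X n) * c f (n + 1) - s4 * (s3 * x) * c f (n + 1)"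
      unfolding xf[symmetric] fK(8)[symmetric] by (simp add: distrib_right mult.assoc)
    finally have x'c: "x' * d X' n = 0" unfolding s3(3) s4(4) by simp
    have "s * s1 * z = s * m * \<pi> n" using s1(3) by (simp add: mult.assoc)
    also have "\<dots> = (s * m * c q1 n) * (c j1 n * \<pi> n) + s * m * c q2 n * (c j2 n * \<pi> n)"
    proof -
      have "s * m \<in> H T4 (obj P n)" using epicD(1)[OF sE] s1(2) by blast
      from decomp[OF this] have "s * m * \<pi> n = (s * m * c q1 n * c j1 n + s * m * c q2 n * c j2 n) * \<pi> n" by simp
      then show ?thesis by (simp add: distrib_right mult.assoc)
    qed
    also have "\<dots> = (x2 + s4 * v) * (c i n * (c j1 n * \<pi> n)) + s * m * c q2 n * (c j2 n * \<pi> n) + w2 * (d Y (n - 1) * c j1 n * \<pi> n)"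
      unfolding sm by (simp add: algebra_simps)
    also have "d Y (n - 1) * c j1 n * \<pi> n = c j1 (n - 1) * \<pi> (n - 1) * d Z (n - 1)"
      using j1(9)[of n] \<pi>Z(2)[of "n - 1"] by (simp add: mult.assoc)
    finally have "s * s1 * z = x' * c i' n + w2 * (c j1 (n - 1) * \<pi> (n - 1)) * d Z (n - 1)"
      unfolding comm by (simp add: x'_def ci' distrib_right mult.assoc)
    moreover have "w2 * (c j1 (n - 1) * \<pi> (n - 1)) \<in> H T4 (obj Z (n - 1))" using s4(3) j1(7) \<pi>Z(1) by blast
    moreover have "epic T4 T (s * s1)" by (rule epic_comp[OF sE s1(1)])
    ultimately show "\<exists>T' s. epic T' T s \<and> (\<exists>x \<in> H T' (obj X' n). \<exists>w \<in> H T' (obj Z (n - 1)). x * d X' n = 0 \<and> s * z = x * c i' n + w * d Z (n - 1))"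
      using x'H x'c by blast
  qed
  have inj': "coh_inj X' Z i' n" for n
    unfolding coh_inj_def
  proof (intro allI ballI impI)
    fix T x' w assume x': "x' \<in> H T (obj X' n)" "w \<in> H T (obj Z (n - 1))" "x' * d X' n = 0" "x' * c i' n = w * d Z (n - 1)"
    obtain T1 s1 m where s1: "epic T1 T s1" "m \<in> H T1 (obj P (n - 1))" "s1 * w = m * \<pi> (n - 1)"
      using pullback_epic[OF \<pi>Z(3) x'(2)] by metis
    have dP: "d P (n - 1) * \<pi> n = \<pi> (n - 1) * d Z (n - 1)" using \<pi>Z(2)[of "n - 1"] by simp
    have "(s1 * x' * c j2 n - m * d P (n - 1)) * \<pi> n = s1 * (x' * c i' n) - m * \<pi> (n - 1) * d Z (n - 1)"
      unfolding ci' using dP by (simp add: left_diff_distrib mult.assoc)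
    also have "\<dots> = 0" unfolding x'(4) s1(3)[symmetric] by (simp add: mult.assoc)
    finally have 0: "(s1 * x' * c j2 n - m * d P (n - 1)) * \<pi> n = 0" .
    have "s1 * x' * c j2 n - m * d P (n - 1) \<in> H T1 (obj P n)"
      using epicD(1)[OF s1(1)] x'(1) j2(7) s1(2) complexD(5)[OF P] by blast
    then obtain T2 s2 x where s2: "epic T2 T1 s2" "x \<in> H T2 (obj X n)" "s2 * (s1 * x' * c j2 n - m * d P (n - 1)) = x * u n"
      using coker_exact[OF \<pi>Z(4)] 0 by metis
    \<comment> \<open>In the pushout the pair \<open>(0, x')\<close> agrees with the differential of
      the lift \<open>m\<close>, so the two differ by the image of some \<open>x\<close> under
      \<open>u\<close>. As \<open>x\<close> maps to a coboundary in \<open>Y\<close>, it is the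
      coboundary of some \<open>v\<close>; subtracting the image of \<open>v\<close> under
      \<open>f\<close> from the second component of \<open>m\<close> gives \<open>a\<close>, whose
      coboundary is \<open>x'\<close>.\<close>
    have xi: "x * c i n = (- (s2 * m * c q1 (n - 1))) * d Y (n - 1)"
    proof -
      have "x * c i n = s2 * (s1 * x' * c j2 n - m * d P (n - 1)) * c q1 n" unfolding s2(3) using uq by (simp add: mult.assoc)
      also have "\<dots> = s2 * s1 * x' * (c j2 n * c q1 n) - s2 * m * (d P (n - 1) * c q1 n)" by (simp add: algebra_simps)
      finally show ?thesis unfolding q1(9) using jq by (simp add: mult.assoc)
    qed
    have xf: "x * c f n = s2 * m * c q2 (n - 1) * d X' (n - 1) - s2 * s1 * x'"
    proof -
      have "- (x * c f n) = s2 * (s1 * x' * c j2 n - m * d P (n - 1)) * c q2 n" unfolding s2(3) using uq by (simp add: mult.assoc)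
      also have "\<dots> = s2 * s1 * (x' * (c j2 n * c q2 n)) - s2 * m * (d P (n - 1) * c q2 n)" by (simp add: algebra_simps)
      finally show ?thesis unfolding q2(9) using jq un_right[OF x'(1)] by (simp add: mult.assoc) (simp add: algebra_simps)
    qed
    have "x * d X n = 0"
    proof (rule monicD(2)[OF mono])
      show "x * d X n \<in> H T2 (obj X (n + 1))" using s2(2) complexD(3)[OF iK(1)] by blast
      have "x * d X n * c i (n + 1) = x * c i n * d Y n" using iK(8)[of n] by (simp add: mult.assoc)
      also have "\<dots> = - (s2 * m * c q1 (n - 1)) * (d Y (n - 1) * d Y n)" unfolding xi by (simp add: mult.assoc)
      finally show "x * d X n * c i (n + 1) = 0" using complexD(6)[OF iK(2)] by simp
    qed
    moreover have "- (s2 * m * c q1 (n - 1)) \<in> H T2 (obj Y (n - 1))" using epicD(1)[OF s2(1)] s1(2) q1(7) by blast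
    ultimately obtain T3 s3 v where s3: "epic T3 T2 s3" "v \<in> H T3 (obj X (n - 1))" "s3 * x = v * d X (n - 1)"
      using iinj[of n, unfolded coh_inj_def, rule_format, OF s2(2) _ _ xi] by blast
    define a where "a = s3 * s2 * m * c q2 (n - 1) - v * c f (n - 1)"
    have "a \<in> H T3 (obj X' (n - 1))"
      unfolding a_def using epicD(1)[OF s3(1)] epicD(1)[OF s2(1)] s1(2) q2(7) s3(2) fK(7) by blast
    moreover have "s3 * s2 * s1 * x' = a * d X' (n - 1)"
    proof -
      have "s3 * (x * c f n) = v * (d X (n - 1) * c f n)" using s3(3) by (simp add: mult.assoc[symmetric])
      then have "s3 * (x * c f n) = v * (c f (n - 1) * d X' (n - 1))" unfolding fK(9) .
      then show ?thesis unfolding xf a_def by (simp add: algebra_simps)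
    qed
    moreover have "epic T3 T (s3 * s2 * s1)" by (intro epic_comp[OF epic_comp[OF s3(1) s2(1)] s1(1)])
    ultimately show "\<exists>T' s. epic T' T s \<and> (\<exists>v \<in> H T' (obj X' (n - 1)). s * x' = v * d X' (n - 1))" by blast
  qed
  have "i' \<in> complex_SDen A"
    using Den_iff_chase[OF i'H] surj' inj' mono' by (simp add: complex_SDen_def)
  moreover have "weak_pushout K i f f' i'"
    unfolding weak_pushout_def
    using iK(3-5) fK(3-5) K_homD(3-5)[OF f'H] K_homD(3-5)[OF i'H] square univ by simp
  ultimately show ?thesis by blast
qed

text \<open>The pullback is the degreewise kernel of the difference \<open>u\<close> of
  \<open>p\<close> and \<open>f\<close>. Besides the chase criteria for \<open>p\<close>, lifts of
  elements of \<open>Z\<close> to \<open>Y\<close> are used, which exist after a cover since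
  \<open>p\<close> is degreewise epic. The main work is injectivity, where the kernel of
  \<open>p\<close> has to be shown acyclic.\<close>

lemma weak_pullback_TDen:
  assumes p: "p \<in> complex_TDen A" and f: "f \<in> complex_mors A" "target f = target p"
  shows "\<exists>f'. \<exists>p' \<in> complex_TDen A. weak_pullback K f p f' p'"
proof -
  define Y Z X' where "Y = source p" and "Z = target p" and "X' = source f"
  have pD: "p \<in> complex_Den A" and pe: "is_epi K p" using p by (auto simp: complex_TDen_def)
  have pH: "p \<in> Hom K Y Z" and fH: "f \<in> Hom K X' Z"
    using Den_mor[OF pD] f by (auto simp: Hom_def Y_def Z_def X'_def)
  note pK = K_homD[OF pH] and fK = K_homD[OF fH]
  have epi: "epic (obj Y n) (obj Z n) (c p n)" for n using pe is_epi_degreewise[OF pH] by blast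
  have psurj: "coh_surj Y Z p n" and pinj: "coh_inj Y Z p n" for n using pD Den_iff_chase[OF pH] by blast+
  obtain P j1 j2 q1 q2 where P: "P \<in> complexes A"
    and j: "j1 \<in> Hom K Y P" "j2 \<in> Hom K X' P" and q: "q1 \<in> Hom K P Y" "q2 \<in> Hom K P X'"
    and jq: "\<And>n. c j1 n * c q1 n = un (obj Y n)" "\<And>n. c j2 n * c q2 n = un (obj X' n)"
      "\<And>n. c j1 n * c q2 n = 0" "\<And>n. c j2 n * c q1 n = 0"
    and qj: "\<And>n. c q1 n * c j1 n + c q2 n * c j2 n = un (obj P n)"
    using K_biproduct_ex[OF pK(1) fK(1)] by metis
  note j1 = K_homD[OF j(1)] and j2 = K_homD[OF j(2)] and q1 = K_homD[OF q(1)] and q2 = K_homD[OF q(2)]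
  define u where "u n = c q1 n * c p n - c q2 n * c f n" for n
  have uH: "u n \<in> H (obj P n) (obj Z n)" for n unfolding u_def using pK(7) fK(7) q1(7) q2(7) by blast
  have ju: "c j1 n * u n = c p n" "c j2 n * u n = - c f n" for n
  proof -
    have "c j1 n * u n = (c j1 n * c q1 n) * c p n - (c j1 n * c q2 n) * c f n"
      "c j2 n * u n = (c j2 n * c q1 n) * c p n - (c j2 n * c q2 n) * c f n"
      by (simp_all only: u_def right_diff_distrib mult.assoc)
    then show "c j1 n * u n = c p n" "c j2 n * u n = - c f n"
      using jq un_left[OF pK(7)] un_left[OF fK(7)] by simp_all
  qed
  have du: "d P n * u (n + 1) = u n * d Z n" for n
  proof -
    have "d P n * u (n + 1) = (d P n * c q1 (n + 1)) * c p (n + 1) - (d P n * c q2 (n + 1)) * c f (n + 1)"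
      by (simp add: u_def right_diff_distrib mult.assoc)
    also have "\<dots> = c q1 n * (d Y n * c p (n + 1)) - c q2 n * (d X' n * c f (n + 1))"
      unfolding q1(8) q2(8) by (simp add: mult.assoc)
    also have "\<dots> = u n * d Z n" unfolding pK(8) fK(8) by (simp add: u_def left_diff_distrib mult.assoc)
    finally show ?thesis .
  qed
  have "\<forall>n. \<exists>Q \<kappa>. ker (obj P n) (obj Z n) (u n) Q \<kappa>" using ker_ex[OF uH] by metis
  then obtain ob \<kappa> where \<kappa>: "\<And>n. ker (obj P n) (obj Z n) (u n) (ob n) (\<kappa> n)" by metis
  note \<kappa>H = kerD(2)[OF \<kappa>] and \<kappa>m = kerD(3)[OF \<kappa>] and \<kappa>u = kerD(4)[OF \<kappa>]
  have "\<exists>\<delta>. \<delta> \<in> H (ob n) (ob (n + 1)) \<and> \<delta> * \<kappa> (n + 1) = \<kappa> n * d P n" for n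
  proof -
    have "\<kappa> n * d P n * u (n + 1) = \<kappa> n * u n * d Z n" using du[of n] by (simp add: mult.assoc)
    then have "\<kappa> n * d P n * u (n + 1) = 0" using \<kappa>u by simp
    then show ?thesis using kerE[OF \<kappa> mult_H[OF \<kappa>H complexD(3)[OF P]]] by metis
  qed
  then obtain \<delta> where \<delta>: "\<And>n. \<delta> n \<in> H (ob n) (ob (n + 1))" "\<And>n. \<delta> n * \<kappa> (n + 1) = \<kappa> n * d P n" by metis
  have "\<delta> n * \<delta> (n + 1) = 0" for n
  proof (rule monicD(2)[OF \<kappa>m mult_H[OF \<delta>(1) \<delta>(1)]])
    have "\<delta> n * \<delta> (n + 1) * \<kappa> (n + 1 + 1) = \<delta> n * \<kappa> (n + 1) * d P (n + 1)" using \<delta>(2)[of "n + 1"] by (simp add: mult.assoc)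
    also have "\<dots> = \<kappa> n * (d P n * d P (n + 1))" unfolding \<delta>(2) by (simp add: mult.assoc)
    finally show "\<delta> n * \<delta> (n + 1) * \<kappa> (n + 1 + 1) = 0" using complexD(4)[OF P] by simp
  qed
  with \<delta>(1) obtain W where W: "W \<in> complexes A" "obj W = ob" "d W = \<delta>" by (rule complex_of_ring)
  have \<kappa>W: "\<kappa> n \<in> H (obj W n) (obj P n)" "d W n * \<kappa> (n + 1) = \<kappa> n * d P n" "monic (obj W n) (obj P n) (\<kappa> n)"
    "ker (obj P n) (obj Z n) (u n) (obj W n) (\<kappa> n)" for n using \<kappa>H \<delta>(2) \<kappa>m \<kappa> W by simp_all
  have \<kappa>W': "d W (n - 1) * \<kappa> n = \<kappa> (n - 1) * d P (n - 1)" for n using \<kappa>W(2)[of "n - 1"] by simp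
  obtain k where k: "k \<in> Hom K W P" "c k = \<kappa>" using K_homI[OF W(1) P \<kappa>W(1,2)] by blast
  define f' p' where "f' = k \<cdot>\<^bsub>K\<^esub> q1" and "p' = k \<cdot>\<^bsub>K\<^esub> q2"
  have f'H: "f' \<in> Hom K W Y" and cf': "\<And>n. c f' n = \<kappa> n * c q1 n"
    and p'H: "p' \<in> Hom K W X'" and cp': "\<And>n. c p' n = \<kappa> n * c q2 n"
    using K_comp[OF k(1) q(1)] K_comp[OF k(1) q(2)] k(2) by (simp_all add: f'_def p'_def)
  have comm: "\<kappa> n * c q1 n * c p n = \<kappa> n * c q2 n * c f n" for n
    using \<kappa>u[of n] by (simp add: u_def right_diff_distrib mult.assoc)
  have decomp: "m = m * c q1 n * c j1 n + m * c q2 n * c j2 n" if "m \<in> H T (obj P n)" for m T n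
  proof -
    have "m = m * (c q1 n * c j1 n + c q2 n * c j2 n)" unfolding qj using un_right[OF that] by simp
    then show ?thesis by (simp add: distrib_left mult.assoc)
  qed
  text \<open>Elements of \<open>W\<close> are pairs of elements of \<open>Y\<close> and \<open>X'\<close> with equal images in \<open>Z\<close>.\<close>
  have pair: "\<exists>a \<in> H T (obj W n). a * \<kappa> n = y * c j1 n + x * c j2 n"
    if "y \<in> H T (obj Y n)" "x \<in> H T (obj X' n)" "y * c p n = x * c f n" for T n y x
  proof -
    have "(y * c j1 n + x * c j2 n) * u n = y * (c j1 n * u n) + x * (c j2 n * u n)" by (simp add: distrib_right mult.assoc)
    also have "\<dots> = 0" unfolding ju using that(3) by simp
    moreover have "y * c j1 n + x * c j2 n \<in> H T (obj P n)" using that j1(7) j2(7) by blast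
    ultimately show ?thesis using kerE[OF \<kappa>W(4)] by metis
  qed
  have square: "f' \<cdot>\<^bsub>K\<^esub> p = p' \<cdot>\<^bsub>K\<^esub> f"
    by (rule K_hom_eqI[OF K_comp(1)[OF f'H pH] K_comp(1)[OF p'H fH]])
      (use K_comp(2)[OF f'H pH] K_comp(2)[OF p'H fH] cf' cp' comm in simp)
  have univ: "\<exists>t \<in> Hom K V W. t \<cdot>\<^bsub>K\<^esub> f' = g \<and> t \<cdot>\<^bsub>K\<^esub> p' = h"
    if g: "g \<in> Hom K V Y" and h: "h \<in> Hom K V X'" and e: "g \<cdot>\<^bsub>K\<^esub> p = h \<cdot>\<^bsub>K\<^esub> f" for V g h
  proof -
    have V: "V \<in> complexes A" using K_homD(1)[OF g] .
    have e': "c g n * c p n = c h n * c f n" for n using e K_comp(2)[OF g pH] K_comp(2)[OF h fH] by metis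
    have "\<forall>n. \<exists>t. t \<in> H (obj V n) (obj W n) \<and> t * \<kappa> n = c g n * c j1 n + c h n * c j2 n"
      using pair[OF K_homD(7)[OF g] K_homD(7)[OF h] e'] by blast
    then obtain t where t: "\<And>n. t n \<in> H (obj V n) (obj W n)" "\<And>n. t n * \<kappa> n = c g n * c j1 n + c h n * c j2 n" by metis
    have dt: "d V n * t (n + 1) = t n * d W n" for n
    proof (rule monic_cancel[OF \<kappa>W(3)])
      show "d V n * t (n + 1) \<in> H (obj V n) (obj W (n + 1))" "t n * d W n \<in> H (obj V n) (obj W (n + 1))"
        using t(1) complexD(3)[OF W(1)] complexD(3)[OF V] by blast+
      have "d V n * t (n + 1) * \<kappa> (n + 1) = (d V n * c g (n + 1)) * c j1 (n + 1) + (d V n * c h (n + 1)) * c j2 (n + 1)"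
        using t(2)[of "n + 1"] by (simp add: distrib_left mult.assoc)
      also have "\<dots> = c g n * (d Y n * c j1 (n + 1)) + c h n * (d X' n * c j2 (n + 1))"
        unfolding K_homD(8)[OF g] K_homD(8)[OF h] by (simp add: mult.assoc)
      also have "\<dots> = t n * \<kappa> n * d P n" unfolding j1(8) j2(8) t(2) by (simp add: distrib_right mult.assoc)
      also have "\<dots> = t n * d W n * \<kappa> (n + 1)" using \<kappa>W(2)[of n] by (simp add: mult.assoc)
      finally show "d V n * t (n + 1) * \<kappa> (n + 1) = t n * d W n * \<kappa> (n + 1)" .
    qed
    obtain l where l: "l \<in> Hom K V W" "c l = t" using K_homI[OF V W(1) t(1) dt] by blast
    have tq: "t n * (\<kappa> n * c q1 n) = c g n" "t n * (\<kappa> n * c q2 n) = c h n" for n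
    proof -
      have "t n * (\<kappa> n * c q1 n) = c g n * (c j1 n * c q1 n) + c h n * (c j2 n * c q1 n)"
        "t n * (\<kappa> n * c q2 n) = c g n * (c j1 n * c q2 n) + c h n * (c j2 n * c q2 n)"
        using t(2)[of n] by (simp_all add: mult.assoc[symmetric] distrib_right)
      then show "t n * (\<kappa> n * c q1 n) = c g n" "t n * (\<kappa> n * c q2 n) = c h n"
        using jq un_right[OF K_homD(7)[OF g]] un_right[OF K_homD(7)[OF h]] by simp_all
    qed
    have "l \<cdot>\<^bsub>K\<^esub> f' = g"
      by (rule K_hom_eqI[OF K_comp(1)[OF l(1) f'H] g]) (use K_comp(2)[OF l(1) f'H] cf' l(2) tq in simp)
    moreover have "l \<cdot>\<^bsub>K\<^esub> p' = h"
      by (rule K_hom_eqI[OF K_comp(1)[OF l(1) p'H] h]) (use K_comp(2)[OF l(1) p'H] cp' l(2) tq in simp)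
    ultimately show ?thesis using l(1) by blast
  qed
  have epi': "is_epi K p'"
    unfolding is_epi_degreewise[OF p'H]
  proof
    fix n
    obtain T s y where s: "epic T (obj X' n) s" "y \<in> H T (obj Y n)" "s * c f n = y * c p n"
      using pullback_epic[OF epi fK(7)] by metis
    obtain a where a: "a \<in> H T (obj W n)" "a * \<kappa> n = y * c j1 n + s * c j2 n"
      using pair[OF s(2) epicD(1)[OF s(1)] s(3)[symmetric]] by blast
    have "a * c p' n = (a * \<kappa> n) * c q2 n" by (simp add: cp' mult.assoc)
    also have "\<dots> = s" unfolding a(2) using jq un_right[OF epicD(1)[OF s(1)]] by (simp add: distrib_right mult.assoc)
    finally show "epic (obj W n) (obj X' n) (c p' n)"
      using epic_of_comp[of T "obj X' n" a "c p' n"] s(1) a(1) K_homD(7)[OF p'H] by simp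
  qed
  have surj': "coh_surj W X' p' n" for n
    unfolding coh_surj_def
  proof (intro allI ballI impI)
    fix T x assume x: "x \<in> H T (obj X' n)" "x * d X' n = 0"
    have "x * c f n * d Z n = x * d X' n * c f (n + 1)" using fK(8)[of n] by (simp add: mult.assoc)
    then have "x * c f n * d Z n = 0" using x by simp
    then obtain T1 s1 y z where s1: "epic T1 T s1" "y \<in> H T1 (obj Y n)" "z \<in> H T1 (obj Z (n - 1))" "y * d Y n = 0"
      "s1 * (x * c f n) = y * c p n + z * d Z (n - 1)"
      using psurj[of n, unfolded coh_surj_def, rule_format, OF mult_H[OF x(1) fK(7)]] by blast
    obtain T2 s2 y2 where s2: "epic T2 T1 s2" "y2 \<in> H T2 (obj Y (n - 1))" "s2 * z = y2 * c p (n - 1)"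
      using pullback_epic[OF epi s1(3)] by metis
    \<comment> \<open>The images of \<open>x\<close> and \<open>y\<close> in \<open>Z\<close> agree
      only up to the coboundary of \<open>z\<close>. Lifting \<open>z\<close> to \<open>y2\<close>
      and adding its coboundary to \<open>y\<close> makes the agreement exact, as a pair in the
      pullback requires.\<close>
    define y' where "y' = s2 * y + y2 * d Y (n - 1)"
    have sE: "epic T2 T (s2 * s1)" by (rule epic_comp[OF s2(1) s1(1)])
    have y'H: "y' \<in> H T2 (obj Y n)" unfolding y'_def using epicD(1)[OF s2(1)] s1(2) s2(2) complexD(5)[OF pK(1)] by blast
    have "y' * c p n = s2 * (y * c p n) + y2 * (d Y (n - 1) * c p n)" by (simp add: y'_def distrib_right mult.assoc)
    also have "\<dots> = s2 * (y * c p n) + s2 * z * d Z (n - 1)" unfolding pK(9) s2(3) by (simp add: mult.assoc)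
    also have "\<dots> = s2 * s1 * x * c f n" using s1(5) by (simp add: mult.assoc distrib_left)
    finally have eq: "y' * c p n = s2 * s1 * x * c f n" .
    have sx: "s2 * s1 * x \<in> H T2 (obj X' n)" using epicD(1)[OF sE] x(1) by blast
    obtain a where a: "a \<in> H T2 (obj W n)" "a * \<kappa> n = y' * c j1 n + s2 * s1 * x * c j2 n"
      using pair[OF y'H sx eq] by blast
    have y'd: "y' * d Y n = 0"
      unfolding y'_def using s1(4) complexD(6)[OF pK(1), of n] by (simp add: distrib_right mult.assoc)
    have "a * d W n = 0"
    proof (rule monicD(2)[OF \<kappa>W(3)])
      show "a * d W n \<in> H T2 (obj W (n + 1))" using a(1) complexD(3)[OF W(1)] by blast
      have "a * d W n * \<kappa> (n + 1) = (a * \<kappa> n) * d P n" using \<kappa>W(2)[of n] by (simp add: mult.assoc)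
      also have "\<dots> = y' * (c j1 n * d P n) + s2 * s1 * x * (c j2 n * d P n)" unfolding a(2) by (simp add: distrib_right mult.assoc)
      also have "\<dots> = (y' * d Y n) * c j1 (n + 1) + s2 * s1 * (x * d X' n) * c j2 (n + 1)"
        unfolding j1(8)[symmetric] j2(8)[symmetric] by (simp add: mult.assoc)
      finally show "a * d W n * \<kappa> (n + 1) = 0" using y'd x(2) by simp
    qed
    moreover have "s2 * s1 * x = a * c p' n + 0 * d X' (n - 1)"
    proof -
      have "a * c p' n = (a * \<kappa> n) * c q2 n" by (simp add: cp' mult.assoc)
      also have "\<dots> = y' * (c j1 n * c q2 n) + s2 * s1 * x * (c j2 n * c q2 n)" unfolding a(2) by (simp add: distrib_right mult.assoc)
      finally show ?thesis using jq un_right[OF sx] by simp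
    qed
    moreover have "0 \<in> H T2 (obj X' (n - 1))" using H_ob(1)[OF sx] complexD(1)[OF fK(1)] by blast
    ultimately show "\<exists>T' s. epic T' T s \<and> (\<exists>a \<in> H T' (obj W n). \<exists>w \<in> H T' (obj X' (n - 1)). a * d W n = 0 \<and> s * x = a * c p' n + w * d X' (n - 1))"
      using sE a(1) by blast
  qed
  have inj': "coh_inj W X' p' n" for n
    unfolding coh_inj_def
  proof (intro allI ballI impI)
    fix T a w assume a: "a \<in> H T (obj W n)" "w \<in> H T (obj X' (n - 1))" "a * d W n = 0" "a * c p' n = w * d X' (n - 1)"
    define y where "y = a * \<kappa> n * c q1 n"
    have yH: "y \<in> H T (obj Y n)" unfolding y_def using a(1) \<kappa>W(1) q1(7) by blast
    have "a * \<kappa> n * c q2 n = w * d X' (n - 1)" using a(4) by (simp add: cp' mult.assoc)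
    then have a\<kappa>: "a * \<kappa> n = y * c j1 n + w * d X' (n - 1) * c j2 n"
      unfolding y_def using decomp[OF mult_H[OF a(1) \<kappa>W(1)]] by simp
    have "y * d Y n = a * (\<kappa> n * d P n) * c q1 (n + 1)" using q1(8)[of n] by (simp add: y_def mult.assoc)
    also have "\<dots> = a * d W n * \<kappa> (n + 1) * c q1 (n + 1)" unfolding \<kappa>W(2)[symmetric] by (simp add: mult.assoc)
    finally have yd: "y * d Y n = 0" using a(3) by simp
    have yp: "y * c p n = w * c f (n - 1) * d Z (n - 1)"
    proof -
      have "y * c p n = a * (\<kappa> n * c q1 n * c p n)" by (simp add: y_def mult.assoc)
      also have "\<dots> = a * c p' n * c f n" unfolding comm by (simp add: cp' mult.assoc)
      finally show ?thesis unfolding a(4) using fK(9)[of n] by (simp add: mult.assoc)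
    qed
    obtain T1 s1 y2 where s1: "epic T1 T s1" "y2 \<in> H T1 (obj Y (n - 1))" "s1 * (w * c f (n - 1)) = y2 * c p (n - 1)"
      using pullback_epic[OF epi mult_H[OF a(2) fK(7)]] by metis
    \<comment> \<open>The second component of \<open>a\<close> is already the coboundary of
      \<open>w\<close>. The lift \<open>y2\<close> of the image of \<open>w\<close> handles the
      first component up to \<open>y0\<close>, a cocycle of \<open>Y\<close> with zero image in
      \<open>Z\<close>; it remains to write \<open>y0\<close> as the coboundary of some
      \<open>b\<close> that also has zero image.\<close>
    define y0 where "y0 = s1 * y - y2 * d Y (n - 1)"
    have y0H: "y0 \<in> H T1 (obj Y n)" unfolding y0_def using epicD(1)[OF s1(1)] yH s1(2) complexD(5)[OF pK(1)] by blast
    have y0d: "y0 * d Y n = 0"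
      unfolding y0_def using yd complexD(6)[OF pK(1), of n] by (simp add: left_diff_distrib mult.assoc)
    have y0p: "y0 * c p n = 0"
    proof -
      have "y0 * c p n = s1 * (y * c p n) - y2 * (d Y (n - 1) * c p n)" by (simp add: y0_def left_diff_distrib mult.assoc)
      also have "\<dots> = (s1 * (w * c f (n - 1))) * d Z (n - 1) - y2 * c p (n - 1) * d Z (n - 1)"
        unfolding yp pK(9) by (simp add: mult.assoc)
      finally show ?thesis unfolding s1(3) by simp
    qed
    have 0: "0 \<in> H T1 (obj Z (n - 1))" using H_ob(1)[OF y0H] complexD(1)[OF pK(2)] by blast
    obtain T2 s2 y3 where s2: "epic T2 T1 s2" "y3 \<in> H T2 (obj Y (n - 1))" "s2 * y0 = y3 * d Y (n - 1)"
      using pinj[of n, unfolded coh_inj_def, rule_format, OF y0H 0 y0d] y0p by auto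
    have "y3 * c p (n - 1) * d Z (n - 1) = y3 * d Y (n - 1) * c p n" using pK(9)[of n] by (simp add: mult.assoc)
    also have "\<dots> = s2 * (y0 * c p n)" unfolding s2(3)[symmetric] by (simp add: mult.assoc)
    finally have "y3 * c p (n - 1) * d Z (n - 1) = 0" using y0p by simp
    then obtain T3 s3 y4 z where s3: "epic T3 T2 s3" "y4 \<in> H T3 (obj Y (n - 1))" "z \<in> H T3 (obj Z (n - 1 - 1))"
      "y4 * d Y (n - 1) = 0" "s3 * (y3 * c p (n - 1)) = y4 * c p (n - 1) + z * d Z (n - 1 - 1)"
      using psurj[of "n - 1", unfolded coh_surj_def, rule_format, OF mult_H[OF s2(2) pK(7)]] by blast
    obtain T4 s4 y5 where s4: "epic T4 T3 s4" "y5 \<in> H T4 (obj Y (n - 1 - 1))" "s4 * z = y5 * c p (n - 1 - 1)"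
      using pullback_epic[OF epi s3(3)] by metis
    \<comment> \<open>Injectivity of \<open>p\<close> gives \<open>y3\<close> with coboundary
      \<open>y0\<close>, but its image in \<open>Z\<close> is only a cocycle. Surjectivity one
      degree lower writes this image as that of a cocycle \<open>y4\<close> plus a coboundary, which
      lifts to the coboundary of \<open>y5\<close>. Subtracting both kills the image and leaves the
      differential unchanged.\<close>
    define b where "b = s4 * s3 * y3 - s4 * y4 - y5 * d Y (n - 1 - 1)"
    have bH: "b \<in> H T4 (obj Y (n - 1))"
      unfolding b_def using epicD(1)[OF s4(1)] epicD(1)[OF s3(1)] s2(2) s3(2) s4(2) complexD(5)[OF pK(1)]
      by (intro diff_H mult_H) blast+
    have bp: "b * c p (n - 1) = 0"
    proof -
      have "b * c p (n - 1) = s4 * (s3 * (y3 * c p (n - 1))) - s4 * (y4 * c p (n - 1)) - y5 * (d Y (n - 1 - 1) * c p (n - 1))"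
        by (simp only: b_def left_diff_distrib mult.assoc)
      also have "\<dots> = s4 * z * d Z (n - 1 - 1) - y5 * c p (n - 1 - 1) * d Z (n - 1 - 1)"
        unfolding s3(5) pK(9) by (simp only: distrib_left mult.assoc) simp
      finally show ?thesis unfolding s4(3) by simp
    qed
    have bd: "b * d Y (n - 1) = s4 * s3 * s2 * y0"
    proof -
      have "b * d Y (n - 1) = s4 * s3 * (y3 * d Y (n - 1)) - s4 * (y4 * d Y (n - 1)) - y5 * (d Y (n - 1 - 1) * d Y (n - 1))"
        by (simp only: b_def left_diff_distrib mult.assoc)
      then show ?thesis unfolding s2(3)[symmetric] s3(4) using complexD(6)[OF pK(1), of "n - 1"] by (simp add: mult.assoc)
    qed
    define t where "t = s4 * s3 * s2"
    have tE: "epic T4 T1 t" unfolding t_def by (intro epic_comp[OF epic_comp[OF s4(1) s3(1)] s2(1)])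
    have tsE: "epic T4 T (t * s1)" by (rule epic_comp[OF tE s1(1)])
    have y6H: "t * y2 + b \<in> H T4 (obj Y (n - 1))" using epicD(1)[OF tE] s1(2) bH by blast
    have wH: "t * s1 * w \<in> H T4 (obj X' (n - 1))" using epicD(1)[OF tsE] a(2) by blast
    have "(t * y2 + b) * c p (n - 1) = t * (s1 * (w * c f (n - 1)))"
      unfolding s1(3) using bp by (simp add: distrib_right mult.assoc)
    then have "(t * y2 + b) * c p (n - 1) = t * s1 * w * c f (n - 1)" by (simp add: mult.assoc)
    then obtain v where v: "v \<in> H T4 (obj W (n - 1))" "v * \<kappa> (n - 1) = (t * y2 + b) * c j1 (n - 1) + t * s1 * w * c j2 (n - 1)"
      using pair[OF y6H wH] by blast
    have y6d: "(t * y2 + b) * d Y (n - 1) = t * s1 * y"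
      using bd by (simp add: distrib_right y0_def t_def right_diff_distrib mult.assoc)
    have "t * s1 * a = v * d W (n - 1)"
    proof (rule monic_cancel[OF \<kappa>W(3)])
      show "t * s1 * a \<in> H T4 (obj W n)" "v * d W (n - 1) \<in> H T4 (obj W n)"
        using epicD(1)[OF tsE] a(1) v(1) complexD(5)[OF W(1)] by blast+
      have "v * d W (n - 1) * \<kappa> n = (v * \<kappa> (n - 1)) * d P (n - 1)" using \<kappa>W'[of n] by (simp add: mult.assoc)
      also have "\<dots> = (t * y2 + b) * (c j1 (n - 1) * d P (n - 1)) + t * s1 * w * (c j2 (n - 1) * d P (n - 1))"
        unfolding v(2) by (simp only: distrib_right mult.assoc)
      also have "\<dots> = ((t * y2 + b) * d Y (n - 1)) * c j1 n + t * s1 * w * d X' (n - 1) * c j2 n"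
        unfolding j1(9)[symmetric] j2(9)[symmetric] by (simp only: mult.assoc)
      also have "\<dots> = t * s1 * (a * \<kappa> n)" unfolding y6d a\<kappa> by (simp only: distrib_left mult.assoc)
      finally show "t * s1 * a * \<kappa> n = v * d W (n - 1) * \<kappa> n" by (simp add: mult.assoc)
    qed
    then show "\<exists>T' s. epic T' T s \<and> (\<exists>v \<in> H T' (obj W (n - 1)). s * a = v * d W (n - 1))" using tsE v(1) by blast
  qed
  have "p' \<in> complex_TDen A"
    using Den_iff_chase[OF p'H] surj' inj' epi' by (simp add: complex_TDen_def)
  moreover have "weak_pullback K f p f' p'"
    unfolding weak_pullback_def
    using pK(3-5) fK(3-5) K_homD(3-5)[OF f'H] K_homD(3-5)[OF p'H] square univ by simp
  ultimately show ?thesis by blast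
qed

end

section \<open>Complexes as a uni-fractionable category\<close>

context abelian_in_ring
begin

lemma SDen_multiplicative: "multiplicative K (complex_SDen A)"
  using Den_semi_saturated K.is_mono_comp K.is_mono_id
  unfolding semi_saturated_def multiplicative_def complex_SDen_def by blast

lemma TDen_multiplicative: "multiplicative K (complex_TDen A)"
  using Den_semi_saturated K.is_epi_comp K.is_epi_id
  unfolding semi_saturated_def multiplicative_def complex_TDen_def by blast

sublocale complexes: additive_uni_fractionable K "complex_Den A" "complex_SDen A" "complex_TDen A"
proof unfold_locales
  show "semi_saturated K (complex_Den A)" by (rule Den_semi_saturated)
  show "multiplicative K (complex_SDen A)" by (rule SDen_multiplicative)
  show "multiplicative K (complex_TDen A)" by (rule TDen_multiplicative)
  show "complex_SDen A \<subseteq> complex_Den A" "complex_TDen A \<subseteq> complex_Den A"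
    by (auto simp: complex_SDen_def complex_TDen_def)
  show "\<exists>f'. \<exists>i' \<in> complex_SDen A. weak_pushout K i f f' i'"
    if "i \<in> complex_SDen A" "f \<in> Mor K" "Src K f = Src K i" for i f
    by (rule weak_pushout_SDen) (use that in simp_all)
  show "\<exists>f'. \<exists>p' \<in> complex_TDen A. weak_pullback K f p f' p'"
    if "p \<in> complex_TDen A" "f \<in> Mor K" "Tgt K f = Tgt K p" for p f
    by (rule weak_pullback_TDen) (use that in simp_all)
  show "\<exists>i \<in> complex_SDen A. \<exists>p \<in> complex_TDen A. Tgt K i = Src K p \<and> f = i \<cdot>\<^bsub>K\<^esub> p" if "f \<in> complex_Den A" for f
    using Den_factorisation[OF that] by simp
  show "g \<in> complex_Den A"
    if "\<And>k. k < n \<Longrightarrow> f k \<in> complex_Den A" "direct_sum K n (\<lambda>k. Src K (f k)) S ins prj"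
      "direct_sum K n (\<lambda>k. Tgt K (f k)) T ins' prj'" "g \<in> Hom K S T" "\<And>k. k < n \<Longrightarrow> ins k \<cdot>\<^bsub>K\<^esub> g = f k \<cdot>\<^bsub>K\<^esub> ins' k"
    for n :: nat and f g S ins prj T ins' prj'
    by (rule Den_direct_sums[of n f S ins prj T ins' prj']) (use that in simp_all)
qed

definition coh_inverse where
  "coh_inverse f = (SOME g. g \<in> Hom G (cohomology_ob A (Tgt K f)) (cohomology_ob A (Src K f)) \<and>
     cohomology_mor A f \<cdot>\<^bsub>G\<^esub> g = Idn G (cohomology_ob A (Src K f)) \<and>
     g \<cdot>\<^bsub>G\<^esub> cohomology_mor A f = Idn G (cohomology_ob A (Tgt K f)))"

lemma coh_inverse:
  assumes f: "f \<in> complex_Den A"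
  shows "coh_inverse f \<in> Hom G (cohomology_ob A (Tgt K f)) (cohomology_ob A (Src K f))"
    "cohomology_mor A f \<cdot>\<^bsub>G\<^esub> coh_inverse f = Idn G (cohomology_ob A (Src K f))"
    "coh_inverse f \<cdot>\<^bsub>G\<^esub> cohomology_mor A f = Idn G (cohomology_ob A (Tgt K f))"
proof -
  have fK: "f \<in> Mor K" and iso: "is_iso G (cohomology_mor A f)" using f by (simp_all add: complex_Den_def)
  have ends: "Src G (cohomology_mor A f) = cohomology_ob A (Src K f)" "Tgt G (cohomology_mor A f) = cohomology_ob A (Tgt K f)"
    using coh.functor_mor[OF fK] unfolding Hom_def by blast+
  have "\<exists>g. g \<in> Hom G (cohomology_ob A (Tgt K f)) (cohomology_ob A (Src K f)) \<and>
     cohomology_mor A f \<cdot>\<^bsub>G\<^esub> g = Idn G (cohomology_ob A (Src K f)) \<and>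
     g \<cdot>\<^bsub>G\<^esub> cohomology_mor A f = Idn G (cohomology_ob A (Tgt K f))"
    using iso unfolding is_iso_def ends by blast
  from someI_ex[OF this, folded coh_inverse_def] show
    "coh_inverse f \<in> Hom G (cohomology_ob A (Tgt K f)) (cohomology_ob A (Src K f))"
    "cohomology_mor A f \<cdot>\<^bsub>G\<^esub> coh_inverse f = Idn G (cohomology_ob A (Src K f))"
    "coh_inverse f \<cdot>\<^bsub>G\<^esub> cohomology_mor A f = Idn G (cohomology_ob A (Tgt K f))"
    by blast+
qed

text \<open>Cohomology inverts the denominators, and by their very definition they are all the
  morphisms that it inverts.\<close>

lemma complexes_saturated: "saturated K (complex_Den A) (complex_SDen A) (complex_TDen A)"
proof -
  have "inverting_functor K (complex_Den A) (complex_SDen A) (complex_TDen A) G (cohomology_ob A) (cohomology_mor A) coh_inverse"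
    by (intro inverting_functor.intro inverting_functor_axioms.intro coh_inverse coh.is_functor_axioms complexes.uni_fractionable_axioms)
  then show ?thesis
    by (rule inverting_functor.saturatedI) (simp add: complex_Den_def)
qed

lemma derived_cat_isomorphic_Frac:
  "isomorphic_categories (derived_cat A) (Frac K (complex_Den A) (complex_SDen A) (complex_TDen A))"
proof -
  \<comment> \<open>The set \<open>W\<close> is now literally the set of homotopy classes of
    quasi-isomorphisms in the definition of \<open>derived_cat\<close>.\<close>
  interpret cylinder_congruence K "complex_Den A" "complex_SDen A" "complex_TDen A" "homotopic A"
    by (intro cylinder_congruence.intro cylinder_congruence_axioms.intro complexes.uni_fractionable_axioms
        homotopy.category_congruence_axioms homotopic_cylinder)
  show ?thesis
    using isomorphic_Frac by (simp add: derived_cat_def homotopy_cat_def)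
qed

end

theorem mainTheorem4:
  fixes A :: "('o, 'm) add_cat"
  assumes "abelian_category A"
  shows "additive_uni_fractionable (complex_cat A) (complex_Den A) (complex_SDen A) (complex_TDen A)
    \<and> saturated (complex_cat A) (complex_Den A) (complex_SDen A) (complex_TDen A)
    \<and> isomorphic_categories (derived_cat A)
        (Frac (complex_cat A) (complex_Den A) (complex_SDen A) (complex_TDen A))"
proof -
  interpret abelian_category A by fact
  interpret abelian_in_ring A by unfold_locales
  show ?thesis
    using complexes.additive_uni_fractionable_axioms complexes_saturated derived_cat_isomorphic_Frac by blast
qed

end
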